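(* Let $D\subset\mathbb{C}^n$ be a bounded domain with $\mathcal{C}^2$ boundary, let $\rho$ be the signed distance function of $D$, and let $U$ be a bounded neighborhood of $\overline{D}$ such that $\rho$ is $\mathcal{C}^2$ on $\overline{U}\setminus D$. Let $\phi\in\mathcal{C}^2(U\setminus D)$ be a real valued function. For $1\le q\le n$ and $0\le p\le n$, let the $(p,q)$-form $u\in\mathcal{C}^1_{p,q}(\overline{U}\setminus D)\cap\operatorname{dom}\bar\partial^*_\phi$ have compact support in $U\setminus D$ (so $u$ need not vanish on $bD$). Then $$\begin{aligned}\|\bar\partial u\|_\phi^2+\|\bar\partial^*_\phi u\|_\phi^2=&-\int_{bD}(H\rho-\tau I)(u,u)e^{-\phi}\,d\sigma+\int_{U\setminus\overline{D}}(H\phi-\gamma_\phi I)(u,u)e^{-\phi}\,dV-4\|\eta u\|_\phi^2\\&+\frac14\|(\overline{N}+4\tau)u\|_\phi^2+\sum_{j=1}^n\|(\overline{L_j}^*-4\rho_j\tau)u\|_\phi^2.\end{aligned}$$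
   Context: Subscripts denote derivatives: $\rho_j=\partial\rho/\partial z_j$, $\rho_{\bar j}=\partial\rho/\partial\bar z_j$, $\psi_{j\bar k}=\partial^2\psi/\partial z_j\partial\bar z_k$, and $\phi_j=\partial\phi/\partial z_j$. The signed distance function is $\rho(z)=\operatorname{dist}(z,bD)$ outside $D$ and $\rho(z)=-\operatorname{dist}(z,bD)$ inside $D$. Define the vector fields $$N=4\sum_{j=1}^n\rho_{\bar j}\frac{\partial}{\partial z_j},\qquad L_j=\frac{\partial}{\partial z_j}-\rho_jN\quad(1\le j\le n),$$ and the functions $$\tau=\sum_{j=1}^n\overline{L_j}\rho_j,\qquad \eta^2=\sum_{j,k=1}^n|L_j\rho_k|^2,\quad \eta\ge 0,\qquad \gamma_\phi=\sum_{j=1}^n\overline{L_j}\phi_j.$$ A $(p,q)$-form is written $u=\sum'_{|J|=p,|K|=q}u_{J,K}\,dz^J\wedge d\bar z^K$, with $\sum'$ denoting summation over increasing multi-indices; $u_{J,K}$ is extended to nonincreasing multi-indices by skew-symmetry. Scalar differential operators act on forms coefficientwise. $|u|^2=\sum'|u_{J,K}|^2$. For a real function $\psi$, $$H\psi(u,u)=\sum_{|J|=p,|K|=q-1}{}^{'}\ \sum_{j,k=1}^n\psi_{j\bar k}\,u_{J,jK}\,\overline{u_{J,kK}},$$ and for a function $g$, $(H\psi-gI)(u,u)=H\psi(u,u)-g|u|^2$. $\|\cdot\|_\phi$ is the norm of the weighted space $L^2(U\setminus\overline{D},e^{-\phi})$, $\|u\|_\phi^2=\int_{U\setminus\overline{D}}|u|^2e^{-\phi}\,dV$.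 $\bar\partial^*_\phi$ is the Hilbert space adjoint, with respect to $L^2(U\setminus\overline{D},e^{-\phi})$, of the maximal weak realization of $\bar\partial$ (whose domain is all square-integrable $u$ with $\bar\partial u$ square-integrable). For a scalar differential operator $X$, $X^*$ is its adjoint as a differential operator (formal adjoint) with respect to the weighted inner product $\int f\bar g\,e^{-\phi}\,dV$. $d\sigma$ is surface measure on $bD$. *)

theory Defs
  imports "HOL-Analysis.Analysis"
begin

section \<open>Functions of class C^k and domains with C^k boundary\<close>

text \<open>
  The set \<open>S\<close> need not be open: derivatives are taken within \<open>S\<close> and have to be continuous
  on \<open>S\<close>, so at points of \<open>S\<close> on its boundary this is regularity up to the boundary.
\<close>

primrec Ck_on ::
    "nat \<Rightarrow> 'a::euclidean_space set \<Rightarrow> ('a \<Rightarrow> 'b::real_normed_vector) \<Rightarrow> bool" where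
  "Ck_on 0 S f \<longleftrightarrow> continuous_on S f"
| "Ck_on (Suc k) S f \<longleftrightarrow>
     (\<exists>f'. (\<forall>x\<in>S. (f has_derivative f' x) (at x within S)) \<and>
           (\<forall>b\<in>Basis. Ck_on k S (\<lambda>x. f' x b)))"

definition Ck_boundary :: "nat \<Rightarrow> 'a::euclidean_space set \<Rightarrow> bool" where
  "Ck_boundary k D \<longleftrightarrow>
     (\<forall>x\<in>frontier D. \<exists>V (r :: 'a \<Rightarrow> real).
        open V \<and> x \<in> V \<and> Ck_on k V r \<and>
        (\<forall>y\<in>V. frechet_derivative r (at y) \<noteq> (\<lambda>_. 0)) \<and>
        D \<inter> V = {y \<in> V. r y < 0})"

definition signed_dist :: "'a::metric_space set \<Rightarrow> 'a \<Rightarrow> real" where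
  "signed_dist D x =
     (if x \<in> D then - infdist x (frontier D) else infdist x (frontier D))"

definition test_function :: "'a::euclidean_space set \<Rightarrow> ('a \<Rightarrow> 'b::real_normed_vector) \<Rightarrow> bool"
  where
  "test_function \<Omega> f \<longleftrightarrow>
     (\<forall>k. Ck_on k UNIV f) \<and> (\<exists>C. compact C \<and> C \<subseteq> \<Omega> \<and> (\<forall>x. x \<notin> C \<longrightarrow> f x = 0))"

section \<open>Surface measure of a hypersurface\<close>

text \<open>
  Lebesgue measure on the coordinate hyperplane orthogonal to \<open>b \<in> Basis\<close>, as a Borel measure
  on the whole space (compare the definition of \<^const>\<open>lborel\<close>).
\<close>

definition hyperplane_lborel :: "'a::euclidean_space \<Rightarrow> 'a measure" where
  "hyperplane_lborel b =
     distr (\<Pi>\<^sub>M i\<in>Basis - {b}. lborel) borel (\<lambda>f. \<Sum>i\<in>Basis - {b}. f i *\<^sub>R i)"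

text \<open>
  Inside the open set \<open>W\<close>, \<open>M\<close> is the graph, in the coordinate direction \<open>b\<close>, of the restriction
  of the C^1 function \<open>g\<close> to the part of \<open>V\<close> in the coordinate hyperplane orthogonal to \<open>b\<close>.
\<close>

definition graph_chart ::
    "'a::euclidean_space set \<Rightarrow> 'a \<Rightarrow> 'a set \<Rightarrow> 'a set \<Rightarrow> ('a \<Rightarrow> real) \<Rightarrow> bool" where
  "graph_chart M b W V g \<longleftrightarrow>
     b \<in> Basis \<and> open W \<and> open V \<and> Ck_on 1 V g \<and>
     M \<inter> W = {y + g y *\<^sub>R b | y. y \<in> V \<and> y \<bullet> b = 0}"

text \<open>
  The surface measure of a C^1 hypersurface \<open>M\<close> is the Borel measure carried by \<open>M\<close> which in each
  graph chart is \<open>sqrt (1 + |grad g|^2)\<close> times Lebesgue measure of the hyperplane.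
\<close>

definition is_surface_measure :: "'a::euclidean_space set \<Rightarrow> 'a measure \<Rightarrow> bool" where
  "is_surface_measure M \<sigma> \<longleftrightarrow>
     sets \<sigma> = sets borel \<and> emeasure \<sigma> (- M) = 0 \<and>
     (\<forall>b W V g. graph_chart M b W V g \<longrightarrow>
        (\<forall>A\<in>sets borel. A \<subseteq> M \<inter> W \<longrightarrow>
           emeasure \<sigma> A =
             (\<integral>\<^sup>+y. indicator V y * indicator A (y + g y *\<^sub>R b) *
                 ennreal (sqrt (1 + (\<Sum>i\<in>Basis - {b}. (frechet_derivative g (at y) i)\<^sup>2)))
              \<partial>hyperplane_lborel b)))"

definition surface_measure :: "'a::euclidean_space set \<Rightarrow> 'a measure" where
  "surface_measure M = (THE \<sigma>. is_surface_measure M \<sigma>)"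

section \<open>Scalar differential operators\<close>

type_synonym 'n cspace = "(complex, 'n) vec"

text \<open>
  The Wirtinger derivatives, taken within \<open>S\<close>. At interior points of \<open>S\<close> these are the
  ordinary ones; at boundary points they are the derivatives from the side of \<open>S\<close>.
\<close>

definition dz ::
    "'n cspace set \<Rightarrow> 'n::finite \<Rightarrow> ('n cspace \<Rightarrow> complex) \<Rightarrow> 'n cspace \<Rightarrow> complex" where
  "dz S j f z =
     (frechet_derivative f (at z within S) (axis j 1)
       - \<i> * frechet_derivative f (at z within S) (axis j \<i>)) / 2"

definition dzbar ::
    "'n cspace set \<Rightarrow> 'n::finite \<Rightarrow> ('n cspace \<Rightarrow> complex) \<Rightarrow> 'n cspace \<Rightarrow> complex" where
  "dzbar S j f z =
     (frechet_derivative f (at z within S) (axis j 1)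
       + \<i> * frechet_derivative f (at z within S) (axis j \<i>)) / 2"

abbreviation (input) cplx :: "('a \<Rightarrow> real) \<Rightarrow> 'a \<Rightarrow> complex" where
  "cplx f \<equiv> (\<lambda>z. complex_of_real (f z))"

type_synonym 'n operator = "('n cspace \<Rightarrow> complex) \<Rightarrow> 'n cspace \<Rightarrow> complex"

definition conj_op :: "'n::finite operator \<Rightarrow> 'n operator" where
  "conj_op X f z = cnj (X (\<lambda>w. cnj (f w)) z)"

definition N_op :: "'n cspace set \<Rightarrow> ('n cspace \<Rightarrow> real) \<Rightarrow> 'n::finite operator" where
  "N_op S \<rho> f z = 4 * (\<Sum>j\<in>UNIV. dzbar S j (cplx \<rho>) z * dz S j f z)"

definition L_op :: "'n cspace set \<Rightarrow> ('n cspace \<Rightarrow> real) \<Rightarrow> 'n::finite \<Rightarrow> 'n operator" where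
  "L_op S \<rho> j f z = dz S j f z - dz S j (cplx \<rho>) z * N_op S \<rho> f z"

definition tau :: "'n::finite cspace set \<Rightarrow> ('n cspace \<Rightarrow> real) \<Rightarrow> 'n cspace \<Rightarrow> complex" where
  "tau S \<rho> z = (\<Sum>j\<in>UNIV. conj_op (L_op S \<rho> j) (dz S j (cplx \<rho>)) z)"

definition eta :: "'n::finite cspace set \<Rightarrow> ('n cspace \<Rightarrow> real) \<Rightarrow> 'n cspace \<Rightarrow> real" where
  "eta S \<rho> z =
     sqrt (\<Sum>j\<in>UNIV. \<Sum>k\<in>UNIV. (cmod (L_op S \<rho> j (dz S k (cplx \<rho>)) z))\<^sup>2)"

definition gamma ::
    "'n::finite cspace set \<Rightarrow> ('n cspace \<Rightarrow> real) \<Rightarrow> ('n cspace \<Rightarrow> real) \<Rightarrow> 'n cspace \<Rightarrow> complex"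
  where
  "gamma S \<rho> \<phi> z = (\<Sum>j\<in>UNIV. conj_op (L_op S \<rho> j) (dz S j (cplx \<phi>)) z)"

definition weighted_lebesgue ::
    "'n::finite cspace set \<Rightarrow> ('n cspace \<Rightarrow> real) \<Rightarrow> 'n cspace measure" where
  "weighted_lebesgue \<Omega> \<phi> = density (lebesgue_on \<Omega>) (\<lambda>z. ennreal (exp (- \<phi> z)))"

text \<open>
  The formal adjoint of a differential operator \<open>X\<close>, applied to \<open>f\<close>: the continuous function on
  \<open>\<Omega>\<close> representing \<open>\<psi> \<mapsto> <X \<psi>, f>\<close>. The test functions \<open>\<psi>\<close> have compact support in \<open>\<Omega>\<close>, so
  that \<open>f\<close> is not required to satisfy any boundary condition. For an \<open>X\<close> of first order with C^1
  coefficients and a C^1 function \<open>f\<close> such a function exists, and it is unique on the open set \<open>\<Omega>\<close>;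
  its values outside \<open>\<Omega>\<close> are arbitrary.
\<close>

definition formal_adjoint ::
    "'n cspace set \<Rightarrow> ('n cspace \<Rightarrow> real) \<Rightarrow> 'n::finite operator \<Rightarrow> 'n operator" where
  "formal_adjoint \<Omega> \<phi> X f =
     (SOME g. continuous_on \<Omega> g \<and>
        (\<forall>\<psi>. test_function \<Omega> \<psi> \<longrightarrow>
           (LINT z|weighted_lebesgue \<Omega> \<phi>. X \<psi> z * cnj (f z)) =
           (LINT z|weighted_lebesgue \<Omega> \<phi>. \<psi> z * cnj (g z))))"

section \<open>Differential forms\<close>

text \<open>
  An increasing multi-index is identified with the set of its entries. A \<open>(p,q)\<close>-form \<open>u\<close> is
  given by its coefficient functions \<open>u J K\<close> with \<open>J \<in> multi_indices p\<close>,
  \<open>K \<in> multi_indices q\<close>; the values \<open>u J K\<close> for other sets \<open>J\<close>, \<open>K\<close> carry no meaning.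
\<close>

type_synonym 'n form = "'n set \<Rightarrow> 'n set \<Rightarrow> 'n cspace \<Rightarrow> complex"

definition multi_indices :: "nat \<Rightarrow> 'n::finite set set" where
  "multi_indices p = {J. card J = p}"

definition inversions :: "'n::linorder list \<Rightarrow> nat" where
  "inversions ks = card {(a, b). a < b \<and> b < length ks \<and> ks ! b < ks ! a}"

definition skew_coeff ::
    "'n form \<Rightarrow> 'n set \<Rightarrow> 'n::{finite,linorder} list \<Rightarrow> 'n cspace \<Rightarrow> complex" where
  "skew_coeff u J ks z =
     (if distinct ks then (-1) ^ inversions ks * u J (set ks) z else 0)"

definition form_inner :: "nat \<Rightarrow> nat \<Rightarrow> 'n::finite form \<Rightarrow> 'n form \<Rightarrow> 'n cspace \<Rightarrow> complex" where
  "form_inner p q u v z =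
     (\<Sum>J\<in>multi_indices p. \<Sum>K\<in>multi_indices q. u J K z * cnj (v J K z))"

definition form_norm_sq :: "nat \<Rightarrow> nat \<Rightarrow> 'n::finite form \<Rightarrow> 'n cspace \<Rightarrow> real" where
  "form_norm_sq p q u z =
     (\<Sum>J\<in>multi_indices p. \<Sum>K\<in>multi_indices q. (cmod (u J K z))\<^sup>2)"

text \<open>The quadratic form \<open>H\<psi>(u,u)\<close> on \<open>(p,q)\<close>-forms, for \<open>q \<ge> 1\<close>.\<close>

definition H_form ::
    "'n cspace set \<Rightarrow> nat \<Rightarrow> nat \<Rightarrow> ('n cspace \<Rightarrow> real) \<Rightarrow> 'n::{finite,linorder} form \<Rightarrow>
     'n cspace \<Rightarrow> complex" where
  "H_form S p q \<psi> u z =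
     (\<Sum>J\<in>multi_indices p. \<Sum>K\<in>multi_indices (q - 1). \<Sum>j\<in>UNIV. \<Sum>k\<in>UNIV.
        dz S j (dzbar S k (cplx \<psi>)) z *
        skew_coeff u J (j # sorted_list_of_set K) z *
        cnj (skew_coeff u J (k # sorted_list_of_set K) z))"

text \<open>
  The coefficients of \<open>dbar u\<close> for a \<open>(p,q)\<close>-form \<open>u\<close>. The factor \<open>(-1)^p\<close> comes from moving
  \<open>dzbar_j\<close> past \<open>dz^J\<close>, the other sign from sorting \<open>dzbar_j \<and> dzbar^(M - {j})\<close>.
\<close>

definition dbar :: "'n cspace set \<Rightarrow> nat \<Rightarrow> 'n::{finite,linorder} form \<Rightarrow> 'n form" where
  "dbar S p u J M z =
     (-1) ^ p * (\<Sum>j\<in>M. (-1) ^ inversions (j # sorted_list_of_set (M - {j})) *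
                        dzbar S j (u J (M - {j})) z)"

text \<open>\<open>g = dbar f\<close> in the sense of distributions on \<open>\<Omega>\<close>, for a \<open>(p,q)\<close>-form \<open>f\<close>.\<close>

definition weak_dbar ::
    "'n cspace set \<Rightarrow> nat \<Rightarrow> nat \<Rightarrow> 'n::{finite,linorder} form \<Rightarrow> 'n form \<Rightarrow> bool" where
  "weak_dbar \<Omega> p q f g \<longleftrightarrow>
     (\<forall>J\<in>multi_indices p. \<forall>M\<in>multi_indices (Suc q). \<forall>\<psi>. test_function \<Omega> \<psi> \<longrightarrow>
        (LINT z:\<Omega>|lebesgue. g J M z * \<psi> z) =
        - (LINT z:\<Omega>|lebesgue.
             (-1) ^ p * (\<Sum>j\<in>M. (-1) ^ inversions (j # sorted_list_of_set (M - {j})) *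
                                f J (M - {j}) z * dzbar \<Omega> j \<psi> z)))"

definition L2_form ::
    "'n cspace set \<Rightarrow> ('n cspace \<Rightarrow> real) \<Rightarrow> nat \<Rightarrow> nat \<Rightarrow> 'n::finite form \<Rightarrow> bool" where
  "L2_form \<Omega> \<phi> p q u \<longleftrightarrow>
     (\<forall>J\<in>multi_indices p. \<forall>K\<in>multi_indices q.
        u J K \<in> borel_measurable (weighted_lebesgue \<Omega> \<phi>) \<and>
        integrable (weighted_lebesgue \<Omega> \<phi>) (\<lambda>z. (cmod (u J K z))\<^sup>2))"

definition L2_inner ::
    "'n cspace set \<Rightarrow> ('n cspace \<Rightarrow> real) \<Rightarrow> nat \<Rightarrow> nat \<Rightarrow> 'n::finite form \<Rightarrow> 'n form \<Rightarrow> complex"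
  where
  "L2_inner \<Omega> \<phi> p q u v = (LINT z|weighted_lebesgue \<Omega> \<phi>. form_inner p q u v z)"

definition L2_norm ::
    "'n cspace set \<Rightarrow> ('n cspace \<Rightarrow> real) \<Rightarrow> nat \<Rightarrow> nat \<Rightarrow> 'n::finite form \<Rightarrow> real" where
  "L2_norm \<Omega> \<phi> p q u = sqrt (LINT z|weighted_lebesgue \<Omega> \<phi>. form_norm_sq p q u z)"

text \<open>
  For \<open>q \<ge> 1\<close>: the \<open>(p,q)\<close>-form \<open>u\<close> lies in the domain of the Hilbert space adjoint of the maximal
  weak realization of \<open>dbar\<close> from \<open>(p,q-1)\<close>- to \<open>(p,q)\<close>-forms, with value \<open>v\<close>. The value is
  unique up to null sets, as \<open>dbar\<close> is densely defined.
\<close>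

definition dbar_adjoint ::
    "'n cspace set \<Rightarrow> ('n cspace \<Rightarrow> real) \<Rightarrow> nat \<Rightarrow> nat \<Rightarrow>
     'n::{finite,linorder} form \<Rightarrow> 'n form \<Rightarrow> bool" where
  "dbar_adjoint \<Omega> \<phi> p q u v \<longleftrightarrow>
     L2_form \<Omega> \<phi> p q u \<and> L2_form \<Omega> \<phi> p (q - 1) v \<and>
     (\<forall>f g. L2_form \<Omega> \<phi> p (q - 1) f \<longrightarrow> L2_form \<Omega> \<phi> p q g \<longrightarrow> weak_dbar \<Omega> p (q - 1) f g \<longrightarrow>
        L2_inner \<Omega> \<phi> p q g u = L2_inner \<Omega> \<phi> p (q - 1) f v)"

definition dom_dbar_star ::
    "'n cspace set \<Rightarrow> ('n cspace \<Rightarrow> real) \<Rightarrow> nat \<Rightarrow> nat \<Rightarrow> 'n::{finite,linorder} form set" where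
  "dom_dbar_star \<Omega> \<phi> p q = {u. \<exists>v. dbar_adjoint \<Omega> \<phi> p q u v}"

definition dbar_star ::
    "'n cspace set \<Rightarrow> ('n cspace \<Rightarrow> real) \<Rightarrow> nat \<Rightarrow> nat \<Rightarrow>
     'n::{finite,linorder} form \<Rightarrow> 'n form" where
  "dbar_star \<Omega> \<phi> p q u = (SOME v. dbar_adjoint \<Omega> \<phi> p q u v)"

end

theory Submission
 imports Defs
begin

text \<open>
 The identity comes from integrating by parts on the exterior region \<open>Om = U - closure D\<close>, for
 coefficients that are \<open>C^1\<close> up to the boundary \<open>M\<close> of \<open>D\<close>, and all second derivatives that could
 appear fall on \<open>\<rho>\<close> or \<open>\<phi>\<close>. Two formulas carry everything: the divergence theorem
 (\<open>divergence_theorem\<close>) and the formula for the integral of \<open>d_j a d_k g - d_k a d_j g\<close>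
 (\<open>exchange_of_derivatives\<close>). The second one is the divergence theorem for the field
 \<open>a d_k g e_j - a d_j g e_k\<close>, whose divergence contains no second derivative of \<open>g\<close>; it therefore
 holds for \<open>g\<close> of class \<open>C^1\<close>, which is why no smooth approximation up to the boundary is needed.

 Both formulas are obtained from integrals over the whole space by cutting off with a function of
 \<open>n \<rho>\<close> and letting \<open>n\<close> tend to infinity. Since \<open>\<bar>grad \<rho>\<bar> = 1\<close>, the derivative of the cutoff acts as
 a unit mass concentrating on \<open>M\<close>. Its limit is identified with the surface measure in graph charts,
 where the area density is the reciprocal of the component of \<open>grad \<rho>\<close> in the graph direction; the same
 identification shows that the chart measures agree on overlaps, so that the surface measure exists.

 Testing the definition of the adjoint of dbar against forms with one coefficient yields, for each
 multi-index \<open>K\<close> of length \<open>q - 1\<close>, the explicit value of the adjoint and the boundary condition that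
 \<open>sum_j \<rho>_j u_{J,jK}\<close> vanishes almost everywhere on \<open>M\<close> (\<open>dbar_adjoint_value\<close>). With the boundary
 condition one proves the identity of Morrey, Kohn and Hoermander for each row \<open>(u_{J,jK})_j\<close>
 (\<open>row_identity\<close>). As the boundary condition holds only almost everywhere, the
 tangential derivative of the vanishing function is handled weakly (\<open>tangential_vanishing\<close>). Summing
 over \<open>J\<close> and \<open>K\<close> gives the two norms on the left in terms of the forms \<open>H \<rho>\<close>, \<open>H \<phi>\<close> and
 of the norms of all derivatives \<open>dbar_j u_{J,K}\<close> (\<open>dbar_norm_expansion\<close>).

 It remains to rewrite the squared norm of the dbar-gradient of a single coefficient \<open>f\<close>, without any
 boundary condition (\<open>scalar_identity\<close>). Its normal part is \<open>1/4 \<bar>conj N f\<bar>^2\<close>. In the tangential part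
 the operators \<open>conj L_j\<close> are exchanged for their adjoints; the commutators produce
 \<open>\<tau>\<close>, \<open>\<gamma>\<close> and \<open>\<eta>^2\<close>. Concretely, the difference of the two
 sides is a sum of three expressions \<open>B1\<close>, \<open>B2\<close>, \<open>B3\<close> of divergence type, and
 only the last has a boundary term, namely \<open>\<tau> \<bar>f\<bar>^2\<close>. That the three add up pointwise is an
 algebraic consequence of \<open>\<bar>grad \<rho>\<bar> = 1\<close> and its first derivative, the eikonal relation (locale
 \<open>levi_data\<close>).
\<close>

section \<open>Calculus on sets with unique one-sided derivatives\<close>

text \<open>Derivatives are taken within \<open>S\<close>, so that at boundary points of \<open>S\<close> they are one-sided. The functions
 are complex valued throughout; real functions enter through their embedding \<open>cplx\<close>.\<close>

definition pd :: "'a::euclidean_space set => 'a => ('a => complex) => 'a => complex" where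
 "pd S b f z = frechet_derivative f (at z within S) b"

definition C1 :: "'a::euclidean_space set => ('a => complex) => bool" where
 "C1 S f \<longleftrightarrow> (\<forall>x\<in>S. f differentiable (at x within S)) \<and>
       (\<forall>b\<in>Basis. continuous_on S (pd S b f))"

text \<open>Enough directions lead from each point into \<open>S\<close>: they contain an open set of vectors, hence span the
 space, and a derivative within \<open>S\<close> is unique. Open sets qualify, and so does the closed exterior of a
 domain with a \<open>C^1\<close> defining function.\<close>

locale fat_set =
 fixes S :: "'a::euclidean_space set"
 assumes fat: "x \<in> S ==>
  \<exists>T. open T \<and> T \<noteq> {} \<and> (\<forall>v\<in>T. \<forall>\<^sub>F s in at_right (0::real). x + s *\<^sub>R v \<in> S)"
begin

text \<open>The difference of two derivatives is a derivative of the zero function. It vanishes in every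
 direction that leads into \<open>S\<close>, and an open set of directions determines a linear map.\<close>

lemma derivative_unique:
 fixes f :: "'a => 'b::real_normed_vector"
 assumes x: "x \<in> S" and f1: "(f has_derivative f1) (at x within S)"
  and f2: "(f has_derivative f2) (at x within S)"
 shows "f1 = f2"
proof -
 define d where "d = (%h. f1 h - f2 h)"
 have "((%y. f y - f y) has_derivative d) (at x within S)"
  unfolding d_def by (intro has_derivative_diff f1 f2)
 then have D: "((%y. 0) has_derivative d) (at x within S)" by simp
 then interpret d: bounded_linear d by (rule has_derivative_bounded_linear)
 have alt: "\<exists>\<delta>>0. \<forall>y\<in>S. norm (y - x) < \<delta> --> norm (d (y - x)) \<le> e * norm (y - x)" if "e > 0" for e
  using D that unfolding has_derivative_within_alt by fastforce
 obtain T where T: "open T" "T \<noteq> {}" and ev: "\<And>v. v \<in> T ==> \<forall>\<^sub>F s in at_right (0::real). x + s *\<^sub>R v \<in> S"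
  using fat[OF x] by blast
 have zero: "d v = 0" if v: "v \<in> T" for v
 proof -
  have le: "norm (d v) \<le> e * norm v" if e: "e > 0" for e
  proof -
   obtain \<delta> where \<delta>: "\<delta> > 0" "\<And>y. y \<in> S ==> norm (y - x) < \<delta> ==> norm (d (y - x)) \<le> e * norm (y - x)"
    using alt[OF e] by blast
   have "((%s::real. norm (s *\<^sub>R v)) \<longlongrightarrow> norm ((0::real) *\<^sub>R v)) (at_right 0)"
    by (intro tendsto_intros)
   then have "\<forall>\<^sub>F s in at_right (0::real). norm (s *\<^sub>R v) < \<delta>"
    by (rule order_tendstoD(2)) (use \<delta>(1) in simp)
   then have "\<forall>\<^sub>F s in at_right (0::real). norm (s *\<^sub>R v) < \<delta> \<and> x + s *\<^sub>R v \<in> S \<and> s > 0"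
    using ev[OF v] eventually_at_right_less[of "0::real"] by eventually_elim auto
   from eventually_happens'[OF trivial_limit_at_right_real this]
   obtain s :: real where s: "norm (s *\<^sub>R v) < \<delta>" "x + s *\<^sub>R v \<in> S" "s > 0"
    by auto
   have "norm (d (s *\<^sub>R v)) \<le> e * norm (s *\<^sub>R v)"
    using \<delta>(2)[OF s(2)] s(1) by simp
   then show ?thesis using s(3) by (simp add: d.scaleR)
  qed
  show ?thesis
  proof (cases "v = 0")
   case False
   have "norm (d v) \<le> 0"
   proof (rule field_le_epsilon)
    fix e :: real assume "e > 0"
    then show "norm (d v) \<le> 0 + e" using le[of "e / norm v"] False by simp
   qed
   then show ?thesis by simp
  qed (simp add: d.zero)
 qed
 obtain v0 \<epsilon> where v0: "v0 \<in> T" "\<epsilon> > 0" "ball v0 \<epsilon> \<subseteq> T" using T by (meson ex_in_conv open_contains_ball)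
 have "d w = 0" for w
 proof (cases "w = 0")
  case False
  define c where "c = \<epsilon> / (2 * norm w)"
  have "v0 + c *\<^sub>R w \<in> ball v0 \<epsilon>" using False v0(2) by (simp add: c_def dist_norm)
  then have "d (v0 + c *\<^sub>R w) = 0" "d v0 = 0" using v0 zero by blast+
  then show ?thesis using False v0(2) by (auto simp: d.add d.scaleR c_def)
 qed simp
 then show ?thesis by (auto simp: d_def fun_eq_iff)
qed

lemma pd_eq: "x \<in> S ==> (f has_derivative f') (at x within S) ==> pd S b f x = f' b"
 unfolding pd_def
 by (subst derivative_unique[of x f f' "frechet_derivative f (at x within S)"])
   (auto simp flip: frechet_derivative_works intro: differentiableI)

lemma C1I:
 assumes "\<And>x. x \<in> S ==> (f has_derivative f' x) (at x within S)"
  and "\<And>b. b \<in> Basis ==> continuous_on S (%x. f' x b)"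
 shows "C1 S f"
proof -
 have "continuous_on S (pd S b f)" if "b \<in> Basis" for b
  by (subst continuous_on_cong[OF refl pd_eq[OF _ assms(1)]]) (auto intro: assms(2) that)
 then show ?thesis unfolding C1_def using assms(1) differentiableI by blast
qed

lemma C1_deriv: "C1 S f ==> x \<in> S ==> (f has_derivative (%h. pd S h f x)) (at x within S)"
 unfolding C1_def pd_def using frechet_derivative_works by fastforce

lemma has_derivative_cong_on:
 assumes "\<And>x. x \<in> S ==> f x = g x" and "x \<in> S"
 shows "(f has_derivative f') (at x within S) \<longleftrightarrow> (g has_derivative f') (at x within S)"
proof
 assume D: "(f has_derivative f') (at x within S)"
 show "(g has_derivative f') (at x within S)"
  by (rule has_derivative_transform[OF assms(2) _ D]) (simp add: assms(1))
next
 assume D: "(g has_derivative f') (at x within S)"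
 show "(f has_derivative f') (at x within S)"
  by (rule has_derivative_transform[OF assms(2) _ D]) (simp add: assms(1))
qed

lemma C1_cong_pd:
 assumes "\<And>x. x \<in> S ==> f x = g x" and "x \<in> S"
 shows "pd S b f x = pd S b g x"
 unfolding pd_def frechet_derivative_def by (simp only: has_derivative_cong_on[OF assms])

lemma C1_cong:
 assumes "\<And>x. x \<in> S ==> f x = g x"
 shows "C1 S f \<longleftrightarrow> C1 S g"
proof -
 have "f differentiable (at x within S) \<longleftrightarrow> g differentiable (at x within S)" if "x \<in> S" for x
  unfolding differentiable_def by (simp only: has_derivative_cong_on[OF assms that])
 moreover have "continuous_on S (pd S b f) \<longleftrightarrow> continuous_on S (pd S b g)" for b
  by (intro continuous_on_cong refl C1_cong_pd assms)
 ultimately show ?thesis unfolding C1_def by simp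
qed

lemma pd_linear: "C1 S f ==> x \<in> S ==> bounded_linear (%h. pd S h f x)"
 using C1_deriv has_derivative_bounded_linear by blast

lemma pd_expand:
 assumes "C1 S f" "x \<in> S"
 shows "pd S v f x = (\<Sum>b\<in>Basis. (v \<bullet> b) *\<^sub>R pd S b f x)"
proof -
 interpret bounded_linear "%h. pd S h f x" by (rule pd_linear[OF assms])
 have "pd S v f x = pd S (\<Sum>b\<in>Basis. (v \<bullet> b) *\<^sub>R b) f x" by (simp add: euclidean_representation)
 also have "\<dots> = (\<Sum>b\<in>Basis. (v \<bullet> b) *\<^sub>R pd S b f x)" by (simp add: sum scaleR)
 finally show ?thesis .
qed

lemma C1_cont: "C1 S f ==> continuous_on S f"
 unfolding C1_def using differentiable_imp_continuous_within continuous_on_eq_continuous_within by blast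

lemma C1_cont_pd: "C1 S f ==> continuous_on S (pd S b f)"
 using pd_expand[of f _ b]
 by (subst continuous_on_cong[OF refl, where g="%x. (\<Sum>c\<in>Basis. (b \<bullet> c) *\<^sub>R pd S c f x)"])
   (auto intro!: continuous_intros simp: C1_def)

lemma C1_const [simp]: "C1 S (%_. c)"
 by (rule C1I[where f'="%_ _. 0"]) auto

lemma pd_const: "x \<in> S ==> pd S b (%_. c) x = 0"
 by (rule pd_eq) auto

lemma
 assumes f: "C1 S f" and g: "C1 S g"
 shows C1_add: "C1 S (%x. f x + g x)"
  and pd_add: "x \<in> S ==> pd S b (%x. f x + g x) x = pd S b f x + pd S b g x"
  and C1_diff: "C1 S (%x. f x - g x)"
  and pd_diff: "x \<in> S ==> pd S b (%x. f x - g x) x = pd S b f x - pd S b g x"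
  and C1_mult: "C1 S (%x. f x * g x)"
  and pd_mult: "x \<in> S ==> pd S b (%x. f x * g x) x = pd S b f x * g x + f x * pd S b g x"
proof -
 note D = C1_deriv[OF f] C1_deriv[OF g]
 note cont = C1_cont[OF f] C1_cont[OF g] C1_cont_pd[OF f] C1_cont_pd[OF g]
 show "C1 S (%x. f x + g x)"
  by (rule C1I[OF has_derivative_add[OF D]]) (auto intro!: continuous_intros cont)
 show "x \<in> S ==> pd S b (%x. f x + g x) x = pd S b f x + pd S b g x"
  by (rule pd_eq[OF _ has_derivative_add[OF D]])
 show "C1 S (%x. f x - g x)"
  by (rule C1I[OF has_derivative_diff[OF D]]) (auto intro!: continuous_intros cont)
 show "x \<in> S ==> pd S b (%x. f x - g x) x = pd S b f x - pd S b g x"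
  by (rule pd_eq[OF _ has_derivative_diff[OF D]])
 show "C1 S (%x. f x * g x)"
  by (rule C1I[OF has_derivative_mult[OF D]]) (auto intro!: continuous_intros cont)
 show "x \<in> S ==> pd S b (%x. f x * g x) x = pd S b f x * g x + f x * pd S b g x"
  using pd_eq[OF _ has_derivative_mult[OF D], of x b] by simp
qed

lemma
 assumes f: "C1 S f"
 shows C1_minus: "C1 S (%x. - f x)"
  and pd_minus: "x \<in> S ==> pd S b (%x. - f x) x = - pd S b f x"
  and C1_cmult: "C1 S (%x. c * f x)"
  and pd_cmult: "x \<in> S ==> pd S b (%x. c * f x) x = c * pd S b f x"
  and C1_cnj: "C1 S (%x. cnj (f x))"
  and pd_cnj: "x \<in> S ==> pd S b (%x. cnj (f x)) x = cnj (pd S b f x)"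
  and C1_exp: "C1 S (%x. exp (f x))"
  and pd_exp: "x \<in> S ==> pd S b (%x. exp (f x)) x = exp (f x) * pd S b f x"
  and C1_inverse: "(\<And>x. x \<in> S ==> f x \<noteq> 0) ==> C1 S (%x. inverse (f x))"
proof -
 note D = C1_deriv[OF f]
 note cont = C1_cont[OF f] C1_cont_pd[OF f]
 show "C1 S (%x. - f x)" "x \<in> S ==> pd S b (%x. - f x) x = - pd S b f x"
  using C1_diff[OF C1_const[of 0] f] pd_diff[OF C1_const[of 0] f, of x b] by (auto simp: pd_const)
 show "C1 S (%x. c * f x)" "x \<in> S ==> pd S b (%x. c * f x) x = c * pd S b f x"
  using C1_mult[OF C1_const[of c] f] pd_mult[OF C1_const[of c] f, of x b] by (auto simp: pd_const)
 show "C1 S (%x. cnj (f x))"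
  by (rule C1I[OF has_derivative_cnj[OF D]]) (auto intro!: continuous_intros cont)
 show "x \<in> S ==> pd S b (%x. cnj (f x)) x = cnj (pd S b f x)"
  by (rule pd_eq[OF _ has_derivative_cnj[OF D]])
 have E: "((%x. exp (f x)) has_derivative (%h. pd S h f x * exp (f x))) (at x within S)" if "x \<in> S" for x
  using has_derivative_compose[OF D[OF that], of exp "%h. h * exp (f x)"]
  by (auto simp: has_field_derivative_def[symmetric] mult.commute[of _ "exp _"] intro!: DERIV_exp)
 show "C1 S (%x. exp (f x))"
  by (rule C1I[OF E]) (auto intro!: continuous_intros cont)
 show "x \<in> S ==> pd S b (%x. exp (f x)) x = exp (f x) * pd S b f x"
  using pd_eq[OF _ E, of x b] by simp
 show "C1 S (%x. inverse (f x))" if nz: "\<And>x. x \<in> S ==> f x \<noteq> 0"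
  by (rule C1I[OF Deriv.has_derivative_inverse[OF nz D]]) (auto intro!: continuous_intros cont nz)
qed

lemma
 assumes f: "\<And>i. i \<in> I ==> C1 S (f i)"
 shows C1_sum: "C1 S (%x. \<Sum>i\<in>I. f i x)"
  and pd_sum: "x \<in> S ==> pd S b (%x. \<Sum>i\<in>I. f i x) x = (\<Sum>i\<in>I. pd S b (f i) x)"
proof -
 have D: "((%x. \<Sum>i\<in>I. f i x) has_derivative (%h. \<Sum>i\<in>I. pd S h (f i) x)) (at x within S)" if "x \<in> S" for x
  by (intro has_derivative_sum C1_deriv f that)
 show "C1 S (%x. \<Sum>i\<in>I. f i x)"
  by (rule C1I[OF D]) (auto intro!: continuous_intros C1_cont_pd f)
 show "x \<in> S ==> pd S b (%x. \<Sum>i\<in>I. f i x) x = (\<Sum>i\<in>I. pd S b (f i) x)"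
  by (rule pd_eq[OF _ D])
qed

lemma C1_of_real_deriv:
 assumes "\<And>x. x \<in> S ==> (f has_derivative f' x) (at x within S)"
 shows "x \<in> S ==> (cplx f has_derivative (%h. complex_of_real (f' x h))) (at x within S)"
 using has_derivative_of_real[OF assms] .

lemma
 assumes f: "C1 S (cplx f)"
 shows C1_real_deriv: "x \<in> S ==> (f has_derivative (%h. Re (pd S h (cplx f) x))) (at x within S)"
  and pd_real: "x \<in> S ==> pd S b (cplx f) x = complex_of_real (Re (pd S b (cplx f) x))"
proof -
 show D: "(f has_derivative (%h. Re (pd S h (cplx f) x))) (at x within S)" if "x \<in> S" for x
  using has_derivative_Re[OF C1_deriv[OF f that]] by simp
 show "pd S b (cplx f) x = complex_of_real (Re (pd S b (cplx f) x))" if "x \<in> S"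
  using pd_eq[OF that has_derivative_of_real[OF D[OF that]], of b] by simp
qed

lemma
 assumes f: "C1 S (cplx f)"
  and h: "\<And>t. (h has_real_derivative h' t) (at t)" and h': "continuous_on UNIV h'"
 shows C1_compose_real: "C1 S (cplx (%x. h (f x)))"
  and pd_compose_real: "x \<in> S ==> pd S b (cplx (%x. h (f x))) x = h' (f x) * pd S b (cplx f) x"
proof -
 have D: "(cplx (%x. h (f x)) has_derivative (%b. complex_of_real (h' (f x) * Re (pd S b (cplx f) x)))) (at x within S)"
  if "x \<in> S" for x
  using has_derivative_of_real[OF has_derivative_compose[OF C1_real_deriv[OF f that] h[unfolded has_field_derivative_def]]]
  by simp
 have cf: "continuous_on S f"
  using continuous_on_Re[OF C1_cont[OF f]] by simp
 show "C1 S (cplx (%x. h (f x)))"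
  by (rule C1I[OF D])
    (auto intro!: continuous_intros C1_cont_pd f continuous_on_compose2[OF h'] cf)
 show "x \<in> S ==> pd S b (cplx (%x. h (f x))) x = h' (f x) * pd S b (cplx f) x"
  using pd_eq[OF _ D, of x b] pd_real[OF f, of x b] by simp
qed

lemma Ck1_imp_C1: "Ck_on 1 S f ==> C1 S f"
 by (auto intro: C1I)

lemma Ck1_imp_C1_real:
 assumes "Ck_on 1 S f"
 shows "C1 S (cplx f)"
proof -
 obtain f' where f': "\<And>x. x \<in> S ==> (f has_derivative f' x) (at x within S)"
  and C: "\<And>b. b \<in> Basis ==> continuous_on S (%x. f' x b)"
  using assms by auto
 show ?thesis
  by (rule C1I[OF C1_of_real_deriv[OF f']]) (auto intro!: continuous_intros C)
qed

lemma
 assumes "Ck_on 2 S f"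
 shows Ck2_imp_C1: "C1 S (cplx f)"
  and Ck2_imp_C1_pd: "C1 S (pd S b (cplx f))"
proof -
 obtain f' where f': "\<And>x. x \<in> S ==> (f has_derivative f' x) (at x within S)"
  and C: "\<And>b. b \<in> Basis ==> Ck_on 1 S (%x. f' x b)"
  using assms by (auto simp: numeral_2_eq_2)
 note CC = Ck1_imp_C1_real[OF C]
 note eq = pd_eq[OF _ C1_of_real_deriv[OF f']]
 show c1: "C1 S (cplx f)"
  by (rule C1I[OF C1_of_real_deriv[OF f']]) (assumption | rule C1_cont[OF CC])+
 have *: "C1 S (pd S b (cplx f))" if "b \<in> Basis" for b
  by (subst C1_cong[OF eq[of _ b]]) (auto intro: CC[OF that])
 have "C1 S (%x. \<Sum>c\<in>Basis. complex_of_real (b \<bullet> c) * pd S c (cplx f) x)"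
  by (intro C1_sum C1_cmult *)
 then show "C1 S (pd S b (cplx f))"
  by (subst C1_cong[of "pd S b (cplx f)"]) (auto simp: pd_expand[OF c1, of _ b] scaleR_conv_of_real)
qed

end

lemma fat_set_open: "open S ==> fat_set S"
proof
 fix x assume S: "open S" and "x \<in> S"
 have "\<forall>\<^sub>F s in at_right (0::real). x + s *\<^sub>R v \<in> S" for v
 proof -
  have "((%s::real. x + s *\<^sub>R v) \<longlongrightarrow> x + 0 *\<^sub>R v) (at_right 0)"
   by (intro tendsto_intros)
  then show ?thesis using S \<open>x \<in> S\<close> by (auto simp: tendsto_def)
 qed
 then show "\<exists>T. open T \<and> T \<noteq> {} \<and> (\<forall>v\<in>T. \<forall>\<^sub>F s in at_right (0::real). x + s *\<^sub>R v \<in> S)"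
  by (intro exI[of _ UNIV]) auto
qed

interpretation UN: fat_set UNIV by (rule fat_set_open) simp

text \<open>On a smaller set the derivative is in principle less constrained; fatness of the smaller set makes it
 the same.\<close>

lemma C1_restrict:
 assumes f: "C1 T f" and "fat_set S" "fat_set T" "S \<subseteq> T"
 shows "C1 S f" "x \<in> S ==> pd S b f x = pd T b f x"
proof -
 interpret S: fat_set S by fact
 interpret T: fat_set T by fact
 have D: "(f has_derivative (%h. pd T h f x)) (at x within S)" if "x \<in> S" for x
  using T.C1_deriv[OF f] that has_derivative_subset assms(4) by blast
 show "C1 S f" by (rule S.C1I[OF D]) (auto intro: continuous_on_subset[OF T.C1_cont_pd[OF f] assms(4)])
 show "pd S b f x = pd T b f x" if "x \<in> S" using S.pd_eq[OF that D[OF that]] .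
qed

lemma Ck_on_subset: "Ck_on k T f ==> S \<subseteq> T ==> Ck_on k S f"
proof (induction k arbitrary: f)
 case 0 then show ?case using continuous_on_subset by auto
next
 case (Suc k) then show ?case by (simp) (meson has_derivative_subset subsetD)
qed

section \<open>Smooth bump functions and equality of measures\<close>

text \<open>The functions \<open>exp (-1/t) t^(-m)\<close> for \<open>t > 0\<close>. Keeping the power of \<open>t\<close> as a parameter closes the
 family under differentiation, which gives smoothness by induction.\<close>

definition flat :: "nat => real => real" where
 "flat m t = (if t \<le> 0 then 0 else exp (- (1 / t)) / t ^ m)"

lemma flat_nonneg: "0 \<le> flat m t" by (simp add: flat_def)
lemma flat_pos: "0 < t ==> 0 < flat m t" by (simp add: flat_def)
lemma flat_zero: "t \<le> 0 ==> flat m t = 0" by (simp add: flat_def)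

lemma flat_tendsto: "(flat m \<longlongrightarrow> 0) (at 0)"
proof -
 have R: "((%x::real. x ^ m / exp x) \<longlongrightarrow> 0) at_top" by (rule tendsto_power_div_exp_0)
 have "((%t. inverse t ^ m / exp (inverse t)) \<longlongrightarrow> (0::real)) (at_right 0)"
  by (rule filterlim_compose[OF R filterlim_inverse_at_top_right])
 then have "(flat m \<longlongrightarrow> 0) (at_right 0)"
 proof (rule tendsto_cong[THEN iffD1, rotated])
  show "\<forall>\<^sub>F t in at_right (0::real). inverse t ^ m / exp (inverse t) = flat m t"
   using eventually_at_right_less[of "0::real"]
   by eventually_elim (auto simp: flat_def exp_minus field_simps)
 qed
 moreover have "(flat m \<longlongrightarrow> 0) (at_left 0)"
 proof (rule tendsto_cong[THEN iffD1, OF _ tendsto_const])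
  show "\<forall>\<^sub>F t in at_left (0::real). 0 = flat m t"
   by (auto simp: eventually_at_left_field flat_def intro: exI[of _ "-1"])
 qed
 ultimately show ?thesis by (simp add: filterlim_split_at)
qed

lemma flat_deriv: "(flat m has_real_derivative (flat (m + 2) t - m * flat (m + 1) t)) (at t)"
proof -
 consider "t < 0" | "t = 0" | "t > 0" by linarith
 then show ?thesis
 proof cases
  case 1
  have "((%_. 0) has_real_derivative 0) (at t)" by simp
  then have "(flat m has_real_derivative 0) (at t)"
   by (rule has_field_derivative_transform_within_open[of _ _ _ "{..<0}"]) (use 1 in \<open>auto simp: flat_def\<close>)
  then show ?thesis using 1 by (simp add: flat_def)
 next
  case 2
  have "((%h. (flat m (0 + h) - flat m 0) / h) \<longlongrightarrow> 0) (at 0)"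
  proof (rule tendsto_cong[THEN iffD1, OF _ flat_tendsto[of "m+1"]])
   show "\<forall>\<^sub>F h in at (0::real). flat (m+1) h = (flat m (0 + h) - flat m 0) / h"
    by (rule eventually_at_topological[THEN iffD2]) (auto simp: flat_def field_simps)
  qed
  then have "(flat m has_real_derivative 0) (at 0)" by (simp add: DERIV_def)
  then show ?thesis using 2 by (simp add: flat_def)
 next
  case 3
  have "((%t. exp (- (1 / t)) / t ^ m) has_real_derivative (flat (m + 2) t - m * flat (m + 1) t)) (at t)"
   apply (rule derivative_eq_intros refl | (use 3 in simp; fail))+
   apply (cases m)
   using 3 by (simp_all add: flat_def field_simps power2_eq_square)
  then show ?thesis
   by (rule has_field_derivative_transform_within_open[of _ _ _ "{0<..}"]) (use 3 in \<open>auto simp: flat_def\<close>)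
 qed
qed

lemma flat_continuous: "continuous_on A (flat m)"
 by (meson DERIV_isCont continuous_at_imp_continuous_on flat_deriv)

lemma Ck_on_Suc_imp: "Ck_on (Suc k) S f ==> Ck_on k S f"
proof (induction k arbitrary: f)
 case 0 then show ?case
  by (auto simp: continuous_on_eq_continuous_within intro: has_derivative_continuous)
next
 case (Suc k)
 then obtain f' where "\<forall>x\<in>S. (f has_derivative f' x) (at x within S)"
  "\<forall>b\<in>Basis. Ck_on (Suc k) S (%x. f' x b)" by (metis Ck_on.simps(2))
 then have "(\<forall>x\<in>S. (f has_derivative f' x) (at x within S)) \<and> (\<forall>b\<in>Basis. Ck_on k S (%x. f' x b))"
  using Suc.IH by blast
 then show ?case unfolding Ck_on.simps by blast
qed

lemma Ck_const: "Ck_on k S (%_. c)"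
proof (induction k arbitrary: c)
 case (Suc k) then show ?case by (auto intro!: exI[of _ "%_ _. 0"])
qed simp

lemma Ck_add: "Ck_on k S f ==> Ck_on k S g ==> Ck_on k S (%x. f x + g x)"
proof (induction k arbitrary: f g)
 case 0 then show ?case by (auto intro: continuous_intros)
next
 case (Suc k)
 then obtain f' g' where "\<forall>x\<in>S. (f has_derivative f' x) (at x within S)"
  "\<forall>b\<in>Basis. Ck_on k S (%x. f' x b)" "\<forall>x\<in>S. (g has_derivative g' x) (at x within S)"
  "\<forall>b\<in>Basis. Ck_on k S (%x. g' x b)" by auto
 then show ?case by (auto intro!: exI[of _ "%x h. f' x h + g' x h"] has_derivative_add Suc.IH)
qed

lemma Ck_mult:
 fixes f g :: "'a::euclidean_space => complex"
 shows "Ck_on k S f ==> Ck_on k S g ==> Ck_on k S (%x. f x * g x)"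
proof (induction k arbitrary: f g)
 case 0 then show ?case by (auto intro: continuous_intros)
next
 case (Suc k)
 then obtain f' g' where "\<forall>x\<in>S. (f has_derivative f' x) (at x within S)"
  "\<forall>b\<in>Basis. Ck_on k S (%x. f' x b)" "\<forall>x\<in>S. (g has_derivative g' x) (at x within S)"
  "\<forall>b\<in>Basis. Ck_on k S (%x. g' x b)" by auto
 moreover have "Ck_on k S f" "Ck_on k S g" using Suc.prems Ck_on_Suc_imp by blast+
 ultimately show ?case
  by (auto intro!: exI[of _ "%x h. f x * g' x h + f' x h * g x"] has_derivative_mult Ck_add Suc.IH)
qed

lemma Ck_prod:
 fixes f :: "'i => 'a::euclidean_space => complex"
 shows "(\<And>i. i \<in> I ==> Ck_on k S (f i)) ==> Ck_on k S (%x. \<Prod>i\<in>I. f i x)"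
 by (induction I rule: infinite_finite_induct) (auto intro: Ck_const Ck_mult)

text \<open>The induction is over the order \<open>k\<close> for all \<open>m\<close> simultaneously, since differentiation raises \<open>m\<close>.\<close>

lemma Ck_flat: "Ck_on k UNIV (%z::'a::euclidean_space. complex_of_real (flat m (a * (z \<bullet> i) + c)))"
proof (induction k arbitrary: m)
 case 0 show ?case by (auto intro!: continuous_intros continuous_on_compose2[OF flat_continuous])
next
 case (Suc k)
 define f' where "f' = (%(z::'a) h. complex_of_real ((flat (m + 2) (a * (z \<bullet> i) + c) - m * flat (m + 1) (a * (z \<bullet> i) + c)) * (a * (h \<bullet> i))))"
 have D: "((%z. complex_of_real (flat m (a * (z \<bullet> i) + c))) has_derivative f' z) (at z)" for z
  unfolding f'_def
  by (rule has_derivative_of_real, rule has_derivative_compose[OF _ flat_deriv[unfolded has_field_derivative_def], of "%z. a * (z \<bullet> i) + c" "%h. a * (h \<bullet> i)"])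
    (auto intro!: derivative_eq_intros)
 have "Ck_on k UNIV (%z. f' z b)" for b
 proof -
  have "Ck_on k UNIV (%z. complex_of_real (flat (m+2) (a * (z \<bullet> i) + c)) * complex_of_real (a * (b \<bullet> i))
    + complex_of_real (- real m * (a * (b \<bullet> i))) * complex_of_real (flat (m + 1) (a * (z \<bullet> i) + c)))"
   by (intro Ck_add Ck_mult Ck_const Suc.IH)
  then show ?thesis by (simp add: f'_def algebra_simps)
 qed
 then show ?case using D by auto
qed

text \<open>A bump function, positive exactly on the open box; it increases to its indicator.\<close>

definition bump :: "nat => 'a::euclidean_space => 'a => 'a => real" where
 "bump k a b z = (\<Prod>i\<in>Basis. flat 0 (real (Suc k) * (z \<bullet> i - a \<bullet> i)) * flat 0 (real (Suc k) * (b \<bullet> i - z \<bullet> i)))"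

lemma flat0_le1: "flat 0 t \<le> 1" by (simp add: flat_def)
lemma flat0_mono: "s \<le> t ==> flat 0 s \<le> flat 0 t" by (auto simp: flat_def field_simps)

lemma bump_nonneg: "0 \<le> bump k a b z"
 unfolding bump_def by (intro prod_nonneg mult_nonneg_nonneg flat_nonneg)

lemma bump_le1: "bump k a b z \<le> 1"
 unfolding bump_def by (intro prod_le_1 conjI mult_nonneg_nonneg mult_le_one flat_nonneg flat0_le1)

lemma bump_pos: "z \<in> box a b ==> 0 < bump k a b z"
 by (auto simp: bump_def mem_box intro!: prod_pos flat_pos mult_pos_pos)

lemma bump_zero: "z \<notin> box a b ==> bump k a b z = 0"
proof -
 assume "z \<notin> box a b"
 then obtain i where i: "i \<in> Basis" "z \<bullet> i \<le> a \<bullet> i \<or> b \<bullet> i \<le> z \<bullet> i" by (auto simp: mem_box not_less)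
 then have "flat 0 (real (Suc k) * (z \<bullet> i - a \<bullet> i)) * flat 0 (real (Suc k) * (b \<bullet> i - z \<bullet> i)) = 0"
  by (auto intro!: flat_zero simp: mult_le_0_iff)
 then show ?thesis unfolding bump_def using i by (intro prod_zero) auto
qed

lemma bump_mono: "k \<le> l ==> bump k a b z \<le> bump l a b z"
proof (cases "z \<in> box a b")
 case True
 assume kl: "k \<le> l"
 show ?thesis unfolding bump_def
  using True kl
  by (intro prod_mono) (auto simp: mem_box less_imp_le intro!: mult_mono flat_nonneg flat0_mono mult_nonneg_nonneg mult_right_mono)
qed (simp add: bump_zero)

lemma bump_tendsto: "(%k. bump k a b z) \<longlonglongrightarrow> indicator (box a b) z"
proof (cases "z \<in> box a b")
 case True
 have flat1: "(%k. flat 0 (real (Suc k) * t)) \<longlonglongrightarrow> 1" if "t > 0" for t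
 proof -
  have "(%k. exp (- (1 / t) * inverse (real (Suc k)))) \<longlonglongrightarrow> exp (- (1/t) * 0)"
   by (intro tendsto_intros LIMSEQ_inverse_real_of_nat)
  moreover have "flat 0 (real (Suc k) * t) = exp (- (1 / t) * inverse (real (Suc k)))" for k
  proof -
   have "real (Suc k) * t > 0" using that by (simp del: of_nat_Suc)
   then show ?thesis by (simp add: flat_def field_simps del: of_nat_Suc)
  qed
  ultimately show ?thesis by simp
 qed
 have "(%k. bump k a b z) \<longlonglongrightarrow> (\<Prod>i\<in>(Basis::'a set). 1 * 1)"
  unfolding bump_def using True
  by (intro tendsto_prod tendsto_mult flat1) (auto simp: mem_box)
 then show ?thesis using True by simp
qed (simp add: bump_zero)

lemma Ck_bump: "Ck_on n UNIV (cplx (bump k a b))"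
proof -
 have "Ck_on n UNIV (%z::'a. \<Prod>i\<in>Basis. complex_of_real (flat 0 (real (Suc k) * (z \<bullet> i) + (- real (Suc k) * (a \<bullet> i)))) *
   complex_of_real (flat 0 (- real (Suc k) * (z \<bullet> i) + real (Suc k) * (b \<bullet> i))))"
  by (intro Ck_prod Ck_mult Ck_flat)
 then show ?thesis by (simp add: bump_def algebra_simps of_real_prod)
qed

lemma test_function_bump: "cbox a b \<subseteq> G ==> test_function G (cplx (bump k a b))"
 unfolding test_function_def using Ck_bump bump_zero box_subset_cbox by (metis compact_cbox of_real_0 subsetD)

lemma C1_bump: "C1 UNIV (cplx (bump k a b))"
 by (rule UN.Ck1_imp_C1[OF Ck_bump])

lemma bump_continuous: "continuous_on A (bump k a b)"
proof -
 have "continuous_on UNIV (cplx (bump k a b))" using UN.C1_cont[OF C1_bump] .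
 then have "continuous_on UNIV (%z. Re (complex_of_real (bump k a b z)))" by (rule continuous_on_Re)
 then show ?thesis by (auto intro: continuous_on_subset)
qed

lemma bump_measurable [measurable]: "bump k a b \<in> borel_measurable borel"
 by (rule borel_measurable_continuous_onI[OF bump_continuous])

text \<open>The bump functions increase to the indicator of the open box, so a Borel measure is determined on
 boxes by the integrals of the bump functions.\<close>

lemma nn_integral_bump_SUP:
 fixes M :: "'a::euclidean_space measure"
 assumes sets: "sets M = sets borel"
 shows "emeasure M (box a b) = (SUP k. \<integral>\<^sup>+z. ennreal (bump k a b z) \<partial>M)"
proof -
 have [measurable]: "bump k a b \<in> borel_measurable M" for k
  using bump_measurable measurable_cong_sets[OF sets refl] by blast
 have inc: "incseq (%k. ennreal (bump k a b z))" for z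
  by (auto simp: incseq_def intro!: ennreal_leI bump_mono)
 have "(%k. ennreal (bump k a b z)) \<longlonglongrightarrow> ennreal (indicator (box a b) z)" for z
  by (intro tendsto_ennrealI bump_tendsto)
 then have "(SUP k. ennreal (bump k a b z)) = indicator (box a b) z" for z
  using LIMSEQ_unique[OF LIMSEQ_SUP[OF inc]] by (simp add: ennreal_indicator)
 moreover have "(\<integral>\<^sup>+z. (SUP k. ennreal (bump k a b z)) \<partial>M) = (SUP k. \<integral>\<^sup>+z. ennreal (bump k a b z) \<partial>M)"
  by (rule nn_integral_monotone_convergence_SUP)
    (auto simp: incseq_def le_fun_def intro!: ennreal_leI bump_mono)
 ultimately show ?thesis by (simp add: sets)
qed

text \<open>Boxes with closure in \<open>G\<close> form an intersection stable generator of the Borel sets inside each such box,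
 and \<open>G\<close> is a countable union of them.\<close>

lemma measures_eq_on_open:
 fixes M N :: "'a::euclidean_space measure"
 assumes sets: "sets M = sets borel" "sets N = sets borel" and G: "open G"
  and fin: "\<And>a b. cbox a b \<subseteq> G ==> emeasure M (box a b) < \<infinity>"
  and eq: "\<And>k a b. cbox a b \<subseteq> G ==>
   (\<integral>\<^sup>+z. ennreal (bump k a b z) \<partial>M) = (\<integral>\<^sup>+z. ennreal (bump k a b z) \<partial>N)"
  and A: "A \<in> sets borel" "A \<subseteq> G"
 shows "emeasure M A = emeasure N A"
proof -
 have box_eq: "emeasure M (box a b) = emeasure N (box a b)" if "cbox a b \<subseteq> G" for a b
  using that by (simp add: nn_integral_bump_SUP sets eq)
 have local_eq: "emeasure M (A \<inter> box a b) = emeasure N (A \<inter> box a b)"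
  if ab: "cbox a b \<subseteq> G" and A: "A \<in> sets borel" for a b A
 proof -
  let ?D = "%M. density M (indicator (box a b))"
  have D: "emeasure (?D M) X = emeasure M (X \<inter> box a b)" if "X \<in> sets borel" "sets M = sets borel"
   for M and X :: "'a set"
   using that by (subst emeasure_density) (auto simp: nn_integral_indicator[symmetric] indicator_inter_arith mult.commute intro!: nn_integral_cong)
  have "?D M = ?D N"
  proof (rule measure_eqI_generator_eq)
   let ?E = "range (%(a, b). box a b::'a set)"
   show "Int_stable ?E"
    by (auto simp: Int_stable_def box_Int_box)
   show "?E \<subseteq> Pow UNIV" "sets (?D M) = sigma_sets UNIV ?E" "sets (?D N) = sigma_sets UNIV ?E"
    by (simp_all add: borel_eq_box sets)
   let ?A = "%n::nat. box (- (real n *\<^sub>R One)) (real n *\<^sub>R One) :: 'a set"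
   show "range ?A \<subseteq> ?E" "(\<Union>i. ?A i) = UNIV"
    unfolding UN_box_eq_UNIV by auto
   show "emeasure (?D M) (?A i) \<noteq> \<infinity>" for i
   proof -
    have "emeasure (?D M) (?A i) \<le> emeasure M (box a b)"
     by (subst D) (auto simp: sets intro!: emeasure_mono)
    then show ?thesis using fin[OF ab] by auto
   qed
   fix X assume "X \<in> ?E"
   then obtain c d where X: "X = box c d" by auto
   obtain e f where ef: "box c d \<inter> box a b = box e f" using box_Int_box by blast
   have "emeasure M (box e f) = emeasure N (box e f)"
   proof (cases "box e f = {}")
    case False
    have "closure (box e f) \<subseteq> closure (box a b)" using ef by (intro closure_mono) auto
    also have "\<dots> \<subseteq> cbox a b" by (meson box_subset_cbox closed_cbox closure_minimal)
    finally have "cbox e f \<subseteq> G" using False ab by (simp add: closure_box)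
    then show ?thesis by (rule box_eq)
   qed simp
   then show "emeasure (?D M) X = emeasure (?D N) X"
    by (simp add: D sets X ef)
  qed
  then show ?thesis using D[OF A sets(1)] D[OF A sets(2)] by simp
 qed
 \<comment> \<open>countably many boxes exhaust \<open>G\<close>; their disjointed parts reduce the claim to one box at a time\<close>
 obtain \<D> where \<D>: "countable \<D>" "\<D> \<subseteq> Pow G" "\<And>X. X \<in> \<D> ==> \<exists>a b. X = cbox a b" "(\<Union>X\<in>\<D>. interior X) = G"
 proof -
  let ?I = "{p :: 'a \<times> 'a. cbox (fst p) (snd p) \<subseteq> G}"
  let ?\<F> = "(%p::'a\<times>'a. box (fst p) (snd p)) ` ?I"
  have cov: "\<Union>?\<F> = G"
  proof
   show "G \<subseteq> \<Union>?\<F>"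
   proof
    fix x assume "x \<in> G"
    then obtain a b where "x \<in> box a b" "cbox a b \<subseteq> G"
     using open_contains_cbox[OF G] by metis
    then show "x \<in> \<Union>?\<F>" by force
   qed
  qed (use box_subset_cbox in fastforce)
  obtain \<F>' where F': "\<F>' \<subseteq> ?\<F>" "countable \<F>'" "\<Union>\<F>' = \<Union>?\<F>"
   by (rule Lindelof[of ?\<F>]) auto
  obtain C where C: "countable C" "C \<subseteq> ?I" "\<F>' = (%p. box (fst p) (snd p)) ` C"
   using countable_subset_image[THEN iffD1, OF conjI[OF F'(2) F'(1)]] by auto
  show ?thesis
  proof (rule that[of "(%p. cbox (fst p) (snd p)) ` C"])
   show "(\<Union>X\<in>(%p. cbox (fst p) (snd p)) ` C. interior X) = G"
    using C F' cov by (simp add: interior_cbox)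
  qed (use C in auto)
 qed
 show ?thesis
 proof (cases "\<D> = {}")
  case True then show ?thesis using \<D> A by auto
 next
  case False
  define B where "B n = interior (from_nat_into \<D> n)" for n
  have B: "\<exists>a b. B n = box a b \<and> cbox a b \<subseteq> G" for n
   using \<D>(2) \<D>(3)[of "from_nat_into \<D> n"] from_nat_into[OF False, of n] unfolding B_def
   by (metis PowD interior_cbox subsetD)
  have [measurable]: "B n \<in> sets borel" for n using B by (metis borel_open open_box)
  have UB: "(\<Union>n. B n) = G"
   using \<D>(4) range_from_nat_into[OF False \<D>(1)] unfolding B_def by (metis (no_types, lifting) SUP_cong UN_extend_simps(10))
  have dis: "disjoint_family (%n. A \<inter> disjointed B n)"
   using disjoint_family_disjointed[of B] by (auto simp: disjoint_family_on_def)
  have mb[measurable]: "A \<inter> disjointed B n \<in> sets borel" for n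
   using A by (auto simp: disjointed_def)
  have Aeq: "A = (\<Union>n. A \<inter> disjointed B n)"
   using A(2) UB UN_disjointed_eq[of B] by auto
  have "emeasure M (A \<inter> disjointed B n) = emeasure N (A \<inter> disjointed B n)" for n
  proof -
   obtain a b where ab: "B n = box a b" "cbox a b \<subseteq> G" using B by blast
   have "A \<inter> disjointed B n = (A \<inter> disjointed B n) \<inter> box a b"
    using disjointed_subset[of B n] ab by auto
   then show ?thesis using local_eq[OF ab(2) mb[of n]] by simp
  qed
  then have "(\<Sum>n. emeasure M (A \<inter> disjointed B n)) = (\<Sum>n. emeasure N (A \<inter> disjointed B n))" by simp
  moreover have "(\<Sum>n. emeasure M (A \<inter> disjointed B n)) = emeasure M A"
  proof -
   have "range (%n. A \<inter> disjointed B n) \<subseteq> sets M" unfolding sets using mb by blast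
   from suminf_emeasure[OF this dis] show ?thesis by (simp only: Aeq[symmetric])
  qed
  moreover have "(\<Sum>n. emeasure N (A \<inter> disjointed B n)) = emeasure N A"
  proof -
   have "range (%n. A \<inter> disjointed B n) \<subseteq> sets N" unfolding sets using mb by blast
   from suminf_emeasure[OF this dis] show ?thesis by (simp only: Aeq[symmetric])
  qed
  ultimately show ?thesis by simp
 qed
qed

text \<open>The fundamental lemma of the calculus of variations. The positive and the negative part of \<open>w\<close>, read as
 densities, are two measures with the same integrals of bump functions; so they agree on the set where
 \<open>w\<close> is positive, on which one of them is zero.\<close>

lemma AE_zero_if_orthogonal_to_bumps_real:
 fixes w :: "'a::euclidean_space => real"
 assumes G: "open G" and meas: "w \<in> borel_measurable lborel"
  and int: "\<And>a b. cbox a b \<subseteq> G ==> integrable lborel (%z. indicator (cbox a b) z * w z)"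
  and zero: "\<And>k a b. cbox a b \<subseteq> G ==> (\<integral>z. bump k a b z * w z \<partial>lborel) = 0"
 shows "AE z in lborel. z \<in> G --> w z = 0"
proof -
 have [measurable]: "w \<in> borel_measurable borel" using meas by simp
 have half: "AE z in lborel. z \<in> G --> v z \<le> 0"
  if v[measurable]: "v \<in> borel_measurable borel"
   and int: "\<And>a b. cbox a b \<subseteq> G ==> integrable lborel (%z. indicator (cbox a b) z * v z)"
   and zero: "\<And>k a b. cbox a b \<subseteq> G ==> (\<integral>z. bump k a b z * v z \<partial>lborel) = 0"
  for v :: "'a => real"
 proof -
  let ?M = "density lborel (%z. ennreal (v z))"
  let ?N = "density lborel (%z. ennreal (- v z))"
  have b_le: "bump k a b z \<le> indicator (cbox a b) z" for k a b and z :: 'a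
   using bump_le1[of k a b z] bump_zero[of z a b k] subsetD[OF box_subset_cbox, of z a b]
   by (cases "z \<in> box a b") (auto simp: indicator_def)
  have ib: "integrable lborel (%z. bump k a b z * v z)" if "cbox a b \<subseteq> G" for k a b
  proof (rule Bochner_Integration.integrable_bound[OF int[OF that]])
   show "AE z in lborel. norm (bump k a b z * v z) \<le> norm (indicator (cbox a b) z * v z)"
    using b_le[of k a b] by (auto simp: abs_mult bump_nonneg intro!: mult_right_mono AE_I2)
  qed simp
  have A: "A \<in> sets borel ==> A \<subseteq> G ==> emeasure ?M A = emeasure ?N A" for A
  proof (rule measures_eq_on_open[OF _ _ G])
   fix a b :: 'a and k assume ab: "cbox a b \<subseteq> G"
   have "emeasure ?M (box a b) \<le> (\<integral>\<^sup>+z. ennreal (norm (indicator (cbox a b) z * v z)) \<partial>lborel)"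
    using box_subset_cbox[of a b] by (subst emeasure_density) (auto simp: indicator_def intro!: nn_integral_mono ennreal_leI)
   also have "\<dots> < \<infinity>" using int[OF ab] by (simp add: integrable_iff_bounded)
   finally show "emeasure ?M (box a b) < \<infinity>" .
   have eq: "(\<integral>\<^sup>+z. ennreal (bump k a b z) \<partial>?M) = (\<integral>\<^sup>+z. ennreal (bump k a b z * v z) \<partial>lborel)"
    by (subst nn_integral_density) (auto simp: ennreal_mult'' bump_nonneg mult.commute intro!: nn_integral_cong)
   have eq': "(\<integral>\<^sup>+z. ennreal (bump k a b z) \<partial>?N) = (\<integral>\<^sup>+z. ennreal (- (bump k a b z * v z)) \<partial>lborel)"
    by (subst nn_integral_density) (auto simp: ennreal_mult''[symmetric] bump_nonneg mult.commute intro!: nn_integral_cong)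
   have fin: "(\<integral>\<^sup>+z. ennreal (bump k a b z * v z) \<partial>lborel) < \<infinity>" "(\<integral>\<^sup>+z. ennreal (- (bump k a b z * v z)) \<partial>lborel) < \<infinity>"
    using ib[OF ab, of k] by (auto simp: real_integrable_def less_top)
   show "(\<integral>\<^sup>+z. ennreal (bump k a b z) \<partial>?M) = (\<integral>\<^sup>+z. ennreal (bump k a b z) \<partial>?N)"
   proof -
    have "enn2real (\<integral>\<^sup>+z. ennreal (bump k a b z * v z) \<partial>lborel) = enn2real (\<integral>\<^sup>+z. ennreal (- (bump k a b z * v z)) \<partial>lborel)"
     using zero[OF ab, of k] real_lebesgue_integral_def[OF ib[OF ab, of k]] by linarith
    then show ?thesis unfolding eq eq' using fin ennreal_enn2real by (metis infinity_ennreal_def)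
   qed
  qed auto
  let ?P = "{z\<in>G. 0 < v z}"
  have [measurable]: "?P \<in> sets borel" using G by measurable
  have "(\<integral>\<^sup>+z. ennreal (v z) * indicator ?P z \<partial>lborel) = (\<integral>\<^sup>+z. ennreal (- v z) * indicator ?P z \<partial>lborel)"
   using A[of ?P] by (simp add: emeasure_density)
  also have "\<dots> = (\<integral>\<^sup>+z. 0 \<partial>(lborel::'a measure))"
   by (intro nn_integral_cong) (auto simp: indicator_def ennreal_neg)
  finally have "AE z in lborel. ennreal (v z) * indicator ?P z = 0"
   by (subst (asm) nn_integral_const) (simp add: nn_integral_0_iff_AE)
  then show ?thesis
   by eventually_elim (auto simp: indicator_def not_less ennreal_eq_0_iff split: if_splits)
 qed
 have "AE z in lborel. z \<in> G --> w z \<le> 0" by (rule half) (auto simp: int zero)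
 moreover have "AE z in lborel. z \<in> G --> - w z \<le> 0"
  by (rule half) (use int zero in \<open>auto simp: int zero\<close>)
 ultimately show ?thesis by eventually_elim auto
qed

text \<open>The version for Lebesgue measurable complex functions, by passing to a Borel representative of the
 real and of the imaginary part.\<close>

lemma AE_zero_if_orthogonal_to_bumps:
 fixes w :: "'a::euclidean_space => complex"
 assumes G: "open G"
  and int: "\<And>a b. cbox a b \<subseteq> G ==> integrable lebesgue (%z. indicator (cbox a b) z *\<^sub>R w z)"
  and meas: "w \<in> borel_measurable lebesgue"
  and zero: "\<And>k a b. cbox a b \<subseteq> G ==> (\<integral>z. bump k a b z *\<^sub>R w z \<partial>lebesgue) = 0"
 shows "AE z in lebesgue. z \<in> G --> w z = 0"
proof -
 have main: "AE z in lebesgue. z \<in> G --> v z = 0"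
  if int: "\<And>a b. cbox a b \<subseteq> G ==> integrable lebesgue (%z. indicator (cbox a b) z * v z)"
   and meas: "v \<in> borel_measurable lebesgue"
   and zero: "\<And>k a b. cbox a b \<subseteq> G ==> (\<integral>z. bump k a b z * v z \<partial>lebesgue) = 0"
  for v :: "'a => real"
 proof -
  obtain v' where v'[measurable]: "v' \<in> borel_measurable lborel" and ae: "AE z in lborel. v z = v' z"
   using completion_ex_borel_measurable_real[OF meas] by blast
  have ae': "AE z in lebesgue. v z = v' z" using ae by (rule AE_completion)
  have "AE z in lborel. z \<in> G --> v' z = 0"
  proof (rule AE_zero_if_orthogonal_to_bumps_real[OF G v'])
   fix a b :: 'a and k assume ab: "cbox a b \<subseteq> G"
   have "integrable lebesgue (%z. indicator (cbox a b) z * v' z)"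
    by (rule integrable_cong_AE_imp[OF int[OF ab]]) (use ae' in \<open>auto intro!: measurable_completion elim: eventually_mono\<close>)
   then show "integrable lborel (%z. indicator (cbox a b) z * v' z)"
    by (subst (asm) integrable_completion) auto
   have "(\<integral>z. bump k a b z * v' z \<partial>lborel) = (\<integral>z. bump k a b z * v' z \<partial>lebesgue)"
    by (rule integral_completion[symmetric]) simp
   also have "\<dots> = (\<integral>z. bump k a b z * v z \<partial>lebesgue)"
    by (rule integral_cong_AE) (use ae' in \<open>auto intro!: borel_measurable_times meas intro: measurable_completion elim: eventually_mono\<close>)
   finally show "(\<integral>z. bump k a b z * v' z \<partial>lborel) = 0" using zero[OF ab] by simp
  qed
  then have "AE z in lebesgue. z \<in> G --> v' z = 0" by (rule AE_completion)
  then show ?thesis using ae' by eventually_elim auto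
 qed
 have bnd: "integrable lebesgue (%z. bump k a b z *\<^sub>R w z)" if ab: "cbox a b \<subseteq> G" for k a b
 proof (rule Bochner_Integration.integrable_bound[OF int[OF ab]])
  show "AE z in lebesgue. norm (bump k a b z *\<^sub>R w z) \<le> norm (indicator (cbox a b) z *\<^sub>R w z)"
  proof (intro AE_I2)
   fix z
   show "norm (bump k a b z *\<^sub>R w z) \<le> norm (indicator (cbox a b) z *\<^sub>R w z)"
    using bump_le1[of k a b z] bump_zero[of z a b k] subsetD[OF box_subset_cbox, of z a b]
    by (cases "z \<in> box a b") (auto simp: bump_nonneg intro!: mult_left_le_one_le)
  qed
  show "(%z. bump k a b z *\<^sub>R w z) \<in> borel_measurable lebesgue"
   by (intro borel_measurable_scaleR meas measurable_completion) simp
 qed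
 have "AE z in lebesgue. z \<in> G --> Re (w z) = 0"
 proof (rule main)
  fix a b :: 'a and k assume ab: "cbox a b \<subseteq> G"
  show "integrable lebesgue (%z. indicator (cbox a b) z * Re (w z))"
   using integrable_Re[OF int[OF ab]] by simp
  show "(\<integral>z. bump k a b z * Re (w z) \<partial>lebesgue) = 0"
   using integral_Re[OF bnd[OF ab, of k]] zero[OF ab, of k] by simp
 qed (use meas in measurable)
 moreover have "AE z in lebesgue. z \<in> G --> Im (w z) = 0"
 proof (rule main)
  fix a b :: 'a and k assume ab: "cbox a b \<subseteq> G"
  show "integrable lebesgue (%z. indicator (cbox a b) z * Im (w z))"
   using integrable_Im[OF int[OF ab]] by simp
  show "(\<integral>z. bump k a b z * Im (w z) \<partial>lebesgue) = 0"
   using integral_Im[OF bnd[OF ab, of k]] zero[OF ab, of k] by simp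
 qed (use meas in measurable)
 ultimately show ?thesis by eventually_elim (auto simp: complex_eq_iff)
qed

section \<open>Integration by parts on the whole space and Fubini along a coordinate\<close>

definition csupp :: "'a::euclidean_space set => ('a => complex) => bool" where
 "csupp G f \<longleftrightarrow> (\<exists>C. compact C \<and> C \<subseteq> G \<and> (\<forall>x. x \<notin> C --> f x = 0))"

lemma csuppI: "compact C ==> C \<subseteq> G ==> (\<And>x. x \<notin> C ==> f x = 0) ==> csupp G f"
 unfolding csupp_def by auto

lemma csupp_UNIV_ball: "csupp G f ==> \<exists>R>0. \<forall>x. norm x > R --> f x = 0"
 unfolding csupp_def
 by (metis bounded_pos compact_imp_bounded not_le)

lemma integral_translate:
 fixes f :: "'a::euclidean_space => 'b::{banach, second_countable_topology}"
 assumes "f \<in> borel_measurable borel"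
 shows "(\<integral>x. f (x + c) \<partial>lborel) = (\<integral>x. f x \<partial>lborel)"
 using integral_distr[of "(+) c" lborel borel f] assms by (simp add: lborel_distr_plus add.commute)

lemma integrable_indicator_cball: "integrable lborel (%x::'a::euclidean_space. c * indicator (cball 0 R) x :: real)"
 using emeasure_bounded_finite[of "cball (0::'a) R"] by (intro integrable_mult_right integrable_real_indicator) auto

lemma integrable_bounded_support:
 fixes f :: "'a::euclidean_space => complex"
 assumes "f \<in> borel_measurable borel" "\<And>x. norm (f x) \<le> B" "\<And>x. norm x > R ==> f x = 0"
 shows "integrable lborel f"
proof (rule Bochner_Integration.integrable_bound[where f="%x. B * indicator (cball 0 R) x"])
 show "integrable lborel (%x. B * indicator (cball 0 R) x :: real)"
  by (rule integrable_indicator_cball)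
 have "0 \<le> B" using assms(2) norm_ge_zero order_trans by blast
 then show "AE x in lborel. norm (f x) \<le> norm (B * indicator (cball 0 R) x :: real)"
  using assms(2,3) by (intro AE_I2) (auto simp: indicator_def not_le)
qed (use assms in simp)

lemma pd_UNIV_zero_outside:
 assumes "C1 UNIV f" and "\<And>x. norm x > R ==> f x = 0" and "norm x > R"
 shows "pd UNIV b f x = 0"
proof -
 have "open (- cball (0::'a) R)" by auto
 interpret O: fat_set "- cball (0::'a) R" by (rule fat_set_open) auto
 have x: "x \<in> - cball 0 R" using assms(3) by auto
 have "pd UNIV b f x = pd (- cball 0 R) b f x"
  using C1_restrict(2)[OF assms(1) O.fat_set_axioms UN.fat_set_axioms _ x] by simp
 also have "\<dots> = pd (- cball 0 R) b (%_. 0) x"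
  by (rule O.C1_cong_pd[OF _ x]) (use assms(2) in auto)
 finally show ?thesis using O.pd_const[OF x] by simp
qed

lemma cont_bounded_outside:
 fixes f :: "'a::euclidean_space => complex"
 assumes "continuous_on UNIV f" "\<And>x. norm x > R ==> f x = 0"
 shows "\<exists>B\<ge>0. \<forall>x. norm (f x) \<le> B"
proof -
 have "compact (f ` cball 0 R)"
  by (intro compact_continuous_image continuous_on_subset[OF assms(1)]) auto
 then obtain B where B: "B > 0" "\<And>y. y \<in> f ` cball 0 R ==> norm y \<le> B"
  using bounded_pos compact_imp_bounded by metis
 have "norm (f x) \<le> B" for x
  using B assms(2)[of x] by (cases "norm x \<le> R") auto
 then show ?thesis using B(1) by (intro exI[of _ B]) auto
qed

text \<open>Difference quotients replace derivatives in the proofs below: translation invariance of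
 Lebesgue measure gives integration by parts for them, and they commute with \<open>pd\<close>.\<close>

definition dq :: "real => 'a::euclidean_space => ('a => complex) => 'a => complex" where
 "dq h b f x = (f (x + h *\<^sub>R b) - f x) / complex_of_real h"

lemma dq_C1: "C1 UNIV f ==> C1 UNIV (dq h b f) \<and> (\<forall>x c. pd UNIV c (dq h b f) x = dq h b (pd UNIV c f) x)"
proof -
 assume f: "C1 UNIV f"
 have D: "((%x. f (x + h *\<^sub>R b)) has_derivative (%c. pd UNIV c f (x + h *\<^sub>R b))) (at x)" for x
 proof -
  have "((%x. x + h *\<^sub>R b) has_derivative (%c. c)) (at x)" by (auto intro!: derivative_eq_intros)
  then show ?thesis using has_derivative_compose UN.C1_deriv[OF f] by blast
 qed
 have sh: "C1 UNIV (%x. f (x + h *\<^sub>R b))"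
  by (rule UN.C1I[OF D]) (auto intro!: continuous_on_compose2[OF UN.C1_cont_pd[OF f]] continuous_intros)
 have p: "pd UNIV c (%x. f (x + h *\<^sub>R b)) x = pd UNIV c f (x + h *\<^sub>R b)" for c x
  by (rule UN.pd_eq[OF _ D]) simp
 have eq: "dq h b f = (%x. (1 / complex_of_real h) * (f (x + h *\<^sub>R b) - f x))" by (auto simp: dq_def)
 have "C1 UNIV (dq h b f)" unfolding eq by (rule UN.C1_cmult[OF UN.C1_diff[OF sh f]])
 moreover have "pd UNIV c (dq h b f) x = dq h b (pd UNIV c f) x" for c x
  unfolding eq by (simp only: UN.pd_cmult[OF UN.C1_diff[OF sh f] UNIV_I] UN.pd_diff[OF sh f UNIV_I] p) (simp add: dq_def)
 ultimately show ?thesis by blast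
qed

text \<open>Dominated convergence: the quotients are bounded by the supremum of the derivative and supported in a
 fixed ball, since the increments are at most 1.\<close>

lemma dq_limit:
 assumes f: "C1 UNIV f" and supp: "csupp UNIV f" and b: "b \<in> Basis"
  and g: "continuous_on UNIV g" "\<And>x. norm (g x) \<le> Bg"
  and h: "\<And>n. h n \<noteq> 0" "\<And>n. \<bar>h n\<bar> \<le> 1" "h \<longlonglongrightarrow> 0"
 shows "(%n. \<integral>x. dq (h n) b f x * g x \<partial>lborel) \<longlonglongrightarrow> (\<integral>x. pd UNIV b f x * g x \<partial>lborel)"
proof -
 obtain R where R: "R > 0" "\<And>x. norm x > R ==> f x = 0" using csupp_UNIV_ball[OF supp] by auto
 have cf: "continuous_on UNIV f" "continuous_on UNIV (pd UNIV b f)" using UN.C1_cont[OF f] UN.C1_cont_pd[OF f] by auto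
 obtain B where B: "B \<ge> 0" "\<And>x. norm (pd UNIV b f x) \<le> B"
 proof -
  have "\<exists>B\<ge>0. \<forall>x. norm (pd UNIV b f x) \<le> B"
   by (rule cont_bounded_outside[OF cf(2) pd_UNIV_zero_outside[OF f R(2)]])
  then show ?thesis using that by blast
 qed
 have line: "((%s. f (x + s *\<^sub>R b)) has_derivative (%k. k *\<^sub>R pd UNIV b f (x + s *\<^sub>R b))) (at s within T)" for x s T
 proof -
  interpret bl: bounded_linear "%h. pd UNIV h f (x + s *\<^sub>R b)" by (rule UN.pd_linear[OF f]) simp
  have "((%s. x + s *\<^sub>R b) has_derivative (%k. k *\<^sub>R b)) (at s within T)" by (auto intro!: derivative_eq_intros)
  from has_derivative_compose[OF this UN.C1_deriv[OF f UNIV_I]]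
  show ?thesis by (simp add: bl.scaleR)
 qed
 have lip: "norm (dq k b f x) \<le> B" if "k \<noteq> 0" for x k
 proof -
  have "norm (f (x + k *\<^sub>R b) - f (x + 0 *\<^sub>R b)) \<le> B * norm (k - 0)"
   by (rule differentiable_bound[OF convex_UNIV line])
     (auto intro!: onorm_le simp: mult.commute[of B] mult_left_mono B)
  then show ?thesis using that by (simp add: dq_def norm_divide field_simps)
 qed
 have lim: "(%n. dq (h n) b f x) \<longlonglongrightarrow> pd UNIV b f x" for x
 proof -
  have "((%s. f (x + s *\<^sub>R b)) has_vector_derivative pd UNIV b f x) (at 0)"
   using line[of x 0 UNIV] by (simp add: has_vector_derivative_def)
  then have "((%s. (f (x + s *\<^sub>R b) - f x) /\<^sub>R s) \<longlongrightarrow> pd UNIV b f x) (at 0)"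
  proof -
   assume "((%s. f (x + s *\<^sub>R b)) has_vector_derivative pd UNIV b f x) (at 0)"
   then have L: "((%s. norm (f (x + s *\<^sub>R b) - f x - s *\<^sub>R pd UNIV b f x) / \<bar>s\<bar>) \<longlongrightarrow> 0) (at 0)"
    by (simp add: has_vector_derivative_def has_derivative_iff_norm)
   have "((%s. norm ((f (x + s *\<^sub>R b) - f x) /\<^sub>R s - pd UNIV b f x)) \<longlongrightarrow> 0) (at 0)"
   proof (rule Lim_transform_eventually[OF L])
    show "\<forall>\<^sub>F s in at 0. norm (f (x + s *\<^sub>R b) - f x - s *\<^sub>R pd UNIV b f x) / \<bar>s\<bar> =
      norm ((f (x + s *\<^sub>R b) - f x) /\<^sub>R s - pd UNIV b f x)"
    proof (rule eventually_at_topological[THEN iffD2], intro exI[of _ UNIV] conjI ballI impI)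
     fix s :: real assume "s \<noteq> 0"
     then have "(f (x + s *\<^sub>R b) - f x) /\<^sub>R s - pd UNIV b f x = (f (x + s *\<^sub>R b) - f x - s *\<^sub>R pd UNIV b f x) /\<^sub>R s"
      by (simp add: scaleR_right_diff_distrib)
     then show "norm (f (x + s *\<^sub>R b) - f x - s *\<^sub>R pd UNIV b f x) / \<bar>s\<bar> =
      norm ((f (x + s *\<^sub>R b) - f x) /\<^sub>R s - pd UNIV b f x)"
      by (simp add: divide_inverse mult.commute)
    qed auto
   qed
   then show ?thesis using Lim_null tendsto_norm_zero_iff by blast
  qed
  then have "(%n. (f (x + h n *\<^sub>R b) - f x) /\<^sub>R h n) \<longlonglongrightarrow> pd UNIV b f x"
   by (rule filterlim_compose) (use h in \<open>auto simp: filterlim_at\<close>)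
  then show ?thesis by (simp add: dq_def scaleR_conv_of_real divide_inverse mult.commute)
 qed
 have Bg: "Bg \<ge> 0" using g(2) norm_ge_zero order_trans by blast
 show ?thesis
 proof (rule integral_dominated_convergence[where w="%x. (B * Bg) * indicator (cball 0 (R+1)) x"])
  have m: "dq k b f \<in> borel_measurable borel" for k
   using UN.C1_cont[of "dq k b f"] dq_C1[OF f] by (auto intro: borel_measurable_continuous_onI)
  have [measurable]: "g \<in> borel_measurable borel" "pd UNIV b f \<in> borel_measurable borel"
   using g cf by (auto intro: borel_measurable_continuous_onI)
  show "(%x. pd UNIV b f x * g x) \<in> borel_measurable lborel" by simp
  show "(%x. dq (h n) b f x * g x) \<in> borel_measurable lborel" for n using m by simp
  show "integrable lborel (%x. (B * Bg) * indicator (cball 0 (R+1)) x :: real)"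
   by (rule integrable_indicator_cball)
  show "AE x in lborel. (%n. dq (h n) b f x * g x) \<longlonglongrightarrow> pd UNIV b f x * g x"
   by (intro AE_I2 tendsto_mult lim tendsto_const)
  show "AE x in lborel. norm (dq (h n) b f x * g x) \<le> (B * Bg) * indicator (cball 0 (R+1)) x" for n
  proof (intro AE_I2)
   fix x :: 'a
   show "norm (dq (h n) b f x * g x) \<le> (B * Bg) * indicator (cball 0 (R+1)) x"
   proof (cases "norm x \<le> R + 1")
    case True
    then show ?thesis using lip[OF h(1), of n x] g(2)[of x] B(1) Bg by (auto simp: norm_mult intro!: mult_mono)
   next
    case False
    have "norm (x + h n *\<^sub>R b) \<ge> norm x - norm (h n *\<^sub>R b)" by (metis norm_diff_ineq)
    moreover have "norm (h n *\<^sub>R b) \<le> 1" using h(2)[of n] b by simp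
    ultimately have "norm (x + h n *\<^sub>R b) > R" using False by simp
    then have "dq (h n) b f x = 0" using False R by (simp add: dq_def)
    then show ?thesis using False by simp
   qed
  qed
 qed
qed

lemma C1_csupp_bounds:
 assumes "C1 UNIV f" "csupp UNIV f"
 shows "\<exists>B\<ge>0. \<forall>x. norm (f x) \<le> B" "\<exists>B\<ge>0. \<forall>x. norm (pd UNIV b f x) \<le> B"
  "integrable lborel f" "integrable lborel (pd UNIV b f)"
proof -
 obtain R where R: "R > 0" "\<And>x. norm x > R ==> f x = 0" using csupp_UNIV_ball[OF assms(2)] by auto
 note c = UN.C1_cont[OF assms(1)] UN.C1_cont_pd[OF assms(1), of b]
 show 1: "\<exists>B\<ge>0. \<forall>x. norm (f x) \<le> B" by (rule cont_bounded_outside[OF c(1) R(2)])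
 show 2: "\<exists>B\<ge>0. \<forall>x. norm (pd UNIV b f x) \<le> B"
  by (rule cont_bounded_outside[OF c(2) pd_UNIV_zero_outside[OF assms(1) R(2)]])
 show "integrable lborel f" using 1
  by (auto intro!: integrable_bounded_support[where R=R] R borel_measurable_continuous_onI c)
 show "integrable lborel (pd UNIV b f)" using 2
  by (auto intro!: integrable_bounded_support[where R=R] pd_UNIV_zero_outside[OF assms(1) R(2)] borel_measurable_continuous_onI c)
qed

lemma integral_pd_zero:
 assumes f: "C1 UNIV f" and supp: "csupp UNIV f" and b: "b \<in> Basis"
 shows "(\<integral>x. pd UNIV b f x \<partial>lborel) = 0"
proof -
 have lim: "(%n. \<integral>x. dq (inverse (real (Suc n))) b f x * 1 \<partial>lborel) \<longlonglongrightarrow> (\<integral>x. pd UNIV b f x * 1 \<partial>lborel)"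
  by (rule dq_limit[OF f supp b, where Bg=1])
    (simp_all add: LIMSEQ_inverse_real_of_nat inverse_le_1_iff del: of_nat_Suc)
 have i: "integrable lborel f" by (rule C1_csupp_bounds[OF f supp])
 have m: "f \<in> borel_measurable borel" using i by auto
 have "integrable lborel (%x. f (x + c))" for c
  using integrable_distr_eq[of "(+) c" lborel borel f] i m by (simp add: lborel_distr_plus add.commute)
 then have "(\<integral>x. dq k b f x * 1 \<partial>lborel) = 0" for k
  using i by (simp add: dq_def integral_translate[OF m])
 then show ?thesis using lim LIMSEQ_unique[OF _ tendsto_const] by fastforce
qed

text \<open>For functions of class \<open>C^2\<close> two integrations by parts would do. With \<open>C^1\<close> functions the derivative in
 direction \<open>j\<close> is replaced by a difference quotient, which is moved from \<open>f\<close> to \<open>g\<close> after integrating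
 by parts in direction \<open>k\<close>, and the step size tends to zero.\<close>

lemma integral_swap_derivatives:
 assumes f: "C1 UNIV f" "csupp UNIV f" and g: "C1 UNIV g" "csupp UNIV g" and j: "j \<in> Basis" and k: "k \<in> Basis"
 shows "(\<integral>x. pd UNIV j f x * pd UNIV k g x \<partial>lborel) = (\<integral>x. pd UNIV k f x * pd UNIV j g x \<partial>lborel)"
proof -
 define h where "h n = inverse (real (Suc n))" for n
 have h: "h n \<noteq> 0" "\<bar>h n\<bar> \<le> 1" "h \<longlonglongrightarrow> 0" "(%n. - h n) \<longlonglongrightarrow> 0" for n
  unfolding h_def[abs_def] using LIMSEQ_inverse_real_of_nat tendsto_minus[OF LIMSEQ_inverse_real_of_nat]
  by (simp_all add: inverse_le_1_iff del: of_nat_Suc)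
 obtain Bf where Bf: "\<And>x. norm (pd UNIV k f x) \<le> Bf" using C1_csupp_bounds(2)[OF f] by blast
 obtain Bg where Bg: "\<And>x. norm (pd UNIV k g x) \<le> Bg" using C1_csupp_bounds(2)[OF g] by blast
 obtain B0 where B0: "\<And>x. norm (g x) \<le> B0" using C1_csupp_bounds(1)[OF g] by blast
 have l1: "(%n. \<integral>x. dq (h n) j f x * pd UNIV k g x \<partial>lborel) \<longlonglongrightarrow> (\<integral>x. pd UNIV j f x * pd UNIV k g x \<partial>lborel)"
  by (rule dq_limit[OF f j UN.C1_cont_pd[OF g(1)] Bg]) (use h in auto)
 have l2: "(%n. \<integral>x. dq (- h n) j g x * pd UNIV k f x \<partial>lborel) \<longlonglongrightarrow> (\<integral>x. pd UNIV j g x * pd UNIV k f x \<partial>lborel)"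
  by (rule dq_limit[OF g j UN.C1_cont_pd[OF f(1)] Bf]) (use h in auto)
 have "(\<integral>x. dq (h n) j f x * pd UNIV k g x \<partial>lborel) = (\<integral>x. dq (- h n) j g x * pd UNIV k f x \<partial>lborel)" for n
 proof -
  let ?d = "dq (h n) j f"
  have d: "C1 UNIV ?d" "\<And>x. pd UNIV k ?d x = dq (h n) j (pd UNIV k f) x" using dq_C1[OF f(1)] by auto
  have P: "C1 UNIV (%x. ?d x * g x)" by (rule UN.C1_mult[OF d(1) g(1)])
  have Ps: "csupp UNIV (%x. ?d x * g x)" using g(2) unfolding csupp_def by force
  have "pd UNIV k (%x. ?d x * g x) x = dq (h n) j (pd UNIV k f) x * g x + ?d x * pd UNIV k g x" for x
   using UN.pd_mult[OF d(1) g(1), of x k] d(2) by simp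
  then have z: "(\<integral>x. dq (h n) j (pd UNIV k f) x * g x + ?d x * pd UNIV k g x \<partial>lborel) = 0"
   using integral_pd_zero[OF P Ps k] by simp
  have bint: "integrable lborel (%x. F x * G x)"
   if "integrable lborel G" "continuous_on UNIV F" "\<And>x. norm (F x) \<le> B" for F G :: "'a => complex" and B
  proof -
   have [measurable]: "F \<in> borel_measurable borel" "G \<in> borel_measurable borel"
    using that by (auto intro: borel_measurable_continuous_onI)
   show ?thesis
   by (rule Bochner_Integration.integrable_bound[where f="%x. complex_of_real B * G x"])
     (use that in \<open>auto simp: norm_mult intro!: mult_right_mono AE_I2 order_trans[OF that(3)]\<close>)
  qed
  have cf: "continuous_on UNIV (pd UNIV k f)" "continuous_on UNIV g"
   using UN.C1_cont_pd[OF f(1)] UN.C1_cont[OF g(1)] by auto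
  have ig: "integrable lborel g" "integrable lborel (pd UNIV k g)" "integrable lborel (pd UNIV k f)" "integrable lborel f"
   using C1_csupp_bounds[OF g] C1_csupp_bounds[OF f] by auto
  have i1: "integrable lborel (%x. pd UNIV k f (x + h n *\<^sub>R j) * g x)"
   by (rule bint[OF ig(1) _ Bf]) (auto intro!: continuous_on_compose2[OF cf(1)] continuous_intros)
  have i1': "integrable lborel (%x. pd UNIV k f x * g x)"
   by (rule bint[OF ig(1) _ Bf]) (use cf in auto)
  have i2: "integrable lborel (%x. pd UNIV k f x * g (x + (- h n) *\<^sub>R j))"
  proof -
   have "integrable lborel (%x. g (x + (- h n) *\<^sub>R j) * pd UNIV k f x)"
    by (rule bint[OF ig(3) _ B0]) (auto intro!: continuous_on_compose2[OF cf(2)] continuous_intros)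
   then show ?thesis by (simp add: mult.commute)
  qed
  obtain Bd where Bd: "\<And>x. norm (?d x) \<le> Bd"
  proof -
   obtain Bff where "\<And>x. norm (f x) \<le> Bff" using C1_csupp_bounds(1)[OF f] by blast
   then have "norm (?d x) \<le> (Bff + Bff) / \<bar>h n\<bar>" for x
    unfolding dq_def norm_divide norm_of_real by (intro divide_right_mono order_trans[OF norm_triangle_ineq4] add_mono) auto
   then show ?thesis using that by blast
  qed
  have i3: "integrable lborel (%x. ?d x * pd UNIV k g x)"
   by (rule bint[OF ig(2) UN.C1_cont[OF d(1)] Bd])
  have i4: "integrable lborel (%x. dq (h n) j (pd UNIV k f) x * g x)"
   using i1 i1' by (simp add: dq_def diff_divide_distrib left_diff_distrib add.commute)
  have tr: "(\<integral>x. pd UNIV k f (x + h n *\<^sub>R j) * g x \<partial>lborel) = (\<integral>x. pd UNIV k f x * g (x + (- h n) *\<^sub>R j) \<partial>lborel)"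
  proof -
   have mm: "(%x. pd UNIV k f x * g (x + (- h n) *\<^sub>R j)) \<in> borel_measurable borel" using i2 by auto
   show ?thesis using integral_translate[OF mm, of "h n *\<^sub>R j"] by simp
  qed
  have "(\<integral>x. dq (h n) j (pd UNIV k f) x * g x \<partial>lborel) =
   ((\<integral>x. pd UNIV k f (x + h n *\<^sub>R j) * g x \<partial>lborel) - (\<integral>x. pd UNIV k f x * g x \<partial>lborel)) / complex_of_real (h n)"
   using i1 i1' by (simp add: dq_def left_diff_distrib flip: Bochner_Integration.integral_diff)
  also have "\<dots> = ((\<integral>x. pd UNIV k f x * g (x + (- h n) *\<^sub>R j) \<partial>lborel) - (\<integral>x. pd UNIV k f x * g x \<partial>lborel)) / complex_of_real (h n)"
   by (simp only: tr)
  also have "\<dots> = - (\<integral>x. dq (- h n) j g x * pd UNIV k f x \<partial>lborel)"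
   using i2 i1' by (simp add: dq_def right_diff_distrib mult.commute flip: Bochner_Integration.integral_diff)
  finally show ?thesis using z i3 i4 by (simp add: add_eq_0_iff)
 qed
 then have "(\<integral>x. pd UNIV j f x * pd UNIV k g x \<partial>lborel) = (\<integral>x. pd UNIV j g x * pd UNIV k f x \<partial>lborel)"
  using LIMSEQ_unique[OF l1] l2 by simp
 then show ?thesis by (simp add: mult.commute)
qed

lemma sets_hyperplane [simp]: "sets (hyperplane_lborel b) = sets borel"
 by (simp add: hyperplane_lborel_def)

lemma space_hyperplane [simp]: "space (hyperplane_lborel b) = UNIV"
 by (simp add: hyperplane_lborel_def)

lemma measurable_hyperplane [simp]: "measurable (hyperplane_lborel b) N = measurable borel N"
 by (rule measurable_cong_sets) auto

context
 fixes b :: "'a::euclidean_space"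
 assumes b: "b \<in> Basis"
begin

lemma hyp_sum: "(\<Sum>i\<in>Basis. (x(b := t)) i *\<^sub>R i) = (\<Sum>i\<in>Basis - {b}. x i *\<^sub>R i) + t *\<^sub>R b"
proof -
 have "(\<Sum>i\<in>Basis. (x(b := t)) i *\<^sub>R i) = t *\<^sub>R b + (\<Sum>i\<in>Basis - {b}. (x(b := t)) i *\<^sub>R i)"
  by (subst sum.remove[OF finite_Basis b]) simp
 also have "(\<Sum>i\<in>Basis - {b}. (x(b := t)) i *\<^sub>R i) = (\<Sum>i\<in>Basis - {b}. x i *\<^sub>R i)"
  by (intro sum.cong) auto
 finally show ?thesis by simp
qed

interpretation product_sigma_finite "%_::'a. lborel :: real measure" by standard

text \<open>Lebesgue measure is the product of the one-dimensional Lebesgue measures of the coordinates, and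
 \<open>hyperplane_lborel b\<close> is the image of the product with the coordinate \<open>b\<close> left out.\<close>

lemma hyperplane_fubini_nn:
 assumes [measurable]: "F \<in> borel_measurable borel"
 shows "(\<integral>\<^sup>+z. F z \<partial>lborel) = (\<integral>\<^sup>+y. (\<integral>\<^sup>+t. F (y + t *\<^sub>R b) \<partial>lborel) \<partial>hyperplane_lborel b)"
proof -
 have Bi: "insert b (Basis - {b}) = Basis" using b by auto
 let ?s = "%f. \<Sum>i\<in>Basis. f i *\<^sub>R (i::'a)"
 have "(\<integral>\<^sup>+z. F z \<partial>lborel) = (\<integral>\<^sup>+f. F (?s f) \<partial>(\<Pi>\<^sub>M i\<in>insert b (Basis - {b}). lborel))"
  unfolding Bi by (subst lborel_eq, rule nn_integral_distr) measurable
 also have "\<dots> = (\<integral>\<^sup>+x. (\<integral>\<^sup>+t. F (?s (x(b := t))) \<partial>lborel) \<partial>(\<Pi>\<^sub>M i\<in>Basis - {b}. lborel))"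
  by (rule product_nn_integral_insert) (auto simp: Bi)
 also have "\<dots> = (\<integral>\<^sup>+x. (\<integral>\<^sup>+t. F ((\<Sum>i\<in>Basis - {b}. x i *\<^sub>R i) + t *\<^sub>R b) \<partial>lborel) \<partial>(\<Pi>\<^sub>M i\<in>Basis - {b}. lborel))"
  by (simp only: hyp_sum)
 also have "\<dots> = (\<integral>\<^sup>+y. (\<integral>\<^sup>+t. F (y + t *\<^sub>R b) \<partial>lborel) \<partial>hyperplane_lborel b)"
  unfolding hyperplane_lborel_def by (subst nn_integral_distr) measurable
 finally show ?thesis .
qed

lemma hyperplane_fubini:
 fixes F :: "'a => complex"
 assumes F: "integrable lborel F"
 shows "(\<integral>z. F z \<partial>lborel) = (\<integral>y. (\<integral>t. F (y + t *\<^sub>R b) \<partial>lborel) \<partial>hyperplane_lborel b)"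
proof -
 have [measurable]: "F \<in> borel_measurable borel" using F by auto
 have Bi: "insert b (Basis - {b}) = Basis" using b by auto
 let ?s = "%f. \<Sum>i\<in>Basis. f i *\<^sub>R (i::'a)"
 have ms: "?s \<in> borel_measurable (\<Pi>\<^sub>M i\<in>Basis. lborel :: real measure)" by measurable
 have int: "integrable (\<Pi>\<^sub>M i\<in>insert b (Basis - {b}). lborel) (%f. F (?s f))"
  unfolding Bi using F by (subst (asm) lborel_eq, subst (asm) integrable_distr_eq) (auto intro: ms)
 have "(\<integral>z. F z \<partial>lborel) = (\<integral>f. F (?s f) \<partial>(\<Pi>\<^sub>M i\<in>insert b (Basis - {b}). lborel))"
  unfolding Bi by (subst lborel_eq, rule integral_distr) (auto intro: ms)
 also have "\<dots> = (\<integral>x. (\<integral>t. F (?s (x(b := t))) \<partial>lborel) \<partial>(\<Pi>\<^sub>M i\<in>Basis - {b}. lborel))"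
  by (rule product_integral_insert[OF _ _ int]) auto
 also have "\<dots> = (\<integral>x. (\<integral>t. F ((\<Sum>i\<in>Basis - {b}. x i *\<^sub>R i) + t *\<^sub>R b) \<partial>lborel) \<partial>(\<Pi>\<^sub>M i\<in>Basis - {b}. lborel))"
  by (simp only: hyp_sum)
 also have "\<dots> = (\<integral>y. (\<integral>t. F (y + t *\<^sub>R b) \<partial>lborel) \<partial>hyperplane_lborel b)"
  unfolding hyperplane_lborel_def
 proof (rule integral_distr[symmetric])
  show "(%y. \<integral>t. F (y + t *\<^sub>R b) \<partial>lborel) \<in> borel_measurable borel"
   by (rule lborel.borel_measurable_lebesgue_integral) measurable
 qed measurable
 finally show ?thesis .
qed

lemma AE_hyperplane: "AE y in hyperplane_lborel b. y \<bullet> b = 0"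
 unfolding hyperplane_lborel_def
proof (subst AE_distr_iff)
 show "AE x in \<Pi>\<^sub>M i\<in>Basis - {b}. lborel. (\<Sum>i\<in>Basis - {b}. x i *\<^sub>R i) \<bullet> b = 0"
  using b by (intro AE_I2) (auto simp: inner_sum_left inner_Basis intro!: sum.neutral)
qed measurable

text \<open>The cylinder of height 1 over \<open>A\<close> is bounded, and by Fubini its volume is the measure of \<open>A\<close>.\<close>

lemma emeasure_hyperplane_bounded:
 assumes A[measurable]: "A \<in> sets borel" and bd: "bounded A"
 shows "emeasure (hyperplane_lborel b) A < \<infinity>"
proof -
 let ?Z = "{z. z - (z \<bullet> b) *\<^sub>R b \<in> A \<and> 0 \<le> z \<bullet> b \<and> z \<bullet> b \<le> 1}"
 have [measurable]: "?Z \<in> sets borel" by measurable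
 have "emeasure lborel ?Z = (\<integral>\<^sup>+z. indicator ?Z z \<partial>lborel)" by simp
 also have "\<dots> = (\<integral>\<^sup>+y. (\<integral>\<^sup>+t. indicator ?Z (y + t *\<^sub>R b) \<partial>lborel) \<partial>hyperplane_lborel b)"
  by (rule hyperplane_fubini_nn) measurable
 also have "\<dots> = (\<integral>\<^sup>+y. indicator A y \<partial>hyperplane_lborel b)"
 proof (rule nn_integral_cong_AE, use AE_hyperplane in eventually_elim)
  fix y :: 'a assume y: "y \<bullet> b = 0"
  have "(\<integral>\<^sup>+t. indicator ?Z (y + t *\<^sub>R b) \<partial>lborel) = (\<integral>\<^sup>+t. indicator A y * indicator {0..1} t \<partial>(lborel::real measure))"
   using y b by (intro nn_integral_cong) (auto simp: indicator_def inner_add_left)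
  also have "\<dots> = indicator A y" by (subst nn_integral_cmult) auto
  finally show "(\<integral>\<^sup>+t. indicator ?Z (y + t *\<^sub>R b) \<partial>lborel) = indicator A y" .
 qed
 also have "\<dots> = emeasure (hyperplane_lborel b) A" by simp
 finally have eq: "emeasure (hyperplane_lborel b) A = emeasure lborel ?Z" by simp
 obtain R where R: "\<And>x. x \<in> A ==> norm x \<le> R" using bd by (auto simp: bounded_iff)
 have "?Z \<subseteq> cball 0 (R + 1)"
 proof
  fix z assume z: "z \<in> ?Z"
  have "norm z \<le> norm (z - (z \<bullet> b) *\<^sub>R b) + norm ((z \<bullet> b) *\<^sub>R b)"
   by (metis diff_add_cancel norm_triangle_ineq)
  also have "\<dots> \<le> R + 1" using R[of "z - (z \<bullet> b) *\<^sub>R b"] z b by (intro add_mono) auto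
  finally show "z \<in> cball 0 (R + 1)" by simp
 qed
 then have "bounded ?Z" by (rule bounded_subset[OF bounded_cball])
 then show ?thesis unfolding eq by (rule emeasure_bounded_finite)
qed

end

section \<open>Cutoff functions and localisation\<close>

text \<open>A smooth step from 0 (for \<open>t \<le> 1\<close>) to 1 (for \<open>t \<ge> 2\<close>), and its derivative \<open>stp'\<close>. That it vanishes
 near 0 keeps functions cut off with \<open>stp (n \<rho>)\<close> away from the boundary.\<close>

definition stp :: "real => real" where
 "stp t = flat 0 (t - 1) / (flat 0 (t - 1) + flat 0 (2 - t))"

definition stp' :: "real => real" where
 "stp' t = (flat 2 (t - 1) * flat 0 (2 - t) + flat 0 (t - 1) * flat 2 (2 - t)) / (flat 0 (t - 1) + flat 0 (2 - t))\<^sup>2"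

lemma flat0_deriv: "(flat 0 has_real_derivative flat 2 t) (at t)"
 using flat_deriv[of 0 t] by (simp only: add_0 of_nat_0 mult_zero_left diff_zero)

lemma stp_denom: "flat 0 (t - 1) + flat 0 (2 - t) > 0"
proof (cases "t > 1")
 case True then show ?thesis by (intro add_pos_nonneg flat_pos flat_nonneg) auto
next
 case False then show ?thesis by (intro add_nonneg_pos flat_pos flat_nonneg) auto
qed

lemma stp_deriv: "(stp has_real_derivative stp' t) (at t)"
proof -
 note d = flat0_deriv
 have 1: "((%t. flat 0 (t - 1)) has_real_derivative flat 2 (t - 1)) (at t)"
 proof -
  have "((%t. t - 1) has_real_derivative 1) (at t)" by (auto intro!: derivative_eq_intros)
  from DERIV_chain2[OF d this] show ?thesis by simp
 qed
 have "((%t. 2 - t) has_real_derivative -1) (at t)" by (auto intro!: derivative_eq_intros)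
 from DERIV_chain2[OF d this]
 have 2: "((%t. flat 0 (2 - t)) has_real_derivative - flat 2 (2 - t)) (at t)" by simp
 have n: "flat 0 (t - 1) + flat 0 (2 - t) \<noteq> 0" using stp_denom[of t] by linarith
 have "((%t. flat 0 (t - 1) / (flat 0 (t - 1) + flat 0 (2 - t))) has_real_derivative stp' t) (at t)"
  by (rule DERIV_cong[OF DERIV_divide[OF 1 DERIV_add[OF 1 2] n]])
    (simp add: stp'_def power2_eq_square algebra_simps)
 then show ?thesis by (simp add: stp_def[abs_def])
qed

lemma stp'_cont: "continuous_on A stp'"
 unfolding stp'_def[abs_def]
 by (intro continuous_intros continuous_on_compose2[OF flat_continuous[of UNIV]])
   (use stp_denom in \<open>auto simp: less_le\<close>)

lemma stp'_nonneg: "0 \<le> stp' t"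
 unfolding stp'_def by (intro divide_nonneg_nonneg add_nonneg_nonneg mult_nonneg_nonneg flat_nonneg) auto

lemma stp_0: "t \<le> 1 ==> stp t = 0" by (simp add: stp_def flat_zero)
lemma stp_1: "2 \<le> t ==> stp t = 1" using flat_pos[of "t - 1" 0] by (simp add: stp_def flat_zero)
lemma stp'_0: "t \<le> 1 ==> stp' t = 0" by (simp add: stp'_def flat_zero)
lemma stp'_1: "2 \<le> t ==> stp' t = 0" by (simp add: stp'_def flat_zero)
lemma stp_bounds: "0 \<le> stp t" "stp t \<le> 1"
 using stp_denom[of t] flat_nonneg[of 0 "t-1"] flat_nonneg[of 0 "2-t"] by (auto simp: stp_def field_simps)

text \<open>A substitute for a partition of unity: the sum of the bump functions has a positive lower bound \<open>m\<close> on
 \<open>C\<close>, and dividing by the sum is left to the applications.\<close>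

lemma bump_cover:
 fixes C :: "'a::euclidean_space set"
 assumes C: "compact C" and loc: "\<And>z. z \<in> C ==> \<exists>G. open G \<and> z \<in> G \<and> Q G"
 obtains I :: "('a \<times> 'a) set" and m :: real where "finite I"
  "\<And>p. p \<in> I ==> \<exists>G. cbox (fst p) (snd p) \<subseteq> G \<and> Q G"
  "m > 0" "\<And>z. z \<in> C ==> m \<le> (\<Sum>p\<in>I. bump 0 (fst p) (snd p) z)"
proof -
 let ?J = "{p :: 'a \<times> 'a. \<exists>G. cbox (fst p) (snd p) \<subseteq> G \<and> Q G}"
 have cov: "C \<subseteq> (\<Union>p\<in>?J. box (fst p) (snd p))"
 proof
  fix z assume "z \<in> C"
  then obtain G where G: "open G" "z \<in> G" "Q G" using loc by blast
  obtain a b where "z \<in> box a b" "cbox a b \<subseteq> G" using open_contains_cbox[OF G(1,2)] by metis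
  then show "z \<in> (\<Union>p\<in>?J. box (fst p) (snd p))" using G by (intro UN_I[of "(a,b)"]) auto
 qed
 obtain I where I: "I \<subseteq> ?J" "finite I" "C \<subseteq> (\<Union>p\<in>I. box (fst p) (snd p))"
  by (rule compactE_image[OF C, of ?J "%p. box (fst p) (snd p)"]) (use cov in auto)
 let ?\<beta> = "%z. \<Sum>p\<in>I. bump 0 (fst p) (snd p) z"
 have pos: "0 < ?\<beta> z" if z: "z \<in> C" for z
 proof -
  obtain p where p: "p \<in> I" "z \<in> box (fst p) (snd p)" using I(3) z by blast
  show ?thesis by (rule sum_pos2[where i=p]) (use I(2) p in \<open>auto intro: bump_pos bump_nonneg\<close>)
 qed
 have cont: "continuous_on C ?\<beta>" by (intro continuous_intros bump_continuous)
 obtain m where m: "m > 0" "\<And>z. z \<in> C ==> m \<le> ?\<beta> z"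
 proof (cases "C = {}")
  case False
  obtain z0 where "z0 \<in> C" "\<And>z. z \<in> C ==> ?\<beta> z0 \<le> ?\<beta> z"
   using continuous_attains_inf[OF C False cont] by blast
  then show ?thesis using that pos by blast
 qed (use that[of 1] in auto)
 show ?thesis using I m by (intro that[of I m]) auto
qed

lemma smooth_cutoff:
 fixes C :: "'a::euclidean_space set"
 assumes C: "compact C" and G: "open G" "C \<subseteq> G"
 obtains \<theta> :: "'a => real" where "C1 UNIV (cplx \<theta>)" "\<And>x. x \<in> C ==> \<theta> x = 1" "csupp G (cplx \<theta>)"
  "\<And>x. 0 \<le> \<theta> x" "\<And>x. \<theta> x \<le> 1" "\<And>x b. x \<in> C ==> pd UNIV b (cplx \<theta>) x = 0"
proof -
 obtain I :: "('a \<times> 'a) set" and m :: real where I: "finite I"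
  "\<And>p. p \<in> I ==> \<exists>G'. cbox (fst p) (snd p) \<subseteq> G' \<and> G' = G"
  "m > 0" "\<And>z. z \<in> C ==> m \<le> (\<Sum>p\<in>I. bump 0 (fst p) (snd p) z)"
  by (rule bump_cover[OF C, of "%G'. G' = G"]) (use G in blast)+
 let ?\<beta> = "%z. \<Sum>p\<in>I. bump 0 (fst p) (snd p) z"
 have "C1 UNIV (%z. \<Sum>p\<in>I. complex_of_real (bump 0 (fst p) (snd p) z))" by (intro UN.C1_sum C1_bump)
 then have b: "C1 UNIV (cplx ?\<beta>)" by simp
 \<comment> \<open>this composition is 1 where the sum is at least \<open>m\<close>, and 0 where it vanishes\<close>
 have h: "((%t. stp (1 + t / m)) has_real_derivative stp' (1 + t / m) * (1 / m)) (at t)" for t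
 proof -
  have "((%t. 1 + t / m) has_real_derivative 1 / m) (at t)" using I(3) by (auto intro!: derivative_eq_intros)
  from DERIV_chain2[OF stp_deriv this] show ?thesis .
 qed
 have hc: "continuous_on UNIV (%t. stp' (1 + t / m) * (1 / m))"
  by (use I(3) in \<open>auto intro!: continuous_intros continuous_on_compose2[OF stp'_cont[of UNIV]]\<close>)
 note c = UN.C1_compose_real[OF b h hc]
 show ?thesis
 proof (rule that[OF c])
  show "pd UNIV c (cplx (%z. stp (1 + ?\<beta> z / m))) x = 0" if "x \<in> C" for x c
   using I(3) I(4)[OF that] by (subst UN.pd_compose_real[OF b h hc]) (auto intro!: stp'_1 simp: field_simps)
  show "stp (1 + ?\<beta> x / m) = 1" if "x \<in> C" for x using I(3) I(4)[OF that] by (intro stp_1) (simp add: field_simps)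
  show "csupp G (cplx (%z. stp (1 + ?\<beta> z / m)))"
  proof (rule csuppI[of "\<Union>p\<in>I. cbox (fst p) (snd p)"])
   fix x assume x: "x \<notin> (\<Union>p\<in>I. cbox (fst p) (snd p))"
   have "bump 0 (fst p) (snd p) x = 0" if "p \<in> I" for p
    using x that box_subset_cbox by (intro bump_zero) blast
   then have "?\<beta> x = 0" by simp
   then show "cplx (%z. stp (1 + ?\<beta> z / m)) x = 0" by (simp add: stp_0)
  qed (use I in auto)
 qed (rule stp_bounds)+
qed

context fat_set begin

definition C1c :: "('a => complex) => bool" where
 "C1c f \<longleftrightarrow> C1 S f \<and> csupp S f"

text \<open>An additive property of compactly supported \<open>C^1\<close> functions holds for \<open>f\<close> if it holds for all functions
 supported near a point of the support of \<open>f\<close>. This is how identities between integrals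
 are reduced to a single chart.\<close>

lemma localisation:
 assumes f: "C1 S f" and C: "compact C" "C \<subseteq> S" "\<And>x. x \<notin> C ==> f x = 0"
  and P0: "P (%_. 0)"
  and Padd: "\<And>f g. C1c f ==> C1c g ==> P f ==> P g ==> P (%x. f x + g x)"
  and loc: "\<And>z. z \<in> C ==> \<exists>G. open G \<and> z \<in> G \<and> (\<forall>g. C1 S g --> csupp (S \<inter> G) g --> P g)"
 shows "P f"
proof -
 define Q where "Q G \<longleftrightarrow> (\<forall>g. C1 S g --> csupp (S \<inter> G) g --> P g)" for G
 have loc': "\<exists>G. open G \<and> z \<in> G \<and> Q G" if z: "z \<in> C" for z
 proof -
  show ?thesis using loc[OF z] unfolding Q_def by blast
 qed
 obtain I :: "('a \<times> 'a) set" and m :: real where I: "finite I"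
  "\<And>p. p \<in> I ==> \<exists>G. cbox (fst p) (snd p) \<subseteq> G \<and> Q G"
  "m > 0" "\<And>z. z \<in> C ==> m \<le> (\<Sum>p\<in>I. bump 0 (fst p) (snd p) z)"
  by (rule bump_cover[OF C(1) loc']) blast+
 \<comment> \<open>\<open>f\<close> is decomposed into its products with normalised bump functions; the denominator \<open>\<beta> + flat 0 (m - \<beta>)\<close> equals \<open>\<beta>\<close> where \<open>\<beta> \<ge> m\<close> and vanishes nowhere\<close>
 let ?\<beta> = "%z. \<Sum>p\<in>I. bump 0 (fst p) (snd p) z"
 have Cb: "C1 S (cplx (bump 0 a b))" for a b
  by (rule C1_restrict[OF C1_bump fat_set_axioms UN.fat_set_axioms]) simp
 have "C1 S (%z. \<Sum>p\<in>I. complex_of_real (bump 0 (fst p) (snd p) z))" by (intro C1_sum Cb)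
 then have b: "C1 S (cplx ?\<beta>)" by simp
 have \<beta>0: "0 \<le> ?\<beta> z" for z by (intro sum_nonneg bump_nonneg)
 have h: "((%t. t + flat 0 (m - t)) has_real_derivative 1 - flat 2 (m - t)) (at t)" for t
 proof -
  note d = flat0_deriv
  have "((%t. m - t) has_real_derivative -1) (at t)" by (auto intro!: derivative_eq_intros)
  from DERIV_add[OF DERIV_ident DERIV_chain2[OF d this]] show ?thesis by simp
 qed
 have den: "C1 S (cplx (%z. ?\<beta> z + flat 0 (m - ?\<beta> z)))"
  by (rule C1_compose_real[OF b h]) (auto intro!: continuous_intros continuous_on_compose2[OF flat_continuous[of UNIV]])
 have nz: "?\<beta> z + flat 0 (m - ?\<beta> z) > 0" for z
 proof (cases "?\<beta> z > 0")
  case True then show ?thesis by (intro add_pos_nonneg flat_nonneg)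
 next
  case False
  then have "?\<beta> z = 0" using \<beta>0[of z] by linarith
  then show ?thesis using I(3) by (simp add: flat_pos)
 qed
 define k where "k z = inverse (complex_of_real (?\<beta> z + flat 0 (m - ?\<beta> z)))" for z
 have k: "C1 S k" unfolding k_def
  by (rule C1_inverse[OF den], rule, drule of_real_eq_0_iff[THEN iffD1]) (use nz in \<open>simp add: less_le\<close>)
 define g where "g p z = complex_of_real (bump 0 (fst p) (snd p) z) * (f z * k z)" for p z
 note f1 = f
 have g1: "C1 S (g p)" for p unfolding g_def by (intro C1_mult Cb f1 k)
 have gc: "C1c (g p)" for p
  unfolding C1c_def using g1 C by (auto intro!: csuppI[of C] simp: g_def)
 have Pg: "P (g p)" if p: "p \<in> I" for p
 proof -
  obtain G where G: "cbox (fst p) (snd p) \<subseteq> G" "Q G" using I(2)[OF p] by blast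
  have "csupp (S \<inter> G) (g p)"
  proof (rule csuppI[of "C \<inter> cbox (fst p) (snd p)"])
   show "compact (C \<inter> cbox (fst p) (snd p))" using C by (intro compact_Int_closed) auto
   fix x assume "x \<notin> C \<inter> cbox (fst p) (snd p)"
   then show "g p x = 0" using C(3)[of x] bump_zero[of x "fst p" "snd p" 0] box_subset_cbox[of "fst p" "snd p"]
    by (auto simp: g_def)
  qed (use C G in auto)
  then show ?thesis using G(2) g1 unfolding Q_def by blast
 qed
 have Psum: "P (%z. \<Sum>p\<in>J. g p z) \<and> C1c (%z. \<Sum>p\<in>J. g p z)" if "finite J" "J \<subseteq> I" for J
  using that
 proof (induction J)
  case empty
  then show ?case using P0 by (auto simp: C1c_def intro!: csuppI[of "{}"])
 next
  case (insert p J)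
  have c: "C1c (%z. g p z + (\<Sum>p\<in>J. g p z))"
  proof -
   have "C1 S (%z. g p z + (\<Sum>p\<in>J. g p z))" by (intro C1_add C1_sum g1)
   then show ?thesis unfolding C1c_def using C by (auto intro!: csuppI[of C] simp: g_def)
  qed
  have "P (%z. g p z + (\<Sum>p\<in>J. g p z))"
   using insert by (intro Padd gc Pg) auto
  then show ?case using c insert by simp
 qed
 have "(\<Sum>p\<in>I. g p z) = f z" for z
 proof (cases "z \<in> C")
  case True
  then have k': "k z = inverse (complex_of_real (?\<beta> z))" using I(4)[OF True] by (simp add: k_def flat_zero)
  have "(\<Sum>p\<in>I. g p z) = complex_of_real (?\<beta> z) * (f z * k z)" by (simp add: g_def sum_distrib_right)
  then show ?thesis using I(3) I(4)[OF True] unfolding k'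
   by (metis (no_types, lifting) less_le_trans mult.assoc mult.commute mult.right_neutral less_irrefl of_real_eq_0_iff right_inverse)
 next
  case False then show ?thesis using C(3) by (simp add: g_def)
 qed
 then show ?thesis using Psum[OF I(1)] by simp
qed

end

section \<open>Geometry of the boundary\<close>

lemma directional_derivative:
 fixes f :: "'a::real_normed_vector => real"
 assumes f: "(f has_derivative f') (at x within A)"
  and ev: "\<forall>\<^sub>F s in at_right (0::real). x + s *\<^sub>R v \<in> A" and x: "x \<in> A"
 shows "((%s. (f (x + s *\<^sub>R v) - f x) / s) \<longlongrightarrow> f' v) (at_right 0)"
proof -
 interpret f': bounded_linear f' using f by (rule has_derivative_bounded_linear)
 obtain \<delta> where \<delta>: "\<delta> > 0" "\<And>s. 0 < s ==> s < \<delta> ==> x + s *\<^sub>R v \<in> A"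
  using ev unfolding eventually_at_right_field by auto
 let ?T = "{0..\<delta>/2}"
 have img: "(%s. x + s *\<^sub>R v) ` ?T \<subseteq> A"
 proof
  fix w assume "w \<in> (%s. x + s *\<^sub>R v) ` ?T"
  then obtain s where s: "0 \<le> s" "s \<le> \<delta>/2" "w = x + s *\<^sub>R v" by auto
  then show "w \<in> A" using \<delta> x by (cases "s = 0") auto
 qed
 have l: "((%s. x + s *\<^sub>R v) has_derivative (%s. s *\<^sub>R v)) (at 0 within ?T)"
  by (auto intro!: derivative_eq_intros)
 have f0: "(f has_derivative f') (at (x + 0 *\<^sub>R v) within (%s. x + s *\<^sub>R v) ` ?T)"
  using has_derivative_subset[OF f img] by simp
 have "((%s. f (x + s *\<^sub>R v)) has_derivative (%s. f' (s *\<^sub>R v))) (at 0 within ?T)"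
  by (rule has_derivative_in_compose[OF l f0])
 then have "((%s. f (x + s *\<^sub>R v)) has_real_derivative f' v) (at 0 within ?T)"
  by (simp add: has_field_derivative_def f'.scaleR mult.commute[of _ "f' v"])
 then have "((%s. (f (x + s *\<^sub>R v) - f x) / s) \<longlongrightarrow> f' v) (at 0 within ?T)"
  by (simp add: has_field_derivative_iff)
 then show ?thesis using \<delta>(1) by (simp add: at_within_Icc_at_right)
qed

definition prj :: "'a::euclidean_space => 'a => 'a" where
 "prj b w = w - (w \<bullet> b) *\<^sub>R b"

lemma prj_prj [simp]: "b \<in> Basis ==> prj b (prj b w) = prj b w"
 by (simp add: prj_def inner_diff_left)
lemma prj_inner [simp]: "b \<in> Basis ==> prj b w \<bullet> b = 0"
 by (simp add: prj_def inner_diff_left)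
lemma prj_plus [simp]: "b \<in> Basis ==> prj b (w + t *\<^sub>R b) = prj b w"
 by (simp add: prj_def inner_add_left algebra_simps)
lemma prj_decomp: "w = prj b w + (w \<bullet> b) *\<^sub>R b" by (simp add: prj_def)
lemma prj_id: "y \<bullet> b = 0 ==> prj b y = y" by (simp add: prj_def)
lemma prj_diff: "prj b (v - w) = prj b v - prj b w" by (simp add: prj_def algebra_simps)
lemma prj_norm: "b \<in> Basis ==> norm (prj b w) \<le> 2 * norm w"
 unfolding prj_def using norm_triangle_ineq4[of w "(w \<bullet> b) *\<^sub>R b"] Basis_le_norm[of b w] by simp
lemma prj_cont: "continuous_on A (prj b)" unfolding prj_def[abs_def] by (intro continuous_intros)
lemma prj_bl: "bounded_linear (prj b)"
 unfolding prj_def[abs_def] by (intro bounded_linear_intros)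

text \<open>All integrals live on \<open>Om\<close>; functions are regular on \<open>S = Om \<union> M\<close>. The functions to be integrated
 have compact support in \<open>S\<close>, so \<open>M\<close> is the part of the boundary that contributes.\<close>

locale exterior_domain =
 fixes D U :: "'a::euclidean_space set" and \<rho> :: "'a => real"
 assumes D: "open D" "bounded D" "D \<noteq> {}" and bdry: "Ck_boundary 2 D"
  and rho: "\<rho> = signed_dist D"
  and U: "open U" "closure D \<subseteq> U" and rho2: "Ck_on 2 (U - D) \<rho>"
begin

abbreviation "S \<equiv> U - D"
abbreviation "Om \<equiv> U - closure D"
abbreviation "M \<equiv> frontier D"

lemma closure_D: "closure D = D \<union> M" using D(1) by (simp add: frontier_def interior_open closure_subset Un_absorb1 Un_Diff_cancel)
lemma M_D: "M \<inter> D = {}" using D(1) by (auto simp: frontier_def interior_open)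
lemma M_sub: "M \<subseteq> S" "M \<subseteq> U" using M_D closure_D U by auto
lemma S_eq: "S = Om \<union> M" using closure_D M_D U by auto
lemma Om_M: "Om \<inter> M = {}" using closure_D by auto
lemma open_Om: "open Om" using U by auto
lemma compact_M: "compact M" using D by (simp add: compact_frontier_bounded)
lemma Om_S: "Om \<subseteq> S" using S_eq by auto
lemma M_ne: "M \<noteq> {}" using D by (metis frontier_eq_empty not_bounded_UNIV)
lemma borel_sets [measurable]: "Om \<in> sets borel" "M \<in> sets borel" "S \<in> sets borel"
 using open_Om D U by (auto simp: frontier_def)

lemma eventually_Om_S: "\<forall>\<^sub>F s in F. x + s *\<^sub>R v \<in> Om ==> \<forall>\<^sub>F s in F. x + s *\<^sub>R v \<in> S"
 by (erule eventually_mono) (use Om_S in blast)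

lemma rho_nonneg: "x \<in> S ==> 0 \<le> \<rho> x" by (auto simp: rho signed_dist_def infdist_nonneg)
lemma rho_M: "x \<in> M ==> \<rho> x = 0" using M_D by (auto simp: rho signed_dist_def)
lemma rho_pos: "x \<in> Om ==> 0 < \<rho> x"
proof -
 assume x: "x \<in> Om"
 have "infdist x M \<noteq> 0" using x Om_M M_ne by (subst in_closed_iff_infdist_zero[symmetric]) auto
 then show ?thesis using x Om_S infdist_nonneg[of x M] by (auto simp: rho signed_dist_def)
qed

text \<open>A defining function \<open>r\<close> of \<open>D\<close> on \<open>V\<close>, with its derivative \<open>r'\<close>. It is needed besides \<open>\<rho>\<close> because
 \<open>\<rho>\<close> is known to be \<open>C^2\<close> on the exterior side only, whereas the implicit function theorem asks for a
 full neighbourhood.\<close>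

definition defining :: "'a set => ('a => real) => ('a => 'a => real) => bool" where
 "defining V r r' \<longleftrightarrow> open V \<and> V \<subseteq> U \<and> (\<forall>y\<in>V. (r has_derivative r' y) (at y)) \<and>
   (\<forall>b. continuous_on V (%y. r' y b)) \<and> (\<forall>y\<in>V. \<exists>v. r' y v > 0) \<and>
   D \<inter> V = {y\<in>V. r y < 0} \<and> M \<inter> V = {y\<in>V. r y = 0}"

text \<open>The definition of a \<open>C^2\<close> boundary only says that \<open>D\<close> is the set \<open>r < 0\<close>. As \<open>r\<close> has no critical
 point, each zero of \<open>r\<close> is a limit of points with \<open>r < 0\<close>, so \<open>M\<close> is exactly the zero set.\<close>

lemma defining_exists:
 assumes x: "x \<in> M"
 shows "\<exists>V r r'. defining V r r' \<and> x \<in> V"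
proof -
 obtain V0 and r :: "'a => real" where r: "open V0" "x \<in> V0" "Ck_on 2 V0 r"
  "\<forall>y\<in>V0. frechet_derivative r (at y) \<noteq> (%_. 0)" "D \<inter> V0 = {y \<in> V0. r y < 0}"
  using bdry x unfolding Ck_boundary_def by blast
 define V where "V = V0 \<inter> U"
 have V: "open V" "x \<in> V" "V \<subseteq> V0" using r U x M_sub by (auto simp: V_def)
 interpret V: fat_set V by (rule fat_set_open[OF V(1)])
 have c1: "C1 V (cplx r)" by (rule V.Ck2_imp_C1[OF Ck_on_subset[OF r(3) V(3)]])
 define r' where "r' y v = Re (pd V v (cplx r) y)" for y v
 have d: "(r has_derivative r' y) (at y)" if "y \<in> V" for y
  using V.C1_real_deriv[OF c1 that] at_within_open[OF that V(1)] by (simp add: r'_def[abs_def])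
 have rc: "continuous_on V r"
  using continuous_on_Re[OF V.C1_cont[OF c1]] by simp
 have pos: "\<exists>v. r' y v > 0" if y: "y \<in> V" for y
 proof -
  interpret bounded_linear "r' y" using d[OF y] by (rule has_derivative_bounded_linear)
  have "frechet_derivative r (at y) = r' y" using d[OF y] frechet_derivative_at by metis
  then obtain v where "r' y v \<noteq> 0" using r(4) V(3) y by (metis subsetD)
  then have "r' y v > 0 \<or> r' y (- v) > 0" by (auto simp: neg)
  then show ?thesis by blast
 qed
 have MV: "r y = 0" if y: "y \<in> V" "y \<in> M" for y
 proof -
  have "\<not> r y < 0" using r(5) V(3) M_D y by blast
  moreover have "\<not> r y > 0"
  proof
   assume "r y > 0"
   let ?O = "V \<inter> r -` {0<..}"
   have "open ?O" using continuous_open_preimage[OF rc V(1)] by auto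
   moreover have "y \<in> ?O" using y \<open>r y > 0\<close> by auto
   moreover have "r w < 0" if "w \<in> V" "w \<in> D" for w using r(5) V(3) that by blast
   then have "?O \<inter> D = {}" by force
   ultimately have "y \<notin> closure D" by (metis Int_commute IntI empty_iff open_Int_closure_eq_empty)
   then show False using y by (simp add: frontier_def)
  qed
  ultimately show ?thesis by linarith
 qed
 have MV': "y \<in> M" if y: "y \<in> V" "r y = 0" for y
 proof (rule ccontr)
  assume "y \<notin> M"
  moreover have "y \<in> D ==> r y < 0" using r(5) V(3) y(1) by blast
  then have "y \<notin> D" using y(2) by auto
  ultimately have ny: "y \<notin> closure D" using closure_D by auto
  obtain v where v: "r' y v > 0" using pos[OF y(1)] by blast
  interpret bounded_linear "r' y" using d[OF y(1)] by (rule has_derivative_bounded_linear)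
  let ?A = "V - closure D"
  have A: "open ?A" "y \<in> ?A" using V y ny by auto
  have "\<forall>\<^sub>F s in at_right (0::real). y + s *\<^sub>R (- v) \<in> ?A"
  proof -
   have "((%s::real. y + s *\<^sub>R (- v)) \<longlongrightarrow> y + 0 *\<^sub>R (- v)) (at_right 0)" by (intro tendsto_intros)
   then show ?thesis using A by (auto simp: tendsto_def)
  qed
  moreover have "((%s. (r (y + s *\<^sub>R (- v)) - r y) / s) \<longlongrightarrow> r' y (- v)) (at_right 0)"
   by (rule directional_derivative[where A=UNIV]) (use d[OF y(1)] in auto)
  then have "\<forall>\<^sub>F s in at_right 0. (r (y + s *\<^sub>R (- v)) - r y) / s < 0"
   by (rule order_tendstoD(2)) (use v in \<open>simp add: neg\<close>)
  ultimately have "\<forall>\<^sub>F s in at_right (0::real). False"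
   using eventually_at_right_less[of "0::real"]
  proof eventually_elim
   case (elim s)
   then have "r (y + s *\<^sub>R (- v)) < 0" using y(2) by (simp add: divide_less_0_iff)
   then have "y + s *\<^sub>R (- v) \<in> D" using r(5) V(3) elim(1) by blast
   then show False using elim(1) closure_subset by blast
  qed
  then show False by simp
 qed
 have "defining V r r'"
  unfolding defining_def
 proof (intro conjI ballI allI)
  show "continuous_on V (%y. r' y b)" for b
   unfolding r'_def by (intro continuous_intros V.C1_cont_pd[OF c1])
  show "D \<inter> V = {y \<in> V. r y < 0}" using r(5) V(3) by blast
  show "M \<inter> V = {y \<in> V. r y = 0}" using MV MV' by blast
 qed (use V d pos in \<open>auto simp: V_def\<close>)
 then show ?thesis using V(2) by blast
qed

text \<open>Along \<open>v\<close> the defining function increases from 0, to first order.\<close>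

lemma defining_outside:
 assumes df: "defining V r r'" and x: "x \<in> V" "x \<in> M" and v: "r' x v > 0"
 shows "\<forall>\<^sub>F s in at_right (0::real). x + s *\<^sub>R v \<in> Om"
proof -
 have d: "(r has_derivative r' x) (at x)" and V: "open V" "V \<subseteq> U" and rx: "r x = 0"
  using df x unfolding defining_def by auto
 have "((%s. (r (x + s *\<^sub>R v) - r x) / s) \<longlongrightarrow> r' x v) (at_right 0)"
  by (rule directional_derivative[where A=UNIV]) (use d in auto)
 then have "\<forall>\<^sub>F s in at_right 0. (r (x + s *\<^sub>R v) - r x) / s > 0"
  by (rule order_tendstoD(1)) (rule v)
 moreover have "\<forall>\<^sub>F s in at_right (0::real). x + s *\<^sub>R v \<in> V"
 proof -
  have "((%s::real. x + s *\<^sub>R v) \<longlongrightarrow> x + 0 *\<^sub>R v) (at_right 0)" by (intro tendsto_intros)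
  then show ?thesis using V x by (auto simp: tendsto_def)
 qed
 ultimately show ?thesis using eventually_at_right_less[of "0::real"]
 proof eventually_elim
  case (elim s)
  then have "r (x + s *\<^sub>R v) > 0" using rx by (simp add: zero_less_divide_iff)
  have "r w < 0" if "w \<in> D" "w \<in> V" for w using df that unfolding defining_def by blast
  moreover have "r w = 0" if "w \<in> M" "w \<in> V" for w using df that unfolding defining_def by blast
  ultimately have "x + s *\<^sub>R v \<notin> D \<union> M"
   using elim(2) \<open>r (x + s *\<^sub>R v) > 0\<close> by force
  then show "x + s *\<^sub>R v \<in> Om" using elim(2) V closure_D by auto
 qed
qed

sublocale fat_set "U - D"
proof
 fix x assume "x \<in> U - D"
 then consider "x \<in> Om" | "x \<in> M" using S_eq by auto
 then show "\<exists>T. open T \<and> T \<noteq> {} \<and> (\<forall>v\<in>T. \<forall>\<^sub>F s in at_right (0::real). x + s *\<^sub>R v \<in> U - D)"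
 proof cases
  case 1
  interpret O: fat_set Om by (rule fat_set_open[OF open_Om])
  obtain T where "open T" "T \<noteq> {}" "\<forall>v\<in>T. \<forall>\<^sub>F s in at_right (0::real). x + s *\<^sub>R v \<in> Om"
   using O.fat[OF 1] by blast
  then show ?thesis using eventually_Om_S by blast
 next
  case 2
  obtain V r r' where df: "defining V r r'" "x \<in> V" using defining_exists[OF 2] by blast
  have bl: "bounded_linear (r' x)" using df unfolding defining_def by (meson has_derivative_bounded_linear)
  have "open {v. r' x v > 0}"
   by (intro open_Collect_less continuous_intros linear_continuous_on bl)
  moreover have "{v. r' x v > 0} \<noteq> {}" using df unfolding defining_def by auto
  moreover have "\<forall>\<^sub>F s in at_right (0::real). x + s *\<^sub>R v \<in> U - D" if "r' x v > 0" for v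
   by (rule eventually_Om_S[OF defining_outside[OF df 2 that]])
  ultimately show ?thesis by blast
 qed
qed

lemma C1_rho: "C1 S (cplx \<rho>)" by (rule Ck2_imp_C1[OF rho2])
lemma C1_pd_rho: "C1 S (pd S b (cplx \<rho>))" by (rule Ck2_imp_C1_pd[OF rho2])

abbreviation "rd b z \<equiv> pd S b (cplx \<rho>) z"
definition "rr z v = Re (rd v z)"

lemma rd_rr: "z \<in> S ==> rd b z = complex_of_real (rr z b)"
 unfolding rr_def by (rule pd_real[OF C1_rho])
lemma rr_deriv: "z \<in> S ==> (\<rho> has_derivative rr z) (at z within S)"
 unfolding rr_def[abs_def] by (rule C1_real_deriv[OF C1_rho])
lemma rr_bl: "z \<in> S ==> bounded_linear (rr z)" using rr_deriv has_derivative_bounded_linear by blast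
lemma rr_cont: "continuous_on S (%z. rr z b)"
 unfolding rr_def by (intro continuous_intros C1_cont_pd[OF C1_rho])
lemma rho_cont: "continuous_on S \<rho>"
 using continuous_on_Re[OF C1_cont[OF C1_rho]] by simp

text \<open>The distance function is 1-Lipschitz, so its gradient has length at most 1; and it decreases with unit
 speed towards a nearest boundary point.\<close>

lemma grad_norm_Om:
 assumes x: "x \<in> Om"
 shows "(\<Sum>b\<in>Basis. (rr x b)\<^sup>2) = 1"
proof -
 have xS: "x \<in> S" using x Om_S by auto
 interpret L: bounded_linear "rr x" by (rule rr_bl[OF xS])
 have ev: "\<forall>\<^sub>F s in at_right (0::real). x + s *\<^sub>R v \<in> Om" for v
 proof -
  have "((%s::real. x + s *\<^sub>R v) \<longlongrightarrow> x + 0 *\<^sub>R v) (at_right 0)" by (intro tendsto_intros)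
  then show ?thesis using open_Om x by (auto simp: tendsto_def)
 qed
 have lim: "((%s. (\<rho> (x + s *\<^sub>R v) - \<rho> x) / s) \<longlongrightarrow> rr x v) (at_right 0)" for v
  by (rule directional_derivative[OF rr_deriv[OF xS] eventually_Om_S[OF ev] xS])
 have \<rho>O: "\<rho> y = infdist y M" if "y \<in> Om" for y using that Om_S by (auto simp: rho signed_dist_def)
 have lip: "rr x v \<le> norm v" for v
 proof (rule tendsto_upperbound[OF lim])
  show "\<forall>\<^sub>F s in at_right 0. (\<rho> (x + s *\<^sub>R v) - \<rho> x) / s \<le> norm v"
   using ev[of v] eventually_at_right_less[of "0::real"]
  proof eventually_elim
   case (elim s)
   have "infdist (x + s *\<^sub>R v) M - infdist x M \<le> dist (x + s *\<^sub>R v) x"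
    using infdist_triangle[of "x + s *\<^sub>R v" M x] by simp
   moreover have "dist (x + s *\<^sub>R v) x = s * norm v" using elim by (simp add: dist_norm)
   ultimately show ?case using elim x by (simp add: \<rho>O field_simps)
  qed
 qed simp
 obtain y where y: "y \<in> M" "infdist x M = dist x y"
  using infdist_attains_inf[of M x] M_ne by auto
 define d where "d = dist x y"
 have d: "d > 0" using x y Om_M by (auto simp: d_def)
 \<comment> \<open>the unit vector towards the nearest boundary point \<open>y\<close>\<close>
 define e where "e = (1/d) *\<^sub>R (y - x)"
 have ne: "norm e = 1" using d by (simp add: e_def d_def dist_norm norm_minus_commute)
 have "rr x e \<le> - 1"
 proof (rule tendsto_upperbound[OF lim])
  have "\<forall>\<^sub>F s in at_right (0::real). s < d" using d by (simp add: eventually_at_right_field) blast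
  then show "\<forall>\<^sub>F s in at_right 0. (\<rho> (x + s *\<^sub>R e) - \<rho> x) / s \<le> -1"
   using ev[of e] eventually_at_right_less[of "0::real"]
  proof eventually_elim
   case (elim s)
   have "y - x = d *\<^sub>R e" using d by (simp add: e_def)
   then have "x + s *\<^sub>R e - y = s *\<^sub>R e - d *\<^sub>R e" by (metis add_diff_eq diff_diff_eq2 add.commute)
   then have "x + s *\<^sub>R e - y = (d - s) *\<^sub>R (- e)" by (simp add: algebra_simps)
   then have "norm (x + s *\<^sub>R e - y) = \<bar>d - s\<bar> * norm (- e)" by (metis norm_scaleR)
   then have "dist (x + s *\<^sub>R e) y = d - s" using elim ne by (simp add: dist_norm)
   then have "infdist (x + s *\<^sub>R e) M \<le> d - s" using infdist_le[OF y(1)] by metis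
   then show ?case using elim x y(2) by (simp add: \<rho>O d_def field_simps)
  qed
 qed simp
 define g where "g = (\<Sum>b\<in>Basis. rr x b *\<^sub>R b)"
 have rg: "rr x v = g \<bullet> v" for v
 proof -
  have "rr x v = rr x (\<Sum>b\<in>Basis. (v \<bullet> b) *\<^sub>R b)" by (simp add: euclidean_representation)
  also have "\<dots> = g \<bullet> v" by (simp add: L.sum L.scaleR g_def inner_sum_left) (simp add: inner_commute mult.commute)
  finally show ?thesis .
 qed
 have "(norm g)\<^sup>2 \<le> norm g" using lip[of g] by (simp add: rg power2_norm_eq_inner)
 have "norm g \<le> 1"
 proof (rule ccontr)
  assume "\<not> norm g \<le> 1"
  then have "norm g * 1 < norm g * norm g" by (intro mult_strict_left_mono) auto
  then show False using \<open>(norm g)\<^sup>2 \<le> norm g\<close> by (simp add: power2_eq_square)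
 qed
 moreover have "1 \<le> norm g"
  using \<open>rr x e \<le> -1\<close> Cauchy_Schwarz_ineq2[of g e] ne by (simp add: rg)
 ultimately have "norm g = 1" by simp
 then have "g \<bullet> g = 1" by (simp add: norm_eq_1)
 moreover have "g \<bullet> g = (\<Sum>b\<in>Basis. (rr x b)\<^sup>2)"
  using rg by (subst euclidean_inner) (simp add: power2_eq_square)
 ultimately show ?thesis by simp
qed

lemma M_limit:
 assumes z: "z \<in> M"
 obtains v where "\<forall>\<^sub>F s in at_right (0::real). z + s *\<^sub>R v \<in> Om"
proof -
 obtain V r r' where df: "defining V r r'" "z \<in> V" using defining_exists[OF z] by blast
 obtain v where "r' z v > 0" using df unfolding defining_def by blast
 then show ?thesis using that defining_outside[OF df z] by blast
qed

text \<open>Every boundary point is a limit of points of \<open>Om\<close>.\<close>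

lemma eq_on_S:
 fixes f g :: "'a => 'b::t2_space"
 assumes f: "continuous_on S f" and g: "continuous_on S g" and eq: "\<And>x. x \<in> Om ==> f x = g x"
  and z: "z \<in> S"
 shows "f z = g z"
proof (cases "z \<in> Om")
 case False
 then have zM: "z \<in> M" using z S_eq by auto
 obtain v where v: "\<forall>\<^sub>F s in at_right (0::real). z + s *\<^sub>R v \<in> Om" by (rule M_limit[OF zM])
 have "filterlim (%s::real. z + s *\<^sub>R v) (at z within S) (at_right 0)"
  unfolding filterlim_at
 proof
  show "\<forall>\<^sub>F s in at_right (0::real). z + s *\<^sub>R v \<in> S \<and> z + s *\<^sub>R v \<noteq> z"
   using v zM Om_M Om_S by (auto elim!: eventually_mono)
  have "((%s::real. z + s *\<^sub>R v) \<longlongrightarrow> z + 0 *\<^sub>R v) (at_right 0)" by (intro tendsto_intros)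
  then show "((%s::real. z + s *\<^sub>R v) \<longlongrightarrow> z) (at_right 0)" by simp
 qed
 then have lf: "((%s. f (z + s *\<^sub>R v)) \<longlongrightarrow> f z) (at_right 0)" and lg: "((%s. g (z + s *\<^sub>R v)) \<longlongrightarrow> g z) (at_right 0)"
  using f g z unfolding continuous_on_def by (auto intro: filterlim_compose)
 have "\<forall>\<^sub>F s in at_right (0::real). f (z + s *\<^sub>R v) = g (z + s *\<^sub>R v)"
  using v by (rule eventually_mono) (rule eq)
 from tendsto_cong[OF this] lf have "((%s. g (z + s *\<^sub>R v)) \<longlongrightarrow> f z) (at_right 0)" by blast
 from tendsto_unique[OF trivial_limit_at_right_real this lg] show ?thesis .
qed (rule eq)

lemma grad_norm: "z \<in> S ==> (\<Sum>b\<in>Basis. (rr z b)\<^sup>2) = 1"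
 by (rule eq_on_S[of "%z. (\<Sum>b\<in>Basis. (rr z b)\<^sup>2)" "%_. 1"])
   (auto intro!: continuous_intros rr_cont grad_norm_Om)

text \<open>Both \<open>r\<close> and \<open>\<rho>\<close> vanish on \<open>M\<close> and are positive outside \<open>D\<close>, so their derivatives at a boundary
 point are proportional with a nonnegative factor. Directions with \<open>r' x v = 0\<close> are approximated by
 directions that leave \<open>D\<close>.\<close>

lemma grad_cone:
 assumes df: "defining V r r'" and x: "x \<in> V" "x \<in> M" and v: "r' x v \<ge> 0"
 shows "rr x v \<ge> 0"
proof -
 have xS: "x \<in> S" using x M_sub by auto
 interpret L: bounded_linear "rr x" by (rule rr_bl[OF xS])
 have "bounded_linear (r' x)" using df x unfolding defining_def by (meson has_derivative_bounded_linear)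
 then interpret R: bounded_linear "r' x" .
 have pos: "rr x v \<ge> 0" if v: "r' x v > 0" for v
 proof (rule tendsto_lowerbound)
  have ev: "\<forall>\<^sub>F s in at_right (0::real). x + s *\<^sub>R v \<in> S"
   by (rule eventually_Om_S[OF defining_outside[OF df x v]])
  show "((%s. (\<rho> (x + s *\<^sub>R v) - \<rho> x) / s) \<longlongrightarrow> rr x v) (at_right 0)"
   by (rule directional_derivative[OF rr_deriv[OF xS] ev xS])
  show "\<forall>\<^sub>F s in at_right 0. 0 \<le> (\<rho> (x + s *\<^sub>R v) - \<rho> x) / s"
   using ev eventually_at_right_less[of "0::real"]
   by eventually_elim (simp add: rho_M[OF x(2)] rho_nonneg)
 qed simp
 obtain v0 where v0: "r' x v0 > 0" using df x unfolding defining_def by blast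
 have "rr x v \<ge> 0 - e" if e: "e > 0" for e
 proof -
  define \<eta> where "\<eta> = e / (1 + \<bar>rr x v0\<bar>)"
  have \<eta>: "\<eta> > 0" using e by (simp add: \<eta>_def add_pos_nonneg)
  have "rr x (v + \<eta> *\<^sub>R v0) \<ge> 0" using v v0 \<eta> by (intro pos) (simp add: R.add R.scaleR add_nonneg_pos)
  then have "rr x v \<ge> - (\<eta> * rr x v0)" by (simp add: L.add L.scaleR)
  moreover have "\<eta> * rr x v0 \<le> \<eta> * (1 + \<bar>rr x v0\<bar>)" using \<eta> by (intro mult_left_mono) auto
  moreover have "\<eta> * (1 + \<bar>rr x v0\<bar>) = e" by (simp add: \<eta>_def add_nonneg_eq_0_iff)
  ultimately show ?thesis by linarith
 qed
 then show ?thesis by (metis diff_0 field_le_epsilon diff_le_eq)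
qed

text \<open>A box-like graph chart: \<open>W\<close> is the part of the cylinder \<open>V\<close> over an open set of the hyperplane
 orthogonal to \<open>b\<close> within distance \<open>\<delta>\<close> of the level \<open>t0\<close>, and \<open>M\<close> is the graph of \<open>g\<close> in it.
 The function \<open>g\<close> is constant in the direction \<open>b\<close>, and the sign \<open>s\<close> tells on which
 side of the graph the exterior lies.\<close>

definition chart :: "'a => real => 'a set => 'a set => ('a => real) => bool" where
 "chart b s V W g \<longleftrightarrow> b \<in> Basis \<and> (s = 1 \<or> s = -1) \<and> open V \<and> open W \<and> Ck_on 1 V g \<and> W \<subseteq> U \<and>
   (\<exists>t0 \<delta>. W = {w\<in>V. \<bar>w \<bullet> b - t0\<bar> < \<delta>} \<and> (\<forall>y\<in>V. \<bar>g y - t0\<bar> < \<delta>)) \<and>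
   (\<forall>y t. y + t *\<^sub>R b \<in> V \<longleftrightarrow> y \<in> V) \<and> (\<forall>y\<in>V. \<forall>t. g (y + t *\<^sub>R b) = g y) \<and>
   (\<forall>w\<in>W. w \<in> M \<longleftrightarrow> w \<bullet> b = g w) \<and> (\<forall>w\<in>W. w \<in> Om \<longleftrightarrow> s * (w \<bullet> b - g w) > 0) \<and>
   (\<forall>w\<in>W \<inter> S. s * rr w b > 0)"

text \<open>Only differentiability of the implicit function is left to show, as its continuity is assumed. The
 first-order expansion of \<open>r\<close> at two points of the zero set first bounds the increment of \<open>g\<close> linearly
 and then determines it up to higher order.\<close>

lemma implicit_function:
 assumes b: "b \<in> Basis" and V: "open V" and \<alpha>: "\<And>y. y \<in> V ==> r' (prj b y + g y *\<^sub>R b) b \<noteq> 0"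
  and g: "continuous_on V g" and r: "\<And>y. y \<in> V ==> r (prj b y + g y *\<^sub>R b) = 0"
  and d: "\<And>y. y \<in> V ==> (r has_derivative r' (prj b y + g y *\<^sub>R b)) (at (prj b y + g y *\<^sub>R b))"
  and y: "y \<in> V"
 shows "(g has_derivative (%h. - r' (prj b y + g y *\<^sub>R b) (prj b h) / r' (prj b y + g y *\<^sub>R b) b)) (at y)"
proof -
 define P where "P y = prj b y + g y *\<^sub>R b" for y
 define R where "R = r' (P y)"
 have dR: "(r has_derivative R) (at (P y))" using d[OF y] by (simp add: R_def P_def)
 then have R: "bounded_linear R" by (rule has_derivative_bounded_linear)
 then interpret R: bounded_linear R .
 obtain K where K: "K > 0" "\<And>h. norm (R h) \<le> norm h * K" using R.pos_bounded by blast
 define a where "a = \<bar>R b\<bar>"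
 have a: "a > 0" using \<alpha>[OF y] by (simp add: a_def R_def P_def)
 have bl: "bounded_linear (%h. - R (prj b h) / R b)"
  using bounded_linear_minus[OF bounded_linear_mult_left[of "1 / R b", THEN bounded_linear_compose, OF bounded_linear_compose[OF R prj_bl]]]
  by (simp add: o_def)
 have "\<exists>\<delta>>0. \<forall>y'. norm (y' - y) < \<delta> -->
   norm (g y' - g y - (- R (prj b (y' - y)) / R b)) \<le> e * norm (y' - y)" if e: "e > 0" for e
 proof -
  \<comment> \<open>\<open>c\<close> collects the constants of the estimate below, so that \<open>e1 * c \<le> e\<close> is what is required\<close>
  define c where "c = (2 + (4 * K + 2 * a) / a) / a"
  have c: "c > 0" using a K by (simp add: c_def add_pos_pos)
  define e1 where "e1 = min (a / 2) (e / c)"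
  have e1: "e1 > 0" "e1 \<le> a / 2" "e1 * c \<le> e" using a e c by (auto simp: e1_def min_le_iff_disj field_simps min_def)
  obtain \<delta>1 where \<delta>1: "\<delta>1 > 0" "\<And>w. norm (w - P y) < \<delta>1 ==> norm (r w - r (P y) - R (w - P y)) \<le> e1 * norm (w - P y)"
   using dR e1(1) unfolding has_derivative_at_alt by blast
  have "continuous_on V P" unfolding P_def[abs_def] by (intro continuous_intros prj_cont g)
  then have "isCont P y" using V y continuous_on_eq_continuous_at by blast
  then obtain \<delta>2 where \<delta>2: "\<delta>2 > 0" "\<And>y'. dist y' y < \<delta>2 ==> dist (P y') (P y) < \<delta>1"
   using \<delta>1(1) unfolding continuous_at_eps_delta by blast
  obtain \<delta>3 where \<delta>3: "\<delta>3 > 0" "ball y \<delta>3 \<subseteq> V" using V y open_contains_ball by blast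
  show ?thesis
  proof (intro exI[of _ "min \<delta>2 \<delta>3"] conjI allI impI)
   fix y' assume y': "norm (y' - y) < min \<delta>2 \<delta>3"
   then have y'V: "y' \<in> V" using \<delta>3 by (auto simp: dist_norm norm_minus_commute)
   define h where "h = y' - y"
   define k where "k = g y' - g y"
   have PP: "P y' - P y = prj b h + k *\<^sub>R b" by (simp add: P_def h_def k_def prj_diff algebra_simps)
   have "norm (P y' - P y) < \<delta>1" using \<delta>2(2)[of y'] y' by (simp add: dist_norm)
   from \<delta>1(2)[OF this] have 1: "\<bar>R (prj b h) + k * R b\<bar> \<le> e1 * norm (prj b h + k *\<^sub>R b)"
    using r[OF y'V] r[OF y] by (simp add: PP R.add R.scaleR flip: P_def)
   have "norm (prj b h + k *\<^sub>R b) \<le> 2 * norm h + \<bar>k\<bar>"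
    using norm_triangle_ineq[of "prj b h" "k *\<^sub>R b"] prj_norm[OF b, of h] b by simp
   then have 2: "\<bar>R (prj b h) + k * R b\<bar> \<le> e1 * (2 * norm h + \<bar>k\<bar>)"
    using 1 e1(1) by (meson mult_left_mono less_imp_le order_trans)
   have 3: "\<bar>R (prj b h)\<bar> \<le> 2 * K * norm h"
  proof -
   have "\<bar>R (prj b h)\<bar> \<le> norm (prj b h) * K" using K(2)[of "prj b h"] by simp
   also have "\<dots> \<le> (2 * norm h) * K" using prj_norm[OF b, of h] K(1) by (intro mult_right_mono) auto
   finally show ?thesis by (simp add: mult_ac)
  qed
   have "a * \<bar>k\<bar> = \<bar>k * R b\<bar>" by (simp add: a_def abs_mult)
   also have "\<dots> \<le> \<bar>R (prj b h) + k * R b\<bar> + \<bar>R (prj b h)\<bar>" by linarith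
   also have "\<dots> \<le> e1 * (2 * norm h + \<bar>k\<bar>) + 2 * K * norm h" using 2 3 by linarith
   also have "\<dots> \<le> a / 2 * (2 * norm h + \<bar>k\<bar>) + 2 * K * norm h"
    using e1(2) by (intro add_right_mono mult_right_mono) auto
   finally have "a * \<bar>k\<bar> \<le> (4 * K + 2 * a) * norm h" by (simp add: algebra_simps)
   then have 4: "\<bar>k\<bar> \<le> (4 * K + 2 * a) / a * norm h" using a by (simp add: field_simps)
   have "norm (k - (- R (prj b h) / R b)) = \<bar>R (prj b h) + k * R b\<bar> / a"
    using a by (simp add: a_def abs_divide[symmetric] add_divide_distrib add.commute)
   also have "\<dots> \<le> e1 * (2 * norm h + \<bar>k\<bar>) / a" using 2 a by (intro divide_right_mono) auto
   also have "\<dots> \<le> e1 * (2 * norm h + (4 * K + 2 * a) / a * norm h) / a"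
    using 4 a e1(1) by (intro divide_right_mono mult_left_mono add_left_mono) auto
   also have "\<dots> = e1 * c * norm h" by (simp add: c_def algebra_simps add_divide_distrib)
   also have "\<dots> \<le> e * norm h" using e1(3) by (intro mult_right_mono) auto
   finally show "norm (g y' - g y - (- R (prj b (y' - y)) / R b)) \<le> e * norm (y' - y)"
    by (simp add: h_def k_def)
  qed (use \<delta>2 \<delta>3 in auto)
 qed
 then have "(g has_derivative (%h. - R (prj b h) / R b)) (at y)"
  unfolding has_derivative_at_alt using bl by blast
 then show ?thesis by (simp add: R_def P_def)
qed

lemma rr_nonzero:
 assumes "z \<in> S"
 obtains b where "b \<in> Basis" "rr z b \<noteq> 0"
proof -
 have "\<exists>b\<in>Basis. rr z b \<noteq> 0"
 proof (rule ccontr)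
  assume "\<not> ?thesis"
  then have "(\<Sum>b\<in>Basis. (rr z b)\<^sup>2) = 0" by (intro sum.neutral) auto
  then show False using grad_norm[OF assms] by simp
 qed
 then show ?thesis using that by blast
qed

text \<open>Along the direction \<open>b\<close> the function \<open>s * r\<close> is strictly increasing near \<open>z\<close>; so on each line close to
 \<open>z\<close> it has exactly one zero, which defines \<open>g\<close>. Strict monotonicity also yields continuity of \<open>g\<close> and
 the two sides of the graph.\<close>

lemma chart_exists:
 assumes z: "z \<in> M" and b: "b \<in> Basis" "rr z b \<noteq> 0"
 shows "\<exists>s V W g. chart b s V W g \<and> z \<in> W"
proof -
 have zS: "z \<in> S" using z M_sub by auto
 obtain V0 r r' where df: "defining V0 r r'" and zV0: "z \<in> V0" using defining_exists[OF z] by blast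
 have V0: "open V0" "V0 \<subseteq> U" and d: "\<And>y. y \<in> V0 ==> (r has_derivative r' y) (at y)"
  and r'c: "\<And>b. continuous_on V0 (%y. r' y b)"
  and DV: "\<And>y. y \<in> V0 ==> y \<in> D \<longleftrightarrow> r y < 0" and MV: "\<And>y. y \<in> V0 ==> y \<in> M \<longleftrightarrow> r y = 0"
  using df unfolding defining_def by blast+
 have rc: "continuous_on V0 r"
  using d has_derivative_continuous by (intro continuous_at_imp_continuous_on) blast
 have bl: "bounded_linear (r' y)" if "y \<in> V0" for y using d[OF that] by (rule has_derivative_bounded_linear)
 define \<alpha> where "\<alpha> = r' z b"
 have sgn: "sgn (r' w b) * rr w b \<ge> 0" if w: "w \<in> V0" "w \<in> M" for w
 proof -
  interpret R: bounded_linear "r' w" by (rule bl[OF w(1)])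
  interpret L: bounded_linear "rr w" by (rule rr_bl) (use w M_sub in auto)
  show ?thesis
  proof (cases "r' w b \<ge> 0")
   case True
   then show ?thesis using grad_cone[OF df w True] by (simp add: sgn_if)
  next
   case False
   then have "r' w (- b) \<ge> 0" by (simp add: R.neg)
   then have "rr w (- b) \<ge> 0" by (rule grad_cone[OF df w])
   then show ?thesis using False by (simp add: L.neg sgn_if)
  qed
 qed
 have \<alpha>: "\<alpha> \<noteq> 0"
 proof
  assume a0: "\<alpha> = 0"
  interpret R: bounded_linear "r' z" by (rule bl[OF zV0])
  interpret L: bounded_linear "rr z" by (rule rr_bl[OF zS])
  have "rr z b \<ge> 0" "rr z (- b) \<ge> 0"
   using a0 by (auto intro!: grad_cone[OF df zV0 z] simp: \<alpha>_def R.neg)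
  then show False using b by (simp add: L.neg)
 qed
 define s where "s = sgn \<alpha>"
 have s: "s = 1 \<or> s = -1" "s * s = 1" using \<alpha> by (auto simp: s_def sgn_if)
 have "open (V0 \<inter> (%y. s * r' y b) -` {0<..})"
  by (rule continuous_open_preimage[OF _ V0(1)]) (auto intro!: continuous_intros r'c)
 moreover have "z \<in> V0 \<inter> (%y. s * r' y b) -` {0<..}" using zV0 \<alpha> by (auto simp: s_def \<alpha>_def sgn_if)
 ultimately obtain \<epsilon>1 where \<epsilon>1: "\<epsilon>1 > 0" "ball z \<epsilon>1 \<subseteq> V0 \<inter> (%y. s * r' y b) -` {0<..}"
  using open_contains_ball by metis
 have szb: "s * rr z b > 0"
  using sgn[OF zV0 z] b(2) s(1) by (auto simp: less_le s_def \<alpha>_def)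
 obtain \<epsilon>2 where \<epsilon>2: "\<epsilon>2 > 0" "\<And>w. w \<in> S ==> dist w z < \<epsilon>2 ==> s * rr w b > 0"
 proof -
  obtain \<delta> where "\<delta> > 0" "\<And>w. w \<in> S ==> dist w z < \<delta> ==> dist (rr w b) (rr z b) < \<bar>rr z b\<bar>"
   using rr_cont[of b] zS b(2) unfolding continuous_on_iff by (metis zero_less_abs_iff)
  then have "s * rr w b > 0" if "w \<in> S" "dist w z < \<delta>" for w
   using that szb s(1) by (force simp: dist_real_def)
  then show ?thesis using that[of \<delta>] \<open>\<delta> > 0\<close> by blast
 qed
 define \<epsilon> where "\<epsilon> = min \<epsilon>1 \<epsilon>2"
 have \<epsilon>: "\<epsilon> > 0" using \<epsilon>1 \<epsilon>2 by (simp add: \<epsilon>_def)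
 have inV: "w \<in> V0" "s * r' w b > 0" if "dist w z < \<epsilon>" for w
  using \<epsilon>1(2) that by (auto simp: \<epsilon>_def dist_commute subset_iff)
 define t0 where "t0 = z \<bullet> b"
 define y0 where "y0 = prj b z"
 define \<delta>2 where "\<delta>2 = \<epsilon> / 2"
 have \<delta>2: "\<delta>2 > 0" using \<epsilon> by (simp add: \<delta>2_def)
 have near: "dist (y + t *\<^sub>R b) z < \<epsilon>" if "dist y y0 < \<delta>2" "\<bar>t - t0\<bar> \<le> \<delta>2" for y t
 proof -
  have "y + t *\<^sub>R b - z = (y - y0) + (t - t0) *\<^sub>R b"
   using prj_decomp[of z b] by (simp add: y0_def t0_def algebra_simps)
  then have "norm (y + t *\<^sub>R b - z) \<le> norm (y - y0) + norm ((t - t0) *\<^sub>R b)" by (metis norm_triangle_ineq)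
  also have "\<dots> < \<epsilon>" using that b(1) by (simp add: dist_norm \<delta>2_def)
  finally show ?thesis by (simp add: dist_norm)
 qed
 define f where "f y t = s * r (y + t *\<^sub>R b)" for y t
 have mono: "f y t1 < f y t2" if y: "dist y y0 < \<delta>2" and t: "t1 < t2" "\<bar>t1 - t0\<bar> \<le> \<delta>2" "\<bar>t2 - t0\<bar> \<le> \<delta>2" for y t1 t2
 proof (rule DERIV_pos_imp_increasing[OF t(1)])
  fix t assume "t1 \<le> t" "t \<le> t2"
  then have "dist (y + t *\<^sub>R b) z < \<epsilon>" using t by (intro near y) auto
  from inV[OF this] have w: "y + t *\<^sub>R b \<in> V0" "s * r' (y + t *\<^sub>R b) b > 0" by auto
  interpret R: bounded_linear "r' (y + t *\<^sub>R b)" by (rule bl[OF w(1)])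
  have "((%t. y + t *\<^sub>R b) has_derivative (%t. t *\<^sub>R b)) (at t)" by (auto intro!: derivative_eq_intros)
  from has_derivative_compose[OF this d[OF w(1)]]
  have "((%t. r (y + t *\<^sub>R b)) has_real_derivative r' (y + t *\<^sub>R b) b) (at t)"
   by (simp add: has_field_derivative_def R.scaleR mult.commute[of _ "r' (y + t *\<^sub>R b) b"])
  from DERIV_cmult[OF this, of s] show "\<exists>l. (f y has_real_derivative l) (at t) \<and> l > 0"
   using w(2) unfolding f_def[abs_def] by blast
 qed
 have fcont: "continuous_on (ball y0 \<delta>2) (%y. f y t)" if "\<bar>t - t0\<bar> \<le> \<delta>2" for t
  unfolding f_def
  by (intro continuous_intros continuous_on_compose2[OF rc]) (use near[OF _ that] inV in \<open>auto simp: dist_commute\<close>)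
 have fcont': "continuous_on {t0 - \<delta>2..t0 + \<delta>2} (f y)" if "dist y y0 < \<delta>2" for y
  unfolding f_def[abs_def]
  by (intro continuous_intros continuous_on_compose2[OF rc]) (use near[OF that] inV in \<open>auto simp: abs_le_iff\<close>)
 have z0: "f y0 t0 = 0"
  using MV[OF zV0] z prj_decomp[of z b] by (simp add: f_def y0_def t0_def)
 have ends: "f y0 (t0 + \<delta>2) > 0" "f y0 (t0 - \<delta>2) < 0"
  using mono[of y0 t0 "t0 + \<delta>2"] mono[of y0 "t0 - \<delta>2" t0] \<delta>2 z0 by auto
 define O1 where "O1 = {y \<in> ball y0 \<delta>2. f y (t0 + \<delta>2) > 0 \<and> f y (t0 - \<delta>2) < 0}"
 have "open O1"
 proof -
  have "O1 = (ball y0 \<delta>2 \<inter> (%y. f y (t0 + \<delta>2)) -` {0<..}) \<inter> (ball y0 \<delta>2 \<inter> (%y. f y (t0 - \<delta>2)) -` {..<0})"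
   by (auto simp: O1_def)
  also have "open \<dots>"
   by (intro open_Int continuous_open_preimage fcont) (use \<delta>2 in auto)
  finally show ?thesis .
 qed
 moreover have "y0 \<in> O1" using ends \<delta>2 by (simp add: O1_def)
 ultimately obtain \<delta>1 where \<delta>1: "\<delta>1 > 0" "ball y0 \<delta>1 \<subseteq> O1" using open_contains_ball by metis
 define V where "V = {w. prj b w \<in> ball y0 \<delta>1}"
 have oV: "open V"
  unfolding V_def using open_vimage[OF open_ball prj_cont[of UNIV b], of y0 \<delta>1] by (simp add: vimage_def)
 have PV: "dist (prj b w) y0 < \<delta>2" "f (prj b w) (t0 + \<delta>2) > 0" "f (prj b w) (t0 - \<delta>2) < 0" if "w \<in> V" for w
  using that \<delta>1(2) unfolding V_def O1_def by (auto simp: dist_commute subset_iff)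
 have ex: "\<exists>t. \<bar>t - t0\<bar> < \<delta>2 \<and> f (prj b w) t = 0" if w: "w \<in> V" for w
 proof -
  have "\<exists>t\<ge>t0 - \<delta>2. t \<le> t0 + \<delta>2 \<and> f (prj b w) t = 0"
   by (rule IVT') (use PV[OF w] \<delta>2 fcont'[OF PV(1)[OF w]] in auto)
  then obtain t where t: "t0 - \<delta>2 \<le> t" "t \<le> t0 + \<delta>2" "f (prj b w) t = 0" by blast
  have "t \<noteq> t0 - \<delta>2" "t \<noteq> t0 + \<delta>2" using t(3) PV[OF w] by auto
  then show ?thesis using t by (intro exI[of _ t]) auto
 qed
 define g where "g w = (SOME t. \<bar>t - t0\<bar> < \<delta>2 \<and> f (prj b w) t = 0)" for w
 have g: "\<bar>g w - t0\<bar> < \<delta>2" "f (prj b w) (g w) = 0" if "w \<in> V" for w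
  using someI_ex[OF ex[OF that]] unfolding g_def by auto
 have cmp: "f (prj b w) t > 0 \<longleftrightarrow> t > g w" "f (prj b w) t < 0 \<longleftrightarrow> t < g w" "f (prj b w) t = 0 \<longleftrightarrow> t = g w"
  if w: "w \<in> V" and t: "\<bar>t - t0\<bar> \<le> \<delta>2" for w t
 proof -
  have lt: "f (prj b w) t < 0" if "t < g w" using mono[OF PV(1)[OF w] that] g[OF w] t by auto
  have gt: "f (prj b w) t > 0" if "g w < t" using mono[OF PV(1)[OF w] that] g[OF w] t by auto
  show "f (prj b w) t > 0 \<longleftrightarrow> t > g w" "f (prj b w) t < 0 \<longleftrightarrow> t < g w" "f (prj b w) t = 0 \<longleftrightarrow> t = g w"
   using lt gt g(2)[OF w] by (cases "t < g w"; cases "t = g w"; force)+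
 qed
 have gprj: "g (w + t *\<^sub>R b) = g w" for w t using b by (simp add: g_def)
 have Vprj: "w + t *\<^sub>R b \<in> V \<longleftrightarrow> w \<in> V" for w t using b by (simp add: V_def)
 have gcont: "continuous_on V g"
 proof -
  have fV: "continuous_on V (%w. f (prj b w) c)" if "\<bar>c - t0\<bar> \<le> \<delta>2" for c
   by (intro continuous_on_compose2[OF fcont[OF that]] prj_cont) (use PV in \<open>auto simp: dist_commute\<close>)
  have "(g \<longlongrightarrow> g w) (at w)" if w: "w \<in> V" for w
  proof (rule order_tendstoI)
   fix a assume a: "a < g w"
   define c where "c = max ((a + g w) / 2) ((t0 - \<delta>2 + g w) / 2)"
   have c: "c < g w" "a < c" "\<bar>c - t0\<bar> \<le> \<delta>2" using a g(1)[OF w] by (auto simp: c_def abs_less_iff abs_le_iff max_def field_simps)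
   have "open (V \<inter> (%w. f (prj b w) c) -` {..<0})" by (rule continuous_open_preimage[OF fV[OF c(3)] oV]) auto
   then have "\<forall>\<^sub>F w' in at w. w' \<in> V \<inter> (%w. f (prj b w) c) -` {..<0}"
    using cmp(2)[OF w c(3)] c(1) w by (intro eventually_at_topological[THEN iffD2]) blast
   then show "\<forall>\<^sub>F w' in at w. a < g w'"
    by (rule eventually_mono) (use cmp(2)[OF _ c(3)] c(2) in fastforce)
  next
   fix a assume a: "g w < a"
   define c where "c = min ((a + g w) / 2) ((t0 + \<delta>2 + g w) / 2)"
   have c: "g w < c" "c < a" "\<bar>c - t0\<bar> \<le> \<delta>2" using a g(1)[OF w] by (auto simp: c_def abs_less_iff abs_le_iff min_def field_simps)
   have "open (V \<inter> (%w. f (prj b w) c) -` {0<..})" by (rule continuous_open_preimage[OF fV[OF c(3)] oV]) auto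
   then have "\<forall>\<^sub>F w' in at w. w' \<in> V \<inter> (%w. f (prj b w) c) -` {0<..}"
    using cmp(1)[OF w c(3)] c(1) w by (intro eventually_at_topological[THEN iffD2]) blast
   then show "\<forall>\<^sub>F w' in at w. g w' < a"
    by (rule eventually_mono) (use cmp(1)[OF _ c(3)] c(2) in fastforce)
  qed
  then show ?thesis using continuous_on_eq_continuous_at[OF oV] by (auto simp: isCont_def)
 qed
 have P: "dist (prj b w + g w *\<^sub>R b) z < \<epsilon>" if "w \<in> V" for w
  using near[OF PV(1)[OF that]] g(1)[OF that] by simp
 have PV0: "prj b w + g w *\<^sub>R b \<in> V0" "r' (prj b w + g w *\<^sub>R b) b \<noteq> 0" if "w \<in> V" for w
  using inV[OF P[OF that]] by auto
 have gd: "(g has_derivative (%h. - r' (prj b y + g y *\<^sub>R b) (prj b h) / r' (prj b y + g y *\<^sub>R b) b)) (at y)"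
  if y: "y \<in> V" for y
 proof (rule implicit_function[OF b(1) oV _ gcont _ _ y, of r' r])
  fix w assume w: "w \<in> V"
  show "r' (prj b w + g w *\<^sub>R b) b \<noteq> 0" by (rule PV0[OF w])
  show "r (prj b w + g w *\<^sub>R b) = 0" using g(2)[OF w] s by (auto simp: f_def)
  show "(r has_derivative r' (prj b w + g w *\<^sub>R b)) (at (prj b w + g w *\<^sub>R b))" by (rule d[OF PV0(1)[OF w]])
 qed
 have Ck: "Ck_on 1 V g"
 proof -
  let ?g' = "%y h. - r' (prj b y + g y *\<^sub>R b) (prj b h) / r' (prj b y + g y *\<^sub>R b) b"
  have 1: "\<forall>h\<in>Basis. continuous_on V (%y. ?g' y h)"
   by (intro ballI continuous_intros continuous_on_compose2[OF r'c] prj_cont gcont) (use PV0 in auto)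
  have 2: "\<forall>y\<in>V. (g has_derivative ?g' y) (at y within V)"
   using gd by (blast intro: has_derivative_at_withinI)
  show ?thesis
   unfolding One_nat_def Ck_on.simps by (rule exI[of _ ?g'], rule conjI[OF 2 1])
 qed
 define W where "W = {w \<in> V. \<bar>w \<bullet> b - t0\<bar> < \<delta>2}"
 have oW: "open W"
 proof -
  have "W = V \<inter> {w. \<bar>w \<bullet> b - t0\<bar> < \<delta>2}" by (auto simp: W_def)
  also have "open \<dots>" by (intro open_Int oV open_Collect_less continuous_intros)
  finally show ?thesis .
 qed
 have Wz: "dist w z < \<epsilon>" if "w \<in> W" for w
  using near[OF PV(1), of w "w \<bullet> b"] that prj_decomp[of w b] by (simp add: W_def)
 have fw: "f (prj b w) (w \<bullet> b) = s * r w" for w using prj_decomp[of w b] by (simp add: f_def)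
 have Wcmp: "s * r w > 0 \<longleftrightarrow> w \<bullet> b > g w" "r w = 0 \<longleftrightarrow> w \<bullet> b = g w" "s * r w < 0 \<longleftrightarrow> w \<bullet> b < g w" if "w \<in> W" for w
  using cmp[of w "w \<bullet> b"] that s unfolding fw by (auto simp: W_def)
 have WM: "w \<in> M \<longleftrightarrow> w \<bullet> b = g w" if "w \<in> W" for w
  using MV[OF inV(1)[OF Wz[OF that]]] Wcmp(2)[OF that] by simp
 have WO: "w \<in> Om \<longleftrightarrow> s * (w \<bullet> b - g w) > 0" if w: "w \<in> W" for w
 proof -
  have wV: "w \<in> V0" by (rule inV(1)[OF Wz[OF w]])
  have "w \<in> Om \<longleftrightarrow> r w > 0" using DV[OF wV] MV[OF wV] closure_D V0(2) wV by auto
  also have "\<dots> \<longleftrightarrow> s * (w \<bullet> b - g w) > 0" using Wcmp[OF w] s(1) by auto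
  finally show ?thesis .
 qed
 have Wrr: "s * rr w b > 0" if "w \<in> W" "w \<in> S" for w
  using \<epsilon>2(2)[OF that(2)] Wz[OF that(1)] by (simp add: \<epsilon>_def)
 have "chart b s V W g"
  unfolding chart_def
 proof (intro conjI)
  show "W \<subseteq> U" using inV(1)[OF Wz] V0(2) by blast
  show "\<exists>t0 \<delta>. W = {w \<in> V. \<bar>w \<bullet> b - t0\<bar> < \<delta>} \<and> (\<forall>y\<in>V. \<bar>g y - t0\<bar> < \<delta>)"
   using g(1) by (intro exI[of _ t0] exI[of _ \<delta>2]) (auto simp: W_def)
  show "s = 1 \<or> s = -1" by (rule s(1))
  show "\<forall>y t. y + t *\<^sub>R b \<in> V \<longleftrightarrow> y \<in> V" using Vprj by blast
  show "\<forall>y\<in>V. \<forall>t. g (y + t *\<^sub>R b) = g y" using gprj by blast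
  show "\<forall>w\<in>W. w \<in> M \<longleftrightarrow> w \<bullet> b = g w" using WM by blast
  show "\<forall>w\<in>W. w \<in> Om \<longleftrightarrow> s * (w \<bullet> b - g w) > 0" using WO by blast
  show "\<forall>w\<in>W \<inter> S. s * rr w b > 0" using Wrr by blast
 qed (fact b oV oW Ck)+
 moreover have "z \<in> W" using \<delta>1 \<delta>2 by (simp add: W_def V_def y0_def t0_def)
 ultimately show ?thesis by blast
qed

lemma chart_graph_chart:
 assumes "chart b s V W g"
 shows "graph_chart M b W V g"
proof -
 have b: "b \<in> Basis" using assms by (simp add: chart_def)
 obtain t0 \<delta> where W: "W = {w \<in> V. \<bar>w \<bullet> b - t0\<bar> < \<delta>}" "\<forall>y\<in>V. \<bar>g y - t0\<bar> < \<delta>"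
  using assms unfolding chart_def by blast
 have V: "\<And>y t. y + t *\<^sub>R b \<in> V \<longleftrightarrow> y \<in> V" "\<And>y t. y \<in> V ==> g (y + t *\<^sub>R b) = g y"
  and WM: "\<And>w. w \<in> W ==> w \<in> M \<longleftrightarrow> w \<bullet> b = g w"
  using assms unfolding chart_def by blast+
 have "M \<inter> W = {y + g y *\<^sub>R b |y. y \<in> V \<and> y \<bullet> b = 0}"
 proof (intro equalityI subsetI)
  fix w assume w: "w \<in> M \<inter> W"
  have p: "prj b w \<in> V" "g (prj b w) = g w"
   using V(1)[of w "- (w \<bullet> b)"] V(2)[of w "- (w \<bullet> b)"] w W by (auto simp: prj_def)
  have "w = prj b w + g (prj b w) *\<^sub>R b" using WM[of w] w p prj_decomp[of w b] by auto
  then show "w \<in> {y + g y *\<^sub>R b |y. y \<in> V \<and> y \<bullet> b = 0}" using p b by (intro CollectI exI[of _ "prj b w"]) auto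
 next
  fix w assume "w \<in> {y + g y *\<^sub>R b |y. y \<in> V \<and> y \<bullet> b = 0}"
  then obtain y where y: "w = y + g y *\<^sub>R b" "y \<in> V" "y \<bullet> b = 0" by blast
  have wb: "w \<bullet> b = g y" using y b by (simp add: inner_add_left)
  then have "w \<in> W" using y V(1) W by simp
  moreover have "w \<in> M" using WM[OF \<open>w \<in> W\<close>] wb V(2)[OF y(2)] y(1) by simp
  ultimately show "w \<in> M \<inter> W" by blast
 qed
 then show ?thesis using assms unfolding graph_chart_def chart_def by blast
qed

text \<open>Differentiating \<open>\<rho> = 0\<close> along the graph gives \<open>\<rho>_i = - g_i \<rho>_b\<close> for \<open>i \<noteq> b\<close>; inserting this into
 \<open>\<bar>grad \<rho>\<bar>^2 = 1\<close> turns the area density into the reciprocal of \<open>\<bar>\<rho>_b\<bar>\<close>.\<close>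

lemma graph_chart_density:
 assumes gc: "graph_chart M b W V g" and y: "y \<in> V" "y \<bullet> b = 0"
 shows "rr (y + g y *\<^sub>R b) b \<noteq> 0"
  and "sqrt (1 + (\<Sum>i\<in>Basis - {b}. (frechet_derivative g (at y) i)\<^sup>2)) = 1 / \<bar>rr (y + g y *\<^sub>R b) b\<bar>"
proof -
 have b: "b \<in> Basis" and V: "open V" and g: "Ck_on 1 V g"
  and MW: "M \<inter> W = {y + g y *\<^sub>R b | y. y \<in> V \<and> y \<bullet> b = 0}"
  using gc unfolding graph_chart_def by auto
 define P where "P = y + g y *\<^sub>R b"
 have PM: "P \<in> M" using MW y unfolding P_def by blast
 then have PS: "P \<in> S" using M_sub by auto
 interpret L: bounded_linear "rr P" by (rule rr_bl[OF PS])
 define G where "G = frechet_derivative g (at y)"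
 have dg: "(g has_derivative G) (at y)"
 proof -
  have "g differentiable (at y within V)" using g y(1) by (auto intro: differentiableI)
  then have "g differentiable (at y)" using at_within_open[OF y(1) V] by simp
  then show ?thesis unfolding G_def using frechet_derivative_works by blast
 qed
 have rel: "rr P i + G i * rr P b = 0" if i: "i \<in> Basis - {b}" for i
 proof -
  let ?c = "%t. (y + t *\<^sub>R i) + g (y + t *\<^sub>R i) *\<^sub>R b"
  let ?T = "(%t. y + t *\<^sub>R i) -` V"
  have oT: "open ?T" by (intro open_vimage V continuous_intros)
  have cM: "?c t \<in> M" if "t \<in> ?T" for t
  proof -
   have "(y + t *\<^sub>R i) \<bullet> b = 0" using y i b by (simp add: inner_add_left inner_not_same_Basis)
   then show ?thesis using that MW by blast
  qed
  interpret G: bounded_linear G using dg by (rule has_derivative_bounded_linear)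
  have l: "((%t. y + t *\<^sub>R i) has_derivative (%t. t *\<^sub>R i)) (at 0)" by (auto intro!: derivative_eq_intros)
  have dgl: "((%t. g (y + t *\<^sub>R i)) has_derivative (%t. t * G i)) (at 0)"
   using has_derivative_compose[OF l, of g G] dg by (simp add: G.scaleR)
  have dc: "(?c has_derivative (%t. t *\<^sub>R i + (t * G i) *\<^sub>R b)) (at 0)"
   by (intro has_derivative_add l has_derivative_scaleR_left dgl)
  have "(\<rho> has_derivative rr P) (at (?c 0) within ?c ` ?T)"
  proof (rule has_derivative_subset)
   show "(\<rho> has_derivative rr P) (at (?c 0) within S)" using rr_deriv[OF PS] by (simp add: P_def)
   show "?c ` ?T \<subseteq> S" using cM M_sub by blast
  qed
  from has_derivative_in_compose[OF has_derivative_at_withinI[OF dc] this]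
  have "((%t. \<rho> (?c t)) has_derivative (%t. rr P (t *\<^sub>R i + (t * G i) *\<^sub>R b))) (at 0 within ?T)" .
  then have 1: "((%t. \<rho> (?c t)) has_derivative (%t. rr P (t *\<^sub>R i + (t * G i) *\<^sub>R b))) (at 0)"
   using at_within_open[OF _ oT, of 0] y by simp
  have "((%t. 0) has_derivative (%t. rr P (t *\<^sub>R i + (t * G i) *\<^sub>R b))) (at 0)"
   by (rule has_derivative_transform_within_open[OF 1 oT]) (use y cM rho_M in auto)
  from has_derivative_unique[OF this, of "%_. 0"]
  have "rr P (1 *\<^sub>R i + (1 * G i) *\<^sub>R b) = 0" by (metis has_derivative_const)
  then show ?thesis by (simp add: L.add L.scaleR)
 qed
 have "1 = (rr P b)\<^sup>2 + (\<Sum>i\<in>Basis - {b}. (rr P i)\<^sup>2)"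
  using grad_norm[OF PS] sum.remove[OF finite_Basis b, of "%i. (rr P i)\<^sup>2"] by simp
 also have "(\<Sum>i\<in>Basis - {b}. (rr P i)\<^sup>2) = (\<Sum>i\<in>Basis - {b}. (rr P b)\<^sup>2 * (G i)\<^sup>2)"
 proof (intro sum.cong refl)
  fix i assume "i \<in> Basis - {b}"
  then have "rr P i = - (G i * rr P b)" using rel by (simp add: add_eq_0_iff)
  then show "(rr P i)\<^sup>2 = (rr P b)\<^sup>2 * (G i)\<^sup>2" by (simp add: power_mult_distrib mult.commute)
 qed
 finally have e: "(rr P b)\<^sup>2 * (1 + (\<Sum>i\<in>Basis - {b}. (G i)\<^sup>2)) = 1"
  by (simp add: sum_distrib_left distrib_left)
 then show nz: "rr (y + g y *\<^sub>R b) b \<noteq> 0" by (auto simp: P_def)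
 have "1 + (\<Sum>i\<in>Basis - {b}. (G i)\<^sup>2) = (1 / \<bar>rr P b\<bar>)\<^sup>2"
  using e nz by (simp add: P_def field_simps power2_eq_square)
 then show "sqrt (1 + (\<Sum>i\<in>Basis - {b}. (frechet_derivative g (at y) i)\<^sup>2)) = 1 / \<bar>rr (y + g y *\<^sub>R b) b\<bar>"
  by (simp add: G_def P_def)
qed

end

section \<open>Cutting off near the boundary\<close>

text \<open>The open sets \<open>G\<close> and \<open>- K\<close> cover the space, and the derivative is continuous on both.\<close>

lemma
 fixes f :: "'a::euclidean_space => complex"
 assumes G: "open G" and K: "closed K" "K \<subseteq> G" and f: "C1 G f" and z: "\<And>x. x \<notin> K ==> f x = 0"
 shows C1_extend: "C1 UNIV f"
  and pd_extend: "x \<in> G ==> pd UNIV b f x = pd G b f x"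
  and pd_extend_0: "x \<notin> K ==> pd UNIV b f x = 0"
proof -
 interpret G: fat_set G by (rule fat_set_open[OF G])
 have dG: "(f has_derivative (%h. pd G h f x)) (at x)" if "x \<in> G" for x
  using G.C1_deriv[OF f that] at_within_open[OF that G] by simp
 have d0: "(f has_derivative (%_. 0)) (at x)" if x: "x \<notin> K" for x
  by (rule has_derivative_transform_within_open[of "%_. 0" _ _ _ "- K"]) (use x K z in auto)
 define f' where "f' x h = (if x \<in> G then pd G h f x else 0)" for x h
 have d: "(f has_derivative f' x) (at x within UNIV)" for x
  using dG d0[of x] K by (cases "x \<in> G") (auto simp: f'_def[abs_def])
 have zero: "pd G h f x = 0" if "x \<in> G" "x \<notin> K" for x h
  using G.pd_eq[OF that(1) has_derivative_at_withinI[OF d0[OF that(2)]]] by simp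
 have c: "continuous_on UNIV (%x. f' x h)" for h
 proof -
  have "continuous_on (G \<union> - K) (%x. f' x h)"
  proof (rule continuous_on_open_Un)
   show "continuous_on G (%x. f' x h)"
    using G.C1_cont_pd[OF f, of h] by (rule continuous_on_eq) (simp add: f'_def)
   show "continuous_on (- K) (%x. f' x h)"
    by (rule continuous_on_eq[OF continuous_on_const[of _ 0]]) (use zero in \<open>auto simp: f'_def\<close>)
  qed (use G K in auto)
  moreover have "G \<union> - K = UNIV" using K by auto
  ultimately show ?thesis by simp
 qed
 show "C1 UNIV f" by (rule UN.C1I[OF d c])
 show "x \<in> G ==> pd UNIV b f x = pd G b f x" using UN.pd_eq[OF UNIV_I d, of b] by (simp add: f'_def)
 show "x \<notin> K ==> pd UNIV b f x = 0" using UN.pd_eq[OF UNIV_I, OF has_derivative_at_withinI[OF d0]] by simp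
qed

context exterior_domain begin

text \<open>The integrands: continuous up to \<open>M\<close>, with support compact in \<open>S\<close>. Values outside \<open>S\<close> are
 unrestricted, in contrast to \<open>C1c\<close>, because one-sided derivatives have no meaning there.\<close>

definition Cc :: "('a => complex) => bool" where
 "Cc F \<longleftrightarrow> continuous_on S F \<and> (\<exists>C. compact C \<and> C \<subseteq> S \<and> (\<forall>x\<in>S. x \<notin> C --> F x = 0))"

definition I :: "('a => complex) => complex" where
 "I F = (LINT z:Om|lborel. F z)"

lemma Cc_cont: "Cc F ==> continuous_on S F" by (simp add: Cc_def)

lemma Cc_bound: "Cc F ==> \<exists>B\<ge>0. \<forall>x\<in>S. norm (F x) \<le> B"
proof -
 assume F: "Cc F"
 then obtain C where C: "compact C" "C \<subseteq> S" "\<And>x. x \<in> S ==> x \<notin> C ==> F x = 0" and c: "continuous_on S F"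
  unfolding Cc_def by blast
 have "compact (F ` C)" by (rule compact_continuous_image[OF continuous_on_subset[OF c C(2)] C(1)])
 then obtain B where B: "B > 0" "\<And>y. y \<in> F ` C ==> norm y \<le> B"
  using bounded_pos compact_imp_bounded by metis
 have "norm (F x) \<le> B" if "x \<in> S" for x using B C(3)[OF that] by (cases "x \<in> C") auto
 then show ?thesis using B(1) by (intro exI[of _ B]) auto
qed

lemma Cc_borel: "Cc F ==> (%z. indicator Om z *\<^sub>R F z) \<in> borel_measurable borel"
 by (intro borel_measurable_continuous_on_indicator borel_sets continuous_on_subset[OF Cc_cont Om_S])

lemma Cc_int: "Cc F ==> set_integrable lborel Om F"
proof -
 assume F: "Cc F"
 obtain B where B: "B \<ge> 0" "\<And>x. x \<in> S ==> norm (F x) \<le> B" using Cc_bound[OF F] by blast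
 obtain C where C: "compact C" "\<And>x. x \<in> S ==> x \<notin> C ==> F x = 0" using F unfolding Cc_def by blast
 obtain R where R: "\<And>x. x \<in> C ==> norm x \<le> R" using compact_imp_bounded[OF C(1)] by (auto simp: bounded_iff)
 have OS: "x \<in> Om ==> x \<in> S" for x using Om_S by blast
 show ?thesis unfolding set_integrable_def
 proof (rule integrable_bounded_support[OF Cc_borel[OF F]])
  fix x
  show "norm (indicator Om x *\<^sub>R F x) \<le> B" using B OS[of x] by (cases "x \<in> Om") auto
  assume "norm x > R"
  then show "indicator Om x *\<^sub>R F x = 0" using R C(2) OS[of x] by (cases "x \<in> Om") force+
 qed
qed

lemma I_add: "Cc F ==> Cc G ==> I (%z. F z + G z) = I F + I G"
 unfolding I_def by (rule set_integral_add) (rule Cc_int; assumption)+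
lemma I_diff: "Cc F ==> Cc G ==> I (%z. F z - G z) = I F - I G"
 unfolding I_def by (rule set_integral_diff) (rule Cc_int; assumption)+
lemma I_cmult: "I (%z. c * F z) = c * I F"
 unfolding I_def by (rule set_integral_mult_right)
lemma I_sum: "(\<And>i. i \<in> A ==> Cc (F i)) ==> I (%z. \<Sum>i\<in>A. F i z) = (\<Sum>i\<in>A. I (F i))"
 using Cc_int unfolding I_def set_lebesgue_integral_def set_integrable_def
 by (subst Bochner_Integration.integral_sum[symmetric]) (auto simp: scaleR_sum_right)
lemma I_cong: "(\<And>z. z \<in> Om ==> F z = G z) ==> I F = I G"
 unfolding I_def by (rule set_lebesgue_integral_cong) auto
lemma I_0: "I (%_. 0) = 0" by (simp add: I_def set_lebesgue_integral_def)

lemma Cc_cong: "(\<And>z. z \<in> S ==> F z = G z) ==> Cc F \<longleftrightarrow> Cc G"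
proof -
 assume eq: "\<And>z. z \<in> S ==> F z = G z"
 have "continuous_on S F \<longleftrightarrow> continuous_on S G" by (rule continuous_on_cong[OF refl eq])
 moreover have "(\<forall>x\<in>S. x \<notin> C --> F x = 0) \<longleftrightarrow> (\<forall>x\<in>S. x \<notin> C --> G x = 0)" for C
  by (intro ball_cong refl) (simp only: eq)
 ultimately show ?thesis unfolding Cc_def by simp
qed
lemma Cc_mult_left: "Cc F ==> continuous_on S g ==> Cc (%z. g z * F z)"
 unfolding Cc_def by (auto intro!: continuous_on_mult)
lemma Cc_mult_right: "Cc F ==> continuous_on S g ==> Cc (%z. F z * g z)"
 unfolding Cc_def by (auto intro!: continuous_on_mult)
lemma Cc_cnj: "Cc F ==> Cc (%z. cnj (F z))"
 unfolding Cc_def by (auto intro!: continuous_on_cnj)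
lemma Cc_0: "Cc (%_. 0)"
 unfolding Cc_def by (auto intro!: exI[of _ "{}"])
lemma Cc_add: "Cc F ==> Cc G ==> Cc (%z. F z + G z)"
proof -
 assume F: "Cc F" and G: "Cc G"
 obtain C where C: "compact C" "C \<subseteq> S" "\<And>x. x \<in> S ==> x \<notin> C ==> F x = 0" using F unfolding Cc_def by blast
 obtain C' where C': "compact C'" "C' \<subseteq> S" "\<And>x. x \<in> S ==> x \<notin> C' ==> G x = 0" using G unfolding Cc_def by blast
 show ?thesis unfolding Cc_def
  using C C' by (intro conjI exI[of _ "C \<union> C'"] continuous_on_add Cc_cont F G) (auto intro: compact_Un)
qed
lemma Cc_cmult: "Cc F ==> Cc (%z. c * F z)" by (rule Cc_mult_left) auto
lemma Cc_diff: "Cc F ==> Cc G ==> Cc (%z. F z - G z)"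
 using Cc_add[of F "%z. (-1) * G z"] Cc_cmult[of G "-1"] by simp
lemma Cc_sum: "(\<And>i. i \<in> A ==> Cc (F i)) ==> Cc (%z. \<Sum>i\<in>A. F i z)"
 by (induction A rule: infinite_finite_induct) (auto intro: Cc_0 Cc_add)

lemma C1c_C1: "C1c f ==> C1 S f" by (simp add: C1c_def)
lemma C1c_supp: "C1c f ==> \<exists>C. compact C \<and> C \<subseteq> S \<and> (\<forall>x. x \<notin> C --> f x = 0)" by (simp add: C1c_def csupp_def)
lemma C1cI: "C1 S f ==> compact C ==> C \<subseteq> S ==> (\<And>x. x \<notin> C ==> f x = 0) ==> C1c f"
 unfolding C1c_def by (auto intro: csuppI)

lemma C1c_Cc: "C1c f ==> Cc f"
 using C1c_supp[of f] unfolding Cc_def by (auto intro: C1_cont C1c_C1)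

lemma pd_0_outside:
 assumes "compact C" "\<And>x. x \<notin> C ==> f x = 0" "x \<in> S" "x \<notin> C"
 shows "pd S b f x = 0"
proof -
 have "(f has_derivative (%_. 0)) (at x)"
  by (rule has_derivative_transform_within_open[of "%_. 0" _ _ _ "- C"])
    (use assms compact_imp_closed in auto)
 from pd_eq[OF assms(3) has_derivative_at_withinI[OF this]] show ?thesis by simp
qed

lemma C1c_Cc_pd: "C1c f ==> Cc (pd S b f)"
 using C1c_supp[of f] pd_0_outside unfolding Cc_def by (blast intro: C1_cont_pd C1c_C1)

lemma C1c_mult_left: "C1c f ==> C1 S g ==> C1c (%z. g z * f z)"
proof -
 assume f: "C1c f" and g: "C1 S g"
 obtain C where C: "compact C" "C \<subseteq> S" "\<And>x. x \<notin> C ==> f x = 0" using C1c_supp[OF f] by blast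
 show ?thesis by (rule C1cI[OF C1_mult[OF g C1c_C1[OF f]] C(1,2)]) (simp add: C(3))
qed
lemma C1c_mult_right: "C1c f ==> C1 S g ==> C1c (%z. f z * g z)"
 using C1c_mult_left by (simp add: mult.commute)
lemma C1c_add: "C1c f ==> C1c g ==> C1c (%z. f z + g z)"
proof -
 assume f: "C1c f" and g: "C1c g"
 obtain C where C: "compact C" "C \<subseteq> S" "\<And>x. x \<notin> C ==> f x = 0" using C1c_supp[OF f] by blast
 obtain C' where C': "compact C'" "C' \<subseteq> S" "\<And>x. x \<notin> C' ==> g x = 0" using C1c_supp[OF g] by blast
 show ?thesis
  by (rule C1cI[of _ "C \<union> C'"]) (use C C' f g in \<open>auto intro: compact_Un C1_add C1c_C1\<close>)
qed
lemma C1c_0: "C1c (%_. 0)" by (rule C1cI[of _ "{}"]) auto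
lemma C1c_sum: "(\<And>i. i \<in> A ==> C1c (F i)) ==> C1c (%z. \<Sum>i\<in>A. F i z)"
 by (induction A rule: infinite_finite_induct) (auto intro: C1c_0 C1c_add)
lemma C1c_cmult: "C1c f ==> C1c (%z. c * f z)" by (rule C1c_mult_left) auto
lemma C1c_cnj: "C1c f ==> C1c (%z. cnj (f z))"
proof -
 assume f: "C1c f"
 obtain C where C: "compact C" "C \<subseteq> S" "\<And>x. x \<notin> C ==> f x = 0" using C1c_supp[OF f] by blast
 show ?thesis by (rule C1cI[OF C1_cnj[OF C1c_C1[OF f]] C(1,2)]) (simp add: C(3))
qed

text \<open>\<open>kn n\<close> is the cutoff \<open>stp (Nn n * \<rho>)\<close>, which tends to 1 on \<open>Om\<close>. Its gradient is \<open>kd n\<close> times the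
 gradient of \<open>\<rho>\<close>, and \<open>Bn n\<close> integrates against the weight \<open>kd n\<close>, which concentrates on \<open>M\<close>.\<close>

definition "Nn n = real (Suc n)"
definition "kn n z = complex_of_real (stp (Nn n * \<rho> z))"
definition "kd n z = complex_of_real (Nn n * stp' (Nn n * \<rho> z))"
definition "Bn n F = I (%z. kd n z * F z)"
definition trunc :: "nat => ('a => complex) => 'a => complex" where
 "trunc n f z = (if z \<in> Om then kn n z * f z else 0)"

lemma Nn_pos: "0 < Nn n" by (simp add: Nn_def)

lemma kn_cont: "continuous_on S (kn n)"
proof -
 have "continuous_on UNIV stp"
  using stp_deriv DERIV_isCont continuous_at_imp_continuous_on by blast
 then have "continuous_on S (%z. stp (Nn n * \<rho> z))"
  by (rule continuous_on_compose2) (auto intro!: continuous_intros rho_cont)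
 then show ?thesis unfolding kn_def by (rule continuous_on_of_real)
qed
lemma kd_cont: "continuous_on S (kd n)"
 unfolding kd_def by (intro continuous_intros continuous_on_compose2[OF stp'_cont[of UNIV]] rho_cont) auto

lemma
 shows C1_kn: "C1 S (kn n)"
  and pd_kn: "x \<in> S ==> pd S b (kn n) x = kd n x * rd b x"
proof -
 have h: "((%t. stp (Nn n * t)) has_real_derivative stp' (Nn n * t) * Nn n) (at t)" for t
 proof -
  have "((%t. Nn n * t) has_real_derivative Nn n) (at t)" by (auto intro!: derivative_eq_intros)
  from DERIV_chain2[OF stp_deriv this] show ?thesis .
 qed
 have c: "continuous_on UNIV (%t. stp' (Nn n * t) * Nn n)"
  by (intro continuous_intros continuous_on_compose2[OF stp'_cont[of UNIV]]) auto
 show "C1 S (kn n)" unfolding kn_def[abs_def] by (rule C1_compose_real[OF C1_rho h c])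
 show "x \<in> S ==> pd S b (kn n) x = kd n x * rd b x"
  using pd_compose_real[OF C1_rho h c, of x b] by (simp add: kn_def[abs_def] kd_def mult.commute)
qed

lemma cut_0: "Nn n * \<rho> z < 1 ==> kn n z = 0 \<and> kd n z = 0"
 by (simp add: kn_def kd_def stp_0 stp'_0)

text \<open>The product with the cutoff vanishes near the boundary and so becomes a \<open>C^1\<close> function on the whole
 space, to which the formulas of the whole space apply.\<close>

lemma
 assumes f: "C1 S f" and C: "compact C" "C \<subseteq> S" "\<And>x. x \<notin> C ==> f x = 0"
 shows cut_C1: "C1 UNIV (trunc n f)"
  and cut_csupp: "csupp (Om \<inter> C) (trunc n f)"
  and cut_pd: "z \<in> Om ==> pd UNIV b (trunc n f) z = kn n z * pd S b f z + kd n z * (rd b z * f z)"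
  and cut_pd_0: "z \<notin> Om \<inter> C ==> pd UNIV b (trunc n f) z = 0"
proof -
 let ?K = "C \<inter> \<rho> -` {1 / Nn n..}"
 have K: "closed ?K"
  by (rule continuous_closed_preimage[OF continuous_on_subset[OF rho_cont C(2)]])
    (use C compact_imp_closed in auto)
 have K': "?K \<subseteq> Om"
 proof
  fix x assume x: "x \<in> ?K"
  then have "\<rho> x > 0" using Nn_pos[of n] by (auto intro: less_le_trans[of 0 "1 / Nn n"])
  then have "x \<notin> M" using rho_M by auto
  then show "x \<in> Om" using x C(2) S_eq by auto
 qed
 have z0: "trunc n f x = 0" if "x \<notin> ?K" for x
 proof (cases "x \<in> C")
  case True
  then have "Nn n * \<rho> x < 1" using that Nn_pos[of n] by (auto simp: field_simps not_le)
  then show ?thesis using cut_0[of n x] by (simp add: trunc_def)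
 qed (simp add: trunc_def C(3))
 interpret O: fat_set Om by (rule fat_set_open[OF open_Om])
 have kf: "C1 S (%z. kn n z * f z)" by (rule C1_mult[OF C1_kn f])
 note kO = C1_restrict[OF kf O.fat_set_axioms fat_set_axioms Om_S]
 have ceq: "\<And>x. x \<in> Om ==> kn n x * f x = trunc n f x" by (simp add: trunc_def)
 have cO: "C1 Om (trunc n f)" using O.C1_cong[of "%x. kn n x * f x" "trunc n f", OF ceq] kO(1) by blast
 show "C1 UNIV (trunc n f)" by (rule C1_extend[OF open_Om K K' cO z0])
 show "csupp (Om \<inter> C) (trunc n f)"
  by (rule csuppI[of ?K]) (use K K' C z0 in \<open>auto intro: compact_Int_closed[of C ?K, simplified]\<close>)
 show "pd UNIV b (trunc n f) z = kn n z * pd S b f z + kd n z * (rd b z * f z)" if z: "z \<in> Om"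
 proof -
  have zS: "z \<in> S" using z Om_S by blast
  have "pd UNIV b (trunc n f) z = pd Om b (trunc n f) z" by (rule pd_extend[OF open_Om K K' cO z0 z])
  also have "\<dots> = pd Om b (%z. kn n z * f z) z" by (rule O.C1_cong_pd[OF ceq[symmetric] z])
  also have "\<dots> = pd S b (%z. kn n z * f z) z" by (rule kO(2)[OF z])
  also have "\<dots> = kd n z * rd b z * f z + kn n z * pd S b f z"
   using pd_mult[OF C1_kn f zS, where b=b] pd_kn[OF zS] by simp
  finally show ?thesis by (simp add: mult_ac)
 qed
 show "pd UNIV b (trunc n f) z = 0" if "z \<notin> Om \<inter> C"
  by (rule pd_extend_0[OF open_Om K K' cO z0]) (use that K' in auto)
qed

lemma integral_to_I:
 assumes "\<And>z. z \<notin> Om ==> F z = 0"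
 shows "(\<integral>z. F z \<partial>lborel) = I F"
 unfolding I_def set_lebesgue_integral_def
 by (rule Bochner_Integration.integral_cong) (use assms in \<open>auto simp: indicator_def\<close>)

text \<open>The integral over the whole space of a derivative of the truncated function is zero.\<close>

lemma cut_parts:
 assumes f: "C1c f" and b: "b \<in> Basis"
 shows "I (%z. kn n z * pd S b f z) = - Bn n (%z. rd b z * f z)"
proof -
 obtain C where C: "compact C" "C \<subseteq> S" "\<And>x. x \<notin> C ==> f x = 0" using C1c_supp[OF f] by blast
 note c = cut_C1[OF C1c_C1[OF f] C, of n] cut_csupp[OF C1c_C1[OF f] C, of n]
 have cU: "csupp UNIV (trunc n f)" using c(2) unfolding csupp_def by blast
 have "0 = (\<integral>z. pd UNIV b (trunc n f) z \<partial>lborel)" by (rule integral_pd_zero[OF c(1) cU b, symmetric])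
 also have "\<dots> = I (pd UNIV b (trunc n f))"
  by (rule integral_to_I) (use cut_pd_0[OF C1c_C1[OF f] C] in auto)
 also have "\<dots> = I (%z. kn n z * pd S b f z + kd n z * (rd b z * f z))"
  by (rule I_cong) (rule cut_pd[OF C1c_C1[OF f] C])
 also have "\<dots> = I (%z. kn n z * pd S b f z) + Bn n (%z. rd b z * f z)"
  unfolding Bn_def
  by (intro I_add Cc_mult_left C1c_Cc_pd C1c_Cc f kn_cont kd_cont C1_cont_pd[OF C1_rho])
 finally show ?thesis by (simp add: add_eq_0_iff)
qed

lemma I_cut_limit:
 assumes F: "Cc F"
 shows "(%n. I (%z. kn n z * F z)) \<longlonglongrightarrow> I F"
 unfolding I_def set_lebesgue_integral_def
proof (rule integral_dominated_convergence[where w="%z. norm (indicator Om z *\<^sub>R F z)"])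
 show "(%z. indicator Om z *\<^sub>R F z) \<in> borel_measurable lborel" using Cc_borel[OF F] by simp
 show "(%z. indicator Om z *\<^sub>R (kn n z * F z)) \<in> borel_measurable lborel" for n
  using Cc_borel[OF Cc_mult_left[OF F kn_cont]] by simp
 show "integrable lborel (%z. norm (indicator Om z *\<^sub>R F z))"
  using Cc_int[OF F] unfolding set_integrable_def by (rule integrable_norm)
 show "AE z in lborel. norm (indicator Om z *\<^sub>R (kn n z * F z)) \<le> norm (indicator Om z *\<^sub>R F z)" for n
  using stp_bounds by (intro AE_I2) (auto simp: kn_def norm_mult indicator_def intro!: mult_left_le_one_le)
 show "AE z in lborel. (%n. indicator Om z *\<^sub>R (kn n z * F z)) \<longlonglongrightarrow> indicator Om z *\<^sub>R F z"
 proof (intro AE_I2)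
  fix z
  show "(%n. indicator Om z *\<^sub>R (kn n z * F z)) \<longlonglongrightarrow> indicator Om z *\<^sub>R F z"
  proof (cases "z \<in> Om")
   case True
   then have p: "\<rho> z > 0" by (rule rho_pos)
   obtain m where m: "2 < real m * \<rho> z" using reals_Archimedean3[OF p] by blast
   have "kn n z = 1" if "n \<ge> m" for n
   proof -
    have "real m * \<rho> z \<le> Nn n * \<rho> z" using that p by (intro mult_right_mono) (auto simp: Nn_def)
    then show ?thesis using m by (simp add: kn_def stp_1)
   qed
   then have "\<forall>\<^sub>F n in sequentially. indicator Om z *\<^sub>R F z = indicator Om z *\<^sub>R (kn n z * F z)"
    unfolding eventually_sequentially by (intro exI[of _ m]) auto
   then show ?thesis by (rule tendsto_cong[THEN iffD1, OF _ tendsto_const])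
  qed simp
 qed
qed

text \<open>A solid integral that will turn out to be the surface integral of \<open>f\<close>: the divergence theorem applied to
 the field \<open>f grad \<rho>\<close>, whose normal component on \<open>M\<close> is \<open>f\<close>. Having it before the surface measure
 makes it possible to compare different charts.\<close>

definition Lam :: "('a => complex) => complex" where
 "Lam f = - (\<Sum>b\<in>Basis. I (pd S b (%z. rd b z * f z)))"

lemma sum_rd_sq: "z \<in> S ==> (\<Sum>b\<in>Basis. rd b z * rd b z) = 1"
 using grad_norm[of z] by (simp add: rd_rr power2_eq_square flip: of_real_mult of_real_sum)

lemma Bn_sum:
 assumes "\<And>b. b \<in> Basis ==> C1c (X b)"
 shows "Bn n (%z. \<Sum>b\<in>Basis. rd b z * X b z) = - (\<Sum>b\<in>Basis. I (%z. kn n z * pd S b (X b) z))"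
proof -
 have "Bn n (%z. \<Sum>b\<in>Basis. rd b z * X b z) = (\<Sum>b\<in>Basis. Bn n (%z. rd b z * X b z))"
  unfolding Bn_def sum_distrib_left
  by (intro I_sum Cc_mult_left C1c_Cc assms kd_cont C1_cont_pd[OF C1_rho])
 also have "\<dots> = (\<Sum>b\<in>Basis. - I (%z. kn n z * pd S b (X b) z))"
  by (intro sum.cong refl) (simp add: cut_parts[OF assms])
 finally show ?thesis by (simp add: sum_negf)
qed

lemma Bn_sum_limit:
 assumes "\<And>b. b \<in> Basis ==> C1c (X b)"
 shows "(%n. Bn n (%z. \<Sum>b\<in>Basis. rd b z * X b z)) \<longlonglongrightarrow> - (\<Sum>b\<in>Basis. I (pd S b (X b)))"
proof -
 have "(%n. Bn n (%z. \<Sum>b\<in>Basis. rd b z * X b z)) = (%n. - (\<Sum>b\<in>Basis. I (%z. kn n z * pd S b (X b) z)))"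
  by (intro ext Bn_sum assms)
 moreover have "(%n. - (\<Sum>b\<in>Basis. I (%z. kn n z * pd S b (X b) z))) \<longlonglongrightarrow> - (\<Sum>b\<in>Basis. I (pd S b (X b)))"
  by (intro tendsto_minus tendsto_sum I_cut_limit C1c_Cc_pd assms)
 ultimately show ?thesis by simp
qed

lemma Bn_cong: "(\<And>z. z \<in> Om ==> F z = G z) ==> Bn n F = Bn n G"
 unfolding Bn_def by (rule I_cong) simp

text \<open>Because \<open>\<bar>grad \<rho>\<bar> = 1\<close>, the function \<open>f\<close> is the normal component of \<open>f grad \<rho>\<close>, also off the boundary.\<close>

lemma Bn_Lam:
 assumes f: "C1c f"
 shows "(%n. Bn n f) \<longlonglongrightarrow> Lam f"
proof -
 have "Bn n f = Bn n (%z. \<Sum>b\<in>Basis. rd b z * (rd b z * f z))" for n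
 proof (rule Bn_cong)
  fix z assume "z \<in> Om"
  then have "z \<in> S" using Om_S by blast
  have "(\<Sum>b\<in>Basis. rd b z * (rd b z * f z)) = (\<Sum>b\<in>Basis. rd b z * rd b z) * f z"
   by (simp add: sum_distrib_right mult.assoc)
  then show "f z = (\<Sum>b\<in>Basis. rd b z * (rd b z * f z))" using sum_rd_sq[OF \<open>z \<in> S\<close>] by simp
 qed
 then show ?thesis unfolding Lam_def
  using Bn_sum_limit[of "%b z. rd b z * f z"] C1c_mult_left[OF f C1_pd_rho] by simp
qed

text \<open>The cutoffs are functions of \<open>\<rho>\<close>, so a field tangential to the level sets of \<open>\<rho>\<close> does not see them.\<close>

lemma tangential_divergence:
 assumes X: "\<And>b. b \<in> Basis ==> C1c (X b)" and t: "\<And>z. z \<in> Om ==> (\<Sum>b\<in>Basis. rd b z * X b z) = 0"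
 shows "(\<Sum>b\<in>Basis. I (pd S b (X b))) = 0"
proof -
 have "Bn n (%z. \<Sum>b\<in>Basis. rd b z * X b z) = 0" for n
  using Bn_cong[OF t, where n=n] by (simp add: Bn_def I_0)
 then show ?thesis using Bn_sum_limit[OF X] LIMSEQ_unique[OF _ tendsto_const[of 0]] by fastforce
qed

lemma I_pd_Om:
 assumes f: "C1c f" and C: "compact C" "C \<subseteq> Om" "\<And>x. x \<notin> C ==> f x = 0" and b: "b \<in> Basis"
 shows "I (pd S b f) = 0"
proof -
 interpret O: fat_set Om by (rule fat_set_open[OF open_Om])
 note fO = C1_restrict[OF C1c_C1[OF f] O.fat_set_axioms fat_set_axioms Om_S]
 have cl: "closed C" using C compact_imp_closed by blast
 have c1: "C1 UNIV f" by (rule C1_extend[OF open_Om cl C(2) fO(1) C(3)])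
 have s: "csupp UNIV f" using C unfolding csupp_def by blast
 have "I (pd S b f) = I (pd UNIV b f)"
  by (rule I_cong) (simp add: pd_extend[OF open_Om cl C(2) fO(1) C(3)] fO(2))
 also have "\<dots> = (\<integral>z. pd UNIV b f z \<partial>lborel)"
  by (rule integral_to_I[symmetric]) (rule pd_extend_0[OF open_Om cl C(2) fO(1) C(3)], use C in auto)
 also have "\<dots> = 0" by (rule integral_pd_zero[OF c1 s b])
 finally show ?thesis .
qed

lemma Lam_Om:
 assumes f: "C1c f" and C: "compact C" "C \<subseteq> Om" "\<And>x. x \<notin> C ==> f x = 0"
 shows "Lam f = 0"
proof -
 have "I (pd S b (%z. rd b z * f z)) = 0" if "b \<in> Basis" for b
  by (rule I_pd_Om[OF C1c_mult_left[OF f C1_pd_rho] C(1,2) _ that]) (simp add: C(3))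
 then show ?thesis by (simp add: Lam_def)
qed

lemma Lam_add: "C1c f ==> C1c g ==> Lam (%z. f z + g z) = Lam f + Lam g"
proof -
 assume f: "C1c f" and g: "C1c g"
 have "I (pd S b (%z. rd b z * (f z + g z))) = I (pd S b (%z. rd b z * f z)) + I (pd S b (%z. rd b z * g z))" for b
 proof -
  have F: "C1c (%z. rd b z * f z)" "C1c (%z. rd b z * g z)" using f g by (auto intro: C1c_mult_left C1_pd_rho)
  have "I (pd S b (%z. rd b z * (f z + g z))) = I (%z. pd S b (%z. rd b z * f z) z + pd S b (%z. rd b z * g z) z)"
  proof (rule I_cong)
   fix z assume "z \<in> Om" then have "z \<in> S" using Om_S by blast
   show "pd S b (%z. rd b z * (f z + g z)) z = pd S b (%z. rd b z * f z) z + pd S b (%z. rd b z * g z) z"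
    using pd_add[OF C1c_C1[OF F(1)] C1c_C1[OF F(2)] \<open>z \<in> S\<close>, of b] by (simp add: distrib_left)
  qed
  then show ?thesis by (simp add: I_add C1c_Cc_pd F)
 qed
 then show ?thesis by (simp add: Lam_def sum.distrib)
qed

lemma Lam_0: "Lam (%_. 0) = 0"
 using I_cong[of "pd S b (%_. 0)" "%_. 0" for b] Om_S by (simp add: Lam_def pd_const I_0 subset_iff)

end

section \<open>The surface measure\<close>

context exterior_domain begin

lemma C1c_borel: "C1c f ==> f \<in> borel_measurable borel"
proof -
 assume f: "C1c f"
 obtain C where C: "compact C" "C \<subseteq> S" "\<And>x. x \<notin> C ==> f x = 0" using C1c_supp[OF f] by blast
 have "(%x. indicator S x *\<^sub>R f x) \<in> borel_measurable borel"
  by (intro borel_measurable_continuous_on_indicator borel_sets C1_cont C1c_C1 f)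
 moreover have "indicator S x *\<^sub>R f x = f x" for x using C by (auto simp: indicator_def)
 ultimately show ?thesis by simp
qed

lemma C1c_bound: "C1c f ==> \<exists>B\<ge>0. \<forall>x. norm (f x) \<le> B"
proof -
 assume f: "C1c f"
 obtain B where B: "B \<ge> 0" "\<And>x. x \<in> S ==> norm (f x) \<le> B" using Cc_bound[OF C1c_Cc[OF f]] by blast
 obtain C where C: "compact C" "C \<subseteq> S" "\<And>x. x \<notin> C ==> f x = 0" using C1c_supp[OF f] by blast
 have "norm (f x) \<le> B" for x using B C by (cases "x \<in> C") auto
 then show ?thesis using B(1) by blast
qed

text \<open>Fubini along \<open>b\<close> and the fundamental theorem of calculus on the half-line from the graph into the
 exterior; only the value at the graph survives.\<close>

lemma chart_ftc:
 assumes ch: "chart b s V W g" and G: "C1 S G" and C: "compact C" "C \<subseteq> S \<inter> W" "\<And>x. x \<notin> C ==> G x = 0"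
 shows "I (pd S b G) = - complex_of_real s *
  (LINT y|hyperplane_lborel b. indicator (V \<inter> {y. y \<bullet> b = 0}) y *\<^sub>R G (y + g y *\<^sub>R b))"
proof -
 have b: "b \<in> Basis" and s: "s = 1 \<or> s = -1" and oV: "open V" and Ckg: "Ck_on 1 V g"
  and VV: "\<And>y t. y + t *\<^sub>R b \<in> V \<longleftrightarrow> y \<in> V" and gg: "\<And>y t. y \<in> V ==> g (y + t *\<^sub>R b) = g y"
  and WM: "\<And>w. w \<in> W ==> w \<in> M \<longleftrightarrow> w \<bullet> b = g w"
  and WO: "\<And>w. w \<in> W ==> w \<in> Om \<longleftrightarrow> s * (w \<bullet> b - g w) > 0"
  using ch unfolding chart_def by blast+
 obtain t0 \<delta> where W: "W = {w \<in> V. \<bar>w \<bullet> b - t0\<bar> < \<delta>}" and gb: "\<And>y. y \<in> V ==> \<bar>g y - t0\<bar> < \<delta>"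
  using ch unfolding chart_def by blast
 have gC: "graph_chart M b W V g" by (rule chart_graph_chart[OF ch])
 have Gc: "C1c G" by (rule C1cI[OF G C(1) _ C(3)]) (use C in auto)
 let ?F = "%z. indicator Om z *\<^sub>R pd S b G z"
 have Fint: "integrable lborel ?F"
  using Cc_int[OF C1c_Cc_pd[OF Gc]] unfolding set_integrable_def .
 have Fmeas: "?F \<in> borel_measurable borel" using Fint by auto
 have F0: "?F z = 0" if "z \<notin> C" for z
  using pd_0_outside[OF C(1) C(3)] that Om_S by (cases "z \<in> Om") auto
 have I: "I (pd S b G) = (LINT y|hyperplane_lborel b. (\<integral>t. ?F (y + t *\<^sub>R b) \<partial>lborel))"
  unfolding I_def set_lebesgue_integral_def by (rule hyperplane_fubini[OF b Fint])
 have line: "(\<integral>t. ?F (y + t *\<^sub>R b) \<partial>lborel) = - complex_of_real s * (indicator (V \<inter> {y. y \<bullet> b = 0}) y *\<^sub>R G (y + g y *\<^sub>R b))"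
  if yb: "y \<bullet> b = 0" for y
 proof (cases "y \<in> V")
  case False
  then have "y + t *\<^sub>R b \<notin> C" for t using VV[of y t] C(2) W by auto
  then have "(\<integral>t. ?F (y + t *\<^sub>R b) \<partial>lborel) = (\<integral>t. 0 \<partial>(lborel::real measure))"
   using F0 by (intro Bochner_Integration.integral_cong) auto
  then show ?thesis using False by simp
 next
  case True
  \<comment> \<open>the line leaves the chart at the parameter \<open>T\<close>; the parameter \<open>\<tau>\<close> runs from the graph into \<open>Om\<close>\<close>
  define T where "T = \<delta> - s * (g y - t0)"
  have T: "T > 0" using gb[OF True] s by (auto simp: T_def)
  define w where "w \<tau> = y + (g y + s * \<tau>) *\<^sub>R b" for \<tau>
  have wb: "w \<tau> \<bullet> b = g y + s * \<tau>" for \<tau> using yb b by (simp add: w_def inner_add_left)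
  have wV: "w \<tau> \<in> V" "g (w \<tau>) = g y" for \<tau> unfolding w_def using VV True gg[OF True] by auto
  have inW: "w \<tau> \<in> W" if "0 \<le> \<tau>" "\<tau> < T" for \<tau>
   using that gb[OF True] s by (auto simp: W wV wb T_def abs_less_iff)
  have nW: "w \<tau> \<notin> W" if "T \<le> \<tau>" for \<tau>
   using that gb[OF True] s by (auto simp: W wV wb T_def abs_less_iff)
  have wO: "w \<tau> \<in> Om \<longleftrightarrow> \<tau> > 0" if "w \<tau> \<in> W" for \<tau>
   using WO[OF that] s by (auto simp: wV wb)
  have wM: "w 0 \<in> M" using WM[OF inW[OF _ T]] wV wb by simp
  have wS: "w \<tau> \<in> S" if "0 \<le> \<tau>" "\<tau> < T" for \<tau>
   using wO[OF inW[OF that]] that wM S_eq by (cases "\<tau> = 0") auto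
  have wc: "continuous_on A w" for A unfolding w_def by (intro continuous_intros)
  \<comment> \<open>by compactness the support ends before the line leaves the chart\<close>
  obtain T' where T': "0 < T'" "T' < T" "\<And>\<tau>. T' \<le> \<tau> ==> w \<tau> \<notin> C"
  proof -
   have "open (w -` (- C))" using C(1) compact_imp_closed by (intro open_vimage wc) auto
   moreover have "T \<in> w -` (- C)" using nW[of T] C(2) by auto
   ultimately obtain \<epsilon> where \<epsilon>0: "\<epsilon> > 0" "ball T \<epsilon> \<subseteq> w -` (- C)" using open_contains_ball by metis
   have \<epsilon>: "\<epsilon> > 0" "w \<tau> \<in> - C" if "dist \<tau> T < \<epsilon>" for \<tau>
    using \<epsilon>0 that by (auto simp: dist_commute)
   show ?thesis
   proof (rule that[of "max (T / 2) (T - \<epsilon> / 2)"])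
    fix \<tau> assume \<tau>: "max (T / 2) (T - \<epsilon> / 2) \<le> \<tau>"
    show "w \<tau> \<notin> C"
    proof (cases "\<tau> < T")
     case True then show ?thesis using \<epsilon>(2)[of \<tau>] \<epsilon>0(1) \<tau> by (auto simp: dist_real_def)
    next
     case False then show ?thesis using nW[of \<tau>] C(2) by auto
    qed
   qed (use T \<epsilon>0 in auto)
  qed
  have s1: "s \<noteq> 0" "\<bar>s\<bar> = 1" using s by auto
  have "(\<integral>t. ?F (y + t *\<^sub>R b) \<partial>lborel) = (\<integral>\<tau>. ?F (w \<tau>) \<partial>lborel)"
   using lborel_integral_real_affine[OF s1(1), of "%t. ?F (y + t *\<^sub>R b)" "g y"] s1(2) by (simp add: w_def)
  also have "\<dots> = (\<integral>\<tau>. indicator {0..T'} \<tau> *\<^sub>R pd S b G (w \<tau>) \<partial>lborel)"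
  proof (rule integral_cong_AE)
   have pc: "continuous_on {0..T'} (%\<tau>. pd S b G (w \<tau>))"
    by (rule continuous_on_compose2[OF C1_cont_pd[OF G] wc]) (use wS T' in auto)
   show "(%\<tau>. indicator {0..T'} \<tau> *\<^sub>R pd S b G (w \<tau>)) \<in> borel_measurable lborel"
    using borel_measurable_continuous_on_indicator[OF _ pc] by simp
   have "w \<in> borel_measurable borel" using wc by (rule borel_measurable_continuous_onI)
   from measurable_compose[OF this Fmeas] show "(%\<tau>. ?F (w \<tau>)) \<in> borel_measurable lborel" by simp
   show "AE \<tau> in lborel. ?F (w \<tau>) = indicator {0..T'} \<tau> *\<^sub>R pd S b G (w \<tau>)"
    using AE_lborel_singleton[of "0::real"]
   proof eventually_elim
    fix \<tau> :: real assume t0: "\<tau> \<noteq> 0"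
    consider "\<tau> < 0" | "0 < \<tau>" "\<tau> \<le> T'" | "T' < \<tau>" using t0 by linarith
    then show "?F (w \<tau>) = indicator {0..T'} \<tau> *\<^sub>R pd S b G (w \<tau>)"
    proof cases
     case 1
     then have "w \<tau> \<in> C ==> w \<tau> \<notin> Om" using wO[of \<tau>] C(2) by auto
     then have "?F (w \<tau>) = 0" using F0[of "w \<tau>"] by (cases "w \<tau> \<in> C") auto
     then show ?thesis using 1 by simp
    next
     case 2
     then have "w \<tau> \<in> Om" using wO[OF inW] T' by auto
     then show ?thesis using 2 by simp
    next
     case 3
     then have "?F (w \<tau>) = 0" using F0 T'(3)[of \<tau>] by simp
     then show ?thesis using 3 by simp
    qed
   qed
  qed
  also have "\<dots> = complex_of_real s * (\<integral>\<tau>. indicator {0..T'} \<tau> *\<^sub>R (complex_of_real s * pd S b G (w \<tau>)) \<partial>lborel)"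
   using s by auto
  also have "(\<integral>\<tau>. indicator {0..T'} \<tau> *\<^sub>R (complex_of_real s * pd S b G (w \<tau>)) \<partial>lborel) = G (w T') - G (w 0)"
  proof (rule integral_FTC_atLeastAtMost)
   fix \<tau> assume \<tau>: "0 \<le> \<tau>" "\<tau> \<le> T'"
   have "(w has_derivative (%h. (s * h) *\<^sub>R b)) (at \<tau> within {0..T'})"
    unfolding w_def[abs_def] by (auto intro!: derivative_eq_intros)
   moreover have "(G has_derivative (%h. pd S h G (w \<tau>))) (at (w \<tau>) within w ` {0..T'})"
    by (rule has_derivative_subset[OF C1_deriv[OF G wS]]) (use \<tau> T' wS in auto)
   ultimately have d: "((%\<tau>. G (w \<tau>)) has_derivative (%h. pd S ((s * h) *\<^sub>R b) G (w \<tau>))) (at \<tau> within {0..T'})"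
    by (rule has_derivative_in_compose)
   interpret L: bounded_linear "%h. pd S h G (w \<tau>)" by (rule pd_linear[OF G wS]) (use \<tau> T' in auto)
   show "((%\<tau>. G (w \<tau>)) has_vector_derivative complex_of_real s * pd S b G (w \<tau>)) (at \<tau> within {0..T'})"
    unfolding has_vector_derivative_def using d by (simp add: L.scaleR scaleR_conv_of_real mult_ac)
  next
   show "continuous_on {0..T'} (%\<tau>. complex_of_real s * pd S b G (w \<tau>))"
    by (intro continuous_intros continuous_on_compose2[OF C1_cont_pd[OF G] wc]) (use wS T' in auto)
  qed (use T' in auto)
  also have "G (w T') = 0" using C(3) T'(3) by simp
  finally show ?thesis using True yb by (simp add: w_def)
 qed
 have mG: "(%y. indicator (V \<inter> {y. y \<bullet> b = 0}) y *\<^sub>R G (y + g y *\<^sub>R b)) \<in> borel_measurable borel"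
 proof (rule borel_measurable_continuous_on_indicator)
  have "closed {y. y \<bullet> b = 0}" by (intro closed_Collect_eq continuous_intros)
  then show "V \<inter> {y. y \<bullet> b = 0} \<in> sets borel" using oV by auto
  have gc: "continuous_on V g" using Ck_on_Suc_imp[of 0 V g] Ckg by simp
  show "continuous_on (V \<inter> {y. y \<bullet> b = 0}) (%y. G (y + g y *\<^sub>R b))"
  proof (rule continuous_on_compose2[OF C1_cont[OF G]])
   show "continuous_on (V \<inter> {y. y \<bullet> b = 0}) (%y. y + g y *\<^sub>R b)"
    by (intro continuous_intros continuous_on_subset[OF gc]) auto
   show "(%y. y + g y *\<^sub>R b) ` (V \<inter> {y. y \<bullet> b = 0}) \<subseteq> S"
    using gC M_sub unfolding graph_chart_def by blast
  qed
 qed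
 have "I (pd S b G) = (LINT y|hyperplane_lborel b. - complex_of_real s * (indicator (V \<inter> {y. y \<bullet> b = 0}) y *\<^sub>R G (y + g y *\<^sub>R b)))"
  unfolding I
 proof (rule integral_cong_AE)
  show "(%y. \<integral>t. ?F (y + t *\<^sub>R b) \<partial>lborel) \<in> borel_measurable (hyperplane_lborel b)"
  proof (subst measurable_hyperplane, rule lborel.borel_measurable_lebesgue_integral)
   have "(%p::'a \<times> real. fst p + snd p *\<^sub>R b) \<in> borel_measurable (borel \<Otimes>\<^sub>M lborel)" by measurable
   from measurable_compose[OF this Fmeas]
   show "(%(y, t). ?F (y + t *\<^sub>R b)) \<in> borel_measurable (borel \<Otimes>\<^sub>M lborel)" by (simp add: case_prod_beta')
  qed
  show "(%y. - complex_of_real s * (indicator (V \<inter> {y. y \<bullet> b = 0}) y *\<^sub>R G (y + g y *\<^sub>R b))) \<in> borel_measurable (hyperplane_lborel b)"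
   by (subst measurable_hyperplane, rule borel_measurable_times[OF borel_measurable_const mG])
  show "AE y in hyperplane_lborel b. (\<integral>t. ?F (y + t *\<^sub>R b) \<partial>lborel) = - complex_of_real s * (indicator (V \<inter> {y. y \<bullet> b = 0}) y *\<^sub>R G (y + g y *\<^sub>R b))"
   using AE_hyperplane[OF b] by eventually_elim (rule line)
 qed
 then show ?thesis by (simp only: integral_mult_right_zero)
qed

text \<open>The fields \<open>f grad \<rho>\<close> and \<open>(f / \<rho>_b) e_b\<close> have the same normal component. Their difference \<open>X\<close> is
 tangential and has total divergence zero, and for the second field \<open>chart_ftc\<close> applies.\<close>

lemma chart_Lam:
 assumes ch: "chart b s V W g" and f: "C1 S f" and C: "compact C" "C \<subseteq> S \<inter> W" "\<And>x. x \<notin> C ==> f x = 0"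
 shows "Lam f = (LINT y|hyperplane_lborel b. indicator (V \<inter> {y. y \<bullet> b = 0}) y *\<^sub>R
   (f (y + g y *\<^sub>R b) / complex_of_real \<bar>rr (y + g y *\<^sub>R b) b\<bar>))"
proof -
 have b: "b \<in> Basis" and s: "s = 1 \<or> s = -1" and oW: "open W"
  and pos: "\<And>w. w \<in> W ==> w \<in> S ==> s * rr w b > 0"
  using ch unfolding chart_def by blast+
 have fc: "C1c f" by (rule C1cI[OF f C(1) _ C(3)]) (use C in auto)
 have CW: "C \<subseteq> W" using C by auto
 obtain \<theta> :: "'a => real" where \<theta>: "C1 UNIV (cplx \<theta>)" "\<And>x. x \<in> C ==> \<theta> x = 1" "csupp W (cplx \<theta>)"
  "\<And>x. 0 \<le> \<theta> x" "\<And>x. \<theta> x \<le> 1"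
  by (rule smooth_cutoff[OF C(1) oW CW]) blast
 have \<theta>W: "\<theta> x = 0" if "x \<notin> W" for x using \<theta>(3) that unfolding csupp_def by auto
 have \<theta>S: "C1 S (cplx \<theta>)" by (rule C1_restrict[OF \<theta>(1) fat_set_axioms UN.fat_set_axioms]) simp
 \<comment> \<open>a globally nonvanishing function that agrees with the derivative on the support of f\<close>
 define \<kappa> where "\<kappa> z = complex_of_real s * (complex_of_real (\<theta> z) * rd b z) + (1 - complex_of_real (\<theta> z))" for z
 have \<kappa>1: "C1 S \<kappa>" unfolding \<kappa>_def by (intro C1_add C1_cmult C1_mult C1_diff C1_const \<theta>S C1_pd_rho)
 have \<kappa>0: "\<kappa> z \<noteq> 0" if z: "z \<in> S" for z
 proof -
  have e: "\<kappa> z = complex_of_real (\<theta> z * (s * rr z b) + (1 - \<theta> z))" using rd_rr[OF z, of b] by (simp add: \<kappa>_def algebra_simps)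
  have "\<theta> z * (s * rr z b) + (1 - \<theta> z) > 0"
  proof (cases "z \<in> W")
   case True
   show ?thesis
   proof (cases "\<theta> z = 0")
    case False
    then have "\<theta> z * (s * rr z b) > 0" using \<theta>(4)[of z] pos[OF True z] by (intro mult_pos_pos[of "\<theta> z" "s * rr z b"]) (auto simp: less_le)
    then show ?thesis using \<theta>(5)[of z] by linarith
   qed simp
  qed (simp add: \<theta>W)
  then show ?thesis unfolding e by (metis less_irrefl of_real_eq_0_iff)
 qed
 define G where "G z = (complex_of_real s * inverse (\<kappa> z)) * f z" for z
 have G1: "C1 S G" unfolding G_def by (intro C1_mult C1_cmult C1_inverse \<kappa>1 \<kappa>0 f)
 have G0: "G x = 0" if "x \<notin> C" for x using C(3)[OF that] by (simp add: G_def)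
 have Gc: "C1c G" by (rule C1cI[OF G1 C(1) _ G0]) (use C in auto)
 have rG: "rd b z * G z = f z" if z: "z \<in> S" for z
 proof (cases "z \<in> C")
  case True
  have "\<kappa> z = complex_of_real s * rd b z" using \<theta>(2)[OF True] by (simp add: \<kappa>_def)
  then show ?thesis using \<kappa>0[OF z] s by (auto simp: G_def)
 qed (simp add: G0 C(3))
 have ss: "complex_of_real s * complex_of_real s = 1" using s by auto
 define X where "X i z = rd i z * f z - (if i = b then G z else 0)" for i z
 have Xc: "C1c (X i)" for i
 proof -
  have "C1 S (X i)"
   unfolding X_def by (cases "i = b") (auto intro!: C1_diff C1_mult C1_pd_rho f G1)
  then show ?thesis by (rule C1cI[OF _ C(1)]) (use C G0 in \<open>auto simp: X_def\<close>)
 qed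
 have "(\<Sum>i\<in>Basis. I (pd S i (X i))) = 0"
 proof (rule tangential_divergence[OF Xc])
  fix z assume "z \<in> Om"
  then have z: "z \<in> S" using Om_S by blast
  have "(\<Sum>i\<in>Basis. rd i z * X i z) = (\<Sum>i\<in>Basis. rd i z * rd i z) * f z - (\<Sum>i\<in>Basis. if i = b then rd i z * G z else 0)"
   by (simp add: X_def right_diff_distrib sum_subtractf sum_distrib_right mult.assoc if_distrib[of "%x. _ * x"] cong: if_cong)
  also have "\<dots> = 0" using sum_rd_sq[OF z] b rG[OF z] by (simp add: sum.delta)
  finally show "(\<Sum>i\<in>Basis. rd i z * X i z) = 0" .
 qed
 moreover have "I (pd S i (X i)) = I (pd S i (%z. rd i z * f z)) - (if i = b then I (pd S b G) else 0)" for i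
 proof -
  have r: "C1c (%z. rd i z * f z)" by (rule C1c_mult_left[OF fc C1_pd_rho])
  show ?thesis
  proof (cases "i = b")
   case True
   have "I (pd S i (X i)) = I (%z. pd S i (%z. rd i z * f z) z - pd S i G z)"
    using pd_diff[OF C1c_C1[OF r] G1] Om_S True by (intro I_cong) (auto simp: X_def[abs_def])
   then show ?thesis using True I_diff[OF C1c_Cc_pd[OF r] C1c_Cc_pd[OF Gc], of i b] by simp
  next
   case False
   then have "X i = (%z. rd i z * f z)" by (auto simp: X_def)
   then show ?thesis using False by simp
  qed
 qed
 ultimately have "(\<Sum>i\<in>Basis. I (pd S i (%z. rd i z * f z))) = I (pd S b G)"
  using b by (simp add: sum_subtractf sum.delta)
 then have "Lam f = - I (pd S b G)" by (simp add: Lam_def)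
 also have "\<dots> = complex_of_real s * (LINT y|hyperplane_lborel b. indicator (V \<inter> {y. y \<bullet> b = 0}) y *\<^sub>R G (y + g y *\<^sub>R b))"
  by (simp add: chart_ftc[OF ch G1 C(1,2) G0])
 also have "\<dots> = (LINT y|hyperplane_lborel b. complex_of_real s * (indicator (V \<inter> {y. y \<bullet> b = 0}) y *\<^sub>R G (y + g y *\<^sub>R b)))"
  by (rule integral_mult_right_zero[symmetric])
 also have "\<dots> = (LINT y|hyperplane_lborel b. indicator (V \<inter> {y. y \<bullet> b = 0}) y *\<^sub>R
   (f (y + g y *\<^sub>R b) / complex_of_real \<bar>rr (y + g y *\<^sub>R b) b\<bar>))"
 proof (intro Bochner_Integration.integral_cong refl)
  fix y
  let ?P = "y + g y *\<^sub>R b"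
  show "complex_of_real s * (indicator (V \<inter> {y. y \<bullet> b = 0}) y *\<^sub>R G ?P) = indicator (V \<inter> {y. y \<bullet> b = 0}) y *\<^sub>R (f ?P / complex_of_real \<bar>rr ?P b\<bar>)"
  proof (cases "?P \<in> C")
   case True
   then have P: "?P \<in> S" "?P \<in> W" using C by auto
   have a: "complex_of_real \<bar>rr ?P b\<bar> = complex_of_real s * rd b ?P"
    using pos[OF P(2,1)] s rd_rr[OF P(1), of b] by auto
   have nz: "rd b ?P \<noteq> 0" using pos[OF P(2,1)] rd_rr[OF P(1), of b] by auto
   have "complex_of_real s * G ?P = f ?P / complex_of_real \<bar>rr ?P b\<bar>"
    unfolding a using rG[OF P(1)] nz ss s by (auto simp: field_simps)
   then show ?thesis by simp
  next
   case False then show ?thesis using G0 C(3) by simp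
  qed
 qed
 finally show ?thesis .
qed

definition hyp0 :: "'a set => 'a => 'a set" where "hyp0 V b = V \<inter> {y. y \<bullet> b = 0}"

text \<open>The measure that a graph chart puts on \<open>M\<close>, with the area density already written as \<open>1 / \<bar>\<rho>_b\<bar>\<close>. Outside
 the domain of the chart all points are sent to 0 with density 0, to keep the map Borel.\<close>

definition chart_measure :: "'a => 'a set => ('a => real) => 'a measure" where
 "chart_measure b V g = distr
   (density (hyperplane_lborel b) (%y. ennreal (indicator (hyp0 V b) y * (1 / \<bar>rr (y + g y *\<^sub>R b) b\<bar>))))
   borel (%y. indicator (hyp0 V b) y *\<^sub>R (y + g y *\<^sub>R b))"

context
 fixes b W V g
 assumes gc: "graph_chart M b W V g"
begin

lemma gc_basic: "b \<in> Basis" "open W" "open V" "Ck_on 1 V g" "M \<inter> W = {y + g y *\<^sub>R b | y. y \<in> V \<and> y \<bullet> b = 0}"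
 using gc unfolding graph_chart_def by auto

lemma gc_point: "y \<in> hyp0 V b ==> y + g y *\<^sub>R b \<in> M \<inter> W"
 using gc_basic(5) unfolding hyp0_def by blast

lemma hyp0_borel: "hyp0 V b \<in> sets borel"
proof -
 have "closed {y. y \<bullet> b = 0}" by (intro closed_Collect_eq continuous_intros)
 then show ?thesis using gc_basic(3) by (auto simp: hyp0_def)
qed

lemma gc_P_cont: "continuous_on (hyp0 V b) (%y. y + g y *\<^sub>R b)"
proof -
 have gc: "continuous_on V g" using Ck_on_Suc_imp[of 0 V g] gc_basic(4) by simp
 show ?thesis by (intro continuous_intros continuous_on_subset[OF gc]) (auto simp: hyp0_def)
qed

lemma gc_P_meas [measurable]: "(%y. indicator (hyp0 V b) y *\<^sub>R (y + g y *\<^sub>R b)) \<in> borel_measurable borel"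
 by (rule borel_measurable_continuous_on_indicator[OF hyp0_borel gc_P_cont])

lemma gc_rr: "y \<in> hyp0 V b ==> rr (y + g y *\<^sub>R b) b \<noteq> 0"
 using graph_chart_density(1)[OF gc] unfolding hyp0_def by auto

lemma gc_dens_meas [measurable]: "(%y. indicator (hyp0 V b) y * (1 / \<bar>rr (y + g y *\<^sub>R b) b\<bar>)) \<in> borel_measurable borel"
proof -
 have "continuous_on (hyp0 V b) (%y. rr (y + g y *\<^sub>R b) b)"
  by (rule continuous_on_compose2[OF rr_cont gc_P_cont]) (use gc_point M_sub in blast)
 then have "continuous_on (hyp0 V b) (%y. 1 / \<bar>rr (y + g y *\<^sub>R b) b\<bar>)"
  by (intro continuous_intros) (use gc_rr in auto)
 from borel_measurable_continuous_on_indicator[OF hyp0_borel this] show ?thesis by simp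
qed

lemmas gc_dens_meas' = gc_dens_meas[simplified]

lemma sets_chart_measure: "sets (chart_measure b V g) = sets borel"
 by (simp add: chart_measure_def)

lemma nn_integral_chart_measure:
 assumes [measurable]: "F \<in> borel_measurable borel"
 shows "(\<integral>\<^sup>+z. F z \<partial>chart_measure b V g) =
  (\<integral>\<^sup>+y. ennreal (indicator (hyp0 V b) y * (1 / \<bar>rr (y + g y *\<^sub>R b) b\<bar>)) * F (y + g y *\<^sub>R b) \<partial>hyperplane_lborel b)"
proof -
 have "(\<integral>\<^sup>+z. F z \<partial>chart_measure b V g) = (\<integral>\<^sup>+y. ennreal (indicator (hyp0 V b) y * (1 / \<bar>rr (y + g y *\<^sub>R b) b\<bar>)) *
   F (indicator (hyp0 V b) y *\<^sub>R (y + g y *\<^sub>R b)) \<partial>hyperplane_lborel b)"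
  unfolding chart_measure_def
  by (subst nn_integral_distr, simp_all, subst nn_integral_density) (auto intro: gc_dens_meas')
 also have "\<dots> = (\<integral>\<^sup>+y. ennreal (indicator (hyp0 V b) y * (1 / \<bar>rr (y + g y *\<^sub>R b) b\<bar>)) * F (y + g y *\<^sub>R b) \<partial>hyperplane_lborel b)"
  by (intro nn_integral_cong) (auto simp: indicator_def)
 finally show ?thesis .
qed

lemma emeasure_chart_measure:
 assumes A: "A \<in> sets borel"
 shows "emeasure (chart_measure b V g) A = (\<integral>\<^sup>+y. indicator V y * indicator A (y + g y *\<^sub>R b) *
   ennreal (sqrt (1 + (\<Sum>i\<in>Basis - {b}. (frechet_derivative g (at y) i)\<^sup>2))) \<partial>hyperplane_lborel b)"
proof -
 have "emeasure (chart_measure b V g) A = (\<integral>\<^sup>+z. indicator A z \<partial>chart_measure b V g)"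
  using A by (simp add: sets_chart_measure)
 also have "\<dots> = (\<integral>\<^sup>+y. ennreal (indicator (hyp0 V b) y * (1 / \<bar>rr (y + g y *\<^sub>R b) b\<bar>)) * indicator A (y + g y *\<^sub>R b) \<partial>hyperplane_lborel b)"
  by (rule nn_integral_chart_measure) (use A in auto)
 also have "\<dots> = (\<integral>\<^sup>+y. indicator V y * indicator A (y + g y *\<^sub>R b) *
   ennreal (sqrt (1 + (\<Sum>i\<in>Basis - {b}. (frechet_derivative g (at y) i)\<^sup>2))) \<partial>hyperplane_lborel b)"
 proof (rule nn_integral_cong_AE, use AE_hyperplane[OF gc_basic(1)] in eventually_elim)
  fix y assume y: "y \<bullet> b = 0"
  show "ennreal (indicator (hyp0 V b) y * (1 / \<bar>rr (y + g y *\<^sub>R b) b\<bar>)) * indicator A (y + g y *\<^sub>R b) =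
   indicator V y * indicator A (y + g y *\<^sub>R b) * ennreal (sqrt (1 + (\<Sum>i\<in>Basis - {b}. (frechet_derivative g (at y) i)\<^sup>2)))"
  proof (cases "y \<in> V")
   case True
   then show ?thesis using y graph_chart_density(2)[OF gc True y] by (simp add: hyp0_def mult.commute)
  qed (simp add: hyp0_def)
 qed
 finally show ?thesis .
qed

lemma integral_chart_measure:
 fixes f :: "'a => complex"
 assumes f[measurable]: "f \<in> borel_measurable borel"
 shows "(\<integral>z. f z \<partial>chart_measure b V g) = (LINT y|hyperplane_lborel b. indicator (hyp0 V b) y *\<^sub>R
   (f (y + g y *\<^sub>R b) / complex_of_real \<bar>rr (y + g y *\<^sub>R b) b\<bar>))"
proof -
 have "(\<integral>z. f z \<partial>chart_measure b V g) = (LINT y|hyperplane_lborel b.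
   (indicator (hyp0 V b) y * (1 / \<bar>rr (y + g y *\<^sub>R b) b\<bar>)) *\<^sub>R f (indicator (hyp0 V b) y *\<^sub>R (y + g y *\<^sub>R b)))"
  unfolding chart_measure_def
  by (subst integral_distr, simp_all, subst integral_density) (auto intro: gc_dens_meas')
 also have "\<dots> = (LINT y|hyperplane_lborel b. indicator (hyp0 V b) y *\<^sub>R
   (f (y + g y *\<^sub>R b) / complex_of_real \<bar>rr (y + g y *\<^sub>R b) b\<bar>))"
  by (intro Bochner_Integration.integral_cong refl) (auto simp: indicator_def scaleR_conv_of_real)
 finally show ?thesis .
qed

lemma chart_measure_outside: "emeasure (chart_measure b V g) (- (M \<inter> W)) = 0"
proof -
 have m: "- (M \<inter> W) \<in> sets borel" using gc_basic(2) by auto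
 have "emeasure (chart_measure b V g) (- (M \<inter> W)) = (\<integral>\<^sup>+z. indicator (- (M \<inter> W)) z \<partial>chart_measure b V g)"
  using m by (simp add: sets_chart_measure)
 also have "\<dots> = (\<integral>\<^sup>+y. ennreal (indicator (hyp0 V b) y * (1 / \<bar>rr (y + g y *\<^sub>R b) b\<bar>)) * indicator (- (M \<inter> W)) (y + g y *\<^sub>R b) \<partial>hyperplane_lborel b)"
  by (rule nn_integral_chart_measure) (use m in auto)
 also have "\<dots> = (\<integral>\<^sup>+y. 0 \<partial>hyperplane_lborel b)"
  by (intro nn_integral_cong) (use gc_point in \<open>auto simp: indicator_def\<close>)
 finally show ?thesis by simp
qed

lemma chart_measure_compact:
 assumes K: "compact K" "K \<subseteq> W"
 shows "emeasure (chart_measure b V g) K < \<infinity>"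
proof -
 have Kc: "closed K" using K compact_imp_closed by blast
 have KM: "compact (K \<inter> M)" using K(1) by (rule compact_Int_closed) (simp add: frontier_closed)
 have nz: "rr w b \<noteq> 0" if "w \<in> K \<inter> M" for w
 proof -
  have "w \<in> M \<inter> W" using that K by auto
  then obtain y where "w = y + g y *\<^sub>R b" "y \<in> V" "y \<bullet> b = 0" using gc_basic(5) by blast
  then show ?thesis using graph_chart_density(1)[OF gc] by blast
 qed
 have "compact ((%w. 1 / \<bar>rr w b\<bar>) ` (K \<inter> M))"
  by (intro compact_continuous_image KM continuous_intros continuous_on_subset[OF rr_cont]) (use M_sub nz in auto)
 then obtain B where B0: "B > 0" "\<And>y. y \<in> (%w. 1 / \<bar>rr w b\<bar>) ` (K \<inter> M) ==> norm y \<le> B"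
  using bounded_pos compact_imp_bounded by metis
 have B: "1 / \<bar>rr w b\<bar> \<le> B" if "w \<in> K \<inter> M" for w
  using B0(2)[OF imageI[OF that]] by simp
 let ?H = "prj b ` K"
 have H: "compact ?H" by (intro compact_continuous_image prj_cont K)
 have Hb: "?H \<in> sets borel" by (rule borel_closed[OF compact_imp_closed[OF H]])
 have "emeasure (chart_measure b V g) K = (\<integral>\<^sup>+z. indicator K z \<partial>chart_measure b V g)"
  using Kc by (simp add: sets_chart_measure)
 also have "\<dots> = (\<integral>\<^sup>+y. ennreal (indicator (hyp0 V b) y * (1 / \<bar>rr (y + g y *\<^sub>R b) b\<bar>)) * indicator K (y + g y *\<^sub>R b) \<partial>hyperplane_lborel b)"
  by (rule nn_integral_chart_measure) (use Kc in auto)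
 also have "\<dots> \<le> (\<integral>\<^sup>+y. ennreal B * indicator ?H y \<partial>hyperplane_lborel b)"
 proof (intro nn_integral_mono)
  fix y
  show "ennreal (indicator (hyp0 V b) y * (1 / \<bar>rr (y + g y *\<^sub>R b) b\<bar>)) * indicator K (y + g y *\<^sub>R b) \<le> ennreal B * indicator ?H y"
  proof (cases "y \<in> hyp0 V b \<and> y + g y *\<^sub>R b \<in> K")
   case True
   then have "y = prj b (y + g y *\<^sub>R b)" using gc_basic(1) by (simp add: prj_id hyp0_def)
   then have "y \<in> ?H" using True by blast
   moreover have "1 / \<bar>rr (y + g y *\<^sub>R b) b\<bar> \<le> B" using True gc_point[of y] by (intro B) auto
   ultimately show ?thesis using True by (simp add: ennreal_leI)
  qed auto
 qed
 also have "\<dots> = ennreal B * emeasure (hyperplane_lborel b) ?H" using Hb by (simp add: nn_integral_cmult)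
 also have "\<dots> < \<infinity>" using emeasure_hyperplane_bounded[OF gc_basic(1) Hb compact_imp_bounded[OF H]]
  by (simp add: ennreal_mult_less_top)
 finally show ?thesis .
qed

lemma chart_measure_integrable:
 assumes f: "C1 S f" and C: "compact C" "C \<subseteq> S \<inter> W" "\<And>x. x \<notin> C ==> f x = 0"
 shows "integrable (chart_measure b V g) f"
proof -
 have fc: "C1c f" by (rule C1cI[OF f C(1) _ C(3)]) (use C in auto)
 obtain B where B: "B \<ge> 0" "\<And>x. norm (f x) \<le> B" using C1c_bound[OF fc] by blast
 have [measurable]: "C \<in> sets (chart_measure b V g)" using C(1) by (auto simp: sets_chart_measure intro: borel_closed compact_imp_closed)
 have fin: "emeasure (chart_measure b V g) C < \<infinity>" by (rule chart_measure_compact) (use C in auto)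
 show ?thesis
 proof (rule Bochner_Integration.integrable_bound[where f="%x. B * indicator C x :: real"])
  show "integrable (chart_measure b V g) (%x. B * indicator C x :: real)"
   using fin by (intro integrable_mult_right integrable_real_indicator) auto
  show "f \<in> borel_measurable (chart_measure b V g)"
   using C1c_borel[OF fc] measurable_cong_sets[OF sets_chart_measure refl] by blast
  show "AE x in chart_measure b V g. norm (f x) \<le> norm (B * indicator C x :: real)"
   using B C(3) by (intro AE_I2) (auto simp: indicator_def)
 qed
qed

text \<open>The graph charts admitted by the definition of surface measure are arbitrary; near each point they are
 compared with a chart in the sense of \<open>chart\<close> with the same direction \<open>b\<close>, in which the graph function is
 necessarily the same.\<close>

lemma chart_measure_Lam:
 assumes f: "C1 S f" and C: "compact C" "C \<subseteq> S \<inter> W" "\<And>x. x \<notin> C ==> f x = 0"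
 shows "(\<integral>z. f z \<partial>chart_measure b V g) = Lam f"
proof -
 let ?K = "chart_measure b V g"
 define P where "P h \<longleftrightarrow> integrable ?K h \<and> (\<integral>z. h z \<partial>?K) = Lam h" for h
 have "P f"
 proof (rule localisation[OF f C(1)])
  show "P (%_. 0)" by (simp add: P_def Lam_0)
  show "P (%x. h x + k x)" if "C1c h" "C1c k" "P h" "P k" for h k
   using that by (simp add: P_def Lam_add)
  fix z assume z: "z \<in> C"
  then have "z \<in> Om \<or> z \<in> M" "z \<in> W" using C(2) S_eq by auto
  then consider "z \<in> Om" "z \<in> W" | "z \<in> M" "z \<in> W" by blast
  then show "\<exists>G. open G \<and> z \<in> G \<and> (\<forall>h. C1 S h --> csupp (S \<inter> G) h --> P h)"
  proof cases
   case 1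
   show ?thesis
   proof (intro exI[of _ "Om \<inter> W"] conjI allI impI)
    show "open (Om \<inter> W)" using open_Om gc_basic(2) by auto
    fix h assume h: "C1 S h" "csupp (S \<inter> (Om \<inter> W)) h"
    obtain C' where C': "compact C'" "C' \<subseteq> S \<inter> (Om \<inter> W)" "\<And>x. x \<notin> C' ==> h x = 0"
     using h(2) unfolding csupp_def by blast
    have hc: "C1c h" by (rule C1cI[OF h(1) C'(1) _ C'(3)]) (use C' in auto)
    have i: "integrable ?K h" by (rule chart_measure_integrable[OF h(1) C'(1) _ C'(3)]) (use C' in auto)
    have "(\<integral>z. h z \<partial>?K) = (LINT y|hyperplane_lborel b. 0)"
     unfolding integral_chart_measure[OF C1c_borel[OF hc]]
    proof (intro Bochner_Integration.integral_cong refl)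
     fix y
     have "h (y + g y *\<^sub>R b) = 0" if "y \<in> hyp0 V b"
      using gc_point[OF that] C'(2,3) Om_M by blast
     then show "indicator (hyp0 V b) y *\<^sub>R (h (y + g y *\<^sub>R b) / complex_of_real \<bar>rr (y + g y *\<^sub>R b) b\<bar>) = 0"
      by (simp add: indicator_def)
    qed
    moreover have "Lam h = 0" by (rule Lam_Om[OF hc C'(1) _ C'(3)]) (use C' in auto)
    ultimately show "P h" using i by (simp add: P_def)
   qed (use 1 in auto)
  next
   case 2
   then obtain y0 where "z = y0 + g y0 *\<^sub>R b" "y0 \<in> V" "y0 \<bullet> b = 0" using gc_basic(5) by blast
   then have "rr z b \<noteq> 0" using graph_chart_density(1)[OF gc] by blast
   from chart_exists[OF 2(1) gc_basic(1) this]
   obtain s V' W' g' where ch: "chart b s V' W' g'" "z \<in> W'" by blast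
   have gc': "graph_chart M b W' V' g'" by (rule chart_graph_chart[OF ch(1)])
   then have MW': "M \<inter> W' = {y + g' y *\<^sub>R b | y. y \<in> V' \<and> y \<bullet> b = 0}" "open W'" unfolding graph_chart_def by auto
   show ?thesis
   proof (intro exI[of _ "W \<inter> W'"] conjI allI impI)
    show "open (W \<inter> W')" using gc_basic(2) MW'(2) by auto
    fix h assume h: "C1 S h" "csupp (S \<inter> (W \<inter> W')) h"
    obtain C' where C': "compact C'" "C' \<subseteq> S \<inter> (W \<inter> W')" "\<And>x. x \<notin> C' ==> h x = 0"
     using h(2) unfolding csupp_def by blast
    have hc: "C1c h" by (rule C1cI[OF h(1) C'(1) _ C'(3)]) (use C' in auto)
    have i: "integrable ?K h" by (rule chart_measure_integrable[OF h(1) C'(1) _ C'(3)]) (use C' in auto)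
    have bB: "b \<in> Basis" by (rule gc_basic)
    have same: "y \<in> V' \<and> y \<bullet> b = 0 \<and> g' y = g y" if y: "y \<in> V" "y \<bullet> b = 0" and hy: "y + g y *\<^sub>R b \<in> C'" for y
    proof -
     have "y + g y *\<^sub>R b \<in> M \<inter> W'" using gc_point[of y] y C'(2) hy by (auto simp: hyp0_def)
     then obtain y' where y': "y + g y *\<^sub>R b = y' + g' y' *\<^sub>R b" "y' \<in> V'" "y' \<bullet> b = 0" using MW' by blast
     have "prj b (y + g y *\<^sub>R b) = prj b (y' + g' y' *\<^sub>R b)" using y'(1) by simp
     then have "y = y'" using bB y(2) y'(3) by (simp add: prj_id)
     then show ?thesis using y' bB by (auto simp: nonzero_Basis)
    qed
    have same': "y \<in> V \<and> y \<bullet> b = 0 \<and> g' y = g y" if y: "y \<in> V'" "y \<bullet> b = 0" and hy: "y + g' y *\<^sub>R b \<in> C'" for y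
    proof -
     have "y + g' y *\<^sub>R b \<in> M \<inter> W" using MW' y C'(2) hy by blast
     then obtain y' where y': "y + g' y *\<^sub>R b = y' + g y' *\<^sub>R b" "y' \<in> V" "y' \<bullet> b = 0" using gc_basic(5) by blast
     have "prj b (y + g' y *\<^sub>R b) = prj b (y' + g y' *\<^sub>R b)" using y'(1) by simp
     then have "y = y'" using bB y(2) y'(3) by (simp add: prj_id)
     then show ?thesis using y' bB by (auto simp: nonzero_Basis)
    qed
    have "(\<integral>z. h z \<partial>?K) = Lam h"
     unfolding integral_chart_measure[OF C1c_borel[OF hc]]
    proof (subst chart_Lam[OF ch(1) h(1) C'(1) _ C'(3)])
     show "(LINT y|hyperplane_lborel b. indicator (hyp0 V b) y *\<^sub>R (h (y + g y *\<^sub>R b) / complex_of_real \<bar>rr (y + g y *\<^sub>R b) b\<bar>)) =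
      (LINT y|hyperplane_lborel b. indicator (V' \<inter> {y. y \<bullet> b = 0}) y *\<^sub>R (h (y + g' y *\<^sub>R b) / complex_of_real \<bar>rr (y + g' y *\<^sub>R b) b\<bar>))"
     proof (intro Bochner_Integration.integral_cong refl)
      fix y
      consider "y \<in> hyp0 V b" "y + g y *\<^sub>R b \<in> C'" | "y \<in> V' \<inter> {y. y \<bullet> b = 0}" "y + g' y *\<^sub>R b \<in> C'"
       | "y \<in> hyp0 V b --> h (y + g y *\<^sub>R b) = 0" "y \<in> V' \<inter> {y. y \<bullet> b = 0} --> h (y + g' y *\<^sub>R b) = 0"
       using C'(3) by blast
      then show "indicator (hyp0 V b) y *\<^sub>R (h (y + g y *\<^sub>R b) / complex_of_real \<bar>rr (y + g y *\<^sub>R b) b\<bar>) =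
       indicator (V' \<inter> {y. y \<bullet> b = 0}) y *\<^sub>R (h (y + g' y *\<^sub>R b) / complex_of_real \<bar>rr (y + g' y *\<^sub>R b) b\<bar>)"
      proof cases
       case 1 then show ?thesis using same[of y] by (simp add: hyp0_def)
      next
       case 2 then show ?thesis using same'[of y] by (simp add: hyp0_def)
      next
       case 3 then show ?thesis by (auto simp: indicator_def)
      qed
     qed
    qed (use C' in auto)
    then show "P h" using i by (simp add: P_def)
   qed (use 2 ch in auto)
  qed
 qed (use C in auto)
 then show ?thesis by (simp add: P_def)
qed

end

end

context exterior_domain begin

text \<open>Both measures integrate a bump function to the same chart-independent value \<open>Lam\<close>.\<close>

lemma chart_measures_agree:
 assumes gc: "graph_chart M b W V g" and gc': "graph_chart M b' W' V' g'"
  and A: "A \<in> sets borel" "A \<subseteq> M \<inter> W \<inter> W'"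
 shows "emeasure (chart_measure b V g) A = emeasure (chart_measure b' V' g') A"
proof (rule measures_eq_on_open[where G="W \<inter> W' \<inter> U"])
 show "sets (chart_measure b V g) = sets borel" "sets (chart_measure b' V' g') = sets borel"
  by (rule sets_chart_measure[OF gc], rule sets_chart_measure[OF gc'])
 show "open (W \<inter> W' \<inter> U)" using gc_basic(2)[OF gc] gc_basic(2)[OF gc'] U(1) by auto
 show "A \<in> sets borel" "A \<subseteq> W \<inter> W' \<inter> U" using A M_sub by auto
 fix a c :: 'a and k assume box: "cbox a c \<subseteq> W \<inter> W' \<inter> U"
 have fin: "emeasure (chart_measure b1 V1 g1) (cbox a c) < \<infinity>"
  if "graph_chart M b1 W1 V1 g1" "cbox a c \<subseteq> W1" for b1 W1 V1 g1
  by (rule chart_measure_compact[OF that(1) compact_cbox that(2)])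
 have "emeasure (chart_measure b V g) (box a c) \<le> emeasure (chart_measure b V g) (cbox a c)"
  by (rule emeasure_mono) (auto simp: sets_chart_measure[OF gc] box_subset_cbox)
 also have "\<dots> < \<infinity>" by (rule fin[OF gc]) (use box in auto)
 finally show "emeasure (chart_measure b V g) (box a c) < \<infinity>" .
 define f where "f z = (if z \<in> S then complex_of_real (bump k a c z) else 0)" for z
 have f1: "C1 S f"
 proof -
  have "C1 S (cplx (bump k a c))" by (rule C1_restrict[OF C1_bump fat_set_axioms UN.fat_set_axioms]) simp
  moreover have "C1 S (cplx (bump k a c)) \<longleftrightarrow> C1 S f" by (rule C1_cong) (simp add: f_def)
  ultimately show ?thesis by simp
 qed
 have C: "compact (cbox a c - D)" using D(1) by (intro compact_diff) auto
 have f0: "f x = 0" if "x \<notin> cbox a c - D" for x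
  using that bump_zero[of x a c k] box_subset_cbox[of a c] by (auto simp: f_def)
 have val: "(\<integral>\<^sup>+z. ennreal (bump k a c z) \<partial>chart_measure b1 V1 g1) = ennreal (Re (Lam f))"
  if gc1: "graph_chart M b1 W1 V1 g1" and bx: "cbox a c \<subseteq> W1" for b1 W1 V1 g1
 proof -
  let ?K = "chart_measure b1 V1 g1"
  have CW: "cbox a c - D \<subseteq> S \<inter> W1" using bx box by auto
  have i: "integrable ?K f" by (rule chart_measure_integrable[OF gc1 f1 C CW f0])
  have L: "(\<integral>z. f z \<partial>?K) = Lam f" by (rule chart_measure_Lam[OF gc1 f1 C CW f0])
  have ae: "AE z in ?K. complex_of_real (bump k a c z) = f z"
  proof (rule AE_I[where N="- (M \<inter> W1)"])
   show "emeasure ?K (- (M \<inter> W1)) = 0" by (rule chart_measure_outside[OF gc1])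
   show "- (M \<inter> W1) \<in> sets ?K" using gc_basic(2)[OF gc1] by (auto simp: sets_chart_measure[OF gc1])
   show "{z \<in> space ?K. complex_of_real (bump k a c z) \<noteq> f z} \<subseteq> - (M \<inter> W1)"
    using M_sub by (auto simp: f_def split: if_splits)
  qed
  have "cplx (bump k a c) \<in> borel_measurable borel" by measurable
  then have mb: "cplx (bump k a c) \<in> borel_measurable ?K"
   unfolding measurable_cong_sets[OF sets_chart_measure[OF gc1] refl] .
  have ib: "integrable ?K (cplx (bump k a c))"
   by (rule integrable_cong_AE_imp[OF i mb]) (use ae in \<open>auto elim: eventually_mono\<close>)
  have ib': "integrable ?K (bump k a c)" using integrable_Re[OF ib] by simp
  have "complex_of_real (\<integral>z. bump k a c z \<partial>?K) = (\<integral>z. f z \<partial>?K)"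
   unfolding integral_complex_of_real[symmetric]
   by (rule integral_cong_AE[OF mb _ ae]) (use i in auto)
  then have "Re (Lam f) = (\<integral>z. bump k a c z \<partial>?K)" using L by (metis Re_complex_of_real)
  moreover have "(\<integral>\<^sup>+z. ennreal (bump k a c z) \<partial>?K) = ennreal (\<integral>z. bump k a c z \<partial>?K)"
   by (rule nn_integral_eq_integral[OF ib']) (simp add: bump_nonneg)
  ultimately show ?thesis by simp
 qed
 show "(\<integral>\<^sup>+z. ennreal (bump k a c z) \<partial>chart_measure b V g) = (\<integral>\<^sup>+z. ennreal (bump k a c z) \<partial>chart_measure b' V' g')"
  using val[OF gc] val[OF gc'] box by simp
qed

text \<open>Finitely many boxes, each inside a chart, cover the compact set \<open>M\<close>; making them disjoint cuts \<open>M\<close>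
 into Borel pieces on which a single chart decides.\<close>

lemma boundary_decomposition:
 obtains n :: nat and Mi W V :: "nat => 'a set" and b :: "nat => 'a" and g :: "nat => 'a => real" where
  "\<And>i. i < n ==> graph_chart M (b i) (W i) (V i) (g i)"
  "\<And>i. Mi i \<in> sets borel" "\<And>i. i < n ==> Mi i \<subseteq> M \<inter> W i"
  "\<And>i. i < n ==> emeasure (chart_measure (b i) (V i) (g i)) (Mi i) < \<infinity>"
  "disjoint_family_on Mi {..<n}" "(\<Union>i<n. Mi i) = M"
proof -
 define Q where "Q W \<longleftrightarrow> (\<exists>b V g. graph_chart M b W V g)" for W
 have loc: "\<exists>G. open G \<and> z \<in> G \<and> Q G" if z: "z \<in> M" for z
 proof -
  have "z \<in> S" using z M_sub by auto
  then obtain b where b: "b \<in> Basis" "rr z b \<noteq> 0" by (rule rr_nonzero)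
  obtain s V W g where ch: "chart b s V W g" "z \<in> W" using chart_exists[OF z b] by blast
  have gc: "graph_chart M b W V g" by (rule chart_graph_chart[OF ch(1)])
  then show ?thesis using ch(2) gc_basic(2)[OF gc] unfolding Q_def by blast
 qed
 obtain I :: "('a \<times> 'a) set" and m :: real where I: "finite I"
  "\<And>p. p \<in> I ==> \<exists>G. cbox (fst p) (snd p) \<subseteq> G \<and> Q G"
  "m > 0" "\<And>z. z \<in> M ==> m \<le> (\<Sum>p\<in>I. bump 0 (fst p) (snd p) z)"
  by (rule bump_cover[OF compact_M loc]) blast+
 obtain e where e': "bij_betw e {0..<card I} I" using ex_bij_betw_nat_finite[OF I(1)] by auto
 define n where "n = card I"
 have e: "bij_betw e {0..<n} I" using e' by (simp add: n_def)
 have eI: "e i \<in> I" if "i < n" for i using e that by (auto simp: bij_betw_def)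
 have "\<forall>i. \<exists>t. i < n --> (case t of (b, W, V, g) => cbox (fst (e i)) (snd (e i)) \<subseteq> W \<and> graph_chart M b W V g)"
 proof
  fix i
  show "\<exists>t. i < n --> (case t of (b, W, V, g) => cbox (fst (e i)) (snd (e i)) \<subseteq> W \<and> graph_chart M b W V g)"
  proof (cases "i < n")
   case True
   obtain W b V g where "cbox (fst (e i)) (snd (e i)) \<subseteq> W" "graph_chart M b W V g"
    using I(2)[OF eI[OF True]] unfolding Q_def by blast
   then show ?thesis by (intro exI[of _ "(b, W, V, g)"]) simp
  qed simp
 qed
 from choice[OF this] obtain t where
  t: "\<And>i. i < n ==> (case t i of (b, W, V, g) => cbox (fst (e i)) (snd (e i)) \<subseteq> W \<and> graph_chart M b W V g)"
  by blast
 define b W V g where "b i = fst (t i)" and "W i = fst (snd (t i))" and "V i = fst (snd (snd (t i)))" and "g i = snd (snd (snd (t i)))" for i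
 have bW: "cbox (fst (e i)) (snd (e i)) \<subseteq> W i" and gc: "graph_chart M (b i) (W i) (V i) (g i)" if "i < n" for i
  using t[OF that] by (auto simp: b_def W_def V_def g_def case_prod_beta)
 define B where "B i = box (fst (e i)) (snd (e i))" for i
 define Mi where "Mi i = M \<inter> disjointed B i" for i
 have dB: "disjointed B i \<in> sets borel" for i by (auto simp: disjointed_def B_def)
 show ?thesis
 proof (rule that[of n b W V g Mi])
  show "Mi i \<in> sets borel" for i using dB borel_sets(2) by (auto simp: Mi_def)
  have sub: "Mi i \<subseteq> cbox (fst (e i)) (snd (e i))" for i
   using disjointed_subset[of B i] box_subset_cbox unfolding Mi_def B_def by blast
  show "Mi i \<subseteq> M \<inter> W i" if "i < n" for i using sub[of i] bW[OF that] by (auto simp: Mi_def)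
  show "emeasure (chart_measure (b i) (V i) (g i)) (Mi i) < \<infinity>" if "i < n" for i
  proof -
   have "emeasure (chart_measure (b i) (V i) (g i)) (Mi i) \<le> emeasure (chart_measure (b i) (V i) (g i)) (cbox (fst (e i)) (snd (e i)))"
    by (rule emeasure_mono[OF sub]) (simp add: sets_chart_measure[OF gc[OF that]])
   also have "\<dots> < \<infinity>" by (rule chart_measure_compact[OF gc[OF that] compact_cbox bW[OF that]])
   finally show ?thesis .
  qed
  show "disjoint_family_on Mi {..<n}"
   using disjoint_family_disjointed[of B] by (auto simp: Mi_def disjoint_family_on_def)
  have "M \<subseteq> (\<Union>i<n. B i)"
  proof
   fix z assume z: "z \<in> M"
   have "\<exists>p\<in>I. z \<in> box (fst p) (snd p)"
   proof (rule ccontr)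
    assume "\<not> ?thesis"
    then have "(\<Sum>p\<in>I. bump 0 (fst p) (snd p) z) = 0" by (intro sum.neutral ballI bump_zero) blast
    then show False using I(3) I(4)[OF z] by simp
   qed
   then obtain p where p: "p \<in> I" "z \<in> box (fst p) (snd p)" by blast
   then obtain i where "i < n" "e i = p" using e unfolding bij_betw_def by (metis atLeastLessThan_iff imageE)
   then show "z \<in> (\<Union>i<n. B i)" using p(2) by (auto simp: B_def)
  qed
  moreover have "(\<Union>i<n. disjointed B i) = (\<Union>i<n. B i)"
   using finite_UN_disjointed_eq[of B n] by (simp add: atLeast0LessThan)
  ultimately show "(\<Union>i<n. Mi i) = M" unfolding Mi_def by auto
 qed (use gc in auto)
qed

lemma surface_measure_unique:
 assumes "is_surface_measure M \<sigma>" "is_surface_measure M \<sigma>'"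
 shows "\<sigma> = \<sigma>'"
proof -
 obtain n Mi W V b g where gc: "\<And>i. i < (n::nat) ==> graph_chart M (b i) (W i) (V i) (g i)"
  and Mi: "\<And>i. Mi i \<in> sets borel" "\<And>i. i < n ==> Mi i \<subseteq> M \<inter> W i"
  "disjoint_family_on Mi {..<n}" "(\<Union>i<n. Mi i) = M"
  by (rule boundary_decomposition) blast
 have ex: "emeasure \<tau> A = (\<Sum>i<n. emeasure (chart_measure (b i) (V i) (g i)) (A \<inter> Mi i))"
  if \<tau>: "is_surface_measure M \<tau>" and A: "A \<in> sets borel" for \<tau> A
 proof -
  have st: "sets \<tau> = sets borel" "emeasure \<tau> (- M) = 0" using \<tau> unfolding is_surface_measure_def by auto
  have ne: "- M \<in> null_sets \<tau>" using st borel_sets(2) by (auto simp: null_sets_def)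
  have "emeasure \<tau> A = emeasure \<tau> (A - (- M))"
   by (rule emeasure_Diff_null_set[OF ne, symmetric]) (simp add: A st)
  also have "A - (- M) = (\<Union>i<n. A \<inter> Mi i)" using Mi(4) by auto
  also have "emeasure \<tau> (\<Union>i<n. A \<inter> Mi i) = (\<Sum>i<n. emeasure \<tau> (A \<inter> Mi i))"
  proof (rule sum_emeasure[symmetric])
   show "disjoint_family_on (%i. A \<inter> Mi i) {..<n}" using Mi(3) unfolding disjoint_family_on_def by blast
  qed (use Mi(1) A st in auto)
  also have "\<dots> = (\<Sum>i<n. emeasure (chart_measure (b i) (V i) (g i)) (A \<inter> Mi i))"
  proof (intro sum.cong refl)
   fix i assume "i \<in> {..<n}"
   then have i: "i < n" by simp
   have "A \<inter> Mi i \<subseteq> M \<inter> W i" "A \<inter> Mi i \<in> sets borel" using Mi(2)[OF i] Mi(1) A by auto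
   then show "emeasure \<tau> (A \<inter> Mi i) = emeasure (chart_measure (b i) (V i) (g i)) (A \<inter> Mi i)"
    using \<tau> gc[OF i] unfolding is_surface_measure_def emeasure_chart_measure[OF gc[OF i] \<open>A \<inter> Mi i \<in> sets borel\<close>] by blast
  qed
  finally show ?thesis .
 qed
 show ?thesis
 proof (rule measure_eqI)
  show "sets \<sigma> = sets \<sigma>'" using assms unfolding is_surface_measure_def by auto
  fix A assume "A \<in> sets \<sigma>"
  then have "A \<in> sets borel" using assms unfolding is_surface_measure_def by auto
  then show "emeasure \<sigma> A = emeasure \<sigma>' A" using ex assms by simp
 qed
qed

text \<open>The pieces of \<open>M\<close> carry their chart measures. Agreement on overlaps makes the sum a surface measure in
 every other chart as well.\<close>

lemma surface_measure_exists:
 obtains \<sigma> where "is_surface_measure M \<sigma>" "emeasure \<sigma> UNIV < \<infinity>"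
proof -
 obtain n Mi W V b g where gc: "\<And>i. i < (n::nat) ==> graph_chart M (b i) (W i) (V i) (g i)"
  and Mi: "\<And>i. Mi i \<in> sets borel" "\<And>i. i < n ==> Mi i \<subseteq> M \<inter> W i"
  "\<And>i. i < n ==> emeasure (chart_measure (b i) (V i) (g i)) (Mi i) < \<infinity>"
  "disjoint_family_on Mi {..<n}" "(\<Union>i<n. Mi i) = M"
  by (rule boundary_decomposition) blast
 define \<kappa> where "\<kappa> i = chart_measure (b i) (V i) (g i)" for i
 have s\<kappa>: "sets (\<kappa> i) = sets borel" if "i < n" for i unfolding \<kappa>_def by (rule sets_chart_measure[OF gc[OF that]])
 define \<mu> where "\<mu> A = (\<Sum>i<n. emeasure (\<kappa> i) (A \<inter> Mi i))" for A
 define \<sigma> where "\<sigma> = measure_of UNIV (sets borel) \<mu>"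
 have sa: "sigma_algebra UNIV (sets (borel :: 'a measure))" using sets.sigma_algebra_axioms[of "borel :: 'a measure"] by simp
 have ss: "sets \<sigma> = sets borel" unfolding \<sigma>_def using sigma_algebra.sigma_sets_eq[OF sa] by simp
 have em: "emeasure \<sigma> A = \<mu> A" if A: "A \<in> sets borel" for A
  unfolding \<sigma>_def
 proof (rule emeasure_measure_of_sigma[OF sa _ _ A])
  show "positive (sets borel) \<mu>" by (simp add: positive_def \<mu>_def)
  show "countably_additive (sets borel) \<mu>"
  proof (rule countably_additiveI)
   fix F :: "nat => 'a set" assume F: "range F \<subseteq> sets borel" "disjoint_family F"
   have "(\<Sum>k. \<mu> (F k)) = (\<Sum>i<n. \<Sum>k. emeasure (\<kappa> i) (F k \<inter> Mi i))"
    unfolding \<mu>_def by (rule suminf_sum) simp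
   also have "\<dots> = (\<Sum>i<n. emeasure (\<kappa> i) (\<Union>k. F k \<inter> Mi i))"
   proof (intro sum.cong refl suminf_emeasure)
    fix i assume "i \<in> {..<n}"
    then show "range (%k. F k \<inter> Mi i) \<subseteq> sets (\<kappa> i)" using F(1) Mi(1) s\<kappa> by auto
    show "disjoint_family (%k. F k \<inter> Mi i)" using F(2) by (auto simp: disjoint_family_on_def)
   qed
   also have "\<dots> = \<mu> (\<Union>k. F k)" by (simp add: \<mu>_def)
   finally show "(\<Sum>k. \<mu> (F k)) = \<mu> (\<Union>k. F k)" .
  qed
 qed
 have "is_surface_measure M \<sigma>"
  unfolding is_surface_measure_def
 proof (intro conjI allI impI ballI)
  show "sets \<sigma> = sets borel" by (rule ss)
  have "- M \<inter> Mi i = {}" if "i < n" for i using Mi(2)[OF that] by auto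
  then show "emeasure \<sigma> (- M) = 0" using borel_sets(2) by (subst em) (auto simp: \<mu>_def)
  fix b' W' V' g' A
  assume gc': "graph_chart M b' W' V' g'" and A: "A \<in> sets borel" "A \<subseteq> M \<inter> W'"
  have "emeasure \<sigma> A = (\<Sum>i<n. emeasure (\<kappa> i) (A \<inter> Mi i))" by (simp add: em[OF A(1)] \<mu>_def)
  also have "\<dots> = (\<Sum>i<n. emeasure (chart_measure b' V' g') (A \<inter> Mi i))"
  proof (intro sum.cong refl)
   fix i assume "i \<in> {..<n}"
   then have i: "i < n" by simp
   have "A \<inter> Mi i \<subseteq> M \<inter> W i \<inter> W'" "A \<inter> Mi i \<in> sets borel" using Mi(2)[OF i] Mi(1) A by auto
   then show "emeasure (\<kappa> i) (A \<inter> Mi i) = emeasure (chart_measure b' V' g') (A \<inter> Mi i)"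
    unfolding \<kappa>_def by (intro chart_measures_agree[OF gc[OF i] gc'])
  qed
  also have "\<dots> = emeasure (chart_measure b' V' g') (\<Union>i<n. A \<inter> Mi i)"
  proof (rule sum_emeasure)
   show "disjoint_family_on (%i. A \<inter> Mi i) {..<n}" using Mi(4) unfolding disjoint_family_on_def by blast
  qed (use Mi(1) A sets_chart_measure[OF gc'] in auto)
  also have "(\<Union>i<n. A \<inter> Mi i) = A" using A Mi(5) by auto
  finally show "emeasure \<sigma> A = (\<integral>\<^sup>+y. indicator V' y * indicator A (y + g' y *\<^sub>R b') *
    ennreal (sqrt (1 + (\<Sum>i\<in>Basis - {b'}. (frechet_derivative g' (at y) i)\<^sup>2))) \<partial>hyperplane_lborel b')"
   by (simp only: emeasure_chart_measure[OF gc' A(1)])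
 qed
 moreover have "emeasure \<sigma> UNIV < \<infinity>"
  using Mi(3) by (subst em) (auto simp: \<mu>_def \<kappa>_def ennreal_sum_less_top less_top)
 ultimately show ?thesis by (rule that)
qed

abbreviation "\<sigma> \<equiv> surface_measure M"

lemma surface_measure_is: "is_surface_measure M \<sigma>"
proof -
 obtain \<tau> where \<tau>: "is_surface_measure M \<tau>" by (rule surface_measure_exists)
 show ?thesis unfolding surface_measure_def
  by (rule theI') (use \<tau> surface_measure_unique[OF _ \<tau>] in blast)
qed

lemma sets_surface [simp]: "sets \<sigma> = sets borel"
 using surface_measure_is unfolding is_surface_measure_def by auto
lemma space_surface [simp]: "space \<sigma> = UNIV"
 using sets_eq_imp_space_eq[OF sets_surface] by simp
lemma measurable_surface [simp]: "measurable \<sigma> N = measurable borel N"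
 by (rule measurable_cong_sets) auto
lemma surface_finite: "emeasure \<sigma> UNIV < \<infinity>"
proof -
 obtain \<tau> where "is_surface_measure M \<tau>" "emeasure \<tau> UNIV < \<infinity>" by (rule surface_measure_exists)
 then show ?thesis using surface_measure_unique[OF surface_measure_is] by auto
qed
lemma AE_surface_M: "AE z in \<sigma>. z \<in> M"
proof (rule AE_I[where N="- M"])
 show "emeasure \<sigma> (- M) = 0" using surface_measure_is unfolding is_surface_measure_def by auto
qed (use borel_sets(2) in auto)

interpretation surf: finite_measure \<sigma>
 by (rule finite_measureI) (use surface_finite in auto)

lemma C1c_surface_integrable: "C1c f ==> integrable \<sigma> f"
proof -
 assume f: "C1c f"
 obtain B where "\<And>x. norm (f x) \<le> B" using C1c_bound[OF f] by blast
 then show ?thesis using C1c_borel[OF f] by (intro surf.integrable_const_bound[of _ B]) auto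
qed

text \<open>The two measures, restricted to \<open>W\<close>, agree on all Borel sets, because both are carried by \<open>M\<close>.\<close>

lemma surface_chart:
 assumes gc: "graph_chart M b W V g" and f: "f \<in> borel_measurable borel" "\<And>x. x \<notin> W ==> f x = (0::complex)"
 shows "(\<integral>z. f z \<partial>\<sigma>) = (\<integral>z. f z \<partial>chart_measure b V g)"
proof -
 let ?K = "chart_measure b V g"
 have W: "W \<in> sets borel" using gc_basic(2)[OF gc] by auto
 have sK: "sets ?K = sets borel" by (rule sets_chart_measure[OF gc])
 have mK: "measurable ?K N = measurable borel N" for N :: "'b measure" by (rule measurable_cong_sets[OF sK refl])
 have fK: "f \<in> borel_measurable ?K" using f(1) measurable_cong_sets[OF sK refl] by blast
 have eq: "density \<sigma> (indicator W) = density ?K (indicator W)"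
 proof (rule measure_eqI)
  show "sets (density \<sigma> (indicator W)) = sets (density ?K (indicator W))" using sK by simp
  fix A assume "A \<in> sets (density \<sigma> (indicator W))"
  then have A: "A \<in> sets borel" by simp
  have D: "emeasure (density \<tau> (indicator W)) A = emeasure \<tau> (A \<inter> W)" if "sets \<tau> = sets borel" for \<tau>
   using that A W by (subst emeasure_density) (auto simp: nn_integral_indicator[symmetric] indicator_inter_arith mult.commute intro!: nn_integral_cong)
  have z: "emeasure \<tau> (A \<inter> W) = emeasure \<tau> (A \<inter> W \<inter> M)" if "sets \<tau> = sets borel" "emeasure \<tau> (- (M \<inter> W)) = 0 \<or> emeasure \<tau> (- M) = 0" for \<tau>
  proof -
   have n: "\<exists>N \<in> null_sets \<tau>. A \<inter> W - N = A \<inter> W \<inter> M"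
    using that(2)
   proof
    assume "emeasure \<tau> (- (M \<inter> W)) = 0"
    then show ?thesis using that(1) W borel_sets(2) by (intro bexI[of _ "- (M \<inter> W)"]) (auto simp: null_sets_def)
   next
    assume "emeasure \<tau> (- M) = 0"
    then show ?thesis using that(1) W borel_sets(2) by (intro bexI[of _ "- M"]) (auto simp: null_sets_def)
   qed
   then obtain N where "N \<in> null_sets \<tau>" "A \<inter> W - N = A \<inter> W \<inter> M" by blast
   then show ?thesis using emeasure_Diff_null_set[of N \<tau> "A \<inter> W"] that(1) A W by auto
  qed
  have AWM: "A \<inter> W \<inter> M \<in> sets borel" "A \<inter> W \<inter> M \<subseteq> M \<inter> W" using A W borel_sets(2) by auto
  have "emeasure \<sigma> (A \<inter> W \<inter> M) = emeasure ?K (A \<inter> W \<inter> M)"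
   using surface_measure_is gc AWM unfolding is_surface_measure_def emeasure_chart_measure[OF gc AWM(1)] by blast
  moreover have "emeasure \<sigma> (- M) = 0" using surface_measure_is unfolding is_surface_measure_def by auto
  ultimately show "emeasure (density \<sigma> (indicator W)) A = emeasure (density ?K (indicator W)) A"
   using D[OF sets_surface] D[OF sK] z[OF sets_surface] z[OF sK] chart_measure_outside[OF gc] by simp
 qed
 have I: "(\<integral>z. f z \<partial>\<tau>) = (\<integral>z. f z \<partial>density \<tau> (indicator W))" if "sets \<tau> = sets borel" for \<tau>
 proof -
  have fm: "f \<in> borel_measurable \<tau>" using f(1) measurable_cong_sets[OF that refl] by blast
  have "(\<integral>z. f z \<partial>density \<tau> (%z. ennreal (indicator W z))) = (\<integral>z. indicator W z *\<^sub>R f z \<partial>\<tau>)"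
   by (rule integral_density[OF fm]) (use W that in auto)
  also have "\<dots> = (\<integral>z. f z \<partial>\<tau>)"
   by (intro Bochner_Integration.integral_cong refl) (use f(2) in \<open>auto simp: indicator_def\<close>)
  finally show ?thesis by (simp add: ennreal_indicator)
 qed
 show ?thesis using I[OF sets_surface] I[OF sK] eq by simp
qed

text \<open>Near an interior point both sides vanish; near a boundary point the integral is the one of a chart measure.\<close>

lemma surface_integral_Lam:
 assumes f: "C1c f"
 shows "(\<integral>z. f z \<partial>\<sigma>) = Lam f"
proof -
 obtain C where C: "compact C" "C \<subseteq> S" "\<And>x. x \<notin> C ==> f x = 0" using C1c_supp[OF f] by blast
 show ?thesis
 proof (rule localisation[OF C1c_C1[OF f] C, where P="%f. (\<integral>z. f z \<partial>\<sigma>) = Lam f"])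
  show "(\<integral>z. 0 \<partial>\<sigma>) = Lam (%_. 0)" by (simp add: Lam_0)
  show "(\<integral>z. h z + k z \<partial>\<sigma>) = Lam (%x. h x + k x)"
   if "C1c h" "C1c k" "(\<integral>z. h z \<partial>\<sigma>) = Lam h" "(\<integral>z. k z \<partial>\<sigma>) = Lam k" for h k
   using that by (simp add: Lam_add Bochner_Integration.integral_add C1c_surface_integrable)
  fix z assume "z \<in> C"
  then consider "z \<in> Om" | "z \<in> M" using C(2) S_eq by auto
  then show "\<exists>G. open G \<and> z \<in> G \<and> (\<forall>h. C1 S h --> csupp (S \<inter> G) h --> (\<integral>z. h z \<partial>\<sigma>) = Lam h)"
  proof cases
   case 1
   show ?thesis
   proof (intro exI[of _ Om] conjI allI impI open_Om 1)
    fix h assume h: "C1 S h" "csupp (S \<inter> Om) h"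
    obtain C' where C': "compact C'" "C' \<subseteq> S \<inter> Om" "\<And>x. x \<notin> C' ==> h x = 0"
     using h(2) unfolding csupp_def by blast
    have hc: "C1c h" by (rule C1cI[OF h(1) C'(1) _ C'(3)]) (use C' in auto)
    have "AE z in \<sigma>. h z = 0" using AE_surface_M
     by eventually_elim (use C' Om_M in blast)
    then have "(\<integral>z. h z \<partial>\<sigma>) = 0" by (rule integral_eq_zero_AE)
    moreover have "Lam h = 0" by (rule Lam_Om[OF hc C'(1) _ C'(3)]) (use C' in auto)
    ultimately show "(\<integral>z. h z \<partial>\<sigma>) = Lam h" by simp
   qed
  next
   case 2
   have "z \<in> S" using 2 M_sub by auto
   then obtain b where b: "b \<in> Basis" "rr z b \<noteq> 0" by (rule rr_nonzero)
   obtain s V W g where ch: "chart b s V W g" "z \<in> W" using chart_exists[OF 2 b] by blast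
   have gc: "graph_chart M b W V g" by (rule chart_graph_chart[OF ch(1)])
   show ?thesis
   proof (intro exI[of _ W] conjI allI impI ch(2) gc_basic(2)[OF gc])
    fix h assume h: "C1 S h" "csupp (S \<inter> W) h"
    obtain C' where C': "compact C'" "C' \<subseteq> S \<inter> W" "\<And>x. x \<notin> C' ==> h x = 0"
     using h(2) unfolding csupp_def by blast
    have hc: "C1c h" by (rule C1cI[OF h(1) C'(1) _ C'(3)]) (use C' in auto)
    have "(\<integral>z. h z \<partial>\<sigma>) = (\<integral>z. h z \<partial>chart_measure b V g)"
     by (rule surface_chart[OF gc C1c_borel[OF hc]]) (use C' in auto)
    also have "\<dots> = Lam h" by (rule chart_measure_Lam[OF gc h(1) C'])
    finally show "(\<integral>z. h z \<partial>\<sigma>) = Lam h" .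
   qed
  qed
 qed
qed

definition BM :: "('a => complex) => complex" where
 "BM F = (LINT z:M|\<sigma>. F z)"

lemma Cc_BM_int: "Cc F ==> set_integrable \<sigma> M F"
proof -
 assume F: "Cc F"
 obtain B where B: "B \<ge> 0" "\<And>x. x \<in> S ==> norm (F x) \<le> B" using Cc_bound[OF F] by blast
 have "norm (indicator M x *\<^sub>R F x) \<le> B" for x using B M_sub by (auto simp: indicator_def)
 moreover have "(%x. indicator M x *\<^sub>R F x) \<in> borel_measurable \<sigma>"
  unfolding measurable_surface
  by (intro borel_measurable_continuous_on_indicator borel_sets continuous_on_subset[OF Cc_cont[OF F] M_sub(1)])
 ultimately show ?thesis unfolding set_integrable_def
  by (intro surf.integrable_const_bound[of _ B]) auto
qed

lemma BM_add: "Cc F ==> Cc G ==> BM (%z. F z + G z) = BM F + BM G"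
 unfolding BM_def by (rule set_integral_add) (rule Cc_BM_int; assumption)+
lemma BM_diff: "Cc F ==> Cc G ==> BM (%z. F z - G z) = BM F - BM G"
 unfolding BM_def by (rule set_integral_diff) (rule Cc_BM_int; assumption)+
lemma BM_cmult: "BM (%z. c * F z) = c * BM F"
 unfolding BM_def by (rule set_integral_mult_right)
lemma BM_cong: "(\<And>z. z \<in> M ==> F z = G z) ==> BM F = BM G"
 unfolding BM_def by (rule set_lebesgue_integral_cong) auto
lemma BM_0: "BM (%_. 0) = 0" by (simp add: BM_def set_lebesgue_integral_def)
lemma BM_sum: "(\<And>i. i \<in> A ==> Cc (F i)) ==> BM (%z. \<Sum>i\<in>A. F i z) = (\<Sum>i\<in>A. BM (F i))"
 using Cc_BM_int unfolding BM_def set_lebesgue_integral_def set_integrable_def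
 by (subst Bochner_Integration.integral_sum[symmetric]) (auto simp: scaleR_sum_right)

lemma BM_C1c: "C1c f ==> BM f = Lam f"
proof -
 assume f: "C1c f"
 have "BM f = (\<integral>z. f z \<partial>\<sigma>)"
  unfolding BM_def set_lebesgue_integral_def
 proof (rule integral_cong_AE)
  show "(%x. indicator M x *\<^sub>R f x) \<in> borel_measurable \<sigma>"
   by (rule borel_measurable_integrable[OF Cc_BM_int[OF C1c_Cc[OF f], unfolded set_integrable_def]])
  show "f \<in> borel_measurable \<sigma>" using C1c_borel[OF f] by simp
  show "AE x in \<sigma>. indicator M x *\<^sub>R f x = f x" using AE_surface_M by eventually_elim auto
 qed
 then show ?thesis using surface_integral_Lam[OF f] by simp
qed

lemma set_integral_dominated:
 fixes F :: "'a => complex" and h :: "'a => real"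
 assumes F: "set_integrable N A F" and H: "set_integrable N A (cplx h)"
  and le: "\<And>z. z \<in> A ==> norm (F z) \<le> h z"
 shows "norm (LINT z:A|N. F z) \<le> Re (LINT z:A|N. complex_of_real (h z))"
proof -
 have H': "integrable N (%z. indicator A z *\<^sub>R h z)"
  using integrable_Re[OF H[unfolded set_integrable_def]] by simp
 have "norm (LINT z:A|N. F z) \<le> (\<integral>z. norm (indicator A z *\<^sub>R F z) \<partial>N)"
  unfolding set_lebesgue_integral_def by (rule integral_norm_bound)
 also have "\<dots> \<le> (\<integral>z. indicator A z *\<^sub>R h z \<partial>N)"
  by (rule integral_mono[OF integrable_norm[OF F[unfolded set_integrable_def]] H'])
    (use le in \<open>auto simp: indicator_def\<close>)
 also have "\<dots> = Re (LINT z:A|N. complex_of_real (h z))"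
  unfolding set_lebesgue_integral_def
  using integral_Re[OF H[unfolded set_integrable_def]] by simp
 finally show ?thesis .
qed

lemma kd_nonneg: "kd n z = complex_of_real (Re (kd n z))" "0 \<le> Re (kd n z)"
 using Nn_pos[of n] stp'_nonneg by (auto simp: kd_def)

lemma Bn_bound:
 assumes F: "Cc F" and H: "Cc (cplx h)" and le: "\<And>z. z \<in> Om ==> norm (F z) \<le> h z"
 shows "norm (Bn n F) \<le> Re (Bn n (cplx h))"
proof -
 have e: "(%z. kd n z * complex_of_real (h z)) = cplx (%z. Re (kd n z) * h z)"
  using kd_nonneg(1) by (metis of_real_mult)
 have "norm (LINT z:Om|lborel. kd n z * F z) \<le> Re (LINT z:Om|lborel. complex_of_real (Re (kd n z) * h z))"
 proof (rule set_integral_dominated)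
  show "set_integrable lborel Om (%z. kd n z * F z)" by (rule Cc_int[OF Cc_mult_left[OF F kd_cont]])
  show "set_integrable lborel Om (cplx (%z. Re (kd n z) * h z))"
   using Cc_int[OF Cc_mult_left[OF H kd_cont[of n]]] unfolding e .
  fix z assume "z \<in> Om"
  have "norm (kd n z) = Re (kd n z)" using kd_nonneg by (metis abs_of_nonneg norm_of_real)
  then show "norm (kd n z * F z) \<le> Re (kd n z) * h z"
   using le[OF \<open>z \<in> Om\<close>] kd_nonneg(2) by (simp add: norm_mult mult_left_mono)
 qed
 then show ?thesis unfolding Bn_def I_def e .
qed

lemma BM_bound:
 assumes F: "Cc F" and H: "Cc (cplx h)" and le: "\<And>z. z \<in> M ==> norm (F z) \<le> h z"
 shows "norm (BM F) \<le> Re (BM (cplx h))"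
 unfolding BM_def by (rule set_integral_dominated[OF Cc_BM_int[OF F] Cc_BM_int[OF H] le])

text \<open>For \<open>C^1\<close> functions the limit is known. A continuous \<open>F\<close> is approximated uniformly (Stone-Weierstrass);
 the error is dominated by a multiple of a fixed \<open>C^1\<close> cutoff, whose integrals converge.\<close>

lemma Bn_limit_real:
 fixes F :: "'a => real"
 assumes F: "Cc (cplx F)"
 shows "(%n. Bn n (cplx F)) \<longlonglongrightarrow> BM (cplx F)"
proof -
 obtain C where C: "compact C" "C \<subseteq> S" "\<And>x. x \<in> S ==> x \<notin> C ==> F x = 0"
  using F unfolding Cc_def by auto
 have CU: "C \<subseteq> U" using C by auto
 obtain \<theta> :: "'a => real" where \<theta>: "C1 UNIV (cplx \<theta>)" "\<And>x. x \<in> C ==> \<theta> x = 1" "csupp U (cplx \<theta>)" "\<And>x. 0 \<le> \<theta> x"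
  by (rule smooth_cutoff[OF C(1) U(1) CU]) blast
 obtain K0 where K0: "compact K0" "K0 \<subseteq> U" "\<And>x. x \<notin> K0 ==> \<theta> x = 0"
  using \<theta>(3) unfolding csupp_def by auto
 define K where "K = K0 - D"
 have K: "compact K" "K \<subseteq> S" using K0 D(1) by (auto simp: K_def intro: compact_diff)
 define hh where "hh z = (if z \<in> S then \<theta> z else 0)" for z
 have hh0: "hh x = 0" if "x \<notin> K" for x using that K0 by (auto simp: hh_def K_def)
 have toS: "C1 S f" if "C1 UNIV f" for f by (rule C1_restrict[OF that fat_set_axioms UN.fat_set_axioms]) simp
 have hh1: "C1 S (cplx hh)"
  using toS[OF \<theta>(1)] by (subst C1_cong[of _ "cplx \<theta>"]) (auto simp: hh_def)
 have hhc: "C1c (cplx hh)" by (rule C1cI[OF hh1 K]) (simp add: hh0)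
 have hhnn: "0 \<le> hh x" for x using \<theta>(4) by (simp add: hh_def)
 have FC: "F z = hh z * F z" if "z \<in> S" for z using C(3)[OF that] \<theta>(2)[of z] that by (cases "z \<in> C") (auto simp: hh_def)
 have cF: "continuous_on S F" using continuous_on_Re[OF Cc_cont[OF F]] by simp
 have limhh: "(%n. Re (Bn n (cplx hh))) \<longlonglongrightarrow> Re (BM (cplx hh))"
  using tendsto_Re[OF Bn_Lam[OF hhc]] BM_C1c[OF hhc] by simp
 have L0: "0 \<le> Re (BM (cplx hh))"
  using BM_bound[OF Cc_0 C1c_Cc[OF hhc]] hhnn by (simp add: BM_0)
 define L where "L = Re (BM (cplx hh))"
 show ?thesis
 proof (rule LIMSEQ_I)
  fix \<epsilon> :: real assume \<epsilon>: "0 < \<epsilon>"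
  \<comment> \<open>eventually the integrals of \<open>hh\<close> are at most \<open>L + 1\<close>, so each of the three errors is at most \<open>\<epsilon> / 3\<close>\<close>
  define e where "e = (\<epsilon> / 3) / (L + 1)"
  have Lp: "L + 1 > 0" using L0 by (simp add: L_def)
  have e: "e > 0" "e * (L + 1) = \<epsilon> / 3"
   using \<epsilon> Lp nonzero_divide_eq_eq[of "L + 1" "\<epsilon> / 3" e] by (auto simp: e_def)
  have "\<exists>p. C1 UNIV (cplx p) \<and> (\<forall>x\<in>K. \<bar>F x - p x\<bar> < e)"
  proof (rule Stone_Weierstrass_HOL[OF K(1)])
   show "C1 UNIV (cplx (%x. c))" for c by simp
   show "continuous_on K f" if "C1 UNIV (cplx f)" for f
    using continuous_on_Re[OF UN.C1_cont[OF that]] by (auto intro: continuous_on_subset)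
   show "C1 UNIV (cplx (%x. f x + g x))" if "C1 UNIV (cplx f) \<and> C1 UNIV (cplx g)" for f g
    using UN.C1_add[of "cplx f" "cplx g"] that by simp
   show "C1 UNIV (cplx (%x. f x * g x))" if "C1 UNIV (cplx f) \<and> C1 UNIV (cplx g)" for f g
    using UN.C1_mult[of "cplx f" "cplx g"] that by simp
   show "\<exists>f. C1 UNIV (cplx f) \<and> f x \<noteq> f y" if xy: "x \<in> K \<and> y \<in> K \<and> x \<noteq> y" for x y :: 'a
   proof -
    obtain b where b: "b \<in> Basis" "x \<bullet> b \<noteq> y \<bullet> b" using xy euclidean_eq_iff[of x y] by auto
    have "C1 UNIV (cplx (%z. z \<bullet> b))"
     by (rule UN.C1I[where f'="%x h. complex_of_real (h \<bullet> b)"]) (auto intro!: derivative_eq_intros)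
    then show ?thesis using b by (intro exI[of _ "%z. z \<bullet> b"]) simp
   qed
  qed (use continuous_on_subset[OF cF K(2)] e in auto)
  then obtain p where p: "C1 UNIV (cplx p)" "\<And>x. x \<in> K ==> \<bar>F x - p x\<bar> < e" by blast
  define G where "G z = complex_of_real (p z) * complex_of_real (hh z)" for z
  have Gc: "C1c G" unfolding G_def by (rule C1c_mult_left[OF hhc toS[OF p(1)]])
  have eh: "Cc (cplx (%z. e * hh z))" using Cc_cmult[OF C1c_Cc[OF hhc], of "complex_of_real e"] by simp
  have FG: "Cc (%z. complex_of_real (F z) - G z)" by (rule Cc_diff[OF F C1c_Cc[OF Gc]])
  have le: "norm (complex_of_real (F z) - G z) \<le> e * hh z" if z: "z \<in> S" for z
  proof (cases "z \<in> K")
   case True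
   have "complex_of_real (F z) - G z = complex_of_real (hh z * (F z - p z))"
    using FC[OF z] by (simp add: G_def algebra_simps flip: of_real_mult of_real_diff)
   then have "norm (complex_of_real (F z) - G z) = hh z * \<bar>F z - p z\<bar>"
    using hhnn[of z] by (metis abs_mult abs_of_nonneg norm_of_real)
   also have "\<dots> \<le> hh z * e" using p(2)[OF True] hhnn[of z] by (intro mult_left_mono) auto
   finally show ?thesis by (simp add: mult.commute)
  next
   case False
   then show ?thesis using FC[OF z] hh0[OF False] by (simp add: G_def)
  qed
  have b1: "norm (Bn n (cplx F) - Bn n G) \<le> e * Re (Bn n (cplx hh))" for n
  proof -
   have "Bn n (cplx F) - Bn n G = Bn n (%z. complex_of_real (F z) - G z)"
    unfolding Bn_def right_diff_distrib
    by (rule I_diff[symmetric]) (rule Cc_mult_left[OF F kd_cont], rule Cc_mult_left[OF C1c_Cc[OF Gc] kd_cont])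
   moreover have "norm (Bn n (%z. complex_of_real (F z) - G z)) \<le> Re (Bn n (cplx (%z. e * hh z)))"
    by (rule Bn_bound[OF FG eh]) (use le Om_S in blast)
   moreover have "Bn n (cplx (%z. e * hh z)) = complex_of_real e * Bn n (cplx hh)"
    unfolding Bn_def by (subst I_cmult[symmetric]) (simp add: mult_ac)
   ultimately show ?thesis by simp
  qed
  have b2: "norm (BM (cplx F) - BM G) \<le> e * L"
  proof -
   have "BM (cplx F) - BM G = BM (%z. complex_of_real (F z) - G z)"
    by (rule BM_diff[OF F C1c_Cc[OF Gc], symmetric])
   moreover have "norm (BM (%z. complex_of_real (F z) - G z)) \<le> Re (BM (cplx (%z. e * hh z)))"
    by (rule BM_bound[OF FG eh]) (use le M_sub in blast)
   moreover have "BM (cplx (%z. e * hh z)) = complex_of_real e * BM (cplx hh)"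
    by (subst BM_cmult[symmetric]) simp
   ultimately show ?thesis by (simp add: L_def)
  qed
  have "(%n. Bn n G) \<longlonglongrightarrow> BM G" using Bn_Lam[OF Gc] BM_C1c[OF Gc] by simp
  then obtain N1 where N1: "\<And>n. n \<ge> N1 ==> norm (Bn n G - BM G) < \<epsilon> / 3"
   using LIMSEQ_D[of _ _ "\<epsilon> / 3"] \<epsilon> by (metis divide_pos_pos zero_less_numeral)
  obtain N2 where N2: "\<And>n. n \<ge> N2 ==> norm (Re (Bn n (cplx hh)) - L) < 1"
   using LIMSEQ_D[OF limhh, of 1] by (auto simp: L_def)
  show "\<exists>N. \<forall>n\<ge>N. norm (Bn n (cplx F) - BM (cplx F)) < \<epsilon>"
  proof (intro exI[of _ "max N1 N2"] allI impI)
   fix n assume n: "max N1 N2 \<le> n"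
   have "e * Re (Bn n (cplx hh)) \<le> e * (L + 1)" using N2[of n] n e by (intro mult_left_mono) auto
   then have 1: "norm (Bn n (cplx F) - Bn n G) \<le> \<epsilon> / 3" using b1[of n] e by linarith
   have "e * L \<le> e * (L + 1)" using e by simp
   then have 2: "norm (BM (cplx F) - BM G) \<le> \<epsilon> / 3" using b2 e by linarith
   have 3: "norm (Bn n G - BM G) < \<epsilon> / 3" using N1 n by simp
   have tri: "norm (p + q - r) \<le> norm p + norm q + norm r" for p q r :: complex
    using norm_triangle_ineq4[of "p + q" r] norm_triangle_ineq[of p q] by linarith
   have "norm (Bn n (cplx F) - BM (cplx F)) =
     norm ((Bn n (cplx F) - Bn n G) + (Bn n G - BM G) - (BM (cplx F) - BM G))" by simp
   also have "\<dots> \<le> norm (Bn n (cplx F) - Bn n G) + norm (Bn n G - BM G) + norm (BM (cplx F) - BM G)"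
    by (rule tri)
   finally show "norm (Bn n (cplx F) - BM (cplx F)) < \<epsilon>" using 1 2 3 by linarith
  qed
 qed
qed

lemma Bn_limit:
 assumes F: "Cc F"
 shows "(%n. Bn n F) \<longlonglongrightarrow> BM F"
proof -
 have part: "Cc (cplx (%z. Re (F z)))" "Cc (cplx (%z. Im (F z)))"
  using F unfolding Cc_def by (auto intro!: continuous_intros)
 have dec: "F = (%z. complex_of_real (Re (F z)) + \<i> * complex_of_real (Im (F z)))"
  by (rule ext) (rule complex_eq)
 have "Bn n F = Bn n (cplx (%z. Re (F z))) + \<i> * Bn n (cplx (%z. Im (F z)))" for n
  unfolding Bn_def
  by (subst dec, subst I_cmult[symmetric], subst I_add[symmetric])
    (auto intro!: Cc_mult_left[OF _ kd_cont] Cc_mult_right[OF _ kd_cont] Cc_cmult part simp: algebra_simps)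
 moreover have "BM F = BM (cplx (%z. Re (F z))) + \<i> * BM (cplx (%z. Im (F z)))"
  by (subst dec, subst BM_cmult[symmetric], subst BM_add[symmetric])
    (auto intro!: Cc_cmult part)
 ultimately show ?thesis
  using tendsto_add[OF Bn_limit_real[OF part(1)] tendsto_mult[OF tendsto_const Bn_limit_real[OF part(2)]], of "\<i>"]
  by simp
qed

text \<open>The outer normal of \<open>Om\<close> along \<open>M\<close> is \<open>- grad \<rho>\<close>, whence the sign.\<close>

theorem divergence_theorem:
 assumes f: "C1c f" and b: "b \<in> Basis"
 shows "I (pd S b f) = - BM (%z. rd b z * f z)"
proof (rule LIMSEQ_unique)
 show "(%n. I (%z. kn n z * pd S b f z)) \<longlonglongrightarrow> I (pd S b f)" by (rule I_cut_limit[OF C1c_Cc_pd[OF f]])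
 show "(%n. I (%z. kn n z * pd S b f z)) \<longlonglongrightarrow> - BM (%z. rd b z * f z)"
  unfolding cut_parts[OF f b]
  by (intro tendsto_minus Bn_limit C1c_Cc C1c_mult_left[OF f C1_pd_rho])
qed

text \<open>Both functions are truncated so that the exchange on the whole space applies. The cutoff of \<open>g\<close> is
 equal to 1 wherever the cutoff of \<open>a\<close> is not 0, and its gradient vanishes there; therefore only the
 gradient of the cutoff of \<open>a\<close> contributes.\<close>

theorem exchange_of_derivatives:
 assumes a: "C1c a" and g: "C1 S g" and j: "j \<in> Basis" and k: "k \<in> Basis"
 shows "I (%z. pd S j a z * pd S k g z - pd S k a z * pd S j g z) =
  - BM (%z. a z * (rd j z * pd S k g z - rd k z * pd S j g z))"
proof -
 obtain C where C: "compact C" "C \<subseteq> S" "\<And>x. x \<notin> C ==> a x = 0" using C1c_supp[OF a] by blast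
 have CU: "C \<subseteq> U" using C by auto
 obtain \<theta> :: "'a => real" where \<theta>: "C1 UNIV (cplx \<theta>)" "\<And>x. x \<in> C ==> \<theta> x = 1" "csupp U (cplx \<theta>)"
  "\<And>x b. x \<in> C ==> pd UNIV b (cplx \<theta>) x = 0"
  by (rule smooth_cutoff[OF C(1) U(1) CU]) blast
 obtain K0 where K0: "compact K0" "K0 \<subseteq> U" "\<And>x. x \<notin> K0 ==> \<theta> x = 0"
  using \<theta>(3) unfolding csupp_def by auto
 have K: "compact (K0 - D)" "K0 - D \<subseteq> S" using K0 D(1) by (auto intro: compact_diff)
 note \<theta>S = C1_restrict[OF \<theta>(1) fat_set_axioms UN.fat_set_axioms subset_UNIV]
 define G where "G z = (if z \<in> S then complex_of_real (\<theta> z) * g z else 0)" for z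
 have Geq: "\<And>z. z \<in> S ==> G z = complex_of_real (\<theta> z) * g z" by (simp add: G_def)
 have G1: "C1 S G" using C1_mult[OF \<theta>S(1) g] C1_cong[of G "%z. complex_of_real (\<theta> z) * g z", OF Geq] by simp
 have G0: "G x = 0" if "x \<notin> K0 - D" for x using that K0 by (auto simp: G_def)
 have pG: "pd S c G z = pd S c g z" if z: "z \<in> C" for c z
 proof -
  have zS: "z \<in> S" using z C by auto
  have "pd S c G z = pd S c (%z. complex_of_real (\<theta> z) * g z) z" by (rule C1_cong_pd[OF Geq zS])
  then show ?thesis using pd_mult[OF \<theta>S(1) g zS, of c] \<theta>S(2)[OF zS, of c] \<theta>(2,4)[OF z] by simp
 qed
 have zero: "I (%z. kn n z * (pd S j a z * pd S k g z - pd S k a z * pd S j g z)) +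
   Bn n (%z. a z * (rd j z * pd S k g z - rd k z * pd S j g z)) = 0" for n
 proof -
  \<comment> \<open>\<open>Nn m = 2 * Nn n\<close>: the cutoff with index \<open>m\<close> is already 1 where the one with index \<open>n\<close> starts to be positive\<close>
  define m where "m = Suc (2 * n)"
  have Nm: "Nn m = 2 * Nn n" by (simp add: m_def Nn_def)
  note ca = cut_C1[OF C1c_C1[OF a] C, of n] cut_csupp[OF C1c_C1[OF a] C, of n]
  note cG = cut_C1[OF G1 K G0, of m] cut_csupp[OF G1 K G0, of m]
  have sa: "csupp UNIV (trunc n a)" using ca(2) unfolding csupp_def by blast
  have sG: "csupp UNIV (trunc m G)" using cG(2) unfolding csupp_def by blast
  have "(\<integral>z. pd UNIV j (trunc n a) z * pd UNIV k (trunc m G) z \<partial>lborel) -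
   (\<integral>z. pd UNIV k (trunc n a) z * pd UNIV j (trunc m G) z \<partial>lborel) = 0"
   using integral_swap_derivatives[OF ca(1) sa cG(1) sG j k] by simp
  moreover have val: "pd UNIV c (trunc n a) z * pd UNIV d (trunc m G) z =
    kn n z * (pd S c a z * pd S d g z) + kd n z * (a z * (rd c z * pd S d g z))"
   if z: "z \<in> Om" for c d z
  proof -
   have zS: "z \<in> S" using z Om_S by blast
   note pa = cut_pd[OF C1c_C1[OF a] C z, of c n]
   note pGm = cut_pd[OF G1 K G0 z, of d m]
   show ?thesis
   proof (cases "z \<in> C \<and> 1 \<le> Nn n * \<rho> z")
    case True
    then have "kn m z = 1" "kd m z = 0" using Nm by (auto simp: kn_def kd_def stp_1 stp'_1)
    then have "pd UNIV d (trunc m G) z = pd S d g z" using pGm pG True by simp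
    then show ?thesis using pa by (simp add: algebra_simps)
   next
    case False
    then have "(a z = 0 \<and> pd S c a z = 0) \<or> (kn n z = 0 \<and> kd n z = 0)"
     using C(3) pd_0_outside[OF C(1) C(3) zS] cut_0[of n z] by fastforce
    then show ?thesis using pa by auto
   qed
  qed
  have toI: "(\<integral>z. pd UNIV c (trunc n a) z * pd UNIV d (trunc m G) z \<partial>lborel) =
    I (%z. kn n z * (pd S c a z * pd S d g z) + kd n z * (a z * (rd c z * pd S d g z)))" for c d
  proof -
   have "(\<integral>z. pd UNIV c (trunc n a) z * pd UNIV d (trunc m G) z \<partial>lborel) =
    I (%z. pd UNIV c (trunc n a) z * pd UNIV d (trunc m G) z)"
    by (rule integral_to_I) (use cut_pd_0[OF C1c_C1[OF a] C] in auto)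
   also have "\<dots> = I (%z. kn n z * (pd S c a z * pd S d g z) + kd n z * (a z * (rd c z * pd S d g z)))"
    by (rule I_cong[OF val])
   finally show ?thesis .
  qed
  have c1: "Cc (%z. kn n z * (pd S c a z * pd S d g z))" for c d
   by (intro Cc_mult_left[OF _ kn_cont] Cc_mult_right[OF C1c_Cc_pd[OF a]] C1_cont_pd[OF g])
  have c2: "Cc (%z. kd n z * (a z * (rd c z * pd S d g z)))" for c d
   by (intro Cc_mult_left[OF _ kd_cont] Cc_mult_right[OF C1c_Cc[OF a]] continuous_on_mult C1_cont_pd g C1_rho)
  ultimately have z: "(I (%z. kn n z * (pd S j a z * pd S k g z)) + I (%z. kd n z * (a z * (rd j z * pd S k g z)))) -
    (I (%z. kn n z * (pd S k a z * pd S j g z)) + I (%z. kd n z * (a z * (rd k z * pd S j g z)))) = 0"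
   unfolding toI by (simp only: I_add[OF c1 c2])
  have e1: "I (%z. kn n z * (pd S j a z * pd S k g z - pd S k a z * pd S j g z)) =
    I (%z. kn n z * (pd S j a z * pd S k g z)) - I (%z. kn n z * (pd S k a z * pd S j g z))"
   unfolding right_diff_distrib by (rule I_diff[OF c1 c1])
  have e2: "Bn n (%z. a z * (rd j z * pd S k g z - rd k z * pd S j g z)) =
    I (%z. kd n z * (a z * (rd j z * pd S k g z))) - I (%z. kd n z * (a z * (rd k z * pd S j g z)))"
   unfolding right_diff_distrib Bn_def by (rule I_diff[OF c2 c2])
  show ?thesis unfolding e1 e2 using z by (simp only: add_diff_add)
 qed
 have P: "Cc (%z. pd S j a z * pd S k g z - pd S k a z * pd S j g z)"
  by (intro Cc_diff Cc_mult_right[OF C1c_Cc_pd[OF a]] C1_cont_pd[OF g])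
 have B: "Cc (%z. a z * (rd j z * pd S k g z - rd k z * pd S j g z))"
  by (intro Cc_mult_right[OF C1c_Cc[OF a]] continuous_on_diff continuous_on_mult C1_cont_pd g C1_rho)
 have l0: "(%n. 0) \<longlonglongrightarrow> I (%z. pd S j a z * pd S k g z - pd S k a z * pd S j g z) +
   BM (%z. a z * (rd j z * pd S k g z - rd k z * pd S j g z))"
  using tendsto_add[OF I_cut_limit[OF P] Bn_limit[OF B]] unfolding zero .
 from LIMSEQ_unique[OF tendsto_const l0] show ?thesis by (simp add: eq_neg_iff_add_eq_0)
qed

end

section \<open>Orthogonality to test functions and symmetry of second derivatives\<close>

lemma continuous_AE_zero:
 fixes w :: "'a::euclidean_space => complex"
 assumes G: "open G" and w: "continuous_on G w" and ae: "AE z in lebesgue. z \<in> G --> w z = 0" and z: "z \<in> G"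
 shows "w z = 0"
proof (rule ccontr)
 assume nz: "w z \<noteq> 0"
 let ?N = "G \<inter> w -` (- {0})"
 have "open ?N" by (rule continuous_open_preimage[OF w G]) auto
 moreover have "?N \<noteq> {}" using z nz by auto
 ultimately have "\<not> negligible ?N" by (rule open_not_negligible)
 moreover have "negligible ?N"
 proof -
  obtain N where N: "N \<in> null_sets lebesgue" "{z. \<not> (z \<in> G --> w z = 0)} \<subseteq> N"
   using ae by (auto simp: eventually_ae_filter)
  have "?N \<subseteq> N" using N(2) by auto
  then show ?thesis using N(1) negligible_iff_null_sets negligible_subset by blast
 qed
 ultimately show False by simp
qed

context exterior_domain begin

lemma C1c_bump:
 assumes "cbox a b \<subseteq> Om"
 shows "C1c (cplx (bump k a b))"
proof (rule C1cI[OF _ compact_cbox[of a b]])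
 show "C1 S (cplx (bump k a b))" by (rule C1_restrict(1)[OF C1_bump fat_set_axioms UN.fat_set_axioms subset_UNIV])
 show "complex_of_real (bump k a b x) = 0" if "x \<notin> cbox a b" for x
  using that bump_zero[of x a b k] box_subset_cbox[of a b] by auto
qed (use assms Om_S in blast)

lemma orthogonal_to_bumps:
 assumes w: "continuous_on Om w"
  and zero: "\<And>k a b. cbox a b \<subseteq> Om ==> I (%z. complex_of_real (bump k a b z) * w z) = 0"
  and z: "z \<in> Om"
 shows "w z = 0"
proof (rule continuous_AE_zero[OF open_Om w _ z])
 let ?w = "%z. indicator Om z *\<^sub>R w z"
 have mw: "?w \<in> borel_measurable borel" by (intro borel_measurable_continuous_on_indicator borel_sets w)
 have "AE z in lebesgue. z \<in> Om --> ?w z = 0"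
 proof (rule AE_zero_if_orthogonal_to_bumps[OF open_Om])
  show "?w \<in> borel_measurable lebesgue" using mw by (auto intro: measurable_completion)
  fix a b :: 'a and k assume ab: "cbox a b \<subseteq> Om"
  have "integrable lborel (%z. indicator (cbox a b) z *\<^sub>R w z)"
   using borel_integrable_compact[OF compact_cbox continuous_on_subset[OF w ab]] .
  then have "integrable lebesgue (%z. indicator (cbox a b) z *\<^sub>R w z)"
   by (subst integrable_completion) auto
  moreover have "(%z. indicator (cbox a b) z *\<^sub>R ?w z) = (%z. indicator (cbox a b) z *\<^sub>R w z)"
   using ab by (intro ext) (auto simp: indicator_def)
  ultimately show "integrable lebesgue (%z. indicator (cbox a b) z *\<^sub>R ?w z)" by (simp only:)
  have "(\<integral>z. bump k a b z *\<^sub>R ?w z \<partial>lebesgue) = (\<integral>z. bump k a b z *\<^sub>R ?w z \<partial>lborel)"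
   by (rule integral_completion) (use mw in measurable)
  also have "\<dots> = I (%z. complex_of_real (bump k a b z) * w z)"
   unfolding I_def set_lebesgue_integral_def
   by (intro Bochner_Integration.integral_cong refl) (simp add: scaleR_conv_of_real mult_ac)
  finally show "(\<integral>z. bump k a b z *\<^sub>R ?w z \<partial>lebesgue) = 0" using zero[OF ab] by simp
 qed
 then show "AE z in lebesgue. z \<in> Om --> w z = 0" by eventually_elim auto
qed

lemma BM_zero: "(\<And>z. z \<in> M ==> F z = 0) ==> BM F = 0"
 using BM_cong[of F "%_. 0"] BM_0 by simp

lemma C1c_csupp_Om:
 assumes f: "C1 S f" and C: "compact C" "C \<subseteq> Om" "\<And>x. x \<notin> C ==> f x = 0"
 shows "C1c f" "z \<in> M ==> f z = 0"
 using assms Om_S Om_M by (auto intro!: C1cI[of f C])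

definition C2 :: "('a => complex) => bool" where
 "C2 f \<longleftrightarrow> C1 S f \<and> (\<forall>b. C1 S (pd S b f))"

text \<open>With a bump function in place of \<open>a\<close> the exchange formula has no boundary term, so the difference of the
 mixed derivatives is orthogonal to all bump functions; by continuity it vanishes up to \<open>M\<close>.\<close>

lemma symmetric_pd:
 assumes f: "C2 f" and j: "j \<in> Basis" and k: "k \<in> Basis" and z: "z \<in> S"
 shows "pd S j (pd S k f) z = pd S k (pd S j f) z"
proof -
 have f1: "C1 S f" and f2: "C1 S (pd S b f)" for b using f by (auto simp: C2_def)
 let ?w = "%z. pd S j (pd S k f) z - pd S k (pd S j f) z"
 have cw: "continuous_on S ?w" by (intro continuous_on_diff C1_cont_pd f2)
 have "?w z = 0" if z: "z \<in> Om" for z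
 proof (rule orthogonal_to_bumps[OF continuous_on_subset[OF cw Om_S] _ z])
  fix n :: nat and a b :: 'a assume ab: "cbox a b \<subseteq> Om"
  let ?p = "cplx (bump n a b)"
  have p: "C1c ?p" by (rule C1c_bump[OF ab])
  have pM: "?p z = 0" if "z \<in> M" for z
   using that ab Om_M bump_zero[of z a b n] box_subset_cbox[of a b] by auto
  have e: "I (%z. pd S c ?p z * pd S d f z) = - I (%z. ?p z * pd S c (pd S d f) z)" if c: "c \<in> Basis" for c d
  proof -
   have P: "C1c (%z. ?p z * pd S d f z)" by (rule C1c_mult_right[OF p f2])
   have "I (pd S c (%z. ?p z * pd S d f z)) = 0"
    by (subst divergence_theorem[OF P c], subst BM_zero) (auto simp: pM)
   moreover have "I (pd S c (%z. ?p z * pd S d f z)) = I (%z. pd S c ?p z * pd S d f z + ?p z * pd S c (pd S d f) z)"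
   proof (rule I_cong)
    fix z assume "z \<in> Om" then have "z \<in> S" using Om_S by blast
    then show "pd S c (%z. ?p z * pd S d f z) z = pd S c ?p z * pd S d f z + ?p z * pd S c (pd S d f) z"
     by (rule pd_mult[OF C1c_C1[OF p] f2])
   qed
   moreover have "\<dots> = I (%z. pd S c ?p z * pd S d f z) + I (%z. ?p z * pd S c (pd S d f) z)"
    by (rule I_add[OF Cc_mult_right[OF C1c_Cc_pd[OF p] C1_cont[OF f2]] Cc_mult_right[OF C1c_Cc[OF p] C1_cont_pd[OF f2]]])
   ultimately show ?thesis by (simp add: eq_neg_iff_add_eq_0)
  qed
  have cc: "Cc (%z. pd S c ?p z * pd S d f z)" for c d
   by (rule Cc_mult_right[OF C1c_Cc_pd[OF p] C1_cont[OF f2]])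
  have cd: "Cc (%z. ?p z * pd S c (pd S d f) z)" for c d
   by (rule Cc_mult_right[OF C1c_Cc[OF p] C1_cont_pd[OF f2]])
  have "I (%z. pd S j ?p z * pd S k f z - pd S k ?p z * pd S j f z) = 0"
   by (subst exchange_of_derivatives[OF p f1 j k], subst BM_zero) (auto simp: pM)
  then have "I (%z. pd S j ?p z * pd S k f z) = I (%z. pd S k ?p z * pd S j f z)"
   by (simp add: I_diff[OF cc cc])
  then have "I (%z. ?p z * pd S j (pd S k f) z) = I (%z. ?p z * pd S k (pd S j f) z)"
   by (simp add: e[OF j] e[OF k])
  then show "I (%z. ?p z * (pd S j (pd S k f) z - pd S k (pd S j f) z)) = 0"
   unfolding right_diff_distrib by (simp add: I_diff[OF cd cd])
 qed
 then have "?w z = 0" by (intro eq_on_S[OF cw continuous_on_const[of _ 0] _ z]) simp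
 then show ?thesis by simp
qed

end

section \<open>Wirtinger calculus on the exterior domain\<close>

locale weighted_domain = exterior_domain D U \<rho>
 for D U :: "'n::{finite,linorder} cspace set" and \<rho> :: "'n cspace => real" +
 fixes \<phi> :: "'n cspace => real"
 assumes phi2: "Ck_on 2 (U - D) \<phi>"
begin

text \<open>Both Wirtinger derivatives at once: \<open>c = - \<i>\<close> gives \<open>d/dz_j\<close> and \<open>c = \<i>\<close> gives its conjugate. Every rule
 below then needs to be proved only once.\<close>

definition Wop :: "complex => 'n => ('n cspace => complex) => 'n cspace => complex" where
 "Wop c j f z = (pd S (axis j 1) f z + c * pd S (axis j \<i>) f z) / 2"

lemma dz_W: "dz S j f = Wop (- \<i>) j f" and dzbar_W: "dzbar S j f = Wop \<i> j f"
 by (auto simp: dz_def dzbar_def Wop_def pd_def fun_eq_iff)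

lemma axis_Basis: "axis j 1 \<in> (Basis :: 'n cspace set)" "axis j \<i> \<in> (Basis :: 'n cspace set)"
 by (auto simp: Basis_vec_def Basis_complex_def)

lemma
 assumes f: "C1 S f" and g: "C1 S g" and z: "z \<in> S"
 shows W_diff: "Wop c j (%z. f z - g z) z = Wop c j f z - Wop c j g z"
  and W_mult: "Wop c j (%z. f z * g z) z = Wop c j f z * g z + f z * Wop c j g z"
  and W_cmult: "Wop c j (%z. a * f z) z = a * Wop c j f z"
  and W_const: "Wop c j (%_. a) z = 0"
  and W_minus: "Wop c j (%z. - f z) z = - Wop c j f z"
  and W_exp: "Wop c j (%z. exp (f z)) z = exp (f z) * Wop c j f z"
 by (auto simp: Wop_def pd_diff[OF f g z] pd_mult[OF f g z] pd_cmult[OF f z] pd_const[OF z]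
   pd_minus[OF f z] pd_exp[OF f z] field_simps)

lemma W_cnj:
 assumes f: "C1 S f" and z: "z \<in> S"
 shows "Wop c j (%z. cnj (f z)) z = cnj (Wop (cnj c) j f z)"
 by (simp add: Wop_def pd_cnj[OF f z])

lemma W_sum:
 assumes f: "\<And>i. i \<in> A ==> C1 S (f i)" and z: "z \<in> S"
 shows "Wop c j (%z. \<Sum>i\<in>A. f i z) z = (\<Sum>i\<in>A. Wop c j (f i) z)"
 by (simp add: Wop_def pd_sum[OF f z] sum_distrib_left sum.distrib flip: sum_divide_distrib)

lemma W_cong: "(\<And>z. z \<in> S ==> f z = g z) ==> z \<in> S ==> Wop c j f z = Wop c j g z"
 unfolding Wop_def using C1_cong_pd[of f g] by metis

lemma W_cont: "C1 S f ==> continuous_on S (Wop c j f)"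
 unfolding Wop_def[abs_def] by (intro continuous_intros C1_cont_pd) auto

lemma W_C1: "C2 f ==> C1 S (Wop c j f)"
proof -
 assume "C2 f"
 then have p: "C1 S (pd S b f)" for b by (simp add: C2_def)
 have "C1 S (%z. (1/2) * (pd S (axis j 1) f z + c * pd S (axis j \<i>) f z))"
  by (intro C1_cmult C1_add p)
 then show ?thesis by (simp add: Wop_def[abs_def])
qed

lemma W_Cc: "C1c f ==> Cc (Wop c j f)"
proof -
 assume f: "C1c f"
 have "Cc (%z. (1/2) * (pd S (axis j 1) f z + c * pd S (axis j \<i>) f z))"
  by (intro Cc_cmult Cc_add C1c_Cc_pd f)
 then show ?thesis by (simp add: Wop_def[abs_def])
qed

text \<open>Mixed Wirtinger derivatives are combinations of mixed real ones, which commute.\<close>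

lemma W_symmetric:
 assumes f: "C2 f" and z: "z \<in> S"
 shows "Wop c j (Wop d k f) z = Wop d k (Wop c j f) z"
proof -
 have p: "C1 S (pd S b f)" for b using f by (simp add: C2_def)
 have pdW: "pd S b (Wop d k f) z = (pd S b (pd S (axis k 1) f) z + d * pd S b (pd S (axis k \<i>) f) z) / 2" for b d k
 proof -
  have "pd S b (Wop d k f) z = pd S b (%z. (1/2) * (pd S (axis k 1) f z + d * pd S (axis k \<i>) f z)) z"
   by (simp add: Wop_def[abs_def])
  also have "\<dots> = (1/2) * (pd S b (pd S (axis k 1) f) z + d * pd S b (pd S (axis k \<i>) f) z)"
   by (subst pd_cmult[OF C1_add[OF p C1_cmult[OF p]] z], subst pd_add[OF p C1_cmult[OF p] z], subst pd_cmult[OF p z]) simp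
  finally show ?thesis by simp
 qed
 have sy: "pd S b (pd S b' f) z = pd S b' (pd S b f) z" if "b \<in> Basis" "b' \<in> Basis" for b b'
  by (rule symmetric_pd[OF f that z])
 show ?thesis
  unfolding Wop_def[of c j "Wop d k f" z] Wop_def[of d k "Wop c j f" z] pdW
   sy[OF axis_Basis(1)[of k] axis_Basis(1)[of j]] sy[OF axis_Basis(1)[of k] axis_Basis(2)[of j]]
   sy[OF axis_Basis(2)[of k] axis_Basis(1)[of j]] sy[OF axis_Basis(2)[of k] axis_Basis(2)[of j]]
  by (simp add: field_simps)
qed

abbreviation "Wr c j z \<equiv> Wop c j (cplx \<rho>) z"

lemma Cc_rd_mult: "Cc F ==> Cc (%z. rd b z * F z)"
 by (rule Cc_mult_left[OF _ C1_cont_pd[OF C1_rho]])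

lemma W_divergence:
 assumes f: "C1c f"
 shows "I (Wop c j f) = - BM (%z. Wr c j z * f z)"
proof -
 let ?p = "axis j 1 :: 'n cspace" and ?q = "axis j \<i> :: 'n cspace"
 have "I (Wop c j f) = I (%z. (1/2) * (pd S ?p f z + c * pd S ?q f z))" by (simp add: Wop_def[abs_def])
 also have "\<dots> = (1/2) * (I (pd S ?p f) + c * I (pd S ?q f))"
  by (simp only: I_cmult I_add[OF C1c_Cc_pd[OF f] Cc_cmult[OF C1c_Cc_pd[OF f]]])
 also have "\<dots> = - ((1/2) * (BM (%z. rd ?p z * f z) + c * BM (%z. rd ?q z * f z)))"
  by (simp add: divergence_theorem[OF f axis_Basis(1)] divergence_theorem[OF f axis_Basis(2)] algebra_simps)
 also have "(1/2) * (BM (%z. rd ?p z * f z) + c * BM (%z. rd ?q z * f z)) =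
   BM (%z. (1/2) * (rd ?p z * f z + c * (rd ?q z * f z)))"
  by (simp only: BM_cmult BM_add[OF Cc_rd_mult[OF C1c_Cc[OF f]] Cc_cmult[OF Cc_rd_mult[OF C1c_Cc[OF f]]]])
 also have "(%z. (1/2) * (rd ?p z * f z + c * (rd ?q z * f z))) = (%z. Wr c j z * f z)"
  by (simp add: Wop_def fun_eq_iff algebra_simps add_divide_distrib)
 finally show ?thesis .
qed

lemma W_exchange:
 assumes a: "C1c a" and g: "C1 S g"
 shows "I (%z. Wop c j a z * Wop d k g z - Wop d k a z * Wop c j g z) =
  - BM (%z. a z * (Wr c j z * Wop d k g z - Wr d k z * Wop c j g z))"
proof -
 let ?p = "axis j 1 :: 'n cspace" and ?p' = "axis j \<i> :: 'n cspace"
 let ?q = "axis k 1 :: 'n cspace" and ?q' = "axis k \<i> :: 'n cspace"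
 define X where "X s t = (%z. pd S s a z * pd S t g z - pd S t a z * pd S s g z)" for s t
 define Y where "Y s t = (%z. a z * (rd s z * pd S t g z - rd t z * pd S s g z))" for s t
 have X: "Cc (X s t)" for s t
  unfolding X_def by (intro Cc_diff Cc_mult_right[OF C1c_Cc_pd[OF a]] C1_cont_pd[OF g])
 have Y: "Cc (Y s t)" for s t
  unfolding Y_def by (intro Cc_mult_right[OF C1c_Cc[OF a]] continuous_on_diff continuous_on_mult C1_cont_pd g C1_rho)
 have XY: "I (X s t) = - BM (Y s t)" if "s \<in> Basis" "t \<in> Basis" for s t
  unfolding X_def Y_def by (rule exchange_of_derivatives[OF a g that])
 have "(%z. Wop c j a z * Wop d k g z - Wop d k a z * Wop c j g z) =
   (%z. (1/4) * ((X ?p ?q z + d * X ?p ?q' z) + (c * X ?p' ?q z + (c * d) * X ?p' ?q' z)))"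
  by (simp add: X_def Wop_def fun_eq_iff field_simps)
 then have "I (%z. Wop c j a z * Wop d k g z - Wop d k a z * Wop c j g z) =
   (1/4) * ((I (X ?p ?q) + d * I (X ?p ?q')) + (c * I (X ?p' ?q) + (c * d) * I (X ?p' ?q')))"
  by (simp only: I_cmult I_add[OF Cc_add[OF X Cc_cmult[OF X]] Cc_add[OF Cc_cmult[OF X] Cc_cmult[OF X]]]
    I_add[OF X Cc_cmult[OF X]] I_add[OF Cc_cmult[OF X] Cc_cmult[OF X]])
 also have "\<dots> = - ((1/4) * ((BM (Y ?p ?q) + d * BM (Y ?p ?q')) + (c * BM (Y ?p' ?q) + (c * d) * BM (Y ?p' ?q'))))"
  by (simp add: XY axis_Basis algebra_simps)
 also have "(1/4) * ((BM (Y ?p ?q) + d * BM (Y ?p ?q')) + (c * BM (Y ?p' ?q) + (c * d) * BM (Y ?p' ?q'))) =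
   BM (%z. (1/4) * ((Y ?p ?q z + d * Y ?p ?q' z) + (c * Y ?p' ?q z + (c * d) * Y ?p' ?q' z)))"
  by (simp only: BM_cmult BM_add[OF Cc_add[OF Y Cc_cmult[OF Y]] Cc_add[OF Cc_cmult[OF Y] Cc_cmult[OF Y]]]
    BM_add[OF Y Cc_cmult[OF Y]] BM_add[OF Cc_cmult[OF Y] Cc_cmult[OF Y]])
 also have "(%z. (1/4) * ((Y ?p ?q z + d * Y ?p ?q' z) + (c * Y ?p' ?q z + (c * d) * Y ?p' ?q' z))) =
   (%z. a z * (Wr c j z * Wop d k g z - Wr d k z * Wop c j g z))"
  by (simp add: Y_def Wop_def fun_eq_iff field_simps)
 finally show ?thesis .
qed

lemma C2_rho: "C2 (cplx \<rho>)" using C1_rho C1_pd_rho by (simp add: C2_def)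
lemma C2_phi: "C2 (cplx \<phi>)" using Ck2_imp_C1[OF phi2] Ck2_imp_C1_pd[OF phi2] by (simp add: C2_def)
lemma C2_C1: "C2 f ==> C1 S f" by (simp add: C2_def)

definition "E z = exp (- complex_of_real (\<phi> z))"

lemma E_real: "E z = complex_of_real (exp (- \<phi> z))" by (simp only: E_def exp_of_real flip: of_real_minus)
lemma E_cnj [simp]: "cnj (E z) = E z" by (simp add: E_real)
lemma E_nz [simp]: "E z \<noteq> 0" by (simp add: E_def)
lemma C1_E: "C1 S E" unfolding E_def[abs_def] by (intro C1_exp C1_minus C2_C1 C2_phi)
lemma W_E: "z \<in> S ==> Wop c j E z = - (E z * Wop c j (cplx \<phi>) z)"
 unfolding E_def[abs_def] using W_exp[OF C1_minus[OF C2_C1[OF C2_phi]] C1_const[of 0], where c=c and j=j and z=z] W_minus[OF C2_C1[OF C2_phi] C1_const, of z c j]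
 by (simp add: C1_minus C2_C1 C2_phi)

lemma real_W_cnj: "C1 S (cplx f) ==> z \<in> S ==> cnj (Wop c j (cplx f) z) = Wop (cnj c) j (cplx f) z"
 using W_cnj[of "cplx f" z "cnj c" j] by simp

lemma sum_Basis_cspace: "(\<Sum>b\<in>(Basis :: 'n cspace set). F b) = (\<Sum>j\<in>UNIV. F (axis j 1) + F (axis j \<i>))"
proof -
 have "(Basis :: 'n cspace set) = (\<Union>j\<in>UNIV. {axis j 1, axis j \<i>})"
  by (auto simp: Basis_vec_def Basis_complex_def)
 also have "(\<Sum>b\<in>\<dots>. F b) = (\<Sum>j\<in>UNIV. \<Sum>b\<in>{axis j 1, axis j \<i>}. F b)"
  by (rule sum.UNION_disjoint) (auto simp: axis_eq_axis)
 also have "\<dots> = (\<Sum>j\<in>UNIV. F (axis j 1) + F (axis j \<i>))"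
  by (intro sum.cong refl) (simp add: axis_eq_axis complex_eq_iff)
 finally show ?thesis .
qed

lemma grad_quarter: "z \<in> S ==> (\<Sum>j\<in>UNIV. Wr (- \<i>) j z * Wr \<i> j z) = 1/4"
proof -
 assume z: "z \<in> S"
 have "(\<Sum>j\<in>UNIV. Wr (- \<i>) j z * Wr \<i> j z) = (\<Sum>j\<in>UNIV. rd (axis j 1) z * rd (axis j 1) z + rd (axis j \<i>) z * rd (axis j \<i>) z) / 4"
  unfolding sum_divide_distrib by (intro sum.cong refl) (simp add: Wop_def field_simps)
 also have "\<dots> = 1/4" using sum_rd_sq[OF z] by (simp add: sum_Basis_cspace)
 finally show ?thesis .
qed

end

section \<open>The algebra of the second derivatives of a distance function\<close>

text \<open>The values at one point of \<open>r j = \<rho>_j\<close>, \<open>A j k = \<rho>_jk\<close> and of the Levi form \<open>h j k\<close>, the mixed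
 derivative with the second index barred. The assumption \<open>eikonal\<close> is the derivative of \<open>quarter\<close>,
 that is of \<open>\<bar>grad \<rho>\<bar>^2 = 1\<close>.\<close>

locale levi_data =
 fixes r :: "'n::finite => complex" and A h :: "'n => 'n => complex"
 assumes quarter: "(\<Sum>j\<in>UNIV. r j * cnj (r j)) = 1/4"
  and A_sym: "A j k = A k j" and h_herm: "cnj (h j k) = h k j"
  and eikonal: "(\<Sum>k\<in>UNIV. A j k * cnj (r k)) + (\<Sum>k\<in>UNIV. r k * h j k) = 0"
begin

text \<open>\<open>Q\<close> is the Levi form in the complex normal direction, so \<open>tt\<close> is the trace of the Levi form over the
 complex tangent space, which is \<open>\<tau>\<close>. The matrix \<open>P\<close> is the orthogonal projection
 to the complex tangent space, and \<open>e\<close> is the first-order error that its derivatives cause (\<open>divP\<close>).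
 \<open>aa\<close> and \<open>AA\<close> are the squared norms of \<open>al\<close> and \<open>A\<close>.\<close>

definition "al j = (\<Sum>k\<in>UNIV. A j k * cnj (r k))"
definition "Q = (\<Sum>j\<in>UNIV. \<Sum>k\<in>UNIV. cnj (r j) * r k * h j k)"
definition "T0 = (\<Sum>j\<in>UNIV. h j j)"
definition "tt = T0 - 4 * Q"
definition "e j = 4 * al j + 16 * r j * Q"
definition "P k l = (if k = l then 1 else 0) - 4 * r l * cnj (r k)"
definition "aa = (\<Sum>j\<in>UNIV. al j * cnj (al j))"
definition "AA = (\<Sum>j\<in>UNIV. \<Sum>k\<in>UNIV. A j k * cnj (A j k))"

lemma rh: "(\<Sum>k\<in>UNIV. r k * h j k) = - al j"
 using eikonal[of j] by (simp add: al_def add_eq_0_iff)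
lemma rh': "(\<Sum>j\<in>UNIV. cnj (r j) * h j k) = - cnj (al k)"
proof -
 have "cnj (\<Sum>j\<in>UNIV. r j * h k j) = (\<Sum>j\<in>UNIV. cnj (r j) * h j k)" by (simp add: h_herm)
 then show ?thesis by (simp add: rh)
qed
lemma rA: "(\<Sum>k\<in>UNIV. cnj (r k) * A k j) = al j"
 unfolding al_def by (intro sum.cong refl) (metis A_sym mult.commute)
lemma rA': "(\<Sum>m\<in>UNIV. r m * cnj (A m l)) = cnj (al l)"
proof -
 have "cnj (al l) = cnj (\<Sum>k\<in>UNIV. cnj (r k) * A k l)" by (simp add: rA)
 then show ?thesis by simp
qed
lemma ra: "(\<Sum>j\<in>UNIV. cnj (r j) * al j) = - Q"
proof -
 have "Q = (\<Sum>j\<in>UNIV. cnj (r j) * (\<Sum>k\<in>UNIV. r k * h j k))"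
  unfolding Q_def sum_distrib_left by (simp add: mult.assoc)
 then show ?thesis by (simp add: rh sum_negf)
qed
lemma ra': "(\<Sum>k\<in>UNIV. r k * cnj (al k)) = - Q"
proof -
 have "Q = (\<Sum>k\<in>UNIV. \<Sum>j\<in>UNIV. cnj (r j) * r k * h j k)" unfolding Q_def by (rule sum.swap)
 also have "\<dots> = (\<Sum>k\<in>UNIV. r k * (\<Sum>j\<in>UNIV. cnj (r j) * h j k))"
  unfolding sum_distrib_left by (intro sum.cong refl) (simp add: mult_ac)
 finally show ?thesis by (simp add: rh' sum_negf)
qed
lemma Q_real: "cnj Q = Q"
proof -
 have "cnj (- Q) = cnj (\<Sum>j\<in>UNIV. cnj (r j) * al j)" by (simp only: ra)
 also have "\<dots> = - Q" using ra' by simp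
 finally show ?thesis by simp
qed
lemma T0_real: "cnj T0 = T0" by (simp add: T0_def h_herm)
lemma tt_real: "cnj tt = tt" by (simp add: tt_def Q_real T0_real)
lemma re: "(\<Sum>j\<in>UNIV. cnj (r j) * e j) = 0"
proof -
 have "(\<Sum>j\<in>UNIV. cnj (r j) * e j) = 4 * (\<Sum>j\<in>UNIV. cnj (r j) * al j) + 16 * Q * (\<Sum>j\<in>UNIV. r j * cnj (r j))"
  unfolding sum_distrib_left sum.distrib[symmetric] by (intro sum.cong refl) (simp add: e_def algebra_simps)
 then show ?thesis by (simp add: ra quarter)
qed
lemma ee: "(\<Sum>j\<in>UNIV. e j * cnj (e j)) = 16 * aa - 64 * Q\<^sup>2"
proof -
 have "(\<Sum>j\<in>UNIV. e j * cnj (e j)) = 16 * aa + 64 * Q * (\<Sum>j\<in>UNIV. cnj (r j) * al j) + 64 * Q * (\<Sum>j\<in>UNIV. r j * cnj (al j))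
   + 256 * Q * Q * (\<Sum>j\<in>UNIV. r j * cnj (r j))"
  unfolding aa_def sum_distrib_left sum.distrib[symmetric]
  by (intro sum.cong refl) (simp add: e_def Q_real algebra_simps)
 then show ?thesis by (simp add: ra ra' quarter power2_eq_square)
qed

lemma P_sum: "(\<Sum>k\<in>UNIV. \<Sum>l\<in>UNIV. P k l * X k l) = (\<Sum>k\<in>UNIV. X k k) - 4 * (\<Sum>k\<in>UNIV. \<Sum>l\<in>UNIV. r l * cnj (r k) * X k l)"
proof -
 have "(\<Sum>l\<in>UNIV. P k l * X k l) = X k k - 4 * (\<Sum>l\<in>UNIV. r l * cnj (r k) * X k l)" for k
 proof -
  have "(\<Sum>l\<in>UNIV. P k l * X k l) = (\<Sum>l\<in>UNIV. (if l = k then X k l else 0) - 4 * (r l * cnj (r k) * X k l))"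
   by (intro sum.cong refl) (auto simp: P_def left_diff_distrib mult.assoc)
  then show ?thesis by (simp add: sum_subtractf sum_distrib_left)
 qed
 then show ?thesis by (simp add: sum_subtractf sum_distrib_left)
qed
lemma P_sum_prod: "(\<Sum>k\<in>UNIV. \<Sum>l\<in>UNIV. P k l * (x k * y l)) = (\<Sum>k\<in>UNIV. x k * y k) - 4 * (\<Sum>k\<in>UNIV. cnj (r k) * x k) * (\<Sum>l\<in>UNIV. r l * y l)"
proof -
 have "(\<Sum>k\<in>UNIV. \<Sum>l\<in>UNIV. r l * cnj (r k) * (x k * y l)) = (\<Sum>k\<in>UNIV. cnj (r k) * x k) * (\<Sum>l\<in>UNIV. r l * y l)"
  unfolding sum_product by (intro sum.cong refl) (simp add: mult_ac)
 then show ?thesis by (simp add: P_sum)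
qed
lemma P_h: "(\<Sum>k\<in>UNIV. \<Sum>l\<in>UNIV. P k l * h k l) = tt"
proof -
 have "(\<Sum>k\<in>UNIV. \<Sum>l\<in>UNIV. r l * cnj (r k) * h k l) = Q"
  unfolding Q_def by (intro sum.cong refl) (simp add: mult_ac)
 then show ?thesis by (simp add: P_sum tt_def T0_def)
qed
lemma P_r: "(\<Sum>k\<in>UNIV. P k l * r k) = 0"
proof -
 have "(\<Sum>k\<in>UNIV. P k l * r k) = (\<Sum>k\<in>UNIV. (if k = l then r k else 0) - 4 * r l * (r k * cnj (r k)))"
  by (intro sum.cong refl) (auto simp: P_def algebra_simps)
 also have "\<dots> = r l - 4 * r l * (\<Sum>k\<in>UNIV. r k * cnj (r k))"
  by (simp add: sum_subtractf sum_distrib_left)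
 finally show ?thesis by (simp add: quarter)
qed
lemma P_r': "(\<Sum>l\<in>UNIV. P k l * cnj (r l)) = 0"
proof -
 have "(\<Sum>l\<in>UNIV. P k l * cnj (r l)) = (\<Sum>l\<in>UNIV. (if l = k then cnj (r l) else 0) - 4 * cnj (r k) * (r l * cnj (r l)))"
  by (intro sum.cong refl) (auto simp: P_def algebra_simps)
 also have "\<dots> = cnj (r k) - 4 * cnj (r k) * (\<Sum>l\<in>UNIV. r l * cnj (r l))"
  by (simp add: sum_subtractf sum_distrib_left)
 finally show ?thesis by (simp add: quarter)
qed

text \<open>The summands on the left are the derivatives \<open>d/dz_k\<close> of \<open>P k l\<close>.\<close>

lemma divP: "(\<Sum>k\<in>UNIV. - 4 * (A k l * cnj (r k) + r l * h k k)) = - e l - 4 * r l * tt"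
proof -
 have "(\<Sum>k\<in>UNIV. - 4 * (A k l * cnj (r k) + r l * h k k)) = - 4 * ((\<Sum>k\<in>UNIV. cnj (r k) * A k l) + r l * T0)"
  unfolding T0_def sum_distrib_left sum.distrib[symmetric] by (intro sum.cong refl) (simp add: algebra_simps)
 also have "\<dots> = - e l - 4 * r l * tt" unfolding rA by (simp add: e_def tt_def algebra_simps)
 finally show ?thesis .
qed

text \<open>The tangential part of a vector; for \<open>x = (f_j)\<close> its components are \<open>L_j f\<close>.\<close>

definition tgl :: "('n => complex) => 'n => complex" where
 "tgl x j = x j - 4 * r j * (\<Sum>k\<in>UNIV. cnj (r k) * x k)"

lemma tgl_tangential: "(\<Sum>j\<in>UNIV. cnj (r j) * tgl x j) = 0"
proof -
 have "(\<Sum>j\<in>UNIV. cnj (r j) * tgl x j) = (\<Sum>j\<in>UNIV. cnj (r j) * x j) - 4 * (\<Sum>k\<in>UNIV. cnj (r k) * x k) * (\<Sum>j\<in>UNIV. r j * cnj (r j))"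
  unfolding sum_distrib_left sum_subtractf[symmetric] by (intro sum.cong refl) (simp add: tgl_def algebra_simps sum_distrib_left)
 then show ?thesis by (simp add: quarter)
qed
lemma tgl_dot:
 assumes "(\<Sum>j\<in>UNIV. cnj (r j) * y j) = 0"
 shows "(\<Sum>j\<in>UNIV. tgl x j * cnj (y j)) = (\<Sum>j\<in>UNIV. x j * cnj (y j))"
proof -
 have c: "(\<Sum>j\<in>UNIV. r j * cnj (y j)) = 0" using arg_cong[OF assms, of cnj] by simp
 have "(\<Sum>j\<in>UNIV. tgl x j * cnj (y j)) = (\<Sum>j\<in>UNIV. x j * cnj (y j)) - 4 * (\<Sum>k\<in>UNIV. cnj (r k) * x k) * (\<Sum>j\<in>UNIV. r j * cnj (y j))"
  unfolding sum_distrib_left sum_subtractf[symmetric] by (intro sum.cong refl) (simp add: tgl_def algebra_simps sum_distrib_left)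
 then show ?thesis by (simp add: c)
qed
lemma tgl_tgl: "(\<Sum>j\<in>UNIV. tgl x j * cnj (tgl y j)) = (\<Sum>j\<in>UNIV. x j * cnj (y j)) - 4 * (\<Sum>k\<in>UNIV. cnj (r k) * x k) * cnj (\<Sum>k\<in>UNIV. cnj (r k) * y k)"
proof -
 have "(\<Sum>j\<in>UNIV. tgl x j * cnj (tgl y j)) = (\<Sum>j\<in>UNIV. x j * cnj (tgl y j))" by (rule tgl_dot[OF tgl_tangential])
 also have "\<dots> = (\<Sum>j\<in>UNIV. x j * cnj (y j)) - 4 * (\<Sum>k\<in>UNIV. cnj (r k) * x k) * cnj (\<Sum>k\<in>UNIV. cnj (r k) * y k)"
 proof -
  have c: "cnj (tgl y j) = cnj (y j) - 4 * cnj (r j) * cnj (\<Sum>k\<in>UNIV. cnj (r k) * y k)" for j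
   by (simp add: tgl_def)
  have "(\<Sum>j\<in>UNIV. x j * cnj (tgl y j)) =
   (\<Sum>j\<in>UNIV. x j * cnj (y j) - 4 * (cnj (r j) * x j) * cnj (\<Sum>k\<in>UNIV. cnj (r k) * y k))"
   by (intro sum.cong refl, subst c) (simp only: algebra_simps)
  then show ?thesis by (simp only: sum_subtractf flip: sum_distrib_left sum_distrib_right)
 qed
 finally show ?thesis .
qed

text \<open>The left-hand side is \<open>\<eta>^2\<close>: removing the normal part of the columns of \<open>A\<close> costs \<open>4 aa\<close>.\<close>

lemma eta_sum: "(\<Sum>j\<in>UNIV. \<Sum>k\<in>UNIV. tgl (%j. A j k) j * cnj (tgl (%j. A j k) j)) = AA - 4 * aa"
proof -
 have "(\<Sum>j\<in>UNIV. \<Sum>k\<in>UNIV. tgl (%j. A j k) j * cnj (tgl (%j. A j k) j)) =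
   (\<Sum>k\<in>UNIV. \<Sum>j\<in>UNIV. tgl (%j. A j k) j * cnj (tgl (%j. A j k) j))" by (rule sum.swap)
 also have "\<dots> = (\<Sum>k\<in>UNIV. (\<Sum>j\<in>UNIV. A j k * cnj (A j k)) - 4 * al k * cnj (al k))"
  by (simp only: tgl_tgl rA)
 also have "\<dots> = (\<Sum>k\<in>UNIV. \<Sum>j\<in>UNIV. A j k * cnj (A j k)) - 4 * aa"
  by (simp add: sum_subtractf aa_def sum_distrib_left mult.assoc)
 also have "(\<Sum>k\<in>UNIV. \<Sum>j\<in>UNIV. A j k * cnj (A j k)) = AA" unfolding AA_def by (rule sum.swap)
 finally show ?thesis .
qed

text \<open>In this and the following two lemmas the left-hand side is one of the divergence expressions after all
 derivatives have been carried out with the product rule. Here \<open>F\<close> stands for \<open>\<bar>f\<bar>^2 exp (- \<phi>)\<close> and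
 \<open>F1\<close>, \<open>Fb\<close> for its derivatives.\<close>

lemma B3_algebra:
 fixes F :: complex and F1 Fb :: "'n => complex"
 shows "(\<Sum>k\<in>UNIV. \<Sum>l\<in>UNIV. \<Sum>m\<in>UNIV.
   4 * (- 4 * (A k l * cnj (r k) + r l * h k k) * (r m * F) + P k l * (A k m * F + r m * F1 k)) * cnj (A m l)
  - 4 * (- 4 * (h l m * cnj (r k) + r l * cnj (A m k)) * (r m * F) + P k l * (h m m * F + r m * Fb m)) * h k l) =
  (\<Sum>k\<in>UNIV. cnj (e k) * F1 k) - 4 * tt * (\<Sum>m\<in>UNIV. r m * Fb m)
  + F * (4 * (AA - 4 * aa) - 4 * tt\<^sup>2 - (\<Sum>j\<in>UNIV. e j * cnj (e j)))"
proof -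
 let ?S = "%f. sum f (UNIV :: 'n set)"
 define AAc where "AAc k l = ?S (%m. A k m * cnj (A m l))" for k l
 define \<beta> where "\<beta> = ?S (%m. r m * Fb m)"
 have inner: "?S (%m. 4 * (- 4 * (A k l * cnj (r k) + r l * h k k) * (r m * F) + P k l * (A k m * F + r m * F1 k)) * cnj (A m l)
  - 4 * (- 4 * (h l m * cnj (r k) + r l * cnj (A m k)) * (r m * F) + P k l * (h m m * F + r m * Fb m)) * h k l) =
  4 * F * ((- 4 * (A k l * cnj (r k) + r l * h k k)) * cnj (al l)) + 4 * F * (P k l * AAc k l) + 4 * (P k l * (F1 k * cnj (al l)))
  + 16 * F * ((r l * cnj (al k) - cnj (r k) * al l) * h k l) - 4 * (T0 * F + \<beta>) * (P k l * h k l)" for k l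
 proof -
  have "?S (%m. 4 * (- 4 * (A k l * cnj (r k) + r l * h k k) * (r m * F) + P k l * (A k m * F + r m * F1 k)) * cnj (A m l)
  - 4 * (- 4 * (h l m * cnj (r k) + r l * cnj (A m k)) * (r m * F) + P k l * (h m m * F + r m * Fb m)) * h k l) =
   4 * F * (- 4 * (A k l * cnj (r k) + r l * h k k)) * ?S (%m. r m * cnj (A m l)) + 4 * F * P k l * AAc k l
   + 4 * P k l * F1 k * ?S (%m. r m * cnj (A m l)) + 16 * F * h k l * cnj (r k) * ?S (%m. r m * h l m)
   + 16 * F * h k l * r l * ?S (%m. r m * cnj (A m k)) - 4 * P k l * h k l * F * T0 - 4 * P k l * h k l * \<beta>"
   unfolding AAc_def T0_def \<beta>_def sum_distrib_left sum.distrib[symmetric] sum_subtractf[symmetric]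
   by (intro sum.cong refl) (simp add: algebra_simps)
  then show ?thesis by (simp add: rA' rh algebra_simps)
 qed
 have p1: "?S (%k. ?S (%l. (- 4 * (A k l * cnj (r k) + r l * h k k)) * cnj (al l))) = - 4 * aa + 4 * T0 * Q"
 proof -
  have "?S (%k. ?S (%l. (- 4 * (A k l * cnj (r k) + r l * h k k)) * cnj (al l))) =
    ?S (%l. ?S (%k. - 4 * (A k l * cnj (r k) + r l * h k k)) * cnj (al l))"
   by (subst sum.swap) (simp only: sum_distrib_right)
  also have "\<dots> = ?S (%l. - 4 * (al l * cnj (al l)) - 4 * T0 * (r l * cnj (al l)))"
   unfolding divP by (intro sum.cong refl) (simp add: e_def tt_def algebra_simps)
  also have "\<dots> = - 4 * aa + 4 * T0 * Q"
   by (simp add: sum_subtractf aa_def sum_negf ra' flip: sum_distrib_left)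
  finally show ?thesis .
 qed
 have p2: "?S (%k. ?S (%l. P k l * AAc k l)) = AA - 4 * aa"
 proof -
  have 1: "?S (%k. AAc k k) = AA"
   unfolding AAc_def AA_def by (intro sum.cong refl) (metis A_sym)
  have "?S (%k. ?S (%l. r l * cnj (r k) * AAc k l)) = ?S (%k. ?S (%l. ?S (%m. (cnj (r k) * A k m) * (r l * cnj (A m l)))))"
   unfolding AAc_def sum_distrib_left by (intro sum.cong refl) (simp add: mult_ac)
  also have "\<dots> = ?S (%k. ?S (%m. ?S (%l. (cnj (r k) * A k m) * (r l * cnj (A m l)))))"
   by (intro sum.cong refl sum.swap)
  also have "\<dots> = ?S (%m. ?S (%k. ?S (%l. (cnj (r k) * A k m) * (r l * cnj (A l m)))))"
   by (subst sum.swap) (intro sum.cong refl, metis A_sym)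
  also have "\<dots> = ?S (%m. ?S (%k. cnj (r k) * A k m) * ?S (%l. r l * cnj (A l m)))"
   by (intro sum.cong refl) (simp only: sum_product)
  also have "\<dots> = aa" by (simp add: rA rA' aa_def)
  finally show ?thesis by (simp add: P_sum 1)
 qed
 have p3: "?S (%k. ?S (%l. P k l * (F1 k * cnj (al l)))) = ?S (%k. F1 k * cnj (al k)) + 4 * Q * ?S (%k. cnj (r k) * F1 k)"
  by (simp add: P_sum_prod ra')
 have p4: "?S (%k. ?S (%l. (r l * cnj (al k) - cnj (r k) * al l) * h k l)) = 0"
 proof -
  have "?S (%k. ?S (%l. (r l * cnj (al k) - cnj (r k) * al l) * h k l)) =
   ?S (%k. ?S (%l. cnj (al k) * (r l * h k l))) - ?S (%k. ?S (%l. al l * (cnj (r k) * h k l)))"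
   unfolding sum_subtractf[symmetric] by (intro sum.cong refl) (simp add: algebra_simps)
  also have "?S (%k. ?S (%l. al l * (cnj (r k) * h k l))) = ?S (%l. ?S (%k. al l * (cnj (r k) * h k l)))" by (rule sum.swap)
  finally show ?thesis by (simp add: rh rh' sum_negf mult.commute flip: sum_distrib_left)
 qed
 have "?S (%k. ?S (%l. 4 * F * ((- 4 * (A k l * cnj (r k) + r l * h k k)) * cnj (al l)) + 4 * F * (P k l * AAc k l) + 4 * (P k l * (F1 k * cnj (al l)))
  + 16 * F * ((r l * cnj (al k) - cnj (r k) * al l) * h k l) - 4 * (T0 * F + \<beta>) * (P k l * h k l))) =
   4 * F * (- 4 * aa + 4 * T0 * Q) + 4 * F * (AA - 4 * aa) + 4 * (?S (%k. F1 k * cnj (al k)) + 4 * Q * ?S (%k. cnj (r k) * F1 k))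
   + 16 * F * 0 - 4 * (T0 * F + \<beta>) * tt"
  unfolding p1[symmetric] p2[symmetric] p3[symmetric] p4[symmetric] P_h[symmetric]
  by (simp only: sum_distrib_left sum.distrib[symmetric] sum_subtractf[symmetric])
 also have "\<dots> = 4 * F * (- 4 * aa + 4 * T0 * Q) + 4 * F * (AA - 4 * aa) + ?S (%k. cnj (e k) * F1 k) - 4 * (T0 * F + \<beta>) * tt"
 proof -
  have "?S (%k. cnj (e k) * F1 k) = 4 * ?S (%k. F1 k * cnj (al k)) + 16 * Q * ?S (%k. cnj (r k) * F1 k)"
   unfolding sum_distrib_left sum.distrib[symmetric] by (intro sum.cong refl) (simp add: e_def Q_real algebra_simps)
  then show ?thesis by (simp add: algebra_simps)
 qed
 also have "\<dots> = ?S (%k. cnj (e k) * F1 k) - 4 * tt * \<beta> + F * (4 * (AA - 4 * aa) - 4 * tt\<^sup>2 - ?S (%j. e j * cnj (e j)))"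
  unfolding ee by (simp add: tt_def power2_eq_square algebra_simps)
 finally show ?thesis unfolding inner \<beta>_def .
qed

lemma B1_algebra:
 fixes f E0 :: complex and p1 f1 fb :: "'n => complex"
 assumes E0: "cnj E0 = E0"
 defines "G \<equiv> %j. tgl p1 j + e j"
 shows "(\<Sum>j\<in>UNIV. \<Sum>k\<in>UNIV.
   ((- 4 * (h j j * cnj (r k) + r j * cnj (A j k)) * E0 - P k j * E0 * cnj (p1 j)) * f + P k j * E0 * fb j) * cnj (fb k)
  - ((- 4 * (A k j * cnj (r k) + r j * h k k) * E0 - P k j * E0 * p1 k) * f + P k j * E0 * f1 k) * cnj (f1 j)) =
  E0 * ((\<Sum>j\<in>UNIV. fb j * cnj (fb j)) - 4 * (\<Sum>j\<in>UNIV. r j * fb j) * cnj (\<Sum>j\<in>UNIV. r j * fb j)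
   - (\<Sum>j\<in>UNIV. f1 j * cnj (f1 j)) + 4 * (\<Sum>j\<in>UNIV. cnj (r j) * f1 j) * cnj (\<Sum>j\<in>UNIV. cnj (r j) * f1 j))
  - E0 * f * (4 * tt * cnj (\<Sum>j\<in>UNIV. r j * fb j) + (\<Sum>k\<in>UNIV. cnj (G k) * cnj (fb k)))
  + E0 * f * (4 * tt * cnj (\<Sum>j\<in>UNIV. cnj (r j) * f1 j) + (\<Sum>j\<in>UNIV. G j * cnj (f1 j)))"
proof -
 let ?S = "%f. sum f (UNIV :: 'n set)"
 have dP: "?S (%k. P k j * p1 k) = tgl p1 j" for j
 proof -
  have "?S (%k. P k j * p1 k) = ?S (%k. (if k = j then p1 k else 0) - 4 * r j * (cnj (r k) * p1 k))"
   by (intro sum.cong refl) (auto simp: P_def algebra_simps)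
  then show ?thesis by (simp add: sum_subtractf tgl_def sum_distrib_left)
 qed
 have s1: "?S (%k. - 4 * (A k j * cnj (r k) + r j * h k k) - P k j * p1 k) = - (4 * r j * tt + G j)" for j
  by (simp only: sum_subtractf divP dP) (simp add: G_def)
 have s2: "?S (%j. - 4 * (h j j * cnj (r k) + r j * cnj (A j k)) - P k j * cnj (p1 j)) = - (4 * cnj (r k) * tt + cnj (G k))" for k
 proof -
  have "cnj (?S (%j. - 4 * (A j k * cnj (r j) + r k * h j j) - P j k * p1 j)) = cnj (- (4 * r k * tt + G k))"
   by (simp only: s1)
  moreover have "cnj (P j k) = P k j" for j by (auto simp: P_def)
  ultimately have "?S (%j. - 4 * (cnj (A j k) * r j + cnj (r k) * h j j) - P k j * cnj (p1 j)) = - (4 * cnj (r k) * tt + cnj (G k))"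
   by (simp add: h_herm tt_real)
  moreover have "?S (%j. - 4 * (cnj (A j k) * r j + cnj (r k) * h j j) - P k j * cnj (p1 j)) =
    ?S (%j. - 4 * (h j j * cnj (r k) + r j * cnj (A j k)) - P k j * cnj (p1 j))"
   by (intro sum.cong refl) (simp add: algebra_simps)
  ultimately show ?thesis by simp
 qed
 have "?S (%j. ?S (%k.
   ((- 4 * (h j j * cnj (r k) + r j * cnj (A j k)) * E0 - P k j * E0 * cnj (p1 j)) * f + P k j * E0 * fb j) * cnj (fb k)
  - ((- 4 * (A k j * cnj (r k) + r j * h k k) * E0 - P k j * E0 * p1 k) * f + P k j * E0 * f1 k) * cnj (f1 j))) =
   E0 * f * ?S (%j. ?S (%k. (- 4 * (h j j * cnj (r k) + r j * cnj (A j k)) - P k j * cnj (p1 j)) * cnj (fb k)))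
   + E0 * ?S (%j. ?S (%k. P k j * (cnj (fb k) * fb j)))
   - E0 * f * ?S (%j. ?S (%k. (- 4 * (A k j * cnj (r k) + r j * h k k) - P k j * p1 k) * cnj (f1 j)))
   - E0 * ?S (%j. ?S (%k. P k j * (f1 k * cnj (f1 j))))"
  unfolding sum_distrib_left sum.distrib[symmetric] sum_subtractf[symmetric]
  by (intro sum.cong refl) (simp add: algebra_simps)
 also have "?S (%j. ?S (%k. (- 4 * (h j j * cnj (r k) + r j * cnj (A j k)) - P k j * cnj (p1 j)) * cnj (fb k))) =
   ?S (%k. - (4 * cnj (r k) * tt + cnj (G k)) * cnj (fb k))"
  by (subst sum.swap) (simp only: s2 flip: sum_distrib_right)
 also have "\<dots> = - (4 * tt * cnj (?S (%j. r j * fb j)) + ?S (%k. cnj (G k) * cnj (fb k)))"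
  unfolding cnj_sum sum_distrib_left sum.distrib[symmetric] sum_negf[symmetric]
  by (intro sum.cong refl) (simp add: algebra_simps)
 also have "?S (%j. ?S (%k. (- 4 * (A k j * cnj (r k) + r j * h k k) - P k j * p1 k) * cnj (f1 j))) =
   ?S (%j. - (4 * r j * tt + G j) * cnj (f1 j))"
  by (simp only: s1 flip: sum_distrib_right)
 also have "\<dots> = - (4 * tt * cnj (?S (%j. cnj (r j) * f1 j)) + ?S (%j. G j * cnj (f1 j)))"
  unfolding cnj_sum sum_distrib_left sum.distrib[symmetric] sum_negf[symmetric]
  by (intro sum.cong refl) (simp add: algebra_simps)
 also have "?S (%j. ?S (%k. P k j * (cnj (fb k) * fb j))) = ?S (%j. fb j * cnj (fb j)) - 4 * ?S (%j. r j * fb j) * cnj (?S (%j. r j * fb j))"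
 proof -
  have "?S (%j. ?S (%k. P k j * (cnj (fb k) * fb j))) = ?S (%k. ?S (%j. P k j * (cnj (fb k) * fb j)))" by (rule sum.swap)
  also have "\<dots> = ?S (%k. cnj (fb k) * fb k) - 4 * ?S (%k. cnj (r k) * cnj (fb k)) * ?S (%j. r j * fb j)" by (rule P_sum_prod)
  finally show ?thesis by (simp add: mult_ac)
 qed
 also have "?S (%j. ?S (%k. P k j * (f1 k * cnj (f1 j)))) = ?S (%j. f1 j * cnj (f1 j)) - 4 * ?S (%j. cnj (r j) * f1 j) * cnj (?S (%j. cnj (r j) * f1 j))"
 proof -
  have "?S (%j. ?S (%k. P k j * (f1 k * cnj (f1 j)))) = ?S (%k. ?S (%j. P k j * (f1 k * cnj (f1 j))))" by (rule sum.swap)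
  also have "\<dots> = ?S (%k. f1 k * cnj (f1 k)) - 4 * ?S (%k. cnj (r k) * f1 k) * ?S (%j. r j * cnj (f1 j))" by (rule P_sum_prod)
  finally show ?thesis by simp
 qed
 finally show ?thesis by (simp add: algebra_simps)
qed

lemma B2_algebra:
 fixes F :: complex and p1 F1 :: "'n => complex" and p2 :: "'n => 'n => complex"
 shows "(\<Sum>m\<in>UNIV. \<Sum>k\<in>UNIV. p2 k m * (P k m * F) + cnj (p1 m) * (- 4 * (A k m * cnj (r k) + r m * h k k) * F + P k m * F1 k)) =
  F * (\<Sum>m\<in>UNIV. \<Sum>k\<in>UNIV. P k m * p2 k m) - F * (\<Sum>m\<in>UNIV. cnj (p1 m) * e m) - 4 * tt * F * (\<Sum>m\<in>UNIV. r m * cnj (p1 m))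
  + (\<Sum>k\<in>UNIV. cnj (tgl p1 k) * F1 k)"
proof -
 let ?S = "%f. sum f (UNIV :: 'n set)"
 have "?S (%m. ?S (%k. p2 k m * (P k m * F) + cnj (p1 m) * (- 4 * (A k m * cnj (r k) + r m * h k k) * F + P k m * F1 k))) =
   F * ?S (%m. ?S (%k. P k m * p2 k m)) + F * ?S (%m. cnj (p1 m) * ?S (%k. - 4 * (A k m * cnj (r k) + r m * h k k)))
   + ?S (%m. ?S (%k. P k m * (F1 k * cnj (p1 m))))"
  unfolding sum_distrib_left sum.distrib[symmetric] by (intro sum.cong refl) (simp add: algebra_simps)
 also have "F * ?S (%m. cnj (p1 m) * ?S (%k. - 4 * (A k m * cnj (r k) + r m * h k k))) =
   - F * ?S (%m. cnj (p1 m) * e m) - 4 * tt * F * ?S (%m. r m * cnj (p1 m))"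
  unfolding divP sum_distrib_left sum_subtractf[symmetric] by (intro sum.cong refl) (simp add: algebra_simps)
 also have "?S (%m. ?S (%k. P k m * (F1 k * cnj (p1 m)))) = ?S (%k. cnj (tgl p1 k) * F1 k)"
 proof -
  have "?S (%m. ?S (%k. P k m * (F1 k * cnj (p1 m)))) = ?S (%k. ?S (%m. P k m * (F1 k * cnj (p1 m))))" by (rule sum.swap)
  also have "\<dots> = ?S (%k. F1 k * cnj (p1 k)) - 4 * ?S (%k. cnj (r k) * F1 k) * ?S (%l. r l * cnj (p1 l))" by (rule P_sum_prod)
  also have "\<dots> = ?S (%k. cnj (tgl p1 k) * F1 k)"
  proof -
   have "cnj (tgl p1 k) * F1 k = F1 k * cnj (p1 k) - 4 * (cnj (r k) * F1 k) * ?S (%l. r l * cnj (p1 l))" for k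
    by (simp add: tgl_def algebra_simps)
   then have "?S (%k. cnj (tgl p1 k) * F1 k) = ?S (%k. F1 k * cnj (p1 k) - 4 * (cnj (r k) * F1 k) * ?S (%l. r l * cnj (p1 l)))"
    by simp
   then show ?thesis by (simp only: sum_subtractf flip: sum_distrib_left sum_distrib_right)
  qed
  finally show ?thesis .
 qed
 finally show ?thesis by simp
qed

text \<open>\<open>E0\<close> stands for \<open>exp (- \<phi>)\<close>, and \<open>p1\<close>, \<open>f1\<close>, \<open>fb\<close> for the derivatives of \<open>\<phi>\<close> and \<open>f\<close>. The adjoint
 of \<open>conj L_j\<close> acts as \<open>G j f - L_j f\<close>, up to the multiple \<open>4 \<rho>_j \<tau> f\<close> that is subtracted in the
 identity to be proved. Squaring it produces \<open>\<bar>G\<bar>^2 \<bar>f\<bar>^2\<close>, which is cancelled by the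
 contributions of \<open>B2\<close> and \<open>B3\<close> that contain no derivative of \<open>f\<close> (\<open>GGe\<close> in the proof).\<close>

lemma scalar_algebra:
 fixes f E0 gam :: complex and p1 f1 fb F1 Fb :: "'n => complex"
 defines "F \<equiv> f * cnj f * E0"
 defines "G \<equiv> %j. tgl p1 j + e j"
 assumes F1: "\<And>k. F1 k = E0 * (f1 k * cnj f + f * cnj (fb k)) - p1 k * F"
  and Fb: "\<And>k. Fb k = E0 * (fb k * cnj f + f * cnj (f1 k)) - cnj (p1 k) * F"
 shows "E0 * (\<Sum>j\<in>UNIV. fb j * cnj (fb j)) + gam * F + 4 * (AA - 4 * aa) * F
   - 1/4 * E0 * ((4 * (\<Sum>j\<in>UNIV. r j * fb j) + 4 * tt * f) * cnj (4 * (\<Sum>j\<in>UNIV. r j * fb j) + 4 * tt * f))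
   - E0 * (\<Sum>j\<in>UNIV. (G j * f - tgl f1 j) * cnj (G j * f - tgl f1 j))
  = (E0 * ((\<Sum>j\<in>UNIV. fb j * cnj (fb j)) - 4 * (\<Sum>j\<in>UNIV. r j * fb j) * cnj (\<Sum>j\<in>UNIV. r j * fb j)
   - (\<Sum>j\<in>UNIV. f1 j * cnj (f1 j)) + 4 * (\<Sum>j\<in>UNIV. cnj (r j) * f1 j) * cnj (\<Sum>j\<in>UNIV. cnj (r j) * f1 j))
  - E0 * f * (4 * tt * cnj (\<Sum>j\<in>UNIV. r j * fb j) + (\<Sum>k\<in>UNIV. cnj (G k) * cnj (fb k)))
  + E0 * f * (4 * tt * cnj (\<Sum>j\<in>UNIV. cnj (r j) * f1 j) + (\<Sum>j\<in>UNIV. G j * cnj (f1 j))))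
  + (F * gam - F * (\<Sum>m\<in>UNIV. cnj (p1 m) * e m) - 4 * tt * F * (\<Sum>m\<in>UNIV. r m * cnj (p1 m))
  + (\<Sum>k\<in>UNIV. cnj (tgl p1 k) * F1 k))
  + ((\<Sum>k\<in>UNIV. cnj (e k) * F1 k) - 4 * tt * (\<Sum>m\<in>UNIV. r m * Fb m)
  + F * (4 * (AA - 4 * aa) - 4 * tt\<^sup>2 - (\<Sum>j\<in>UNIV. e j * cnj (e j))))"
proof -
 let ?S = "%f. sum f (UNIV :: 'n set)"
 define p n where "p = ?S (%j. r j * fb j)" and "n = ?S (%j. cnj (r j) * f1 j)"
 define s1 where "s1 = ?S (%j. cnj (G j) * f1 j)"
 define s2 where "s2 = ?S (%k. cnj (G k) * cnj (fb k))"
 define GG where "GG = ?S (%j. G j * cnj (G j))"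
 have Gt: "?S (%j. cnj (r j) * G j) = 0"
  by (simp add: G_def distrib_left sum.distrib tgl_tangential re)
 have c1: "cnj s1 = ?S (%j. G j * cnj (f1 j))" by (simp add: s1_def)
 have LG: "?S (%j. tgl x j * cnj (G j)) = ?S (%j. x j * cnj (G j))" for x by (rule tgl_dot[OF Gt])
 have LG': "?S (%j. G j * cnj (tgl x j)) = ?S (%j. G j * cnj (x j))" for x
  using arg_cong[OF LG[of x], of cnj] by (simp add: mult.commute)
 have sq: "?S (%j. (G j * f - tgl f1 j) * cnj (G j * f - tgl f1 j)) =
   GG * (f * cnj f) - f * cnj s1 - cnj f * s1 + (?S (%j. f1 j * cnj (f1 j)) - 4 * n * cnj n)"
 proof -
  have "?S (%j. (G j * f - tgl f1 j) * cnj (G j * f - tgl f1 j)) =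
    GG * (f * cnj f) - f * ?S (%j. G j * cnj (tgl f1 j)) - cnj f * ?S (%j. tgl f1 j * cnj (G j)) + ?S (%j. tgl f1 j * cnj (tgl f1 j))"
   unfolding GG_def sum_distrib_left sum_distrib_right sum.distrib[symmetric] sum_subtractf[symmetric]
   by (intro sum.cong refl) (simp add: algebra_simps)
  moreover have "?S (%j. f1 j * cnj (G j)) = s1" unfolding s1_def by (intro sum.cong refl) (simp add: mult.commute)
  ultimately show ?thesis by (simp only: LG LG' tgl_tgl c1 n_def)
 qed
 have GF: "?S (%k. cnj (tgl p1 k) * F1 k) + ?S (%k. cnj (e k) * F1 k) = E0 * (cnj f * s1 + f * s2) - F * ?S (%k. cnj (G k) * p1 k)"
  unfolding s1_def s2_def sum_distrib_left sum.distrib[symmetric] sum_subtractf[symmetric]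
  by (intro sum.cong refl) (simp add: F1 G_def algebra_simps)
 have rF: "?S (%m. r m * Fb m) = E0 * (p * cnj f + f * cnj n) - F * ?S (%m. r m * cnj (p1 m))"
  unfolding p_def n_def cnj_sum sum_distrib_left sum_distrib_right sum.distrib[symmetric] sum_subtractf[symmetric]
  by (intro sum.cong refl) (simp add: Fb algebra_simps)
 have GGe: "GG = ?S (%k. cnj (G k) * p1 k) + ?S (%m. cnj (p1 m) * e m) + ?S (%j. e j * cnj (e j))"
 proof -
  have "GG = ?S (%j. tgl p1 j * cnj (G j)) + ?S (%j. cnj (tgl p1 j) * e j) + ?S (%j. e j * cnj (e j))"
   unfolding GG_def sum.distrib[symmetric] by (intro sum.cong refl) (simp add: G_def algebra_simps)
  moreover have "?S (%j. cnj (tgl p1 j) * e j) = ?S (%m. cnj (p1 m) * e m)"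
   using arg_cong[OF tgl_dot[OF re, of p1], of cnj] by simp
  moreover have "?S (%j. p1 j * cnj (G j)) = ?S (%k. cnj (G k) * p1 k)" by (intro sum.cong refl) (simp add: mult.commute)
  ultimately show ?thesis by (simp only: LG)
 qed
 show ?thesis
  unfolding sq rF c1[symmetric] s2_def[symmetric] p_def[symmetric] n_def[symmetric]
  using GF GGe unfolding F_def
  by (simp add: tt_real algebra_simps power2_eq_square)
qed

end

section \<open>The integral identity for a scalar function\<close>

context weighted_domain
begin

text \<open>The data of \<open>levi_data\<close> as functions of the point: \<open>Rz\<close>, \<open>Rb\<close> are the derivatives of \<open>\<rho>\<close>, \<open>A2\<close>, \<open>H2\<close>
 the second ones, \<open>Pt\<close> the projection \<open>P\<close> and \<open>ta\<close> the function \<open>\<tau>\<close>.\<close>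

definition "Rz j z = Wr (- \<i>) j z"
definition "Rb j z = Wr \<i> j z"
definition "A2 j k z = Wop (- \<i>) j (Rz k) z"
definition "H2 j k z = Wop (- \<i>) j (Rb k) z"
definition "Pt k l z = (if k = l then 1 else 0) - 4 * Rz l z * Rb k z"
definition "ta z = levi_data.tt (%j. Rz j z) (%j k. H2 j k z)"

lemma C1_Rz: "C1 S (Rz j)" and C1_Rb: "C1 S (Rb j)"
 using W_C1[OF C2_rho] by (simp_all add: Rz_def[abs_def] Rb_def[abs_def])
lemma cnj_Rz: "z \<in> S ==> cnj (Rz j z) = Rb j z" and cnj_Rb: "z \<in> S ==> cnj (Rb j z) = Rz j z"
 by (simp_all add: Rz_def Rb_def real_W_cnj[OF C1_rho])

lemma W_Rb: "z \<in> S ==> Wop c j (Rb k) z = cnj (Wop (cnj c) j (Rz k) z)"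
 using W_cnj[OF C1_Rz, of z c j k] W_cong[of "%z. cnj (Rz k z)" "Rb k" z c j] cnj_Rz by simp

lemma W_R:
 assumes z: "z \<in> S"
 shows "Wop (- \<i>) j (Rz k) z = A2 j k z" "Wop (- \<i>) j (Rb k) z = H2 j k z"
  "Wop \<i> j (Rb k) z = cnj (A2 j k z)" "Wop \<i> j (Rz k) z = H2 k j z"
proof -
 show "Wop (- \<i>) j (Rz k) z = A2 j k z" "Wop (- \<i>) j (Rb k) z = H2 j k z" by (simp_all add: A2_def H2_def)
 show "Wop \<i> j (Rb k) z = cnj (A2 j k z)" by (simp add: A2_def W_Rb[OF z])
 show "Wop \<i> j (Rz k) z = H2 k j z"
  using W_symmetric[OF C2_rho z, of "\<i>" j "- \<i>" k] by (simp add: H2_def Rz_def[abs_def] Rb_def[abs_def])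
qed

lemma levi: assumes z: "z \<in> S" shows "levi_data (%j. Rz j z) (%j k. A2 j k z) (%j k. H2 j k z)"
proof
 show "(\<Sum>j\<in>UNIV. Rz j z * cnj (Rz j z)) = 1/4"
  using grad_quarter[OF z] by (simp add: Rz_def real_W_cnj[OF C1_rho z])
 fix j k
 show "A2 j k z = A2 k j z"
  using W_symmetric[OF C2_rho z, of "- \<i>" j "- \<i>" k] by (simp add: A2_def Rz_def[abs_def])
 show "cnj (H2 j k z) = H2 k j z"
  using W_Rb[OF z, of "- \<i>" j k] W_R(4)[OF z, of j k] by (simp add: H2_def)
 have "Wop (- \<i>) j (%z. \<Sum>k\<in>UNIV. Rz k z * Rb k z) z = Wop (- \<i>) j (%z. 1/4) z"
  by (rule W_cong[OF _ z]) (simp add: Rz_def Rb_def grad_quarter)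
 also have "\<dots> = 0" by (rule W_const[OF C1_const C1_const z])
 also have "Wop (- \<i>) j (%z. \<Sum>k\<in>UNIV. Rz k z * Rb k z) z = (\<Sum>k\<in>UNIV. A2 j k z * Rb k z + Rz k z * H2 j k z)"
  by (subst W_sum[OF C1_mult[OF C1_Rz C1_Rb] z]) (simp add: W_mult[OF C1_Rz C1_Rb z] W_R[OF z])
 finally show "(\<Sum>k\<in>UNIV. A2 j k z * cnj (Rz k z)) + (\<Sum>k\<in>UNIV. Rz k z * H2 j k z) = 0"
  by (simp add: sum.distrib cnj_Rz[OF z])
qed

lemma P_Pt: "z \<in> S ==> levi_data.P (%j. Rz j z) k l = Pt k l z"
 by (simp add: levi_data.P_def[OF levi] Pt_def cnj_Rz)

lemma C1_Pt: "C1 S (Pt k l)"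
 unfolding Pt_def[abs_def] by (intro C1_diff C1_mult C1_const C1_Rz C1_Rb)

lemma W_Pt: assumes z: "z \<in> S"
 shows "Wop c j (Pt k l) z = - 4 * (Wop c j (Rz l) z * Rb k z + Rz l z * Wop c j (Rb k) z)"
proof -
 have "Wop c j (Pt k l) z = Wop c j (%z. (if k = l then 1 else 0) - 4 * (Rz l z * Rb k z)) z"
  by (simp add: Pt_def[abs_def] mult.assoc)
 also have "\<dots> = 0 - 4 * (Wop c j (Rz l) z * Rb k z + Rz l z * Wop c j (Rb k) z)"
  by (subst W_diff[OF C1_const C1_cmult[OF C1_mult[OF C1_Rz C1_Rb]] z],
    subst W_const[OF C1_const C1_const z], subst W_cmult[OF C1_mult[OF C1_Rz C1_Rb] C1_const z],
    subst W_mult[OF C1_Rz C1_Rb z]) simp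
 finally show ?thesis by simp
qed

lemma W_exchange_Cc:
 assumes a: "C1c a" and g: "C1 S g"
 shows "Cc (%z. Wop c j a z * Wop d k g z - Wop d k a z * Wop c j g z)"
  and "Cc (%z. a z * (Wr c j z * Wop d k g z - Wr d k z * Wop c j g z))"
proof -
 show "Cc (%z. Wop c j a z * Wop d k g z - Wop d k a z * Wop c j g z)"
  by (intro Cc_diff Cc_mult_right W_Cc[OF a] W_cont[OF g])
 show "Cc (%z. a z * (Wr c j z * Wop d k g z - Wr d k z * Wop c j g z))"
  by (intro Cc_mult_right[OF C1c_Cc[OF a]] continuous_on_diff continuous_on_mult W_cont g C1_rho)
qed

lemma W_exchange_sum:
 assumes a: "\<And>i. i \<in> X ==> C1c (a i)" and g: "\<And>i. i \<in> X ==> C1 S (g i)"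
 shows "I (%z. \<Sum>i\<in>X. Wop c (j i) (a i) z * Wop d (k i) (g i) z - Wop d (k i) (a i) z * Wop c (j i) (g i) z) =
  - BM (%z. \<Sum>i\<in>X. a i z * (Wr c (j i) z * Wop d (k i) (g i) z - Wr d (k i) z * Wop c (j i) (g i) z))"
  and "Cc (%z. \<Sum>i\<in>X. Wop c (j i) (a i) z * Wop d (k i) (g i) z - Wop d (k i) (a i) z * Wop c (j i) (g i) z)"
 by (simp_all add: I_sum BM_sum Cc_sum W_exchange_Cc a g W_exchange flip: sum_negf)

text \<open>The density of the weighted norm of \<open>f\<close>.\<close>

definition "FF f z = f z * cnj (f z) * E z"

lemma C1c_FF: "C1c f ==> C1c (FF f)"
 unfolding FF_def[abs_def] by (intro C1c_mult_right C1_cnj C1c_C1 C1_E)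

lemma W_FF: assumes f: "C1c f" and z: "z \<in> S"
 shows "Wop c j (FF f) z = E z * (Wop c j f z * cnj (f z) + f z * cnj (Wop (cnj c) j f z)) - Wop c j (cplx \<phi>) z * FF f z"
proof -
 note f1 = C1c_C1[OF f]
 have "Wop c j (FF f) z = (Wop c j f z * cnj (f z) + f z * cnj (Wop (cnj c) j f z)) * E z + f z * cnj (f z) * (- (E z * Wop c j (cplx \<phi>) z))"
  unfolding FF_def[abs_def]
  by (subst W_mult[OF C1_mult[OF f1 C1_cnj[OF f1]] C1_E z], subst W_mult[OF f1 C1_cnj[OF f1] z])
    (simp add: W_cnj[OF f1 z] W_E[OF z])
 then show ?thesis by (simp add: FF_def algebra_simps)
qed

text \<open>The scalar functions of the identity in explicit form: \<open>Aj f j\<close> is the adjoint of \<open>conj L_j\<close> applied to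
 \<open>f\<close>, minus \<open>4 \<rho>_j \<tau> f\<close>; \<open>gam\<close>, \<open>et2\<close> and \<open>Nb f\<close> are \<open>\<gamma>\<close>, \<open>\<eta>^2\<close> and \<open>conj N f\<close>.\<close>

definition "Gc j z = levi_data.tgl (%j. Rz j z) (%j. Wop (- \<i>) j (cplx \<phi>) z) j + levi_data.e (%j. Rz j z) (%j k. A2 j k z) (%j k. H2 j k z) j"
definition "Aj f j z = Gc j z * f z - levi_data.tgl (%j. Rz j z) (%j. Wop (- \<i>) j f z) j"
definition "gam z = (\<Sum>m\<in>UNIV. \<Sum>k\<in>UNIV. Pt k m z * Wop (- \<i>) k (Wop \<i> m (cplx \<phi>)) z)"
definition "et2 z = (\<Sum>j\<in>UNIV. \<Sum>k\<in>UNIV. levi_data.tgl (%j. Rz j z) (%j. A2 j k z) j * cnj (levi_data.tgl (%j. Rz j z) (%j. A2 j k z) j))"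
definition "Nb f z = 4 * (\<Sum>j\<in>UNIV. Rz j z * Wop \<i> j f z)"

text \<open>Three integrands whose integrals are boundary integrals. \<open>B1\<close> exchanges \<open>conj L_j f\<close> for \<open>L_j f\<close>, \<open>B2\<close>
 is a tangential divergence that trades the first derivatives of \<open>\<phi>\<close> for \<open>\<gamma>\<close>, and \<open>B3\<close> does the same
 for the second derivatives of \<open>\<rho>\<close>. Sums over several indices are sums over pairs and triples, which
 lets the rules for finite sums be applied once.\<close>

definition "B1 f z = (\<Sum>i\<in>UNIV. Wop \<i> (fst i) (%z. Pt (snd i) (fst i) z * E z * f z) z * Wop (- \<i>) (snd i) (%z. cnj (f z)) z
  - Wop (- \<i>) (snd i) (%z. Pt (snd i) (fst i) z * E z * f z) z * Wop \<i> (fst i) (%z. cnj (f z)) z)"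
definition "B2 f z = (\<Sum>i\<in>UNIV. Wop (- \<i>) (snd i) (%z. Wop \<i> (fst i) (cplx \<phi>) z * (Pt (snd i) (fst i) z * FF f z)) z)"
definition "B3 f z = (\<Sum>i\<in>UNIV. Wop (- \<i>) (fst i) (%z. 4 * Pt (fst i) (fst (snd i)) z * (Rz (snd (snd i)) z * FF f z)) z * Wop \<i> (snd (snd i)) (Rb (fst (snd i))) z
  - Wop \<i> (snd (snd i)) (%z. 4 * Pt (fst i) (fst (snd i)) z * (Rz (snd (snd i)) z * FF f z)) z * Wop (- \<i>) (fst i) (Rb (fst (snd i))) z)"

lemma sum_prod2: "(\<Sum>i\<in>(UNIV :: ('n \<times> 'n) set). F (fst i) (snd i)) = (\<Sum>j\<in>UNIV. \<Sum>k\<in>UNIV. F j k)"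
 by (simp add: sum.cartesian_product case_prod_beta)
lemma sum_prod3: "(\<Sum>i\<in>(UNIV :: ('n \<times> 'n \<times> 'n) set). F (fst i) (fst (snd i)) (snd (snd i))) = (\<Sum>j\<in>UNIV. \<Sum>k\<in>UNIV. \<Sum>l\<in>UNIV. F j k l)"
 by (simp add: sum.cartesian_product case_prod_beta)

text \<open>The boundary term contains the projection \<open>P\<close> applied to the normal, which is zero. The same
 happens for \<open>B2\<close>.\<close>

lemma I_B1: assumes f: "C1c f" shows "I (B1 f) = 0" and "Cc (B1 f)"
proof -
 note f1 = C1c_C1[OF f]
 have a: "C1c (%z. Pt k j z * E z * f z)" for k j by (intro C1c_mult_left[OF f] C1_mult C1_Pt C1_E)
 show "Cc (B1 f)" unfolding B1_def[abs_def] by (rule W_exchange_sum(2)[OF a C1_cnj[OF f1]])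
 have "I (B1 f) = - BM (%z. \<Sum>i\<in>UNIV. (Pt (snd i) (fst i) z * E z * f z) *
   (Wr \<i> (fst i) z * Wop (- \<i>) (snd i) (%z. cnj (f z)) z - Wr (- \<i>) (snd i) z * Wop \<i> (fst i) (%z. cnj (f z)) z))"
  unfolding B1_def[abs_def] by (rule W_exchange_sum(1)[OF a C1_cnj[OF f1]])
 also have "\<dots> = 0"
 proof (subst BM_zero)
  fix z assume "z \<in> M"
  then have z: "z \<in> S" using M_sub by blast
  interpret L: levi_data "%j. Rz j z" "%j k. A2 j k z" "%j k. H2 j k z" by (rule levi[OF z])
  let ?g = "%z. cnj (f z)"
  have "(\<Sum>i\<in>UNIV. (Pt (snd i) (fst i) z * E z * f z) * (Wr \<i> (fst i) z * Wop (- \<i>) (snd i) ?g z - Wr (- \<i>) (snd i) z * Wop \<i> (fst i) ?g z)) =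
   (\<Sum>j\<in>UNIV. \<Sum>k\<in>UNIV. (Pt k j z * E z * f z) * (Rb j z * Wop (- \<i>) k ?g z - Rz k z * Wop \<i> j ?g z))"
   unfolding Rz_def Rb_def by (rule sum_prod2)
  also have "\<dots> = E z * f z * ((\<Sum>j\<in>UNIV. \<Sum>k\<in>UNIV. Wop (- \<i>) k ?g z * (Pt k j z * Rb j z)) - (\<Sum>j\<in>UNIV. \<Sum>k\<in>UNIV. Wop \<i> j ?g z * (Pt k j z * Rz k z)))"
   unfolding sum_subtractf[symmetric] sum_distrib_left by (intro sum.cong refl) (simp add: algebra_simps)
  also have "(\<Sum>j\<in>UNIV. \<Sum>k\<in>UNIV. Wop (- \<i>) k ?g z * (Pt k j z * Rb j z)) = (\<Sum>k\<in>UNIV. \<Sum>j\<in>UNIV. Wop (- \<i>) k ?g z * (Pt k j z * Rb j z))"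
   by (rule sum.swap)
  finally show "(\<Sum>i\<in>UNIV. (Pt (snd i) (fst i) z * E z * f z) * (Wr \<i> (fst i) z * Wop (- \<i>) (snd i) ?g z - Wr (- \<i>) (snd i) z * Wop \<i> (fst i) ?g z)) = 0"
   using L.P_r L.P_r' by (simp add: P_Pt[OF z] cnj_Rz[OF z] flip: sum_distrib_left)
 qed simp
 finally show "I (B1 f) = 0" .
qed

lemma I_B2: assumes f: "C1c f" shows "I (B2 f) = 0" and "Cc (B2 f)"
proof -
 have a: "C1c (%z. Wop \<i> m (cplx \<phi>) z * (Pt k m z * FF f z))" for k m
  by (intro C1c_mult_left C1c_FF f C1_Pt W_C1 C2_phi)
 show "Cc (B2 f)" unfolding B2_def[abs_def] by (intro Cc_sum W_Cc a)
 have "I (B2 f) = (\<Sum>i\<in>UNIV. - BM (%z. Wr (- \<i>) (snd i) z * (Wop \<i> (fst i) (cplx \<phi>) z * (Pt (snd i) (fst i) z * FF f z))))"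
  unfolding B2_def[abs_def] by (simp add: I_sum W_Cc a W_divergence)
 also have "\<dots> = - BM (%z. \<Sum>i\<in>UNIV. Wr (- \<i>) (snd i) z * (Wop \<i> (fst i) (cplx \<phi>) z * (Pt (snd i) (fst i) z * FF f z)))"
  by (subst BM_sum) (auto simp: sum_negf intro!: Cc_mult_left[OF C1c_Cc[OF a]] W_cont C1_rho)
 also have "\<dots> = 0"
 proof (subst BM_zero)
  fix z assume "z \<in> M"
  then have z: "z \<in> S" using M_sub by blast
  interpret L: levi_data "%j. Rz j z" "%j k. A2 j k z" "%j k. H2 j k z" by (rule levi[OF z])
  have "(\<Sum>i\<in>UNIV. Wr (- \<i>) (snd i) z * (Wop \<i> (fst i) (cplx \<phi>) z * (Pt (snd i) (fst i) z * FF f z))) =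
    (\<Sum>m\<in>UNIV. \<Sum>k\<in>UNIV. Rz k z * (Wop \<i> m (cplx \<phi>) z * (Pt k m z * FF f z)))"
   unfolding Rz_def by (rule sum_prod2)
  also have "\<dots> = (\<Sum>m\<in>UNIV. (Wop \<i> m (cplx \<phi>) z * FF f z) * (\<Sum>k\<in>UNIV. Pt k m z * Rz k z))"
   unfolding sum_distrib_left by (intro sum.cong refl) (simp add: algebra_simps)
  finally show "(\<Sum>i\<in>UNIV. Wr (- \<i>) (snd i) z * (Wop \<i> (fst i) (cplx \<phi>) z * (Pt (snd i) (fst i) z * FF f z))) = 0"
   using L.P_r by (simp add: P_Pt[OF z])
 qed simp
 finally show "I (B2 f) = 0" .
qed

text \<open>On the boundary, half of the terms contain \<open>P\<close> applied to the normal and vanish; the others contract \<open>P\<close>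
 with the Levi form, which is \<open>\<tau>\<close>.\<close>

lemma I_B3: assumes f: "C1c f" shows "I (B3 f) = BM (%z. ta z * FF f z)" and "Cc (B3 f)"
proof -
 have a: "C1c (%z. 4 * Pt k l z * (Rz m z * FF f z))" for k l m
  by (intro C1c_mult_left C1c_FF f C1_cmult C1_Pt C1_Rz)
 show "Cc (B3 f)" unfolding B3_def[abs_def] by (rule W_exchange_sum(2)[OF a C1_Rb])
 have "I (B3 f) = - BM (%z. \<Sum>i\<in>UNIV. (4 * Pt (fst i) (fst (snd i)) z * (Rz (snd (snd i)) z * FF f z)) *
   (Wr (- \<i>) (fst i) z * Wop \<i> (snd (snd i)) (Rb (fst (snd i))) z - Wr \<i> (snd (snd i)) z * Wop (- \<i>) (fst i) (Rb (fst (snd i))) z))"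
  unfolding B3_def[abs_def] by (rule W_exchange_sum(1)[OF a C1_Rb])
 also have "\<dots> = - BM (%z. (- 1) * (ta z * FF f z))"
 proof (intro arg_cong[of _ _ uminus] BM_cong)
  fix z assume "z \<in> M"
  then have z: "z \<in> S" using M_sub by blast
  interpret L: levi_data "%j. Rz j z" "%j k. A2 j k z" "%j k. H2 j k z" by (rule levi[OF z])
  have q: "(\<Sum>m\<in>UNIV. Rz m z * Rb m z) = 1/4" using L.quarter by (simp add: cnj_Rz[OF z])
  have "(\<Sum>i\<in>UNIV. (4 * Pt (fst i) (fst (snd i)) z * (Rz (snd (snd i)) z * FF f z)) *
   (Wr (- \<i>) (fst i) z * Wop \<i> (snd (snd i)) (Rb (fst (snd i))) z - Wr \<i> (snd (snd i)) z * Wop (- \<i>) (fst i) (Rb (fst (snd i))) z)) =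
   (\<Sum>k\<in>UNIV. \<Sum>l\<in>UNIV. \<Sum>m\<in>UNIV. (4 * Pt k l z * (Rz m z * FF f z)) * (Rz k z * Wop \<i> m (Rb l) z - Rb m z * Wop (- \<i>) k (Rb l) z))"
   unfolding Rz_def[symmetric] Rb_def[symmetric] by (rule sum_prod3)
  also have "\<dots> = (\<Sum>k\<in>UNIV. \<Sum>l\<in>UNIV. (Pt k l z * Rz k z) * (\<Sum>m\<in>UNIV. 4 * (Rz m z * FF f z * Wop \<i> m (Rb l) z)))
    - 4 * FF f z * (\<Sum>k\<in>UNIV. \<Sum>l\<in>UNIV. (Pt k l z * H2 k l z) * (\<Sum>m\<in>UNIV. Rz m z * Rb m z))"
   unfolding sum_subtractf[symmetric] sum_distrib_left
   by (intro sum.cong refl) (simp add: W_R(2)[OF z] algebra_simps)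
  also have "(\<Sum>k\<in>UNIV. \<Sum>l\<in>UNIV. (Pt k l z * Rz k z) * (\<Sum>m\<in>UNIV. 4 * (Rz m z * FF f z * Wop \<i> m (Rb l) z))) =
    (\<Sum>l\<in>UNIV. \<Sum>k\<in>UNIV. (Pt k l z * Rz k z) * (\<Sum>m\<in>UNIV. 4 * (Rz m z * FF f z * Wop \<i> m (Rb l) z)))" by (rule sum.swap)
  also have "\<dots> = 0"
   using L.P_r by (simp only: P_Pt[OF z] mult_zero_left sum.neutral_const flip: sum_distrib_right)
  also have "(\<Sum>k\<in>UNIV. \<Sum>l\<in>UNIV. (Pt k l z * H2 k l z) * (\<Sum>m\<in>UNIV. Rz m z * Rb m z)) = ta z / 4"
   using L.P_h by (simp add: q P_Pt[OF z] ta_def flip: sum_divide_distrib)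
  finally show "(\<Sum>i\<in>UNIV. (4 * Pt (fst i) (fst (snd i)) z * (Rz (snd (snd i)) z * FF f z)) *
   (Wr (- \<i>) (fst i) z * Wop \<i> (snd (snd i)) (Rb (fst (snd i))) z - Wr \<i> (snd (snd i)) z * Wop (- \<i>) (fst i) (Rb (fst (snd i))) z)) = (- 1) * (ta z * FF f z)"
   by simp
 qed
 finally show "I (B3 f) = BM (%z. ta z * FF f z)" by (simp only: BM_cmult) simp
qed

text \<open>The three divergences add up, pointwise, to the integrand of the scalar identity.\<close>

lemma scalar_pointwise:
 assumes f: "C1c f" and z: "z \<in> S"
 shows "E z * (\<Sum>j\<in>UNIV. Wop \<i> j f z * cnj (Wop \<i> j f z)) + gam z * FF f z + 4 * et2 z * FF f z
  - 1/4 * E z * ((Nb f z + 4 * ta z * f z) * cnj (Nb f z + 4 * ta z * f z))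
  - E z * (\<Sum>j\<in>UNIV. Aj f j z * cnj (Aj f j z)) = B1 f z + B2 f z + B3 f z"
proof -
 interpret L: levi_data "%j. Rz j z" "%j k. A2 j k z" "%j k. H2 j k z" by (rule levi[OF z])
 note f1 = C1c_C1[OF f]
 note FF1 = C1c_C1[OF C1c_FF[OF f]]
 define p1 where "p1 k = Wop (- \<i>) k (cplx \<phi>) z" for k
 define fd where "fd k = Wop (- \<i>) k f z" for k
 define fb where "fb k = Wop \<i> k f z" for k
 define F1 where "F1 k = Wop (- \<i>) k (FF f) z" for k
 define Fb where "Fb k = Wop \<i> k (FF f) z" for k
 define p2 where "p2 k m = Wop (- \<i>) k (Wop \<i> m (cplx \<phi>)) z" for k m
 have phib: "Wop \<i> m (cplx \<phi>) z = cnj (p1 m)" for m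
  using real_W_cnj[OF C2_C1[OF C2_phi] z, of "- \<i>" m] by (simp add: p1_def)
 note PE = C1_mult[OF C1_Pt C1_E]
 have e1: "B1 f z = (\<Sum>j\<in>UNIV. \<Sum>k\<in>UNIV. Wop \<i> j (%z. Pt k j z * E z * f z) z * Wop (- \<i>) k (%z. cnj (f z)) z
  - Wop (- \<i>) k (%z. Pt k j z * E z * f z) z * Wop \<i> j (%z. cnj (f z)) z)"
  unfolding B1_def by (rule sum_prod2)
 have e2: "B2 f z = (\<Sum>m\<in>UNIV. \<Sum>k\<in>UNIV. Wop (- \<i>) k (%z. Wop \<i> m (cplx \<phi>) z * (Pt k m z * FF f z)) z)"
  unfolding B2_def by (rule sum_prod2)
 have e3: "B3 f z = (\<Sum>k\<in>UNIV. \<Sum>l\<in>UNIV. \<Sum>m\<in>UNIV. Wop (- \<i>) k (%z. 4 * Pt k l z * (Rz m z * FF f z)) z * Wop \<i> m (Rb l) z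
  - Wop \<i> m (%z. 4 * Pt k l z * (Rz m z * FF f z)) z * Wop (- \<i>) k (Rb l) z)"
  unfolding B3_def by (rule sum_prod3)
 have b1: "B1 f z = (\<Sum>j\<in>UNIV. \<Sum>k\<in>UNIV.
   ((- 4 * (H2 j j z * cnj (Rz k z) + Rz j z * cnj (A2 j k z)) * E z - L.P k j * E z * cnj (p1 j)) * f z + L.P k j * E z * fb j) * cnj (fb k)
  - ((- 4 * (A2 k j z * cnj (Rz k z) + Rz j z * H2 k k z) * E z - L.P k j * E z * p1 k) * f z + L.P k j * E z * fd k) * cnj (fd j))"
  unfolding e1
  by (intro sum.cong refl arg_cong2[of _ _ _ _ "(-)"])
    (simp_all add: W_mult[OF PE f1 z] W_mult[OF C1_Pt C1_E z] W_cnj[OF f1 z] W_Pt[OF z] W_R[OF z] W_E[OF z] P_Pt[OF z]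
     cnj_Rz[OF z] phib fb_def fd_def flip: p1_def)
 have b2: "B2 f z = (\<Sum>m\<in>UNIV. \<Sum>k\<in>UNIV. p2 k m * (L.P k m * FF f z) + cnj (p1 m) * (- 4 * (A2 k m z * cnj (Rz k z) + Rz m z * H2 k k z) * FF f z + L.P k m * F1 k))"
  unfolding e2
  by (intro sum.cong refl)
    (simp add: W_mult[OF W_C1[OF C2_phi] C1_mult[OF C1_Pt FF1] z] W_mult[OF C1_Pt FF1 z] W_Pt[OF z] W_R[OF z] P_Pt[OF z]
     cnj_Rz[OF z] phib p2_def F1_def)
 have b3: "B3 f z = (\<Sum>k\<in>UNIV. \<Sum>l\<in>UNIV. \<Sum>m\<in>UNIV.
   4 * (- 4 * (A2 k l z * cnj (Rz k z) + Rz l z * H2 k k z) * (Rz m z * FF f z) + L.P k l * (A2 k m z * FF f z + Rz m z * F1 k)) * cnj (A2 m l z)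
  - 4 * (- 4 * (H2 l m z * cnj (Rz k z) + Rz l z * cnj (A2 m k z)) * (Rz m z * FF f z) + L.P k l * (H2 m m z * FF f z + Rz m z * Fb m)) * H2 k l z)"
  unfolding e3 mult.assoc[of 4]
  by (intro sum.cong refl arg_cong2[of _ _ _ _ "(-)"])
    (simp_all add: W_cmult[OF C1_mult[OF C1_Pt C1_mult[OF C1_Rz FF1]] C1_const z] W_mult[OF C1_Pt C1_mult[OF C1_Rz FF1] z] W_mult[OF C1_Rz FF1 z]
     W_Pt[OF z] W_R[OF z] P_Pt[OF z] cnj_Rz[OF z] F1_def Fb_def)
 have F1: "F1 k = E z * (fd k * cnj (f z) + f z * cnj (fb k)) - p1 k * (f z * cnj (f z) * E z)" for k
  by (simp add: F1_def W_FF[OF f z] fd_def fb_def p1_def FF_def)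
 have Fb: "Fb k = E z * (fb k * cnj (f z) + f z * cnj (fd k)) - cnj (p1 k) * (f z * cnj (f z) * E z)" for k
  by (simp add: Fb_def W_FF[OF f z] fd_def fb_def phib FF_def)
 have et: "et2 z = L.AA - 4 * L.aa" unfolding et2_def by (rule L.eta_sum)
 have gm: "gam z = (\<Sum>m\<in>UNIV. \<Sum>k\<in>UNIV. L.P k m * p2 k m)" by (simp add: gam_def p2_def P_Pt[OF z])
 have Nz: "Nb f z = 4 * (\<Sum>j\<in>UNIV. Rz j z * fb j)" by (simp add: Nb_def fb_def)
 have Az: "Aj f j z = (L.tgl p1 j + L.e j) * f z - L.tgl fd j" for j
  by (simp add: Aj_def Gc_def p1_def[abs_def] fd_def[abs_def])
 show ?thesis
  unfolding b1 b2 b3 L.B1_algebra[OF E_cnj] L.B2_algebra L.B3_algebra et Nz Az ta_def gm[symmetric]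
  unfolding fb_def[symmetric] FF_def
  by (rule L.scalar_algebra[OF F1 Fb])
qed

lemma scalar_identity:
 assumes f: "C1c f"
 shows "I (%z. E z * (\<Sum>j\<in>UNIV. Wop \<i> j f z * cnj (Wop \<i> j f z)) + gam z * FF f z + 4 * et2 z * FF f z
  - 1/4 * E z * ((Nb f z + 4 * ta z * f z) * cnj (Nb f z + 4 * ta z * f z))
  - E z * (\<Sum>j\<in>UNIV. Aj f j z * cnj (Aj f j z))) = BM (%z. ta z * FF f z)"
proof -
 have "I (%z. E z * (\<Sum>j\<in>UNIV. Wop \<i> j f z * cnj (Wop \<i> j f z)) + gam z * FF f z + 4 * et2 z * FF f z
  - 1/4 * E z * ((Nb f z + 4 * ta z * f z) * cnj (Nb f z + 4 * ta z * f z))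
  - E z * (\<Sum>j\<in>UNIV. Aj f j z * cnj (Aj f j z))) = I (%z. (B1 f z + B2 f z) + B3 f z)"
  using scalar_pointwise[OF f] Om_S by (intro I_cong) blast
 also have "\<dots> = I (B1 f) + I (B2 f) + I (B3 f)"
  using I_B1(2)[OF f] I_B2(2)[OF f] I_B3(2)[OF f] by (simp only: I_add Cc_add)
 finally show ?thesis by (simp add: I_B1(1)[OF f] I_B2(1)[OF f] I_B3(1)[OF f])
qed

end

section \<open>The basic identity for one row of coefficients\<close>

context weighted_domain
begin

lemma BM_AE_zero: "AE z in \<sigma>. z \<in> M --> F z = 0 ==> BM F = 0"
 unfolding BM_def set_lebesgue_integral_def
 by (rule integral_eq_zero_AE) (auto elim: eventually_mono simp: indicator_def)

text \<open>If \<open>w\<close> were differentiable along \<open>M\<close>, a tangential derivative of a function vanishing on \<open>M\<close> would be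
 zero. Knowing \<open>w = 0\<close> only almost everywhere, the tangential derivative is written with the
 fields \<open>\<rho>_k d_j - \<rho>_j d_k\<close>, and the exchange formula is applied twice: once with the roles of the two
 functions interchanged, so that \<open>w\<close> itself appears on the boundary.\<close>

lemma tangential_vanishing:
 assumes UE: "\<And>j. C1c (UE j)" and w: "C1c w"
  and w0: "AE z in \<sigma>. z \<in> M --> w z = 0"
  and U0: "AE z in \<sigma>. z \<in> M --> (\<Sum>j\<in>UNIV. Rz j z * UE j z) = 0"
 shows "BM (%z. \<Sum>j\<in>UNIV. UE j z * Wop (- \<i>) j w z) = 0"
proof -
 note w1 = C1c_C1[OF w]
 \<comment> \<open>multiplied by \<open>4 conj \<rho>_k\<close> and summed over \<open>k\<close>, the factors \<open>\<rho>_k\<close> yield 1\<close>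
 define a where "a j k = (%z. 4 * (Rb k z * UE j z))" for j k
 have a: "C1c (a j k)" for j k unfolding a_def by (intro C1c_cmult C1c_mult_left UE C1_Rb)
 define Y where "Y j k = (%z. a j k z * (Wr (- \<i>) k z * Wop (- \<i>) j w z - Wr (- \<i>) j z * Wop (- \<i>) k w z))" for j k
 have Yc: "Cc (Y j k)" for j k unfolding Y_def by (rule W_exchange_Cc(2)[OF a w1])
 have Y: "BM (Y j k) = 0" for j k
 proof -
  have "- BM (Y j k) = I (%z. Wop (- \<i>) k (a j k) z * Wop (- \<i>) j w z - Wop (- \<i>) j (a j k) z * Wop (- \<i>) k w z)"
   unfolding Y_def by (rule W_exchange[OF a w1, symmetric])
  also have "\<dots> = I (%z. (- 1) * (Wop (- \<i>) k w z * Wop (- \<i>) j (a j k) z - Wop (- \<i>) j w z * Wop (- \<i>) k (a j k) z))"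
   by (intro I_cong) (simp add: algebra_simps)
  also have "\<dots> = (- 1) * (- BM (%z. w z * (Wr (- \<i>) k z * Wop (- \<i>) j (a j k) z - Wr (- \<i>) j z * Wop (- \<i>) k (a j k) z)))"
   by (simp only: I_cmult W_exchange[OF w C1c_C1[OF a]])
  also have "BM (%z. w z * (Wr (- \<i>) k z * Wop (- \<i>) j (a j k) z - Wr (- \<i>) j z * Wop (- \<i>) k (a j k) z)) = 0"
   by (rule BM_AE_zero) (use w0 in \<open>auto elim: eventually_mono\<close>)
  finally show ?thesis by simp
 qed
 define Z where "Z z = (\<Sum>j\<in>UNIV. Rz j z * UE j z) * (4 * (\<Sum>k\<in>UNIV. Rb k z * Wop (- \<i>) k w z))" for z
 have Zc: "Cc Z"
  unfolding Z_def[abs_def]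
  by (intro Cc_mult_right Cc_sum Cc_mult_left C1c_Cc UE C1_cont C1_Rz continuous_on_mult continuous_on_sum continuous_on_const C1_Rb W_cont w1)
 have Z: "BM Z = 0" by (rule BM_AE_zero) (use U0 in \<open>auto elim: eventually_mono simp: Z_def\<close>)
 have e: "(\<Sum>j\<in>UNIV. UE j z * Wop (- \<i>) j w z) = (\<Sum>j\<in>UNIV. \<Sum>k\<in>UNIV. Y j k z) + Z z" if "z \<in> M" for z
 proof -
  have z: "z \<in> S" using that M_sub by blast
  have q: "(\<Sum>k\<in>UNIV. Rz k z * Rb k z) = 1/4" using grad_quarter[OF z] by (simp add: Rz_def Rb_def)
  have "(\<Sum>j\<in>UNIV. \<Sum>k\<in>UNIV. Y j k z) = 4 * (\<Sum>j\<in>UNIV. UE j z * Wop (- \<i>) j w z * (\<Sum>k\<in>UNIV. Rz k z * Rb k z))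
    - (\<Sum>j\<in>UNIV. \<Sum>k\<in>UNIV. (Rz j z * UE j z) * (4 * (Rb k z * Wop (- \<i>) k w z)))"
   unfolding sum_distrib_left sum_subtractf[symmetric]
   by (intro sum.cong refl) (simp add: Y_def a_def Rz_def algebra_simps)
  moreover have "Z z = (\<Sum>j\<in>UNIV. \<Sum>k\<in>UNIV. (Rz j z * UE j z) * (4 * (Rb k z * Wop (- \<i>) k w z)))"
   unfolding Z_def sum_distrib_left[of 4] by (rule sum_product)
  ultimately show ?thesis by (simp add: q flip: sum_divide_distrib)
 qed
 have "BM (%z. \<Sum>j\<in>UNIV. UE j z * Wop (- \<i>) j w z) = BM (%z. (\<Sum>j\<in>UNIV. \<Sum>k\<in>UNIV. Y j k z) + Z z)"
  by (rule BM_cong) (rule e)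
 also have "\<dots> = (\<Sum>j\<in>UNIV. \<Sum>k\<in>UNIV. BM (Y j k)) + BM Z"
  by (simp add: BM_add[OF Cc_sum[OF Cc_sum[OF Yc]] Zc] BM_sum Cc_sum Yc)
 finally show ?thesis by (simp add: Y Z)
qed

definition "Hp j k z = Wop (- \<i>) j (Wop \<i> k (cplx \<phi>)) z"

text \<open>The identity of Morrey, Kohn and Hoermander. Exchanging \<open>d_j\<close> and \<open>conj d_k\<close> in the product of
 \<open>exp (- \<phi>) u_j\<close> and \<open>conj u_k\<close> turns the adjoint derivatives into the dbar-derivatives, up to a
 divergence and the second derivatives of \<open>\<phi>\<close>. On the boundary the terms with \<open>\<rho>_j u_j\<close> vanish; in the
 remaining one, differentiating the boundary condition produces the Levi form.\<close>

lemma row_identity: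
 assumes u: "\<And>j. C1c (u j)" and w0: "AE z in \<sigma>. z \<in> M --> (\<Sum>j\<in>UNIV. Rz j z * u j z) = 0"
 shows "I (%z. \<Sum>j\<in>UNIV. \<Sum>k\<in>UNIV. inverse (E z) * (Wop (- \<i>) j (%z. E z * u j z) z * cnj (Wop (- \<i>) k (%z. E z * u k z) z))
   - E z * (Wop \<i> k (u j) z * cnj (Wop \<i> j (u k) z)))
  = I (%z. \<Sum>j\<in>UNIV. \<Sum>k\<in>UNIV. Hp j k z * u j z * cnj (u k z) * E z)
  - BM (%z. \<Sum>j\<in>UNIV. \<Sum>k\<in>UNIV. H2 j k z * u j z * cnj (u k z) * E z)"
proof -
 note u1 = C1c_C1[OF u]
 define UE where "UE j = (%z. E z * u j z)" for j
 have Uc: "C1c (UE j)" for j unfolding UE_def by (rule C1c_mult_left[OF u C1_E])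
 note U1 = C1c_C1[OF Uc]
 note ub = C1_cnj[OF u1]
 have P1: "C1 S (Wop \<i> k (cplx \<phi>))" for k by (rule W_C1[OF C2_phi])
 define X where "X j k = (%z. Wop (- \<i>) j (UE j) z * Wop \<i> k (%z. cnj (u k z)) z - Wop \<i> k (UE j) z * Wop (- \<i>) j (%z. cnj (u k z)) z)" for j k
 define Y where "Y j k = (%z. UE j z * (Wr (- \<i>) j z * Wop \<i> k (%z. cnj (u k z)) z - Wr \<i> k z * Wop (- \<i>) j (%z. cnj (u k z)) z))" for j k
 define V where "V j k = (%z. Wop \<i> k (cplx \<phi>) z * cnj (u k z) * UE j z)" for j k
 define Hh where "Hh j k = (%z. Hp j k z * u j z * cnj (u k z) * E z)" for j k
 define Rr where "Rr j k = (%z. H2 j k z * u j z * cnj (u k z) * E z)" for j k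
 have Xc: "Cc (X j k)" and Yc: "Cc (Y j k)" and XY: "I (X j k) = - BM (Y j k)" for j k
  unfolding X_def Y_def by (rule W_exchange_Cc[OF Uc ub] W_exchange[OF Uc ub])+
 have Vc: "C1c (V j k)" for j k unfolding V_def by (intro C1c_mult_left[OF Uc] C1_mult P1 ub)
 have Hc: "Cc (Hh j k)" and Rc: "Cc (Rr j k)" for j k
  unfolding Hh_def Rr_def Hp_def H2_def
  by (intro Cc_mult_right[OF _ C1_cont[OF C1_E]] Cc_mult_right[OF _ C1_cont[OF ub]] Cc_mult_left[OF C1c_Cc[OF u]] W_cont P1 C1_Rb)+
 define w where "w = (%z. \<Sum>k\<in>UNIV. Rb k z * cnj (u k z))"
 have wc: "C1c w" unfolding w_def by (intro C1c_sum C1c_mult_left C1c_cnj u C1_Rb)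
 have ww: "AE z in \<sigma>. z \<in> M --> w z = 0"
 proof -
  have "w z = cnj (\<Sum>j\<in>UNIV. Rz j z * u j z)" if "z \<in> M" for z
   using that M_sub by (auto simp: w_def cnj_Rz)
  then show ?thesis using w0 by (auto elim!: eventually_mono simp del: cnj_sum)
 qed
 have U0: "AE z in \<sigma>. z \<in> M --> (\<Sum>j\<in>UNIV. Rz j z * UE j z) = 0"
 proof -
  have "(\<Sum>j\<in>UNIV. Rz j z * UE j z) = E z * (\<Sum>j\<in>UNIV. Rz j z * u j z)" for z
   by (simp add: UE_def sum_distrib_left mult_ac)
  then show ?thesis using w0 by (auto elim: eventually_mono)
 qed
 have pt: "inverse (E z) * (Wop (- \<i>) j (%z. E z * u j z) z * cnj (Wop (- \<i>) k (%z. E z * u k z) z))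
   - E z * (Wop \<i> k (u j) z * cnj (Wop \<i> j (u k) z)) = X j k z + (Hh j k z - Wop (- \<i>) j (V j k) z)"
  if z: "z \<in> S" for j k z
 proof -
  have wu: "Wop c m (UE l) z = E z * (Wop c m (u l) z - Wop c m (cplx \<phi>) z * u l z)" for c m l
   unfolding UE_def by (simp add: W_mult[OF C1_E u1 z] W_E[OF z] algebra_simps)
  have wb: "Wop c m (%z. cnj (u l z)) z = cnj (Wop (cnj c) m (u l) z)" for c m l by (rule W_cnj[OF u1 z])
  have pb: "cnj (Wop (- \<i>) m (cplx \<phi>) z) = Wop \<i> m (cplx \<phi>) z" for m
   using real_W_cnj[OF C2_C1[OF C2_phi] z, of "- \<i>" m] by simp
  have V: "Wop (- \<i>) j (V j k) z = (Hp j k z * cnj (u k z) + Wop \<i> k (cplx \<phi>) z * cnj (Wop \<i> j (u k) z)) * UE j z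
    + Wop \<i> k (cplx \<phi>) z * cnj (u k z) * Wop (- \<i>) j (UE j) z"
   unfolding V_def by (simp add: W_mult[OF C1_mult[OF P1 ub] U1 z] W_mult[OF P1 ub z] wb Hp_def)
  show ?thesis
   unfolding UE_def[symmetric] V X_def Hh_def wb wu
   by (simp add: pb UE_def) (simp add: field_simps)
 qed
 have "I (%z. \<Sum>j\<in>UNIV. \<Sum>k\<in>UNIV. inverse (E z) * (Wop (- \<i>) j (%z. E z * u j z) z * cnj (Wop (- \<i>) k (%z. E z * u k z) z))
   - E z * (Wop \<i> k (u j) z * cnj (Wop \<i> j (u k) z))) = I (%z. \<Sum>j\<in>UNIV. \<Sum>k\<in>UNIV. X j k z + (Hh j k z - Wop (- \<i>) j (V j k) z))"
  using pt Om_S by (intro I_cong sum.cong refl) blast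
 also have "\<dots> = (\<Sum>j\<in>UNIV. \<Sum>k\<in>UNIV. I (X j k) + (I (Hh j k) - I (Wop (- \<i>) j (V j k))))"
  by (simp add: I_sum Cc_sum Cc_add Cc_diff Xc Hc W_Cc[OF Vc] I_add I_diff)
 also have "\<dots> = (\<Sum>j\<in>UNIV. \<Sum>k\<in>UNIV. I (Hh j k)) + (\<Sum>j\<in>UNIV. \<Sum>k\<in>UNIV. BM (%z. Wr (- \<i>) j z * V j k z - Y j k z))"
 proof -
  have VY: "BM (%z. Wr (- \<i>) j z * V j k z - Y j k z) = BM (%z. Wr (- \<i>) j z * V j k z) - BM (Y j k)" for j k
   by (rule BM_diff[OF Cc_mult_left[OF C1c_Cc[OF Vc] W_cont[OF C1_rho]] Yc])
  show ?thesis by (simp add: VY XY W_divergence[OF Vc] sum.distrib sum_subtractf sum_negf)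
 qed
 also have "(\<Sum>j\<in>UNIV. \<Sum>k\<in>UNIV. I (Hh j k)) = I (%z. \<Sum>j\<in>UNIV. \<Sum>k\<in>UNIV. Hh j k z)"
  by (simp add: I_sum Cc_sum Hc)
 also have "(\<Sum>j\<in>UNIV. \<Sum>k\<in>UNIV. BM (%z. Wr (- \<i>) j z * V j k z - Y j k z)) = BM (%z. \<Sum>j\<in>UNIV. \<Sum>k\<in>UNIV. Wr (- \<i>) j z * V j k z - Y j k z)"
  by (simp add: BM_sum Cc_sum Cc_diff Cc_mult_left[OF C1c_Cc[OF Vc] W_cont[OF C1_rho]] Yc)
 also have "\<dots> = BM (%z. ((\<Sum>j\<in>UNIV. Rz j z * UE j z) * (\<Sum>k\<in>UNIV. Wop \<i> k (cplx \<phi>) z * cnj (u k z) - Wop \<i> k (%z. cnj (u k z)) z)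
   + (\<Sum>j\<in>UNIV. UE j z * Wop (- \<i>) j w z)) - (\<Sum>j\<in>UNIV. \<Sum>k\<in>UNIV. Rr j k z))"
 proof (rule BM_cong)
  fix z assume "z \<in> M"
  then have z: "z \<in> S" using M_sub by blast
  have wz: "Wop (- \<i>) j w z = (\<Sum>k\<in>UNIV. H2 j k z * cnj (u k z) + Rb k z * Wop (- \<i>) j (%z. cnj (u k z)) z)" for j
   unfolding w_def by (subst W_sum[OF C1_mult[OF C1_Rb ub] z]) (simp add: W_mult[OF C1_Rb ub z] W_R[OF z])
  show "(\<Sum>j\<in>UNIV. \<Sum>k\<in>UNIV. Wr (- \<i>) j z * V j k z - Y j k z) =
    ((\<Sum>j\<in>UNIV. Rz j z * UE j z) * (\<Sum>k\<in>UNIV. Wop \<i> k (cplx \<phi>) z * cnj (u k z) - Wop \<i> k (%z. cnj (u k z)) z)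
   + (\<Sum>j\<in>UNIV. UE j z * Wop (- \<i>) j w z)) - (\<Sum>j\<in>UNIV. \<Sum>k\<in>UNIV. Rr j k z)"
   unfolding sum_product unfolding wz sum_distrib_left sum_subtractf[symmetric] sum.distrib[symmetric]
   by (intro sum.cong refl) (simp add: V_def Y_def Rr_def UE_def Rz_def[symmetric] Rb_def[symmetric] algebra_simps)
 qed
 also have "\<dots> = (BM (%z. (\<Sum>j\<in>UNIV. Rz j z * UE j z) * (\<Sum>k\<in>UNIV. Wop \<i> k (cplx \<phi>) z * cnj (u k z) - Wop \<i> k (%z. cnj (u k z)) z))
   + BM (%z. \<Sum>j\<in>UNIV. UE j z * Wop (- \<i>) j w z)) - BM (%z. \<Sum>j\<in>UNIV. \<Sum>k\<in>UNIV. Rr j k z)"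
 proof -
  have c1: "Cc (%z. (\<Sum>j\<in>UNIV. Rz j z * UE j z) * (\<Sum>k\<in>UNIV. Wop \<i> k (cplx \<phi>) z * cnj (u k z) - Wop \<i> k (%z. cnj (u k z)) z))"
   by (intro Cc_mult_right Cc_sum Cc_mult_left[OF C1c_Cc[OF Uc]] C1_cont[OF C1_Rz] continuous_on_sum continuous_on_diff continuous_on_mult
     C1_cont[OF P1] C1_cont[OF ub] W_cont[OF ub])
  have c2: "Cc (%z. \<Sum>j\<in>UNIV. UE j z * Wop (- \<i>) j w z)"
   by (intro Cc_sum Cc_mult_right[OF C1c_Cc[OF Uc]] W_cont C1c_C1 wc)
  have c3: "Cc (%z. \<Sum>j\<in>UNIV. \<Sum>k\<in>UNIV. Rr j k z)" by (intro Cc_sum Rc)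
  show ?thesis by (simp only: BM_diff[OF Cc_add[OF c1 c2] c3] BM_add[OF c1 c2])
 qed
 also have "BM (%z. (\<Sum>j\<in>UNIV. Rz j z * UE j z) * (\<Sum>k\<in>UNIV. Wop \<i> k (cplx \<phi>) z * cnj (u k z) - Wop \<i> k (%z. cnj (u k z)) z)) = 0"
  by (rule BM_AE_zero) (use U0 in \<open>auto elim: eventually_mono\<close>)
 also have "BM (%z. \<Sum>j\<in>UNIV. UE j z * Wop (- \<i>) j w z) = 0"
  by (rule tangential_vanishing[OF Uc wc ww U0])
 finally show ?thesis by (simp add: Hh_def Rr_def)
qed

end

section \<open>Signs and the pointwise norm of dbar\<close>

text \<open>The sign in \<open>u_{J,jK}\<close>; it equals the sign in the definition of dbar.\<close>

definition sg :: "'n::{finite,linorder} => 'n set => complex" where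
 "sg j K = (-1) ^ inversions (j # sorted_list_of_set K)"

lemma inversions_Cons_sorted:
 fixes K :: "'n::{finite,linorder} set"
 shows "inversions (j # sorted_list_of_set K) = card {i \<in> K. i < j}"
proof -
 let ?L = "sorted_list_of_set K"
 have "{(a, b). a < b \<and> b < length (j # ?L) \<and> (j # ?L) ! b < (j # ?L) ! a} = (%b. (0, Suc b)) ` {b. b < length ?L \<and> ?L ! b < j}"
  (is "?A = ?B")
 proof (intro set_eqI iffI; clarify)
  fix a b assume ab: "a < b" "b < length (j # ?L)" "(j # ?L) ! b < (j # ?L) ! a"
  obtain b' where b': "b = Suc b'" using ab(1) by (cases b) auto
  have "a = 0"
  proof (rule ccontr)
   assume "a \<noteq> 0"
   then obtain a' where a': "a = Suc a'" by (cases a) auto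
   have "?L ! a' \<le> ?L ! b'" by (rule sorted_nth_mono) (use ab a' b' in auto)
   then show False using ab a' b' by auto
  qed
  then show "(a, b) \<in> ?B" using ab b' by auto
 next
  fix b assume "b < length ?L" "?L ! b < j"
  then show "0 < Suc b \<and> Suc b < length (j # ?L) \<and> (j # ?L) ! Suc b < (j # ?L) ! 0" by auto
 qed
 then have "inversions (j # ?L) = card {b. b < length ?L \<and> ?L ! b < j}"
  unfolding inversions_def by (simp add: card_image inj_on_def)
 also have "\<dots> = card ((%b. ?L ! b) ` {b. b < length ?L \<and> ?L ! b < j})"
  by (rule card_image[symmetric]) (auto intro!: inj_onI simp: nth_eq_iff_index_eq)
 also have "(%b. ?L ! b) ` {b. b < length ?L \<and> ?L ! b < j} = {i \<in> set ?L. i < j}"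
 proof -
  have "x \<in> set ?L \<longleftrightarrow> (\<exists>b<length ?L. ?L ! b = x)" for x by (auto simp only: in_set_conv_nth)
  then show ?thesis by (auto simp only: image_iff mem_Collect_eq set_eq_iff)
 qed
 finally show ?thesis by simp
qed

lemma sg_card: "sg j K = (-1) ^ card {i \<in> K. i < j}"
 by (simp only: sg_def inversions_Cons_sorted)

lemma sg_square: "sg j K * sg j K = 1" and sg_real: "cnj (sg j K) = sg j K"
 by (simp_all add: sg_def flip: power_mult_distrib)

lemma sg_insert: "k \<notin> K ==> sg j (insert k K) = (if k < j then - sg j K else sg j K)"
proof -
 assume k: "k \<notin> K"
 have "{i \<in> insert k K. i < j} = (if k < j then insert k {i \<in> K. i < j} else {i \<in> K. i < j})" by auto
 then show ?thesis using k by (simp add: sg_card)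
qed

text \<open>Exactly one of \<open>j\<close> and \<open>k\<close> is the smaller one.\<close>

lemma sg_swap:
 assumes "j \<noteq> k" "j \<notin> K" "k \<notin> K"
 shows "sg j (insert k K) * sg k (insert j K) = - (sg j K * sg k K)"
 using assms by (auto simp: sg_insert)

lemma skew_coeff_Cons:
 "skew_coeff u J (j # sorted_list_of_set K) z = (if j \<in> K then 0 else sg j K * u J (insert j K) z)"
 by (simp add: skew_coeff_def sg_def)

text \<open>The pairs \<open>(M, j)\<close> with \<open>j \<in> M\<close> correspond to the pairs \<open>(K, j)\<close> with \<open>j \<notin> K\<close>.\<close>

lemma sum_remove_element:
 fixes g :: "'n::finite => 'n set => complex"
 shows "(\<Sum>M\<in>multi_indices (Suc q). \<Sum>j\<in>M. g j (M - {j})) = (\<Sum>K\<in>multi_indices q. \<Sum>j\<in>- K. g j K)"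
proof -
 have "(\<Sum>M\<in>multi_indices (Suc q). \<Sum>j\<in>M. g j (M - {j})) = (\<Sum>(M, j)\<in>(SIGMA M:multi_indices (Suc q). M). g j (M - {j}))"
  by (rule sum.Sigma) auto
 also have "\<dots> = (\<Sum>(K, j)\<in>(SIGMA K:multi_indices q. - K). g j K)"
  by (rule sum.reindex_bij_witness[of _ "%(K, j). (insert j K, j)" "%(M, j). (M - {j}, j)"])
    (auto simp: multi_indices_def card_insert_if insert_absorb)
 also have "\<dots> = (\<Sum>K\<in>multi_indices q. \<Sum>j\<in>- K. g j K)" by (rule sum.Sigma[symmetric]) auto
 finally show ?thesis .
qed

text \<open>\<open>a j K\<close> stands for \<open>dbar_j u_K\<close>, and \<open>b k j K\<close> for \<open>dbar_k u_{jK}\<close>. In the square of the alternating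
 sum the diagonal terms give \<open>\<bar>a j K\<bar>^2\<close> for \<open>j \<notin> K\<close>. The mixed terms are, up to the
 sign from \<open>sg_swap\<close>, the mixed terms of the last sum, whose diagonal supplies the missing
 \<open>\<bar>a j K\<bar>^2\<close> with \<open>j \<in> K\<close>.\<close>

lemma dbar_norm_expansion:
 fixes a :: "'n::{finite,linorder} => 'n set => complex"
 defines "b \<equiv> %k j K. if j \<in> K then 0 else sg j K * a k (insert j K)"
 shows "(\<Sum>M\<in>multi_indices (Suc (Suc q)). (\<Sum>j\<in>M. sg j (M - {j}) * a j (M - {j})) * cnj (\<Sum>j\<in>M. sg j (M - {j}) * a j (M - {j}))) =
  (\<Sum>K\<in>multi_indices (Suc q). \<Sum>j\<in>UNIV. a j K * cnj (a j K)) - (\<Sum>K\<in>multi_indices q. \<Sum>j\<in>UNIV. \<Sum>k\<in>UNIV. b k j K * cnj (b j k K))"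
proof -
 let ?s = "%M j. sg j (M - {j}) * a j (M - {j})"
 have sq: "(sg j K * x) * cnj (sg j K * y) = x * cnj y" for j K x y
 proof -
  have "(sg j K * x) * cnj (sg j K * y) = (sg j K * sg j K) * (x * cnj y)" by (simp add: sg_real mult_ac)
  then show ?thesis by (simp add: sg_square)
 qed
 define g where "g j k K = - ((sg k K * a j (insert k K)) * cnj (sg j K * a k (insert j K)))" for j k K
 have M: "(\<Sum>j\<in>M. ?s M j) * cnj (\<Sum>j\<in>M. ?s M j) = (\<Sum>j\<in>M. a j (M - {j}) * cnj (a j (M - {j})) + (\<Sum>k\<in>M - {j}. g j k (M - {j} - {k})))" for M
 proof -
  have "(\<Sum>j\<in>M. ?s M j) * cnj (\<Sum>j\<in>M. ?s M j) = (\<Sum>j\<in>M. \<Sum>k\<in>M. ?s M j * cnj (?s M k))"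
   unfolding cnj_sum sum_product ..
  also have "\<dots> = (\<Sum>j\<in>M. ?s M j * cnj (?s M j) + (\<Sum>k\<in>M - {j}. ?s M j * cnj (?s M k)))"
   by (intro sum.cong refl sum.remove) auto
  also have "\<dots> = (\<Sum>j\<in>M. a j (M - {j}) * cnj (a j (M - {j})) + (\<Sum>k\<in>M - {j}. g j k (M - {j} - {k})))"
  proof (intro sum.cong refl arg_cong2[of _ _ _ _ "(+)"] sq)
   fix j k assume jk: "j \<in> M" "k \<in> M - {j}"
   define K where "K = M - {j} - {k}"
   have K: "M - {j} = insert k K" "M - {k} = insert j K" "j \<noteq> k" "j \<notin> K" "k \<notin> K" using jk by (auto simp: K_def)
   have "?s M j * cnj (?s M k) = (sg j (insert k K) * sg k (insert j K)) * (a j (insert k K) * cnj (a k (insert j K)))"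
    by (simp add: K sg_real mult_ac)
   also have "\<dots> = g j k K" unfolding sg_swap[OF K(3-5)] by (simp add: g_def sg_real mult_ac)
   finally show "?s M j * cnj (?s M k) = g j k (M - {j} - {k})" by (simp add: K_def)
  qed
  finally show ?thesis .
 qed
 have "(\<Sum>M\<in>multi_indices (Suc (Suc q)). (\<Sum>j\<in>M. ?s M j) * cnj (\<Sum>j\<in>M. ?s M j)) =
   (\<Sum>K\<in>multi_indices (Suc q). \<Sum>j\<in>- K. a j K * cnj (a j K) + (\<Sum>k\<in>K. g j k (K - {k})))"
  unfolding M by (rule sum_remove_element)
 also have "\<dots> = (\<Sum>K\<in>multi_indices (Suc q). \<Sum>j\<in>- K. a j K * cnj (a j K)) + (\<Sum>K\<in>multi_indices (Suc q). \<Sum>j\<in>- K. \<Sum>k\<in>K. g j k (K - {k}))"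
  by (simp only: sum.distrib)
 also have "(\<Sum>K\<in>multi_indices (Suc q). \<Sum>j\<in>- K. \<Sum>k\<in>K. g j k (K - {k})) = (\<Sum>K\<in>multi_indices (Suc q). \<Sum>k\<in>K. \<Sum>j\<in>- (insert k (K - {k})). g j k (K - {k}))"
 proof (rule sum.cong[OF refl])
  fix K :: "'n set"
  have "(\<Sum>j\<in>- K. \<Sum>k\<in>K. g j k (K - {k})) = (\<Sum>k\<in>K. \<Sum>j\<in>- K. g j k (K - {k}))" by (rule sum.swap)
  also have "\<dots> = (\<Sum>k\<in>K. \<Sum>j\<in>- (insert k (K - {k})). g j k (K - {k}))"
   by (intro sum.cong) (auto simp: insert_absorb)
  finally show "(\<Sum>j\<in>- K. \<Sum>k\<in>K. g j k (K - {k})) = (\<Sum>k\<in>K. \<Sum>j\<in>- (insert k (K - {k})). g j k (K - {k}))" .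
 qed
 also have "\<dots> = (\<Sum>K\<in>multi_indices q. \<Sum>k\<in>- K. \<Sum>j\<in>- (insert k K). g j k K)" by (rule sum_remove_element)
 also have "\<dots> = (\<Sum>K\<in>multi_indices q. \<Sum>j\<in>- K. a j (insert j K) * cnj (a j (insert j K))) -
   (\<Sum>K\<in>multi_indices q. \<Sum>j\<in>UNIV. \<Sum>k\<in>UNIV. b k j K * cnj (b j k K))"
 proof -
  have "(\<Sum>k\<in>- K. \<Sum>j\<in>- (insert k K). g j k K) = (\<Sum>j\<in>- K. a j (insert j K) * cnj (a j (insert j K))) - (\<Sum>j\<in>UNIV. \<Sum>k\<in>UNIV. b k j K * cnj (b j k K))" for K
  proof -
   have in1: "(\<Sum>k\<in>UNIV. b k j K * cnj (b j k K)) = (\<Sum>k\<in>- K. - g k j K)" if "j \<notin> K" for j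
   proof -
    have "(\<Sum>k\<in>UNIV. b k j K * cnj (b j k K)) = (\<Sum>k\<in>- K. b k j K * cnj (b j k K))"
     by (rule sum.mono_neutral_right) (auto simp: b_def)
    also have "\<dots> = (\<Sum>k\<in>- K. - g k j K)" using that by (intro sum.cong refl) (simp add: b_def g_def)
    finally show ?thesis .
   qed
   have "(\<Sum>j\<in>UNIV. \<Sum>k\<in>UNIV. b k j K * cnj (b j k K)) = (\<Sum>j\<in>- K. \<Sum>k\<in>UNIV. b k j K * cnj (b j k K))"
    by (rule sum.mono_neutral_right) (auto simp: b_def)
   also have "\<dots> = (\<Sum>j\<in>- K. \<Sum>k\<in>- K. - g k j K)" by (intro sum.cong refl in1) auto
   also have "\<dots> = (\<Sum>j\<in>- K. - g j j K + (\<Sum>k\<in>- K - {j}. - g k j K))" by (intro sum.cong refl sum.remove) auto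
   also have "\<dots> = (\<Sum>j\<in>- K. a j (insert j K) * cnj (a j (insert j K))) - (\<Sum>j\<in>- K. \<Sum>k\<in>- K - {j}. g k j K)"
    by (simp only: sum.distrib sum_negf g_def sq minus_minus) simp
   also have "(\<Sum>j\<in>- K. \<Sum>k\<in>- K - {j}. g k j K) = (\<Sum>k\<in>- K. \<Sum>j\<in>- (insert k K). g j k K)"
    by (intro sum.cong refl) auto
   finally show ?thesis by simp
  qed
  then show ?thesis by (simp only: sum_subtractf)
 qed
 also have "(\<Sum>K\<in>multi_indices q. \<Sum>j\<in>- K. a j (insert j K) * cnj (a j (insert j K))) = (\<Sum>K\<in>multi_indices (Suc q). \<Sum>j\<in>K. a j K * cnj (a j K))"
 proof -
  have "(\<Sum>K\<in>multi_indices (Suc q). \<Sum>j\<in>K. a j K * cnj (a j K)) = (\<Sum>K\<in>multi_indices (Suc q). \<Sum>j\<in>K. a j (insert j (K - {j})) * cnj (a j (insert j (K - {j}))))"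
   by (intro sum.cong refl) (auto simp: insert_absorb)
  also have "\<dots> = (\<Sum>K\<in>multi_indices q. \<Sum>j\<in>- K. a j (insert j K) * cnj (a j (insert j K)))" by (rule sum_remove_element)
  finally show ?thesis by simp
 qed
 finally have e: "(\<Sum>M\<in>multi_indices (Suc (Suc q)). (\<Sum>j\<in>M. ?s M j) * cnj (\<Sum>j\<in>M. ?s M j)) =
   (\<Sum>K\<in>multi_indices (Suc q). \<Sum>j\<in>- K. a j K * cnj (a j K)) + ((\<Sum>K\<in>multi_indices (Suc q). \<Sum>j\<in>K. a j K * cnj (a j K)) -
   (\<Sum>K\<in>multi_indices q. \<Sum>j\<in>UNIV. \<Sum>k\<in>UNIV. b k j K * cnj (b j k K)))" .
 have "(\<Sum>j\<in>UNIV. a j K * cnj (a j K)) = (\<Sum>j\<in>- K. a j K * cnj (a j K)) + (\<Sum>j\<in>K. a j K * cnj (a j K))" for K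
  by (subst sum.union_disjoint[symmetric]) (auto intro: sum.cong)
 then have "(\<Sum>K\<in>multi_indices (Suc q). \<Sum>j\<in>UNIV. a j K * cnj (a j K)) =
  (\<Sum>K\<in>multi_indices (Suc q). \<Sum>j\<in>- K. a j K * cnj (a j K)) + (\<Sum>K\<in>multi_indices (Suc q). \<Sum>j\<in>K. a j K * cnj (a j K))"
  by (simp only: sum.distrib)
 then show ?thesis unfolding e by simp
qed

section \<open>Weighted integrals over the exterior domain\<close>

context weighted_domain
begin

abbreviation "wO \<equiv> weighted_lebesgue Om \<phi>"
definition "IL F = (LINT z:Om|lebesgue. F z)"

lemma measurable_cnj [measurable]: "cnj \<in> borel_measurable borel"
 by (rule borel_measurable_continuous_onI) (intro continuous_intros)

lemma Om_lebesgue: "Om \<in> sets lebesgue"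
 using open_Om by (simp add: borel_open sets_completionI_sets)

lemma cont_Om_borel: "continuous_on Om F ==> (%z. indicator Om z *\<^sub>R F z) \<in> borel_measurable borel"
 for F :: "'n cspace => 'b::real_normed_vector"
 by (intro borel_measurable_continuous_on_indicator borel_open open_Om)

lemma cont_Om_wO: "continuous_on Om F ==> F \<in> borel_measurable (lebesgue_on Om)"
 for F :: "'n cspace => 'b::real_normed_vector"
 using cont_Om_borel[of F] by (subst borel_measurable_restrict_space_iff) (auto intro: measurable_completion simp: Om_lebesgue)

lemma measurable_wO [simp]: "borel_measurable wO = borel_measurable (lebesgue_on Om)"
 unfolding weighted_lebesgue_def by (rule measurable_cong_sets) auto

lemma IL_I: "continuous_on Om F ==> IL F = I F"
 unfolding IL_def I_def set_lebesgue_integral_def using cont_Om_borel[of F] by (intro integral_completion) simp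

lemma wdens: "(%z. exp (- \<phi> z)) \<in> borel_measurable (lebesgue_on Om)"
 using continuous_on_subset[OF C1_cont[OF C1_E] Om_S]
 by (intro cont_Om_wO) (auto simp: E_real dest: continuous_on_Re)

lemma wO_integral: "F \<in> borel_measurable (lebesgue_on Om) ==> (LINT z|wO. F z) = IL (%z. E z * F z)" for F :: "'n cspace => complex"
 unfolding weighted_lebesgue_def IL_def set_lebesgue_integral_def
 by (subst integral_density) (auto simp: wdens integral_restrict_space Om_lebesgue E_real scaleR_conv_of_real mult_ac)

lemma wO_integrable: "F \<in> borel_measurable (lebesgue_on Om) ==> integrable wO F \<longleftrightarrow> set_integrable lebesgue Om (%z. E z * F z)" for F :: "'n cspace => complex"
 unfolding weighted_lebesgue_def set_integrable_def
 by (subst integrable_density) (auto simp: wdens integrable_restrict_space Om_lebesgue E_real scaleR_conv_of_real mult_ac)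

lemma cont_E_Om: "continuous_on Om F ==> continuous_on Om (%z. E z * F z)"
 by (intro continuous_on_mult continuous_on_subset[OF C1_cont[OF C1_E] Om_S])

lemma wO_I: "continuous_on Om F ==> (LINT z|wO. F z) = I (%z. E z * F z)"
 using wO_integral[OF cont_Om_wO] IL_I[OF cont_E_Om] by simp

lemma Cc_Om: "Cc F ==> continuous_on Om F"
 using Cc_cont continuous_on_subset Om_S by blast

lemma Cc_IL: "Cc F ==> set_integrable lebesgue Om F"
 using Cc_int[of F] cont_Om_borel[OF Cc_Om, of F] unfolding set_integrable_def
 by (subst integrable_completion) auto

lemma Cc_L2:
 assumes F: "Cc F"
 shows "F \<in> borel_measurable wO" "integrable wO (%z. (cmod (F z))\<^sup>2)"
proof -
 have c: "(%z. complex_of_real ((cmod (F z))\<^sup>2)) = (%z. F z * cnj (F z))" by (simp add: complex_norm_square[symmetric])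
 have C: "Cc (%z. F z * cnj (F z))" by (intro Cc_mult_right F Cc_cont[OF Cc_cnj[OF F]])
 show "F \<in> borel_measurable wO" using cont_Om_wO[OF Cc_Om[OF F]] by simp
 have "integrable wO (%z. F z * cnj (F z))"
  by (subst wO_integrable[OF cont_Om_wO[OF Cc_Om[OF C]]]) (intro Cc_IL Cc_mult_left C C1_cont C1_E)
 then show "integrable wO (%z. (cmod (F z))\<^sup>2)" unfolding c[symmetric] complex_of_real_integrable_eq .
qed

lemma form_norm_sq_complex:
 "complex_of_real (form_norm_sq p q u z) = (\<Sum>J\<in>multi_indices p. \<Sum>K\<in>multi_indices q. u J K z * cnj (u J K z))"
 by (simp only: form_norm_sq_def of_real_sum complex_norm_square)

lemma L2_norm_sq:
 assumes F: "\<And>z. z \<in> Om ==> complex_of_real (form_norm_sq p q u z) = F z" and c: "continuous_on Om F"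
 shows "complex_of_real ((L2_norm Om \<phi> p q u)\<^sup>2) = I (%z. E z * F z)"
proof -
 have "0 \<le> (LINT z|wO. form_norm_sq p q u z)"
  by (rule integral_nonneg_AE) (auto simp: form_norm_sq_def intro!: sum_nonneg)
 then have "complex_of_real ((L2_norm Om \<phi> p q u)\<^sup>2) = (LINT z|wO. complex_of_real (form_norm_sq p q u z))"
  by (simp add: L2_norm_def)
 also have "\<dots> = (LINT z|wO. F z)"
  by (intro Bochner_Integration.integral_cong refl) (simp add: weighted_lebesgue_def F)
 finally show ?thesis by (simp only: wO_I[OF c])
qed

lemma Cc_Om_local:
 assumes F: "continuous_on Om F" and ab: "cbox a b \<subseteq> Om" and 0: "\<And>z. z \<notin> cbox a b ==> F z = 0"
 shows "Cc F"
proof -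
 have "continuous_on (- cbox a b) F"
  using continuous_on_cong[of "- cbox a b" "- cbox a b" F "%_. 0"] 0 by simp
 then have "continuous_on (Om \<union> - cbox a b) F"
  by (intro continuous_on_open_Un F open_Om) (simp_all add: open_Compl closed_cbox)
 moreover have "Om \<union> - cbox a b = UNIV" using ab by blast
 ultimately have "continuous_on UNIV F" by simp
 then have "continuous_on S F" by (rule continuous_on_subset) simp
 moreover have "cbox a b \<subseteq> S" using ab Om_S by blast
 ultimately show ?thesis unfolding Cc_def using 0 compact_cbox[of a b] by blast
qed

section \<open>The formal adjoint\<close>

text \<open>Test functions vanish near \<open>M\<close>, so for them the boundary integrals disappear, and derivatives within
 \<open>Om\<close> and within \<open>S\<close> agree.\<close>

lemma C1c_test_function:
 assumes "test_function Om \<psi>"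
 shows "C1c \<psi>" "z \<in> M ==> \<psi> z = 0" "z \<in> Om ==> pd Om b \<psi> z = pd S b \<psi> z"
proof -
 from assms have 1: "Ck_on 1 UNIV \<psi>" by (simp add: test_function_def)
 from assms obtain C where C: "compact C" "C \<subseteq> Om" "\<And>x. x \<notin> C ==> \<psi> x = 0" by (auto simp: test_function_def)
 have c: "C1 S \<psi>" by (rule Ck1_imp_C1[OF Ck_on_subset[OF 1]]) simp
 show "C1c \<psi>" "z \<in> M ==> \<psi> z = 0" using C1c_csupp_Om[OF c C] by auto
 show "z \<in> Om ==> pd Om b \<psi> z = pd S b \<psi> z"
  by (rule C1_restrict(2)[OF c fat_set_open[OF open_Om] fat_set_axioms Om_S])
qed

lemma tgl_Pt: "z \<in> S ==> levi_data.tgl (%j. Rz j z) x j = (\<Sum>k\<in>UNIV. Pt k j z * x k)"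
proof -
 assume z: "z \<in> S"
 have "(\<Sum>k\<in>UNIV. Pt k j z * x k) = (\<Sum>k\<in>UNIV. (if k = j then x k else 0) - 4 * Rz j z * (Rb k z * x k))"
  by (intro sum.cong refl) (auto simp: Pt_def algebra_simps)
 then show ?thesis by (simp add: sum_subtractf levi_data.tgl_def[OF levi[OF z]] cnj_Rz[OF z] flip: sum_distrib_left)
qed

lemma L_op_Pt: "z \<in> S ==> L_op S \<rho> j f z = (\<Sum>k\<in>UNIV. Pt k j z * Wop (- \<i>) k f z)"
 by (simp add: L_op_def N_op_def dz_W dzbar_W tgl_Pt[symmetric] levi_data.tgl_def[OF levi] Rz_def[symmetric] Rb_def[symmetric] cnj_Rz mult_ac)

lemma cnj_Pt: "z \<in> S ==> cnj (Pt k j z) = Pt j k z"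
 by (auto simp: Pt_def cnj_Rz cnj_Rb)

lemma conj_L_op: "C1 S f ==> z \<in> S ==> conj_op (L_op S \<rho> j) f z = (\<Sum>k\<in>UNIV. cnj (Pt k j z) * Wop \<i> k f z)"
 by (simp add: conj_op_def L_op_Pt W_cnj)

text \<open>\<open>conj L_j\<close> has the coefficients \<open>conj (Pt k j)\<close>, so its formal adjoint is the divergence below divided by
 \<open>- exp (- \<phi>)\<close>.\<close>

lemma adjoint_divergence:
 assumes f: "C1 S f" and z: "z \<in> S"
 shows "(\<Sum>k\<in>UNIV. Wop (- \<i>) k (%z. Pt k j z * (E z * f z)) z) = - (E z * (Aj f j z + 4 * Rz j z * ta z * f z))"
proof -
 interpret L: levi_data "%j. Rz j z" "%j k. A2 j k z" "%j k. H2 j k z" by (rule levi[OF z])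
 have "(\<Sum>k\<in>UNIV. Wop (- \<i>) k (%z. Pt k j z * (E z * f z)) z) =
  E z * f z * (\<Sum>k\<in>UNIV. - 4 * (A2 k j z * cnj (Rz k z) + Rz j z * H2 k k z))
  + E z * (\<Sum>k\<in>UNIV. Pt k j z * Wop (- \<i>) k f z) - E z * f z * (\<Sum>k\<in>UNIV. Pt k j z * Wop (- \<i>) k (cplx \<phi>) z)"
  unfolding sum_distrib_left sum.distrib[symmetric] sum_subtractf[symmetric]
  by (intro sum.cong refl, simp only: W_mult[OF C1_Pt C1_mult[OF C1_E f] z] W_mult[OF C1_E f z] W_Pt[OF z] W_R[OF z] W_E[OF z] cnj_Rz[OF z])
    (simp add: algebra_simps)
 then show ?thesis
  unfolding L.divP tgl_Pt[OF z, symmetric] by (simp add: Aj_def Gc_def ta_def algebra_simps)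
qed

lemma ta_sum: "z \<in> S ==> ta z = (\<Sum>k\<in>UNIV. \<Sum>l\<in>UNIV. Pt k l z * H2 k l z)"
 by (simp add: ta_def levi_data.P_h[OF levi, symmetric] P_Pt)

lemma cont_ta: "continuous_on S ta"
proof -
 have "continuous_on S (%z. \<Sum>k\<in>UNIV. \<Sum>l\<in>UNIV. Pt k l z * H2 k l z)"
  unfolding H2_def by (intro continuous_on_sum continuous_on_mult C1_cont[OF C1_Pt] W_cont C1_Rb)
 then show ?thesis by (rule continuous_on_eq) (simp add: ta_sum)
qed

lemma cont_Aj: assumes f: "C1 S f" shows "continuous_on S (Aj f j)"
proof -
 have e: "Aj f j z = - (inverse (E z) * (\<Sum>k\<in>UNIV. Wop (- \<i>) k (%z. Pt k j z * (E z * f z)) z)) - 4 * Rz j z * ta z * f z" if "z \<in> S" for z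
  unfolding adjoint_divergence[OF f that] by (simp add: field_simps)
 have "continuous_on S (%z. - (inverse (E z) * (\<Sum>k\<in>UNIV. Wop (- \<i>) k (%z. Pt k j z * (E z * f z)) z)) - 4 * Rz j z * ta z * f z)"
  by (intro continuous_intros W_cont C1_mult C1_cont[OF C1_E] C1_cont[OF f] cont_ta C1_cont[OF C1_Rz] C1_Pt C1_E f ballI E_nz)
 then show ?thesis by (rule continuous_on_eq) (simp only: e)
qed

text \<open>The definition selects some continuous representative. The explicit expression is one by
 integration by parts, and two of them agree since their difference is orthogonal to all bump functions.\<close>

lemma formal_adjoint_eq:
 assumes f: "C1c f" and z: "z \<in> Om"
 shows "formal_adjoint Om \<phi> (conj_op (L_op S \<rho> j)) f z = Aj f j z + 4 * Rz j z * ta z * f z"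
proof -
 note f1 = C1c_C1[OF f]
 let ?X = "conj_op (L_op S \<rho> j)"
 define g0 where "g0 z = Aj f j z + 4 * Rz j z * ta z * f z" for z
 have c0: "continuous_on S g0"
  unfolding g0_def[abs_def] by (intro continuous_intros cont_Aj f1 C1_cont[OF f1] cont_ta C1_cont[OF C1_Rz])
 have c0': "continuous_on Om g0" using c0 Om_S continuous_on_subset by blast
 have cf: "continuous_on Om f" by (rule continuous_on_subset[OF C1_cont[OF f1] Om_S])
 have adj: "(LINT z|wO. ?X \<psi> z * cnj (f z)) = I (%z. E z * (\<psi> z * cnj (g0 z)))" if t: "test_function Om \<psi>" for \<psi> :: "'n cspace => complex"
 proof -
  note p = C1c_test_function(1)[OF t]
  note p1 = C1c_C1[OF p]
  define G where "G k = (%z. Pt k j z * (E z * f z))" for k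
  have G: "C1 S (G k)" for k unfolding G_def by (intro C1_mult C1_Pt C1_E f1)
  have cX: "continuous_on Om (?X \<psi>)"
  proof -
   have "continuous_on S (%z. \<Sum>k\<in>UNIV. cnj (Pt k j z) * Wop \<i> k \<psi> z)"
    by (intro continuous_intros C1_cont[OF C1_Pt] W_cont p1)
   then have "continuous_on S (?X \<psi>)" by (rule continuous_on_eq) (simp only: conj_L_op[OF p1])
   then show ?thesis using Om_S continuous_on_subset by blast
  qed
  have "(LINT z|wO. ?X \<psi> z * cnj (f z)) = I (%z. E z * (?X \<psi> z * cnj (f z)))"
   by (rule wO_I) (intro continuous_intros cX cf)
  also have "\<dots> = I (%z. (\<Sum>k\<in>UNIV. Wop \<i> k (%z. \<psi> z * cnj (G k z)) z) + E z * (\<psi> z * cnj (g0 z)))"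
  proof (rule I_cong)
   fix z assume "z \<in> Om" then have z: "z \<in> S" using Om_S by blast
   have "(\<Sum>k\<in>UNIV. Wop \<i> k (%z. \<psi> z * cnj (G k z)) z) = (\<Sum>k\<in>UNIV. Wop \<i> k \<psi> z * cnj (G k z)) + \<psi> z * cnj (\<Sum>k\<in>UNIV. Wop (- \<i>) k (G k) z)"
    by (simp add: W_mult[OF p1 C1_cnj[OF G] z] W_cnj[OF G z] sum.distrib sum_distrib_left)
   also have "(\<Sum>k\<in>UNIV. Wop (- \<i>) k (G k) z) = - (E z * g0 z)" unfolding G_def g0_def by (rule adjoint_divergence[OF f1 z])
   also have "(\<Sum>k\<in>UNIV. Wop \<i> k \<psi> z * cnj (G k z)) = E z * (?X \<psi> z * cnj (f z))"
    unfolding conj_L_op[OF p1 z] sum_distrib_left sum_distrib_right by (intro sum.cong refl) (simp add: G_def mult_ac)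
   finally show "E z * (?X \<psi> z * cnj (f z)) = (\<Sum>k\<in>UNIV. Wop \<i> k (%z. \<psi> z * cnj (G k z)) z) + E z * (\<psi> z * cnj (g0 z))"
    by (simp add: algebra_simps)
  qed
  also have "\<dots> = (\<Sum>k\<in>UNIV. I (Wop \<i> k (%z. \<psi> z * cnj (G k z)))) + I (%z. E z * (\<psi> z * cnj (g0 z)))"
  proof -
   have c1: "Cc (Wop \<i> k (%z. \<psi> z * cnj (G k z)))" for k by (intro W_Cc C1c_mult_right p C1_cnj G)
   have c2: "Cc (%z. E z * (\<psi> z * cnj (g0 z)))"
    by (intro Cc_mult_left[OF _ C1_cont[OF C1_E]] Cc_mult_right C1c_Cc p continuous_on_cnj c0)
   show ?thesis by (simp add: I_add[OF Cc_sum[OF c1] c2] I_sum c1)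
  qed
  also have "(\<Sum>k\<in>UNIV. I (Wop \<i> k (%z. \<psi> z * cnj (G k z)))) = 0"
   by (intro sum.neutral ballI, subst W_divergence[OF C1c_mult_right[OF p C1_cnj[OF G]]], subst BM_zero)
     (simp_all add: C1c_test_function(2)[OF t])
  finally show ?thesis by simp
 qed
 let ?Q = "%g. continuous_on Om g \<and> (\<forall>\<psi>. test_function Om \<psi> -->
    (LINT z|wO. ?X \<psi> z * cnj (f z)) = (LINT z|wO. \<psi> z * cnj (g z)))"
 have ct: "continuous_on Om \<psi>" if "test_function Om \<psi>" for \<psi> :: "'n cspace => complex"
  by (rule Cc_Om[OF C1c_Cc[OF C1c_test_function(1)[OF that]]])
 have Q0: "?Q g0"
 proof (intro conjI allI impI c0')
  fix \<psi> :: "'n cspace => complex" assume t: "test_function Om \<psi>"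
  show "(LINT z|wO. ?X \<psi> z * cnj (f z)) = (LINT z|wO. \<psi> z * cnj (g0 z))"
   unfolding adj[OF t] by (rule wO_I[symmetric]) (intro continuous_intros ct t c0')
 qed
 define g where "g = formal_adjoint Om \<phi> ?X f"
 have Q: "?Q g" unfolding g_def formal_adjoint_def by (rule someI[where P = ?Q, OF Q0])
 have cg: "continuous_on Om g" using Q by blast
 have "E z * cnj (g z - g0 z) = 0"
 proof (rule orthogonal_to_bumps[OF _ _ z])
  show "continuous_on Om (%z. E z * cnj (g z - g0 z))"
   by (intro cont_E_Om continuous_intros cg c0')
  fix k :: nat and a b :: "'n cspace" assume ab: "cbox a b \<subseteq> Om"
  let ?b = "cplx (bump k a b)"
  note t = test_function_bump[OF ab, of k]
  have cc: "Cc (%z. E z * (?b z * cnj (h z)))" if "continuous_on Om h" for h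
   by (rule Cc_Om_local[OF _ ab]) (use that ct[OF t] bump_zero[of _ a b k] box_subset_cbox[of a b] in \<open>auto intro!: cont_E_Om continuous_intros\<close>)
  have "I (%z. E z * (?b z * cnj (g z))) = (LINT z|wO. ?b z * cnj (g z))"
   by (rule wO_I[symmetric]) (intro continuous_intros ct t cg)
  also have "\<dots> = I (%z. E z * (?b z * cnj (g0 z)))"
  proof -
   have "(LINT z|wO. ?X ?b z * cnj (f z)) = (LINT z|wO. ?b z * cnj (g z))"
    by (rule conjunct2[OF Q, rule_format, OF t])
   then show ?thesis by (simp only: adj[OF t])
  qed
  finally have "I (%z. E z * (?b z * cnj (g z)) - E z * (?b z * cnj (g0 z))) = 0"
   by (simp only: I_diff[OF cc[OF cg] cc[OF c0']]) simp
  then show "I (%z. ?b z * (E z * cnj (g z - g0 z))) = 0" by (simp add: algebra_simps)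
 qed
 then have "g z - g0 z = 0" by (simp only: mult_eq_0_iff E_nz complex_cnj_zero_iff simp_thms)
 then show ?thesis by (simp only: g_def g0_def right_minus_eq)
qed

section \<open>The domain of the adjoint of dbar\<close>

text \<open>\<open>rw u J K\<close> is the row \<open>(u_{J,jK})_j\<close>, \<open>vf\<close> the formal adjoint of dbar applied to \<open>u\<close>, and \<open>ncomp\<close> the
 normal component of \<open>u\<close>, which the domain condition will force to vanish on \<open>M\<close>.\<close>

definition "rw u J K j z = skew_coeff u J (j # sorted_list_of_set K) z"
definition "vf p u J K z = - ((-1) ^ p * (inverse (E z) * (\<Sum>j\<in>UNIV. Wop (- \<i>) j (%z. E z * rw u J K j z) z)))"
definition "ncomp u J K z = (\<Sum>j\<in>UNIV. Rz j z * rw u J K j z)"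

lemma rw_eq: "rw u J K j = (%z. if j \<in> K then 0 else sg j K * u J (insert j K) z)"
 by (simp add: fun_eq_iff rw_def skew_coeff_Cons)

lemma C1c_rw: "(\<And>J K. C1c (u J K)) ==> C1c (rw u J K j)"
 unfolding rw_eq by (cases "j \<in> K") (auto intro: C1c_0 C1c_cmult)

lemma dbar_sg: "dbar S p f J L z = (-1) ^ p * (\<Sum>j\<in>L. sg j (L - {j}) * Wop \<i> j (f J (L - {j})) z)"
 by (simp add: dbar_def sg_def dzbar_W)

text \<open>A form that is \<open>C^1\<close> up to \<open>M\<close> has its classical dbar as weak dbar, hence may be used for testing.\<close>

lemma weak_dbar_dbar:
 assumes f: "\<And>J K. C1c (f J K)"
 shows "weak_dbar Om p q f (dbar S p f)"
 unfolding weak_dbar_def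
proof (intro ballI allI impI)
 fix J L and \<theta> :: "'n cspace => complex"
 assume t: "test_function Om \<theta>"
 note p = C1c_test_function(1)[OF t]
 note p1 = C1c_C1[OF p]
 note f1 = C1c_C1[OF f]
 define F where "F j = (%z. f J (L - {j}) z * \<theta> z)" for j
 have F: "C1c (F j)" for j unfolding F_def by (intro C1c_mult_left p f1)
 let ?A = "%z. dbar S p f J L z * \<theta> z"
 let ?B = "%z. (-1) ^ p * (\<Sum>j\<in>L. sg j (L - {j}) * f J (L - {j}) z * Wop \<i> j \<theta> z)"
 have A: "Cc ?A" unfolding dbar_sg
  by (intro Cc_mult_left[OF C1c_Cc[OF p]] continuous_intros W_cont f1)
 have B: "Cc ?B" by (intro Cc_cmult Cc_sum Cc_mult_left[OF W_Cc[OF p]] continuous_intros C1_cont f1)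
 have D: "Cc (%z. (-1) ^ p * (\<Sum>j\<in>L. sg j (L - {j}) * Wop \<i> j (F j) z))" by (intro Cc_cmult Cc_sum W_Cc F)
 have "I ?A + I ?B = I (%z. ?A z + ?B z)" by (simp only: I_add[OF A B])
 also have "\<dots> = I (%z. (-1) ^ p * (\<Sum>j\<in>L. sg j (L - {j}) * Wop \<i> j (F j) z))"
 proof (rule I_cong)
  fix z assume "z \<in> Om" then have z: "z \<in> S" using Om_S by blast
  show "?A z + ?B z = (-1) ^ p * (\<Sum>j\<in>L. sg j (L - {j}) * Wop \<i> j (F j) z)"
   proof -
   have Wj: "Wop \<i> j (F j) z = Wop \<i> j (f J (L - {j})) z * \<theta> z + f J (L - {j}) z * Wop \<i> j \<theta> z" for j
    unfolding F_def by (rule W_mult[OF f1 p1 z])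
   show ?thesis
    unfolding Wj dbar_sg sum_distrib_left sum_distrib_right sum.distrib[symmetric]
    by (intro sum.cong refl) (simp add: algebra_simps)
  qed
 qed
 also have "\<dots> = 0"
  by (simp add: I_cmult I_sum Cc_cmult W_Cc F W_divergence) (simp add: F_def BM_zero C1c_test_function(2)[OF t])
 finally have "I ?A = - I ?B" by (rule eq_neg_iff_add_eq_0[THEN iffD2])
 moreover have "I ?A = (LINT z:Om|lebesgue. ?A z)" unfolding IL_def[symmetric] by (rule IL_I[OF Cc_Om[OF A], symmetric])
 moreover have "I ?B = (LINT z:Om|lebesgue. (-1) ^ p * (\<Sum>j\<in>L. (-1) ^ inversions (j # sorted_list_of_set (L - {j})) * f J (L - {j}) z * dzbar Om j \<theta> z))"
 proof -
  have e: "dzbar Om j \<theta> z = Wop \<i> j \<theta> z" if "z \<in> Om" for j z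
   using C1c_test_function(3)[OF t that] by (simp add: dzbar_def Wop_def pd_def)
  have "I ?B = IL ?B" by (rule IL_I[OF Cc_Om[OF B], symmetric])
  also have "\<dots> = (LINT z:Om|lebesgue. (-1) ^ p * (\<Sum>j\<in>L. (-1) ^ inversions (j # sorted_list_of_set (L - {j})) * f J (L - {j}) z * dzbar Om j \<theta> z))"
   unfolding IL_def by (rule set_lebesgue_integral_cong) (simp_all add: Om_lebesgue e sg_def)
  finally show ?thesis .
 qed
 ultimately show "(LINT z:Om|lebesgue. dbar S p f J L z * \<theta> z) =
  - (LINT z:Om|lebesgue. (-1) ^ p * (\<Sum>j\<in>L. (-1) ^ inversions (j # sorted_list_of_set (L - {j})) * f J (L - {j}) z * dzbar Om j \<theta> z))"
  by simp
qed

lemma Cc_dbar: "(\<And>J K. C1c (f J K)) ==> Cc (dbar S p f J L)"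
 unfolding dbar_sg[abs_def] by (intro Cc_cmult Cc_sum W_Cc)

lemma L2_form_Cc: "(\<And>J K. Cc (f J K)) ==> L2_form Om \<phi> p q f"
 unfolding L2_form_def using Cc_L2 by auto

text \<open>
 Testing against a form whose only coefficient is \<open>\<psi>\<close>, which need not vanish on \<open>M\<close>. Integration by
 parts leaves the normal component of \<open>u\<close> on the boundary.
\<close>

lemma dbar_adjoint_test:
 assumes u: "\<And>J K. C1c (u J K)" and v: "dbar_adjoint Om \<phi> p (Suc q) u v"
  and J: "J \<in> multi_indices p" and K: "K \<in> multi_indices q" and p: "C1c \<psi>"
 shows "IL (%z. E z * (\<psi> z * cnj (v J K z))) = I (%z. E z * (\<psi> z * cnj (vf p u J K z))) - (-1) ^ p * BM (%z. \<psi> z * (E z * cnj (ncomp u J K z)))"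
proof -
 note p1 = C1c_C1[OF p]
 define f where "f J' K' = (if J' = J \<and> K' = K then \<psi> else (%_. 0))" for J' K'
 have f: "C1c (f J' K')" for J' K' by (simp add: f_def p C1c_0)
 have fz: "f J' K' z = (if J' = J \<and> K' = K then \<psi> z else 0)" for J' K' z by (simp add: f_def)
 have fC: "Cc (f J' K')" for J' K' by (rule C1c_Cc[OF f])
 let ?g = "dbar S p f"
 have vL: "L2_form Om \<phi> p q v" using v by (simp add: dbar_adjoint_def)
 have "L2_inner Om \<phi> p (Suc q) ?g u = L2_inner Om \<phi> p q f v"
  using v weak_dbar_dbar[of f p q, OF f] L2_form_Cc[of f p q, OF fC] L2_form_Cc[of ?g p "Suc q", OF Cc_dbar[of f, OF f]]
  by (simp add: dbar_adjoint_def)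
 moreover have "L2_inner Om \<phi> p q f v = IL (%z. E z * (\<psi> z * cnj (v J K z)))"
 proof -
  have e: "form_inner p q f v z = \<psi> z * cnj (v J K z)" for z
  proof -
   have "form_inner p q f v z = (\<Sum>J'\<in>multi_indices p. if J' = J then (\<Sum>K'\<in>multi_indices q. if K' = K then \<psi> z * cnj (v J K' z) else 0) else 0)"
    unfolding form_inner_def by (intro sum.cong refl) (simp add: fz mult_delta_left)
   then show ?thesis using J K by simp
  qed
  have vm: "v J K \<in> borel_measurable (lebesgue_on Om)" using vL J K by (auto simp: L2_form_def)
  have pm: "\<psi> \<in> borel_measurable (lebesgue_on Om)" by (rule cont_Om_wO[OF Cc_Om[OF C1c_Cc[OF p]]])
  show ?thesis unfolding L2_inner_def e by (rule wO_integral) (use vm pm in measurable)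
 qed
 moreover have "L2_inner Om \<phi> p (Suc q) ?g u = I (%z. E z * (\<psi> z * cnj (vf p u J K z))) - (-1) ^ p * BM (%z. \<psi> z * (E z * cnj (ncomp u J K z)))"
 proof -
  define UE where "UE j = (%z. E z * rw u J K j z)" for j
  have Uc: "C1c (UE j)" for j unfolding UE_def by (intro C1c_mult_left C1c_rw u C1_E)
  note U1 = C1_cnj[OF C1c_C1[OF Uc]]
  have e: "form_inner p (Suc q) ?g u z = (-1) ^ p * (\<Sum>j\<in>UNIV. Wop \<i> j \<psi> z * cnj (rw u J K j z))" if z: "z \<in> S" for z
  proof -
   define G where "G J' j K' = (if K' = K then if J' = J then (-1) ^ p * (sg j K * Wop \<i> j \<psi> z * cnj (u J (insert j K) z)) else 0 else 0)" for J' j K'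
   have W0: "Wop \<i> j (f J' K') z = (if K' = K then if J' = J then Wop \<i> j \<psi> z else 0 else 0)" for j J' K'
    by (simp add: f_def W_const[OF C1_const[of 0] C1_const[of 0] z])
   have "form_inner p (Suc q) ?g u z = (\<Sum>J'\<in>multi_indices p. \<Sum>L\<in>multi_indices (Suc q). \<Sum>j\<in>L. G J' j (L - {j}))"
    unfolding form_inner_def dbar_sg sum_distrib_left sum_distrib_right
    by (intro sum.cong refl) (auto simp: W0 G_def insert_absorb)
   also have "\<dots> = (\<Sum>J'\<in>multi_indices p. \<Sum>K'\<in>multi_indices q. \<Sum>j\<in>- K'. G J' j K')"
    by (intro sum.cong refl sum_remove_element)
   also have "\<dots> = (\<Sum>J'\<in>multi_indices p. \<Sum>K'\<in>multi_indices q. if K' = K then (\<Sum>j\<in>- K. G J' j K) else 0)"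
    by (intro sum.cong refl) (auto simp: G_def)
   also have "\<dots> = (\<Sum>J'\<in>multi_indices p. if J' = J then (\<Sum>j\<in>- K. G J j K) else 0)"
    using K by (intro sum.cong refl) (auto simp: G_def)
   also have "\<dots> = (\<Sum>j\<in>- K. G J j K)" using J by simp
   also have "\<dots> = (\<Sum>j\<in>UNIV. (-1) ^ p * (Wop \<i> j \<psi> z * cnj (rw u J K j z)))"
    by (rule sum.mono_neutral_cong_left) (auto simp: G_def rw_eq sg_real)
   finally show ?thesis by (simp only: sum_distrib_left)
  qed
  have "L2_inner Om \<phi> p (Suc q) ?g u = I (%z. E z * form_inner p (Suc q) ?g u z)"
   unfolding L2_inner_def form_inner_def
   by (rule wO_I) (intro continuous_intros Cc_Om Cc_dbar f C1c_Cc u)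
  also have "\<dots> = I (%z. (-1) ^ p * (\<Sum>j\<in>UNIV. Wop \<i> j (%z. \<psi> z * cnj (UE j z)) z) + E z * (\<psi> z * cnj (vf p u J K z)))"
  proof (rule I_cong)
   fix z assume "z \<in> Om" then have z: "z \<in> S" using Om_S by blast
   have Wj: "Wop \<i> j (%z. \<psi> z * cnj (UE j z)) z = Wop \<i> j \<psi> z * cnj (UE j z) + \<psi> z * cnj (Wop (- \<i>) j (UE j) z)" for j
    by (simp add: W_mult[OF p1 U1 z] W_cnj[OF C1c_C1[OF Uc] z])
   have vz: "E z * cnj (vf p u J K z) = - ((-1) ^ p * (\<Sum>j\<in>UNIV. cnj (Wop (- \<i>) j (UE j) z)))"
    by (simp add: vf_def UE_def[symmetric])
   show "E z * form_inner p (Suc q) ?g u z = (-1) ^ p * (\<Sum>j\<in>UNIV. Wop \<i> j (%z. \<psi> z * cnj (UE j z)) z) + E z * (\<psi> z * cnj (vf p u J K z))"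
    unfolding e[OF z] Wj mult.left_commute[of "E z" "\<psi> z"] vz
    by (simp add: UE_def sum.distrib sum_distrib_left algebra_simps)
  qed
  also have "\<dots> = (-1) ^ p * (\<Sum>j\<in>UNIV. I (Wop \<i> j (%z. \<psi> z * cnj (UE j z)))) + I (%z. E z * (\<psi> z * cnj (vf p u J K z)))"
  proof -
   have c1: "Cc (Wop \<i> j (%z. \<psi> z * cnj (UE j z)))" for j by (intro W_Cc C1c_mult_right p U1)
   have cv: "continuous_on S (vf p u J K)"
    unfolding vf_def[abs_def] by (intro continuous_intros W_cont C1_mult C1_E C1_cont[OF C1_E] C1c_C1[OF C1c_rw] u ballI E_nz)
   have c2: "Cc (%z. E z * (\<psi> z * cnj (vf p u J K z)))"
    by (intro Cc_mult_left[OF _ C1_cont[OF C1_E]] Cc_mult_right C1c_Cc p continuous_on_cnj cv)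
   show ?thesis by (simp only: I_add[OF Cc_cmult[OF Cc_sum[OF c1]] c2] I_cmult I_sum c1)
  qed
  also have "(\<Sum>j\<in>UNIV. I (Wop \<i> j (%z. \<psi> z * cnj (UE j z)))) = - BM (%z. \<Sum>j\<in>UNIV. Wr \<i> j z * (\<psi> z * cnj (UE j z)))"
   by (subst BM_sum) (simp_all add: Cc_mult_left C1c_Cc C1c_mult_right p U1 W_cont C1_rho W_divergence sum_negf)
  also have "BM (%z. \<Sum>j\<in>UNIV. Wr \<i> j z * (\<psi> z * cnj (UE j z))) = BM (%z. \<psi> z * (E z * cnj (ncomp u J K z)))"
  proof (rule BM_cong)
   fix z assume "z \<in> M" then have z: "z \<in> S" using M_sub by blast
   show "(\<Sum>j\<in>UNIV. Wr \<i> j z * (\<psi> z * cnj (UE j z))) = \<psi> z * (E z * cnj (ncomp u J K z))"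
    by (simp add: ncomp_def UE_def Rb_def[symmetric] cnj_Rz[OF z] sum_distrib_left mult_ac)
  qed
  finally show ?thesis by simp
 qed
 ultimately show ?thesis by simp
qed

lemma cont_vf: "(\<And>J K. C1c (u J K)) ==> continuous_on S (vf p u J K)"
 unfolding vf_def[abs_def] by (intro continuous_intros W_cont C1_mult C1_E C1_cont[OF C1_E] C1c_C1[OF C1c_rw] ballI E_nz)

text \<open>Test forms with support in \<open>Om\<close> determine \<open>v\<close>. Then for all other test functions the boundary term has
 to vanish, and the normal component of \<open>u\<close> itself is an admissible test function.\<close>

lemma dbar_adjoint_value:
 assumes u: "\<And>J K. C1c (u J K)" and v: "dbar_adjoint Om \<phi> p (Suc q) u v"
  and J: "J \<in> multi_indices p" and K: "K \<in> multi_indices q"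
 shows "AE z in lebesgue. z \<in> Om --> v J K z = vf p u J K z"
  and "AE z in \<sigma>. z \<in> M --> ncomp u J K z = 0"
proof -
 have cv: "continuous_on Om (vf p u J K)" using cont_vf[of u p J K, OF u] Om_S continuous_on_subset by blast
 have vm: "v J K \<in> borel_measurable (lebesgue_on Om)" and v2: "integrable wO (%z. (cmod (v J K z))\<^sup>2)"
  using v J K by (auto simp: dbar_adjoint_def L2_form_def)
 have vfm: "vf p u J K \<in> borel_measurable (lebesgue_on Om)" by (rule cont_Om_wO[OF cv])
 have Em: "E \<in> borel_measurable (lebesgue_on Om)" by (rule cont_Om_wO[OF continuous_on_subset[OF C1_cont[OF C1_E] Om_S]])
 define d where "d z = v J K z - vf p u J K z" for z
 define w where "w z = indicator Om z *\<^sub>R (E z * cnj (d z))" for z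
 have dm: "(%z. E z * cnj (d z)) \<in> borel_measurable (lebesgue_on Om)" unfolding d_def using vm vfm Em by measurable
 then have wm: "w \<in> borel_measurable lebesgue"
  unfolding w_def[abs_def] by (subst (asm) borel_measurable_restrict_space_iff) (simp_all add: Om_lebesgue)
 have i2: "integrable lebesgue (%z. indicator Om z *\<^sub>R (exp (- \<phi> z) * (cmod (v J K z))\<^sup>2))"
 proof -
  have m: "(%z. complex_of_real ((cmod (v J K z))\<^sup>2)) \<in> borel_measurable (lebesgue_on Om)" using vm by measurable
  have "integrable wO (%z. complex_of_real ((cmod (v J K z))\<^sup>2))" using v2 by (simp only: complex_of_real_integrable_eq)
  then have "set_integrable lebesgue Om (%z. E z * complex_of_real ((cmod (v J K z))\<^sup>2))" by (simp only: wO_integrable[OF m])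
  then have "integrable lebesgue (%z. complex_of_real (indicator Om z *\<^sub>R (exp (- \<phi> z) * (cmod (v J K z))\<^sup>2)))"
   by (simp add: set_integrable_def E_real scaleR_conv_of_real)
  then show ?thesis by (simp only: complex_of_real_integrable_eq)
 qed
 have iw: "integrable lebesgue (%z. indicator (cbox a b) z *\<^sub>R w z)" if ab: "cbox a b \<subseteq> Om" for a b
 proof (rule Bochner_Integration.integrable_bound)
  let ?h = "%z. indicator (cbox a b) z *\<^sub>R (exp (- \<phi> z) * (1 + cmod (vf p u J K z)))"
  have "continuous_on Om (%z. exp (- \<phi> z) * (1 + cmod (vf p u J K z)))"
  proof -
   have "continuous_on Om (%z. Re (E z))" by (intro continuous_intros continuous_on_subset[OF C1_cont[OF C1_E] Om_S])
   then have "continuous_on Om (%z. exp (- \<phi> z))" by (simp add: E_real)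
   then show ?thesis by (rule continuous_on_mult) (intro continuous_intros cv)
  qed
  then have "integrable lborel ?h"
   by (intro borel_integrable_compact compact_cbox) (use ab continuous_on_subset in blast)
  then have "integrable lebesgue ?h" by (subst integrable_completion) auto
  then show "integrable lebesgue (%z. ?h z + indicator Om z *\<^sub>R (exp (- \<phi> z) * (cmod (v J K z))\<^sup>2))"
   using i2 by (rule Bochner_Integration.integrable_add)
  show "(%z. indicator (cbox a b) z *\<^sub>R w z) \<in> borel_measurable lebesgue"
   using wm by (intro borel_measurable_scaleR borel_measurable_indicator) (auto simp: sets_completionI_sets)
  show "AE z in lebesgue. norm (indicator (cbox a b) z *\<^sub>R w z) \<le> norm (?h z + indicator Om z *\<^sub>R (exp (- \<phi> z) * (cmod (v J K z))\<^sup>2))"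
  proof (rule AE_I2)
   fix z
   show "norm (indicator (cbox a b) z *\<^sub>R w z) \<le> norm (?h z + indicator Om z *\<^sub>R (exp (- \<phi> z) * (cmod (v J K z))\<^sup>2))"
   proof (cases "z \<in> cbox a b")
    case True
    then have z: "z \<in> Om" using ab by blast
    have "norm (w z) = exp (- \<phi> z) * cmod (d z)" using z by (simp add: w_def E_real norm_mult)
    also have "cmod (d z) \<le> cmod (v J K z) + cmod (vf p u J K z)" unfolding d_def by (rule norm_triangle_ineq4)
    \<comment> \<open>\<open>v\<close> is only known to be square integrable; this makes it locally integrable\<close>
    also have "cmod (v J K z) \<le> 1 + (cmod (v J K z))\<^sup>2"
    proof -
     have "0 \<le> (cmod (v J K z) - 1)\<^sup>2" by simp
     then have "2 * cmod (v J K z) \<le> 1 + (cmod (v J K z))\<^sup>2" by (simp add: power2_eq_square algebra_simps)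
     then show ?thesis using norm_ge_zero[of "v J K z"] by linarith
    qed
    finally have "norm (w z) \<le> exp (- \<phi> z) * (1 + cmod (vf p u J K z)) + exp (- \<phi> z) * (cmod (v J K z))\<^sup>2"
     by (simp add: algebra_simps)
    also have "\<dots> \<le> norm (?h z + indicator Om z *\<^sub>R (exp (- \<phi> z) * (cmod (v J K z))\<^sup>2))"
     using True z by simp
    finally show ?thesis using True by simp
   qed simp
  qed
 qed
 have ae: "AE z in lebesgue. z \<in> Om --> w z = 0"
 proof (rule AE_zero_if_orthogonal_to_bumps[OF open_Om iw wm])
  fix k :: nat and a b :: "'n cspace" assume ab: "cbox a b \<subseteq> Om"
  let ?b = "cplx (bump k a b)"
  note t = test_function_bump[OF ab, of k]
  note p = C1c_test_function(1)[OF t]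
  have b0: "BM (%z. ?b z * (E z * cnj (ncomp u J K z))) = 0" by (rule BM_zero) (simp only: C1c_test_function(2)[OF t] mult_zero_left)
  have c: "Cc (%z. E z * (?b z * cnj (vf p u J K z)))"
   by (intro Cc_mult_left[OF _ C1_cont[OF C1_E]] Cc_mult_right C1c_Cc p continuous_on_cnj cont_vf u)
  have e: "IL (%z. E z * (?b z * cnj (v J K z))) = IL (%z. E z * (?b z * cnj (vf p u J K z)))"
   using dbar_adjoint_test[OF u v J K p] b0 IL_I[OF Cc_Om[OF c]] by simp
  have i1: "set_integrable lebesgue Om (%z. E z * (?b z * cnj (vf p u J K z)))" by (rule Cc_IL[OF c])
  have eq: "bump k a b z *\<^sub>R w z = indicator Om z *\<^sub>R (E z * (?b z * cnj (v J K z))) - indicator Om z *\<^sub>R (E z * (?b z * cnj (vf p u J K z)))" for z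
   by (simp add: w_def d_def scaleR_conv_of_real algebra_simps)
  have ib: "integrable lebesgue (%z. bump k a b z *\<^sub>R w z)"
  proof (rule Bochner_Integration.integrable_bound[OF iw[OF ab]])
   show "(%z. bump k a b z *\<^sub>R w z) \<in> borel_measurable lebesgue"
    using wm by (intro borel_measurable_scaleR) (auto intro: measurable_completion)
   show "AE z in lebesgue. norm (bump k a b z *\<^sub>R w z) \<le> norm (indicator (cbox a b) z *\<^sub>R w z)"
   proof (rule AE_I2)
    fix z
    have "z \<notin> cbox a b ==> bump k a b z = 0" using bump_zero[of z a b k] box_subset_cbox[of a b] by blast
    then show "norm (bump k a b z *\<^sub>R w z) \<le> norm (indicator (cbox a b) z *\<^sub>R w z)"
     using bump_le1[of k a b z] bump_nonneg[of k a b z] by (cases "z \<in> cbox a b") (auto simp: mult_left_le_one_le)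
   qed
  qed
  have i3: "integrable lebesgue (%z. indicator Om z *\<^sub>R (E z * (?b z * cnj (v J K z))))"
   using Bochner_Integration.integrable_add[OF ib i1[unfolded set_integrable_def]] by (simp add: eq)
  show "(\<integral>z. bump k a b z *\<^sub>R w z \<partial>lebesgue) = 0"
   unfolding eq using e i1 i3 by (simp add: IL_def set_lebesgue_integral_def set_integrable_def)
 qed
 then show av: "AE z in lebesgue. z \<in> Om --> v J K z = vf p u J K z"
  by eventually_elim (auto simp: w_def d_def)
 have bt: "BM (%z. \<psi> z * (E z * cnj (ncomp u J K z))) = 0" if p: "C1c \<psi>" for \<psi>
 proof -
  have c: "Cc (%z. E z * (\<psi> z * cnj (vf p u J K z)))"
   by (intro Cc_mult_left[OF _ C1_cont[OF C1_E]] Cc_mult_right C1c_Cc p continuous_on_cnj cont_vf u)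
  have pm: "\<psi> \<in> borel_measurable (lebesgue_on Om)" by (rule cont_Om_wO[OF Cc_Om[OF C1c_Cc[OF p]]])
  have m1: "(%z. E z * (\<psi> z * cnj (v J K z))) \<in> borel_measurable (lebesgue_on Om)" using vm pm Em by measurable
  have m2: "(%z. E z * (\<psi> z * cnj (vf p u J K z))) \<in> borel_measurable (lebesgue_on Om)" using vfm pm Em by measurable
  have "IL (%z. E z * (\<psi> z * cnj (v J K z))) = IL (%z. E z * (\<psi> z * cnj (vf p u J K z)))"
   unfolding IL_def set_lebesgue_integral_def
  proof (rule integral_cong_AE)
   show "AE z in lebesgue. indicator Om z *\<^sub>R (E z * (\<psi> z * cnj (v J K z))) = indicator Om z *\<^sub>R (E z * (\<psi> z * cnj (vf p u J K z)))"
    using av by eventually_elim (auto simp: indicator_def)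
  qed (use m1 m2 in \<open>simp_all add: borel_measurable_restrict_space_iff Om_lebesgue\<close>)
  then show ?thesis using dbar_adjoint_test[OF u v J K p] IL_I[OF Cc_Om[OF c]] by simp
 qed
 have wc: "C1c (ncomp u J K)" unfolding ncomp_def[abs_def] by (intro C1c_sum C1c_mult_left C1c_rw u C1_Rz)
 let ?F = "%z. indicator M z * (exp (- \<phi> z) * (cmod (ncomp u J K z))\<^sup>2)"
 have FE: "indicator M z *\<^sub>R (ncomp u J K z * (E z * cnj (ncomp u J K z))) = complex_of_real (?F z)" for z
  by (simp add: E_real complex_norm_square scaleR_conv_of_real indicator_def del: of_real_power)
 have cF: "Cc (%z. ncomp u J K z * (E z * cnj (ncomp u J K z)))"
  by (intro Cc_mult_left Cc_cnj C1c_Cc wc C1_cont[OF C1_E] C1_cont[OF C1c_C1])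
 have iF: "integrable \<sigma> (%z. complex_of_real (?F z))"
  using Cc_BM_int[OF cF] unfolding set_integrable_def FE .
 have "complex_of_real (integral\<^sup>L \<sigma> ?F) = BM (%z. ncomp u J K z * (E z * cnj (ncomp u J K z)))"
  unfolding BM_def set_lebesgue_integral_def FE by (rule integral_complex_of_real[symmetric])
 then have "integral\<^sup>L \<sigma> ?F = 0" using bt[OF wc] by simp
 then have "AE z in \<sigma>. ?F z = 0"
  by (subst (asm) integral_nonneg_eq_0_iff_AE[OF iF[unfolded complex_of_real_integrable_eq]]) simp_all
 then show "AE z in \<sigma>. z \<in> M --> ncomp u J K z = 0" by eventually_elim auto
qed

lemma dbar_star_norm:
 assumes u: "\<And>J K. C1c (u J K)" and v: "dbar_adjoint Om \<phi> p (Suc q) u v"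
 shows "complex_of_real ((L2_norm Om \<phi> p q v)\<^sup>2) = I (%z. E z * (\<Sum>J\<in>multi_indices p. \<Sum>K\<in>multi_indices q. vf p u J K z * cnj (vf p u J K z)))"
proof -
 have vL: "v J K \<in> borel_measurable (lebesgue_on Om)" if "J \<in> multi_indices p" "K \<in> multi_indices q" for J K
  using v that by (auto simp: dbar_adjoint_def L2_form_def)
 have cmod2: "(%x. (cmod x)\<^sup>2) \<in> borel_measurable borel" by measurable
 have cv: "continuous_on Om (vf p u J K)" for J K using cont_vf[of u p J K, OF u] Om_S continuous_on_subset by blast
 have "L2_norm Om \<phi> p q v = L2_norm Om \<phi> p q (vf p u)"
  unfolding L2_norm_def
 proof (rule arg_cong[of _ _ sqrt], rule integral_cong_AE)
  show "form_norm_sq p q v \<in> borel_measurable wO"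
   unfolding form_norm_sq_def[abs_def] measurable_wO by (intro borel_measurable_sum measurable_compose[OF vL cmod2])
  show "form_norm_sq p q (vf p u) \<in> borel_measurable wO"
   unfolding form_norm_sq_def[abs_def] measurable_wO by (intro borel_measurable_sum measurable_compose[OF cont_Om_wO[OF cv] cmod2])
  have "AE z in lebesgue. \<forall>J\<in>multi_indices p. \<forall>K\<in>multi_indices q. z \<in> Om --> v J K z = vf p u J K z"
   by (intro AE_finite_allI finite dbar_adjoint_value(1)[OF u v])
  then have "AE z in lebesgue_on Om. form_norm_sq p q v z = form_norm_sq p q (vf p u) z"
   by (subst AE_restrict_space_iff) (auto simp: Om_lebesgue form_norm_sq_def elim!: eventually_mono)
  then show "AE z in wO. form_norm_sq p q v z = form_norm_sq p q (vf p u) z"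
   unfolding weighted_lebesgue_def using wdens by (subst AE_density) (auto elim: eventually_mono)
 qed
 then show ?thesis
  by (simp only:) (rule L2_norm_sq[OF form_norm_sq_complex], intro continuous_intros cv)
qed

end

section \<open>The identity for forms\<close>

context weighted_domain
begin

lemma dz_rho: "dz S j (cplx \<rho>) = Rz j" and dzbar_rho: "dzbar S j (cplx \<rho>) = Rb j"
 by (simp_all add: dz_W dzbar_W Rz_def[abs_def] Rb_def[abs_def])

text \<open>This and the following lemmas evaluate \<open>\<tau>\<close>, \<open>\<gamma>\<close>, \<open>\<eta>\<close> and \<open>conj N\<close>, which are defined through
 operators, in terms of the functions of the scalar identity.\<close>

lemma tau_eq: assumes z: "z \<in> S" shows "tau S \<rho> z = ta z"
 by (simp add: tau_def dz_rho conj_L_op[OF C1_Rz z] ta_sum[OF z] cnj_Pt[OF z] W_R[OF z])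

lemma gamma_eq: assumes z: "z \<in> S" shows "gamma S \<rho> \<phi> z = gam z"
proof -
 have "gamma S \<rho> \<phi> z = (\<Sum>j\<in>UNIV. \<Sum>k\<in>UNIV. Pt j k z * Wop (- \<i>) j (Wop \<i> k (cplx \<phi>)) z)"
  by (simp add: gamma_def dz_W conj_L_op[OF W_C1[OF C2_phi] z] cnj_Pt[OF z] W_symmetric[OF C2_phi z, of "\<i>" _ "- \<i>"])
 also have "\<dots> = gam z" unfolding gam_def by (rule sum.swap)
 finally show ?thesis .
qed

lemma eta_eq: assumes z: "z \<in> S" shows "(complex_of_real (eta S \<rho> z))\<^sup>2 = et2 z"
proof -
 have L: "L_op S \<rho> j (dz S k (cplx \<rho>)) z = levi_data.tgl (%j. Rz j z) (%j. A2 j k z) j" for j k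
  by (simp add: L_op_Pt[OF z] tgl_Pt[OF z] dz_rho W_R[OF z])
 have "(eta S \<rho> z)\<^sup>2 = (\<Sum>j\<in>UNIV. \<Sum>k\<in>UNIV. (cmod (L_op S \<rho> j (dz S k (cplx \<rho>)) z))\<^sup>2)"
  unfolding eta_def by (rule real_sqrt_pow2) (intro sum_nonneg zero_le_power2)
 then have "complex_of_real ((eta S \<rho> z)\<^sup>2) = et2 z"
  by (simp only: of_real_sum complex_norm_square L et2_def)
 then show ?thesis by simp
qed

lemma N_eq: assumes f: "C1 S f" and z: "z \<in> S" shows "conj_op (N_op S \<rho>) f z = Nb f z"
 by (simp add: conj_op_def N_op_def dz_W dzbar_rho W_cnj[OF f z] cnj_Rb[OF z] Nb_def)

lemma cont_gam: "continuous_on S gam"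
 unfolding gam_def[abs_def] by (intro continuous_intros C1_cont[OF C1_Pt] W_cont W_C1 C2_phi)

lemma cont_et2: "continuous_on S et2"
proof -
 have "continuous_on S (%z. \<Sum>j\<in>UNIV. \<Sum>k\<in>UNIV. (\<Sum>l\<in>UNIV. Pt l j z * A2 l k z) * cnj (\<Sum>l\<in>UNIV. Pt l j z * A2 l k z))"
  unfolding A2_def by (intro continuous_intros C1_cont[OF C1_Pt] W_cont C1_Rz)
 then show ?thesis by (rule continuous_on_eq) (simp add: et2_def tgl_Pt)
qed

text \<open>The remaining integrands of the scalar identity, without their numerical factors.\<close>

definition "s0 f z = E z * (\<Sum>j\<in>UNIV. Wop \<i> j f z * cnj (Wop \<i> j f z))"
definition "nt f z = E z * ((Nb f z + 4 * ta z * f z) * cnj (Nb f z + 4 * ta z * f z))"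
definition "at1 f j z = E z * (Aj f j z * cnj (Aj f j z))"

text \<open>An expression formed from \<open>f\<close> and its first derivatives inherits the compact support of \<open>f\<close>.\<close>

lemma csq_Cc: "C1c f ==> continuous_on S g ==> (\<And>z. z \<in> S ==> g z = 0 \<or> f z \<noteq> 0 \<or> (\<exists>j c. Wop c j f z \<noteq> 0)) ==> Cc g"
proof -
 assume f: "C1c f" and g: "continuous_on S g" and z: "\<And>z. z \<in> S ==> g z = 0 \<or> f z \<noteq> 0 \<or> (\<exists>j c. Wop c j f z \<noteq> 0)"
 obtain C where C: "compact C" "C \<subseteq> S" "\<And>x. x \<notin> C ==> f x = 0" using C1c_supp[OF f] by blast
 have "pd S b f x = 0" if "x \<in> S" "x \<notin> C" for b x
  by (rule pd_0_outside[OF _ C(3)]) (use C that in \<open>auto dest: compact_imp_closed\<close>)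
 then have "g x = 0" if "x \<in> S" "x \<notin> C" for x
  using z[OF that(1)] C(3)[OF that(2)] that by (auto simp: Wop_def)
 then show "Cc g" using g C(1,2) unfolding Cc_def by blast
qed

lemma
 assumes f: "C1c f"
 shows Cc_s0: "Cc (s0 f)" and Cc_nt: "Cc (nt f)" and Cc_at1: "Cc (at1 f j)"
proof -
 note f1 = C1c_C1[OF f]
 show "Cc (s0 f)"
  by (rule csq_Cc[OF f]) (auto simp: s0_def[abs_def] intro!: continuous_intros C1_cont[OF C1_E] W_cont f1)
 show "Cc (nt f)"
  by (rule csq_Cc[OF f]) (auto simp: nt_def[abs_def] Nb_def intro!: continuous_intros C1_cont[OF C1_E] C1_cont[OF f1] C1_cont[OF C1_Rz] W_cont f1 cont_ta)
 show "Cc (at1 f j)"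
 proof (rule csq_Cc[OF f])
  show "continuous_on S (at1 f j)"
   unfolding at1_def[abs_def] by (intro continuous_intros C1_cont[OF C1_E] cont_Aj f1)
  show "at1 f j z = 0 \<or> f z \<noteq> 0 \<or> (\<exists>j c. Wop c j f z \<noteq> 0)" if "z \<in> S" for z
   by (auto simp: at1_def Aj_def tgl_Pt[OF that])
 qed
qed

lemma Cc_FF: "C1c f ==> continuous_on S g ==> Cc (%z. g z * FF f z)"
 by (rule Cc_mult_left[OF C1c_Cc[OF C1c_FF]])

lemma scalar_identity':
 assumes f: "C1c f"
 shows "I (s0 f) = BM (%z. ta z * FF f z) - I (%z. gam z * FF f z) - 4 * I (%z. et2 z * FF f z)
   + 1/4 * I (nt f) + (\<Sum>j\<in>UNIV. I (at1 f j))"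
proof -
 note c = Cc_s0[OF f] Cc_FF[OF f cont_gam] Cc_cmult[OF Cc_FF[OF f cont_et2], of 4] Cc_cmult[OF Cc_nt[OF f], of "1/4"] Cc_sum[OF Cc_at1[OF f]]
 have "BM (%z. ta z * FF f z) = I (%z. s0 f z + gam z * FF f z + 4 * (et2 z * FF f z) - 1/4 * nt f z - (\<Sum>j\<in>UNIV. at1 f j z))"
  unfolding scalar_identity[OF f, symmetric]
  by (intro I_cong) (simp add: s0_def nt_def at1_def sum_distrib_left mult.assoc)
 also have "\<dots> = I (s0 f) + I (%z. gam z * FF f z) + 4 * I (%z. et2 z * FF f z) - 1/4 * I (nt f) - (\<Sum>j\<in>UNIV. I (at1 f j))"
  by (simp only: I_diff[OF Cc_diff[OF Cc_add[OF Cc_add[OF c(1,2)] c(3)] c(4)] c(5)]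
    I_diff[OF Cc_add[OF Cc_add[OF c(1,2)] c(3)] c(4)] I_add[OF Cc_add[OF c(1,2)] c(3)] I_add[OF c(1,2)] I_cmult I_sum[OF Cc_at1[OF f]])
 finally show ?thesis by (simp add: algebra_simps)
qed

text \<open>The integrand of \<open>row_identity\<close> for one row of \<open>u\<close>, and the contributions of the row to \<open>H \<phi>\<close> and \<open>H \<rho>\<close>.\<close>

definition "rowI u J K z = (\<Sum>j\<in>UNIV. \<Sum>k\<in>UNIV. inverse (E z) * (Wop (- \<i>) j (%z. E z * rw u J K j z) z * cnj (Wop (- \<i>) k (%z. E z * rw u J K k z) z))
   - E z * (Wop \<i> k (rw u J K j) z * cnj (Wop \<i> j (rw u J K k) z)))"
definition "rowH u J K z = (\<Sum>j\<in>UNIV. \<Sum>k\<in>UNIV. Hp j k z * rw u J K j z * cnj (rw u J K k z) * E z)"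
definition "rowR u J K z = (\<Sum>j\<in>UNIV. \<Sum>k\<in>UNIV. H2 j k z * rw u J K j z * cnj (rw u J K k z) * E z)"

lemma
 assumes u: "\<And>J K. C1c (u J K)"
 shows Cc_rowI: "Cc (rowI u J K)" and Cc_rowH: "Cc (rowH u J K)" and Cc_rowR: "Cc (rowR u J K)"
proof -
 note r = C1c_rw[of u J K, OF u]
 note r1 = C1c_C1[OF r]
 have U: "C1c (%z. E z * rw u J K j z)" for j by (intro C1c_mult_left r C1_E)
 show "Cc (rowI u J K)"
  unfolding rowI_def[abs_def]
  by (intro Cc_sum Cc_diff Cc_mult_left Cc_mult_right[OF W_Cc[OF U]] Cc_mult_right[OF W_Cc[OF r]] continuous_on_cnj
    W_cont r1 C1c_C1[OF U] continuous_on_inverse C1_cont[OF C1_E] ballI E_nz)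
 have P1: "C1 S (Wop \<i> k (cplx \<phi>))" for k by (rule W_C1[OF C2_phi])
 show "Cc (rowH u J K)" "Cc (rowR u J K)"
  unfolding rowH_def[abs_def] rowR_def[abs_def] Hp_def H2_def
  by (intro Cc_sum Cc_mult_right[OF _ C1_cont[OF C1_E]] Cc_mult_right[OF _ C1_cont[OF C1_cnj[OF r1]]] Cc_mult_left[OF C1c_Cc[OF r]] W_cont P1 C1_Rb)+
qed

text \<open>
 The diagonal part of \<open>\<bar>dbar u\<bar>^2\<close> consists of the scalar integrands \<open>s0\<close>; its mixed part and the square
 of the adjoint are collected in the row integrands.
\<close>

lemma norms_pointwise:
 assumes u: "\<And>J K. C1c (u J K)" and z: "z \<in> S"
 shows "E z * (\<Sum>J\<in>multi_indices p. \<Sum>L\<in>multi_indices (Suc (Suc q)). dbar S p u J L z * cnj (dbar S p u J L z))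
   + E z * (\<Sum>J\<in>multi_indices p. \<Sum>K\<in>multi_indices q. vf p u J K z * cnj (vf p u J K z)) =
  (\<Sum>J\<in>multi_indices p. (\<Sum>K\<in>multi_indices (Suc q). s0 (u J K) z) + (\<Sum>K\<in>multi_indices q. rowI u J K z))"
proof -
 have pp: "((-1::complex) ^ p * x) * cnj ((-1) ^ p * y) = x * cnj y" for x y
  by (simp add: flip: power_add mult_2)
 have Wr: "Wop \<i> k (rw u J K j) z = (if j \<in> K then 0 else sg j K * Wop \<i> k (u J (insert j K)) z)" for J K j k
  by (simp add: rw_eq W_const[OF C1_const C1_const z] W_cmult[OF C1c_C1[OF u] C1_const z])
 have d: "(\<Sum>L\<in>multi_indices (Suc (Suc q)). dbar S p u J L z * cnj (dbar S p u J L z)) =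
   (\<Sum>K\<in>multi_indices (Suc q). \<Sum>j\<in>UNIV. Wop \<i> j (u J K) z * cnj (Wop \<i> j (u J K) z))
  - (\<Sum>K\<in>multi_indices q. \<Sum>j\<in>UNIV. \<Sum>k\<in>UNIV. Wop \<i> k (rw u J K j) z * cnj (Wop \<i> j (rw u J K k) z))" for J
  unfolding dbar_sg pp Wr by (rule dbar_norm_expansion)
 have v: "E z * (vf p u J K z * cnj (vf p u J K z)) =
   (\<Sum>j\<in>UNIV. \<Sum>k\<in>UNIV. inverse (E z) * (Wop (- \<i>) j (%z. E z * rw u J K j z) z * cnj (Wop (- \<i>) k (%z. E z * rw u J K k z) z)))" for J K
 proof -
  define s where "s = (\<Sum>j\<in>UNIV. Wop (- \<i>) j (%z. E z * rw u J K j z) z)"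
  have vf: "vf p u J K z = (-1) ^ p * (- (inverse (E z) * s))" by (simp add: vf_def s_def)
  have "E z * (vf p u J K z * cnj (vf p u J K z)) = inverse (E z) * (s * cnj s)"
   unfolding vf pp by (simp add: field_simps)
  then show ?thesis unfolding s_def cnj_sum unfolding sum_product unfolding sum_distrib_left .
 qed
 have "E z * (\<Sum>K\<in>multi_indices q. vf p u J K z * cnj (vf p u J K z)) =
   (\<Sum>K\<in>multi_indices q. rowI u J K z) + E z * (\<Sum>K\<in>multi_indices q. \<Sum>j\<in>UNIV. \<Sum>k\<in>UNIV. Wop \<i> k (rw u J K j) z * cnj (Wop \<i> j (rw u J K k) z))" for J
  unfolding rowI_def sum_distrib_left v sum.distrib[symmetric] by (intro sum.cong refl) simp
 then show ?thesis
  unfolding sum_distrib_left[of "E z" _ "multi_indices p"] sum.distrib[symmetric] d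
  by (intro sum.cong refl) (simp add: s0_def right_diff_distrib sum_distrib_left)
qed

lemma L2_norm_cong:
 assumes "\<And>J K z. J \<in> multi_indices p ==> K \<in> multi_indices q ==> z \<in> Om ==> a J K z = b J K z"
 shows "L2_norm Om \<phi> p q a = L2_norm Om \<phi> p q b"
 unfolding L2_norm_def form_norm_sq_def
 by (intro arg_cong[of _ _ sqrt] Bochner_Integration.integral_cong refl sum.cong) (simp add: assms weighted_lebesgue_def)

text \<open>
 The coefficients of the given form \<open>u\<close> carry no information for indices of the wrong length and
 outside \<open>S\<close>, where they may be arbitrary. Below \<open>w\<close> is a copy of \<open>u\<close> that is set to 0 there, so that
 all its coefficients are compactly supported \<open>C^1\<close> functions; no term of the identity notices
 the difference.
\<close>

context
 fixes p q :: nat and u w :: "'n form"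
 assumes uw: "\<And>J K z. J \<in> multi_indices p ==> K \<in> multi_indices (Suc q) ==> z \<in> S ==> u J K z = w J K z"
begin

lemma uw_Om: "J \<in> multi_indices p ==> K \<in> multi_indices (Suc q) ==> z \<in> Om ==> u J K z = w J K z"
 using uw Om_S by blast

lemma W_uw: "J \<in> multi_indices p ==> K \<in> multi_indices (Suc q) ==> z \<in> S ==> Wop c j (u J K) z = Wop c j (w J K) z"
 by (rule W_cong) (rule uw)

lemma dbar_uw:
 assumes J: "J \<in> multi_indices p" and L: "L \<in> multi_indices (Suc (Suc q))" and z: "z \<in> S"
 shows "dbar S p u J L z = dbar S p w J L z"
proof -
 have "L - {j} \<in> multi_indices (Suc q)" if "j \<in> L" for j using L that by (simp add: multi_indices_def)
 then show ?thesis by (simp add: dbar_sg W_uw[OF J _ z])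
qed

lemma form_norm_sq_uw: "z \<in> S ==> form_norm_sq p (Suc q) u z = form_norm_sq p (Suc q) w z"
 unfolding form_norm_sq_def by (intro sum.cong refl) (simp add: uw)

lemma skew_uw: "J \<in> multi_indices p ==> K \<in> multi_indices q ==> z \<in> S ==>
  skew_coeff u J (j # sorted_list_of_set K) z = skew_coeff w J (j # sorted_list_of_set K) z"
 using uw[of J "insert j K" z] by (auto simp: skew_coeff_Cons multi_indices_def)

lemma H_form_uw: "z \<in> S ==> H_form S p (Suc q) \<psi> u z = H_form S p (Suc q) \<psi> w z"
 unfolding H_form_def by (intro sum.cong refl) (simp add: skew_uw)

lemma dbar_adjoint_uw: "dbar_adjoint Om \<phi> p (Suc q) u = dbar_adjoint Om \<phi> p (Suc q) w"
proof -
 have sp: "space wO = Om" by (simp add: weighted_lebesgue_def)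
 have 1: "u J K \<in> borel_measurable wO \<longleftrightarrow> w J K \<in> borel_measurable wO" if "J \<in> multi_indices p" "K \<in> multi_indices (Suc q)" for J K
  by (rule measurable_cong) (simp add: sp uw_Om[OF that])
 have 2: "integrable wO (%z. (cmod (u J K z))\<^sup>2) \<longleftrightarrow> integrable wO (%z. (cmod (w J K z))\<^sup>2)" if "J \<in> multi_indices p" "K \<in> multi_indices (Suc q)" for J K
  by (rule Bochner_Integration.integrable_cong) (simp_all add: sp uw_Om[OF that])
 have 3: "L2_form Om \<phi> p (Suc q) u \<longleftrightarrow> L2_form Om \<phi> p (Suc q) w"
  unfolding L2_form_def by (intro ball_cong refl) (simp only: 1 2)
 have 4: "L2_inner Om \<phi> p (Suc q) g u = L2_inner Om \<phi> p (Suc q) g w" for g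
  unfolding L2_inner_def form_inner_def
  by (intro Bochner_Integration.integral_cong refl sum.cong) (simp add: sp uw_Om)
 show ?thesis by (intro ext) (simp only: dbar_adjoint_def 3 4)
qed

lemma formal_adjoint_uw:
 assumes "J \<in> multi_indices p" "K \<in> multi_indices (Suc q)"
 shows "formal_adjoint Om \<phi> X (u J K) = formal_adjoint Om \<phi> X (w J K)"
proof -
 have "(LINT z|wO. X \<psi> z * cnj (u J K z)) = (LINT z|wO. X \<psi> z * cnj (w J K z))" for \<psi>
  by (intro Bochner_Integration.integral_cong refl) (simp add: weighted_lebesgue_def uw_Om[OF assms])
 then show ?thesis by (simp only: formal_adjoint_def)
qed

lemma N_uw:
 assumes "J \<in> multi_indices p" "K \<in> multi_indices (Suc q)" and z: "z \<in> S"
 shows "conj_op (N_op S \<rho>) (u J K) z = conj_op (N_op S \<rho>) (w J K) z"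
proof -
 have "Wop (- \<i>) j (%z. cnj (u J K z)) z = Wop (- \<i>) j (%z. cnj (w J K z)) z" for j
  by (rule W_cong[OF _ z]) (simp add: uw[OF assms(1,2)])
 then show ?thesis by (simp add: conj_op_def N_op_def dz_W)
qed

text \<open>The two norms on the left are sums of \<open>s0\<close> and \<open>rowI\<close>. The scalar identity is applied to each coefficient and
 the row identity to each row, and the results are collected into the terms on the right.\<close>

lemma weighted_identity:
 assumes w: "\<And>J K. C1c (w J K)" and v: "dbar_adjoint Om \<phi> p (Suc q) u v"
 shows "complex_of_real ((L2_norm Om \<phi> p (Suc (Suc q)) (dbar S p u))\<^sup>2) + complex_of_real ((L2_norm Om \<phi> p q v)\<^sup>2) =
    - (LINT z:M|\<sigma>. (H_form S p (Suc q) \<rho> u z - tau S \<rho> z * complex_of_real (form_norm_sq p (Suc q) u z)) * complex_of_real (exp (- \<phi> z)))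
    + (LINT z:Om|lebesgue. (H_form S p (Suc q) \<phi> u z - gamma S \<rho> \<phi> z * complex_of_real (form_norm_sq p (Suc q) u z)) * complex_of_real (exp (- \<phi> z)))
    - complex_of_real (4 * (L2_norm Om \<phi> p (Suc q) (%J K z. complex_of_real (eta S \<rho> z) * u J K z))\<^sup>2)
    + complex_of_real (1 / 4 * (L2_norm Om \<phi> p (Suc q) (%J K z. conj_op (N_op S \<rho>) (u J K) z + 4 * tau S \<rho> z * u J K z))\<^sup>2)
    + (\<Sum>j\<in>UNIV. complex_of_real ((L2_norm Om \<phi> p (Suc q)
      (%J K z. formal_adjoint Om \<phi> (conj_op (L_op S \<rho> j)) (u J K) z - 4 * dz S j (cplx \<rho>) z * tau S \<rho> z * u J K z))\<^sup>2))"
proof -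
 let ?P = "multi_indices p :: 'n set set" and ?Q1 = "multi_indices (Suc q) :: 'n set set" and ?Q = "multi_indices q :: 'n set set"
 note w1 = C1c_C1[OF w]
 have v: "dbar_adjoint Om \<phi> p (Suc q) w v" using v by (simp only: dbar_adjoint_uw)
 note cu = C1_cont[OF w1]
 have OmS: "z \<in> Om ==> z \<in> S" for z using Om_S by blast
 have cOm: "continuous_on S F ==> continuous_on Om F" for F :: "'n cspace => complex" using Om_S continuous_on_subset by blast
 have cdb: "Cc (dbar S p w J L)" for J L by (rule Cc_dbar[of w, OF w])
 have cvf: "continuous_on S (vf p w J K)" for J K by (rule cont_vf[of w, OF w])
 have wI: "I (rowI w J K) = I (rowH w J K) - BM (rowR w J K)" if "J \<in> ?P" "K \<in> ?Q" for J K
  unfolding rowI_def[abs_def] rowH_def[abs_def] rowR_def[abs_def]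
  by (rule row_identity[OF C1c_rw[of w, OF w]]) (use dbar_adjoint_value(2)[OF w v that] in \<open>simp add: ncomp_def\<close>)
 have left: "complex_of_real ((L2_norm Om \<phi> p (Suc (Suc q)) (dbar S p u))\<^sup>2) + complex_of_real ((L2_norm Om \<phi> p q v)\<^sup>2) =
   (\<Sum>J\<in>?P. (\<Sum>K\<in>?Q1. I (s0 (w J K))) + (\<Sum>K\<in>?Q. I (rowI w J K)))"
 proof -
  let ?A = "%z. \<Sum>J\<in>?P. \<Sum>L\<in>multi_indices (Suc (Suc q)). dbar S p w J L z * cnj (dbar S p w J L z)"
  let ?B = "%z. \<Sum>J\<in>?P. \<Sum>K\<in>?Q. vf p w J K z * cnj (vf p w J K z)"
  have cA: "continuous_on S ?A" by (intro continuous_intros Cc_cont[OF cdb])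
  have cB: "continuous_on S ?B" by (intro continuous_intros cvf)
  have dA: "Cc (%z. E z * ?A z)"
   by (intro Cc_mult_left Cc_sum cdb Cc_mult_right C1_cont[OF C1_E] continuous_on_cnj Cc_cont[OF cdb])
  have dR: "Cc (%z. \<Sum>J\<in>?P. (\<Sum>K\<in>?Q1. s0 (w J K) z) + (\<Sum>K\<in>?Q. rowI w J K z))"
   by (intro Cc_sum Cc_add Cc_s0 Cc_rowI w)
  have dB: "Cc (%z. E z * ?B z)"
  proof -
   have "Cc (%z. (\<Sum>J\<in>?P. (\<Sum>K\<in>?Q1. s0 (w J K) z) + (\<Sum>K\<in>?Q. rowI w J K z)) - E z * ?A z)" by (rule Cc_diff[OF dR dA])
   then show ?thesis
    by (rule Cc_cong[THEN iffD1, rotated]) (simp add: norms_pointwise[OF w, symmetric])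
  qed
  have "L2_norm Om \<phi> p (Suc (Suc q)) (dbar S p u) = L2_norm Om \<phi> p (Suc (Suc q)) (dbar S p w)"
   by (rule L2_norm_cong) (rule dbar_uw[OF _ _ OmS])
  then have "complex_of_real ((L2_norm Om \<phi> p (Suc (Suc q)) (dbar S p u))\<^sup>2) = I (%z. E z * ?A z)"
   using L2_norm_sq[OF form_norm_sq_complex cOm[OF cA]] by simp
  moreover have "complex_of_real ((L2_norm Om \<phi> p q v)\<^sup>2) = I (%z. E z * ?B z)"
   by (rule dbar_star_norm[OF w v])
  moreover have "I (%z. E z * ?A z) + I (%z. E z * ?B z) = I (%z. E z * ?A z + E z * ?B z)"
   by (rule I_add[OF dA dB, symmetric])
  moreover have "\<dots> = I (%z. \<Sum>J\<in>?P. (\<Sum>K\<in>?Q1. s0 (w J K) z) + (\<Sum>K\<in>?Q. rowI w J K z))"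
   by (rule I_cong, rule norms_pointwise[OF w OmS])
  moreover have "\<dots> = (\<Sum>J\<in>?P. (\<Sum>K\<in>?Q1. I (s0 (w J K))) + (\<Sum>K\<in>?Q. I (rowI w J K)))"
   by (simp add: I_sum I_add Cc_sum Cc_add Cc_s0[OF w] Cc_rowI[of w, OF w])
  ultimately show ?thesis by simp
 qed
 have FFs: "complex_of_real (form_norm_sq p (Suc q) u z) * E z = (\<Sum>J\<in>?P. \<Sum>K\<in>?Q1. FF (w J K) z)" if "z \<in> S" for z
  by (simp only: form_norm_sq_uw[OF that] form_norm_sq_complex sum_distrib_right FF_def)
 let ?L = "%\<psi> t z. (H_form S p (Suc q) \<psi> u z - t z * complex_of_real (form_norm_sq p (Suc q) u z)) * complex_of_real (exp (- \<phi> z))"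
 have L: "?L \<psi> t z = H_form S p (Suc q) \<psi> w z * E z - (\<Sum>J\<in>?P. \<Sum>K\<in>?Q1. t z * FF (w J K) z)" if z: "z \<in> S" for \<psi> t z
  by (simp only: E_real[symmetric] left_diff_distrib mult.assoc FFs[OF z] H_form_uw[OF z] sum_distrib_left)
 have bd: "(LINT z:M|\<sigma>. ?L \<rho> (tau S \<rho>) z)
   = (\<Sum>J\<in>?P. \<Sum>K\<in>?Q. BM (rowR w J K)) - (\<Sum>J\<in>?P. \<Sum>K\<in>?Q1. BM (%z. ta z * FF (w J K) z))"
 proof -
  have "(LINT z:M|\<sigma>. ?L \<rho> (tau S \<rho>) z) = BM (%z. (\<Sum>J\<in>?P. \<Sum>K\<in>?Q. rowR w J K z) - (\<Sum>J\<in>?P. \<Sum>K\<in>?Q1. ta z * FF (w J K) z))"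
   unfolding BM_def[symmetric]
  proof (rule BM_cong)
   fix z assume "z \<in> M" then have z: "z \<in> S" using M_sub by blast
   have "H_form S p (Suc q) \<rho> w z * E z = (\<Sum>J\<in>?P. \<Sum>K\<in>?Q. rowR w J K z)"
    by (simp add: H_form_def rowR_def dz_W dzbar_rho H2_def rw_def sum_distrib_right)
   then show "?L \<rho> (tau S \<rho>) z = (\<Sum>J\<in>?P. \<Sum>K\<in>?Q. rowR w J K z) - (\<Sum>J\<in>?P. \<Sum>K\<in>?Q1. ta z * FF (w J K) z)"
    by (simp only: L[OF z] tau_eq[OF z])
  qed
  then show ?thesis by (simp add: BM_sum BM_diff Cc_sum Cc_rowR[of w, OF w] Cc_FF[OF w cont_ta])
 qed
 have iw: "(LINT z:Om|lebesgue. ?L \<phi> (gamma S \<rho> \<phi>) z)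
   = (\<Sum>J\<in>?P. \<Sum>K\<in>?Q. I (rowH w J K)) - (\<Sum>J\<in>?P. \<Sum>K\<in>?Q1. I (%z. gam z * FF (w J K) z))"
 proof -
  let ?F = "%z. (\<Sum>J\<in>?P. \<Sum>K\<in>?Q. rowH w J K z) - (\<Sum>J\<in>?P. \<Sum>K\<in>?Q1. gam z * FF (w J K) z)"
  have cF: "Cc ?F" by (intro Cc_diff Cc_sum Cc_rowH w Cc_FF cont_gam)
  have "(LINT z:Om|lebesgue. ?L \<phi> (gamma S \<rho> \<phi>) z) = IL ?F"
   unfolding IL_def
  proof (rule set_lebesgue_integral_cong[OF Om_lebesgue], intro allI impI)
   fix z assume "z \<in> Om" then have z: "z \<in> S" by (rule OmS)
   have "H_form S p (Suc q) \<phi> w z * E z = (\<Sum>J\<in>?P. \<Sum>K\<in>?Q. rowH w J K z)"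
    by (simp add: H_form_def rowH_def dz_W dzbar_W Hp_def rw_def sum_distrib_right)
   then show "?L \<phi> (gamma S \<rho> \<phi>) z = ?F z" by (simp only: L[OF z] gamma_eq[OF z])
  qed
  also have "\<dots> = I ?F" by (rule IL_I[OF Cc_Om[OF cF]])
  finally show ?thesis by (simp add: I_sum I_diff Cc_sum Cc_rowH[of w, OF w] Cc_FF[OF w cont_gam])
 qed
 have norm: "complex_of_real ((L2_norm Om \<phi> p (Suc q) a)\<^sup>2) = (\<Sum>J\<in>?P. \<Sum>K\<in>?Q1. I (G J K))"
  if a: "\<And>J K z. J \<in> ?P ==> K \<in> ?Q1 ==> z \<in> Om ==> E z * (a J K z * cnj (a J K z)) = G J K z" and G: "\<And>J K. Cc (G J K)" for a G
 proof -
  have e: "complex_of_real (form_norm_sq p (Suc q) a z) = inverse (E z) * (\<Sum>J\<in>?P. \<Sum>K\<in>?Q1. G J K z)" if "z \<in> Om" for z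
   unfolding form_norm_sq_complex sum_distrib_left
   by (intro sum.cong refl) (simp add: a[OF _ _ that, symmetric])
  have "complex_of_real ((L2_norm Om \<phi> p (Suc q) a)\<^sup>2) = I (%z. E z * (inverse (E z) * (\<Sum>J\<in>?P. \<Sum>K\<in>?Q1. G J K z)))"
   by (rule L2_norm_sq[OF e]) (auto intro!: continuous_intros cOm C1_cont[OF C1_E] Cc_cont[OF G])
  also have "\<dots> = I (%z. \<Sum>J\<in>?P. \<Sum>K\<in>?Q1. G J K z)" by (intro I_cong) simp
  finally show ?thesis by (simp add: I_sum Cc_sum G)
 qed
 have n1: "complex_of_real ((L2_norm Om \<phi> p (Suc q) (%J K z. complex_of_real (eta S \<rho> z) * u J K z))\<^sup>2) = (\<Sum>J\<in>?P. \<Sum>K\<in>?Q1. I (%z. et2 z * FF (w J K) z))"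
  by (rule norm[OF _ Cc_FF[OF w cont_et2]]) (simp add: uw_Om eta_eq[OF OmS, symmetric] FF_def power2_eq_square mult_ac)
 have n2: "complex_of_real ((L2_norm Om \<phi> p (Suc q) (%J K z. conj_op (N_op S \<rho>) (u J K) z + 4 * tau S \<rho> z * u J K z))\<^sup>2) = (\<Sum>J\<in>?P. \<Sum>K\<in>?Q1. I (nt (w J K)))"
  by (rule norm) (simp_all add: uw_Om N_uw[OF _ _ OmS] N_eq[OF w1 OmS] tau_eq[OF OmS] nt_def Cc_nt[OF w])
 have n3: "complex_of_real ((L2_norm Om \<phi> p (Suc q)
      (%J K z. formal_adjoint Om \<phi> (conj_op (L_op S \<rho> j)) (u J K) z - 4 * dz S j (cplx \<rho>) z * tau S \<rho> z * u J K z))\<^sup>2) = (\<Sum>J\<in>?P. \<Sum>K\<in>?Q1. I (at1 (w J K) j))" for j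
  by (rule norm) (simp_all add: uw_Om formal_adjoint_uw formal_adjoint_eq[OF w] dz_rho tau_eq[OF OmS] at1_def Cc_at1[OF w])
 have "(\<Sum>J\<in>?P. (\<Sum>K\<in>?Q1. I (s0 (w J K))) + (\<Sum>K\<in>?Q. I (rowI w J K))) =
   (\<Sum>J\<in>?P. \<Sum>K\<in>?Q1. BM (%z. ta z * FF (w J K) z) - I (%z. gam z * FF (w J K) z) - 4 * I (%z. et2 z * FF (w J K) z)
    + 1/4 * I (nt (w J K)) + (\<Sum>j\<in>UNIV. I (at1 (w J K) j))) + (\<Sum>J\<in>?P. \<Sum>K\<in>?Q. I (rowH w J K) - BM (rowR w J K))"
  unfolding sum.distrib[of _ _ "?P"] scalar_identity'[OF w] using wI by (intro arg_cong2[of _ _ _ _ "(+)"] refl sum.cong) auto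
 also have "\<dots> = - ((\<Sum>J\<in>?P. \<Sum>K\<in>?Q. BM (rowR w J K)) - (\<Sum>J\<in>?P. \<Sum>K\<in>?Q1. BM (%z. ta z * FF (w J K) z)))
   + ((\<Sum>J\<in>?P. \<Sum>K\<in>?Q. I (rowH w J K)) - (\<Sum>J\<in>?P. \<Sum>K\<in>?Q1. I (%z. gam z * FF (w J K) z)))
   - 4 * (\<Sum>J\<in>?P. \<Sum>K\<in>?Q1. I (%z. et2 z * FF (w J K) z))
   + 1/4 * (\<Sum>J\<in>?P. \<Sum>K\<in>?Q1. I (nt (w J K))) + (\<Sum>J\<in>?P. \<Sum>K\<in>?Q1. \<Sum>j\<in>UNIV. I (at1 (w J K) j))"
  by (simp only: sum.distrib sum_subtractf sum_distrib_left) simp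
 also have "(\<Sum>J\<in>?P. \<Sum>K\<in>?Q1. \<Sum>j\<in>UNIV. I (at1 (w J K) j)) = (\<Sum>j\<in>UNIV. \<Sum>J\<in>?P. \<Sum>K\<in>?Q1. I (at1 (w J K) j))"
 proof -
  have "(\<Sum>J\<in>?P. \<Sum>K\<in>?Q1. \<Sum>j\<in>UNIV. I (at1 (w J K) j)) = (\<Sum>J\<in>?P. \<Sum>j\<in>UNIV. \<Sum>K\<in>?Q1. I (at1 (w J K) j))"
   by (rule sum.cong[OF refl], rule sum.swap)
  also have "\<dots> = (\<Sum>j\<in>UNIV. \<Sum>J\<in>?P. \<Sum>K\<in>?Q1. I (at1 (w J K) j))" by (rule sum.swap)
  finally show ?thesis .
 qed
 finally show ?thesis unfolding left bd iw n3 of_real_mult n1 n2 by simp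
qed

end

end

theorem theorem2p6:
  fixes D U :: "'n::{finite,linorder} cspace set"
    and \<rho> \<phi> :: "'n cspace \<Rightarrow> real"
    and u :: "'n form"
    and p q :: nat
  assumes "open D" and "connected D" and "D \<noteq> {}" and "bounded D" and "Ck_boundary 2 D"
    and "\<rho> = signed_dist D"
    and "open U" and "bounded U" and "closure D \<subseteq> U"
    and "Ck_on 2 (closure U - D) \<rho>"
    and "Ck_on 2 (U - D) \<phi>"
    and "1 \<le> q" and "q \<le> CARD('n)" and "p \<le> CARD('n)"
    and "\<forall>J\<in>multi_indices p. \<forall>K\<in>multi_indices q. Ck_on 1 (closure U - D) (u J K)"
    and "u \<in> dom_dbar_star (U - closure D) \<phi> p q"
    and "\<exists>C. compact C \<and> C \<subseteq> U - D \<and>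
           (\<forall>J\<in>multi_indices p. \<forall>K\<in>multi_indices q. \<forall>z\<in>(closure U - D) - C. u J K z = 0)"
  shows
    "complex_of_real ((L2_norm (U - closure D) \<phi> p (q + 1) (dbar (U - D) p u))\<^sup>2) +
     complex_of_real ((L2_norm (U - closure D) \<phi> p (q - 1) (dbar_star (U - closure D) \<phi> p q u))\<^sup>2) =
       - (LINT z:frontier D|surface_measure (frontier D).
            (H_form (U - D) p q \<rho> u z
              - tau (U - D) \<rho> z * complex_of_real (form_norm_sq p q u z)) *
            complex_of_real (exp (- \<phi> z)))
       + (LINT z:U - closure D|lebesgue.
            (H_form (U - D) p q \<phi> u z
              - gamma (U - D) \<rho> \<phi> z * complex_of_real (form_norm_sq p q u z)) *
            complex_of_real (exp (- \<phi> z)))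
       - complex_of_real (4 * (L2_norm (U - closure D) \<phi> p q
            (\<lambda>J K z. complex_of_real (eta (U - D) \<rho> z) * u J K z))\<^sup>2)
       + complex_of_real (1 / 4 * (L2_norm (U - closure D) \<phi> p q
            (\<lambda>J K z. conj_op (N_op (U - D) \<rho>) (u J K) z + 4 * tau (U - D) \<rho> z * u J K z))\<^sup>2)
       + (\<Sum>j\<in>UNIV. complex_of_real ((L2_norm (U - closure D) \<phi> p q
            (\<lambda>J K z.
               formal_adjoint (U - closure D) \<phi> (conj_op (L_op (U - D) \<rho> j)) (u J K) z
               - 4 * dz (U - D) j (cplx \<rho>) z * tau (U - D) \<rho> z * u J K z))\<^sup>2))"
proof -
 have SU: "U - D \<subseteq> closure U - D" using closure_subset by blast
 interpret weighted_domain D U \<rho> \<phi>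
  by unfold_locales (fact assms(1-11) Ck_on_subset[OF assms(10) SU])+
 obtain q' where q: "q = Suc q'" using assms(12) by (cases q) auto
 obtain C where C: "compact C" "C \<subseteq> U - D"
  and C0: "\<And>J K z. J \<in> multi_indices p ==> K \<in> multi_indices q ==> z \<in> (closure U - D) - C ==> u J K z = 0"
  using assms(17) by blast
 \<comment> \<open>the coefficients that matter, cut off to the compact support\<close>
 define w where "w J K z = (if J \<in> multi_indices p \<and> K \<in> multi_indices q \<and> z \<in> C then u J K z else 0)" for J K z
 have uw: "u J K z = w J K z" if "J \<in> multi_indices p" "K \<in> multi_indices (Suc q')" "z \<in> U - D" for J K z
  using that C0[of J K z] SU by (auto simp: w_def q)
 have w: "C1c (w J K)" for J K
 proof (cases "J \<in> multi_indices p \<and> K \<in> multi_indices q")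
  case True
  then have "Ck_on 1 (U - D) (u J K)" using assms(15) Ck_on_subset[OF _ SU] by blast
  then have "C1 (U - D) (u J K)" by (rule Ck1_imp_C1)
  moreover have "C1 (U - D) (u J K) \<longleftrightarrow> C1 (U - D) (w J K)" using True uw by (intro C1_cong) (simp add: q)
  ultimately have "C1 (U - D) (w J K)" by simp
  then show ?thesis by (rule C1cI[OF _ C]) (simp add: w_def)
 next
  case False
  then have "w J K = (%_. 0)" by (auto simp: w_def fun_eq_iff)
  then show ?thesis by (simp add: C1c_0)
 qed
 have "dbar_adjoint (U - closure D) \<phi> p q u (dbar_star (U - closure D) \<phi> p q u)"
  using assms(16) unfolding dbar_star_def dom_dbar_star_def mem_Collect_eq by (rule someI_ex)
 from weighted_identity[of p q' u w, OF uw w this[unfolded q]]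
 show ?thesis unfolding q by (simp only: Suc_eq_plus1[symmetric] diff_Suc_1)
qed

end
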